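(* Let $k \geq 2$ and let $G = G_1 \ast \dots \ast G_k$ be a free product of freely indecomposable groups $G_1,\dots,G_k$. Assume that at most two of the factors $G_i$ are infinite cyclic and that there exists $j \in \{1,\dots,k\}$ with $G_j \not\cong \mathbb{Z}/2$. Then $G$ admits infinitely many linearly independent homogeneous Aut-invariant quasimorphisms, all of which vanish on single letters.
   Context: A quasimorphism on a group $G$ is a map $\psi\colon G\to\mathbb{R}$ for which there is $D\ge 0$ with $|\psi(g)+\psi(h)-\psi(gh)|\le D$ for all $g,h\in G$. It is homogeneous if $\psi(g^n)=n\psi(g)$ for all $g\in G$, $n\in\mathbb{Z}$, and Aut-invariant if $\psi(\varphi(g))=\psi(g)$ for all $g\in G$ and all automorphisms $\varphi$ of $G$. Linear independence refers to the real vector space of functions $G\to\mathbb{R}$. A group is freely indecomposable if it is non-trivial and not isomorphic to a free product $H_1\ast H_2$ of two non-trivial groups. A letter of a free product $\ast_i G_i$ is an element of one of the factors $G_i$ (viewed as a subgroup via the canonical inclusion). *)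

theory Defs
  imports "HOL-Algebra.Algebra"
begin

text \<open>Internal free products.  A family of subgroups H i (i in I) of a group G
  realises G as their free product iff they generate G and every nonempty
  reduced word (consecutive letters from different factors, each letter
  nontrivial) has nontrivial product (normal form theorem).\<close>

definition reduced_word :: "('a, 'b) monoid_scheme \<Rightarrow> 'i set \<Rightarrow> ('i \<Rightarrow> 'a set) \<Rightarrow> ('i \<times> 'a) list \<Rightarrow> bool" where
  "reduced_word G I H ws \<longleftrightarrow>
     (\<forall>p\<in>set ws. fst p \<in> I \<and> snd p \<in> H (fst p) \<and> snd p \<noteq> \<one>\<^bsub>G\<^esub>) \<and>
     (\<forall>m. Suc m < length ws \<longrightarrow> fst (ws ! m) \<noteq> fst (ws ! Suc m))"

definition word_prod :: "('a, 'b) monoid_scheme \<Rightarrow> ('i \<times> 'a) list \<Rightarrow> 'a" where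
  "word_prod G ws = foldr (\<lambda>p acc. snd p \<otimes>\<^bsub>G\<^esub> acc) ws \<one>\<^bsub>G\<^esub>"

definition is_free_product :: "('a, 'b) monoid_scheme \<Rightarrow> 'i set \<Rightarrow> ('i \<Rightarrow> 'a set) \<Rightarrow> bool" where
  "is_free_product G I H \<longleftrightarrow>
     group G \<and> (\<forall>i\<in>I. subgroup (H i) G) \<and>
     generate G (\<Union>i\<in>I. H i) = carrier G \<and>
     (\<forall>ws. ws \<noteq> [] \<and> reduced_word G I H ws \<longrightarrow> word_prod G ws \<noteq> \<one>\<^bsub>G\<^esub>)"

text \<open>Freely indecomposable: nontrivial, and not a free product of two nontrivial groups
  (equivalently: not the internal free product of two nontrivial subgroups).\<close>

definition freely_indecomposable :: "('a, 'b) monoid_scheme \<Rightarrow> bool" where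
  "freely_indecomposable G \<longleftrightarrow>
     group G \<and> carrier G \<noteq> {\<one>\<^bsub>G\<^esub>} \<and>
     \<not> (\<exists>A B. A \<noteq> {\<one>\<^bsub>G\<^esub>} \<and> B \<noteq> {\<one>\<^bsub>G\<^esub>} \<and>
             is_free_product G (UNIV :: bool set) (\<lambda>b. if b then A else B))"

definition quasimorphism :: "('a, 'b) monoid_scheme \<Rightarrow> ('a \<Rightarrow> real) \<Rightarrow> bool" where
  "quasimorphism G \<psi> \<longleftrightarrow> (\<exists>D\<ge>0. \<forall>g\<in>carrier G. \<forall>h\<in>carrier G.
       \<bar>\<psi> g + \<psi> h - \<psi> (g \<otimes>\<^bsub>G\<^esub> h)\<bar> \<le> D)"

definition homogeneous_qm :: "('a, 'b) monoid_scheme \<Rightarrow> ('a \<Rightarrow> real) \<Rightarrow> bool" where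
  "homogeneous_qm G \<psi> \<longleftrightarrow> (\<forall>g\<in>carrier G. \<forall>n::int. \<psi> (g [^]\<^bsub>G\<^esub> n) = of_int n * \<psi> g)"

definition aut_invariant :: "('a, 'b) monoid_scheme \<Rightarrow> ('a \<Rightarrow> real) \<Rightarrow> bool" where
  "aut_invariant G \<psi> \<longleftrightarrow> (\<forall>\<phi>\<in>auto G. \<forall>g\<in>carrier G. \<psi> (\<phi> g) = \<psi> g)"

definition lin_indep_funs :: "('a, 'b) monoid_scheme \<Rightarrow> ('a \<Rightarrow> real) set \<Rightarrow> bool" where
  "lin_indep_funs G S \<longleftrightarrow>
     (\<forall>F c. finite F \<and> F \<subseteq> S \<and> (\<forall>g\<in>carrier G. (\<Sum>\<psi>\<in>F. c \<psi> * \<psi> g) = 0)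
            \<longrightarrow> (\<forall>\<psi>\<in>F. c \<psi> = 0))"

definition infinite_cyclic :: "('a, 'b) monoid_scheme \<Rightarrow> bool" where
  "infinite_cyclic G \<longleftrightarrow> G \<cong> integer_group"

end

theory Submission
  imports Defs "HOL-Library.Product_Plus"
begin

text \<open>It suffices to find quasimorphisms that every automorphism changes by a bounded amount, that are bounded
  on powers of letters, and that are detected by suitable elements: their homogenizations are then
  invariant and independent.

  An automorphism maps each factor that is not infinite cyclic to a conjugate of such a factor, because an
  indecomposable group other than \<open>\<int>\<close> has no almost invariant subset of the kind produced by the
  tree of the free product.

  Without infinite cyclic factors, retract to pairs of factors \<open>G\<^sub>i * G\<^sub>j\<close> and record, along the normal
  form, which consecutive letters of \<open>G\<^sub>i\<close> agree; with one infinite cyclic factor, record the signs of its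
  exponents instead.  Automorphisms alter these codes only by conjugation and reversal, so counting
  patterns in them gives the quasimorphisms.

  With two infinite cyclic factors, kill the others and let the free group of rank two act through the
  punctured torus group in the modular group.  Along the geodesic from a cusp \<open>a\<close> to \<open>b\<close> count the pairs of
  neighbouring cusps around which it winds \<open>p\<close> and then \<open>q\<close> times, minus the same number from \<open>b\<close> to \<open>a\<close>.
  By Nielsen, the automorphism group is generated by conjugations, by two automorphisms that are
  conjugations inside \<open>GL\<^sub>2(\<int>)\<close>, and by \<open>x \<mapsto> x\<inverse>\<close>, which acts on the cusps by a map reversing the cyclic
  order; all of them preserve the count up to a bounded error.\<close>

section \<open>Normal forms and the universal property\<close>

text \<open>The obstacle is partial conjugation: conjugating one factor and fixing the rest spoils
  normal forms. With two factors left it is inner up to automorphisms of the factors, so everything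
  is pushed forward to pairs and summed over the pairs that automorphisms permute. An infinite
  cyclic factor adds substitutions of \<open>a \<zeta> b\<close> for \<open>\<zeta>\<close>: they
  break up powers of \<open>\<zeta>\<close>, but keep the sequence of signs or flip all of it. With
  two such factors \<open>x \<mapsto> x y\<close> changes words too much for any count of letters;
  the punctured torus helps because all automorphisms of the free group of rank two respect its
  peripheral subgroups, hence act on cusps. Few of them are isometries: \<open>x y\<close> and
  \<open>x\<inverse> y\<close> have traces 3 and 6, so no matrix conjugation inverts
  \<open>x\<close>. The induced bijection of the cusps preserves whether a winding number exceeds an
  integer, up to a global sign, but not its value. Therefore only integer thresholds enter the
  count.\<close>

locale free_prod =
  fixes G :: "('a, 'b) monoid_scheme" (structure) and I :: "'i set" and H :: "'i \<Rightarrow> 'a set"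
  assumes is_fp: "is_free_product G I H"

sublocale free_prod \<subseteq> group G
  using is_fp by (simp add: is_free_product_def)

context free_prod
begin

abbreviation "red \<equiv> reduced_word G I H"
abbreviation "wp \<equiv> word_prod G"

lemma H_subgroup: "i \<in> I \<Longrightarrow> subgroup (H i) G"
  using is_fp by (simp add: is_free_product_def)

lemma H_closed [simp]: "i \<in> I \<Longrightarrow> a \<in> H i \<Longrightarrow> a \<in> carrier G"
  by (rule subgroup.mem_carrier[OF H_subgroup])

lemma H_mult [simp]: "i \<in> I \<Longrightarrow> a \<in> H i \<Longrightarrow> b \<in> H i \<Longrightarrow> a \<otimes> b \<in> H i"
  by (rule subgroup.m_closed[OF H_subgroup])

lemma H_inv [simp]: "i \<in> I \<Longrightarrow> a \<in> H i \<Longrightarrow> inv a \<in> H i"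
  by (rule subgroup.m_inv_closed[OF H_subgroup])

lemma H_one [simp]: "i \<in> I \<Longrightarrow> \<one> \<in> H i"
  by (rule subgroup.one_closed[OF H_subgroup])

lemma word_prod_Nil [simp]: "wp [] = \<one>"
  and word_prod_Cons [simp]: "wp (p # ws) = snd p \<otimes> wp ws"
  by (simp_all add: word_prod_def)

lemma red_Nil [simp]: "red []"
  by (simp add: reduced_word_def)

lemma red_Cons: "red (p # ws) \<longleftrightarrow> fst p \<in> I \<and> snd p \<in> H (fst p) \<and> snd p \<noteq> \<one> \<and> red ws \<and>
    (ws = [] \<or> fst (hd ws) \<noteq> fst p)"
proof -
  have "(\<forall>m. Suc m < length (p # ws) \<longrightarrow> fst ((p # ws) ! m) \<noteq> fst ((p # ws) ! Suc m)) \<longleftrightarrow>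
      (ws = [] \<or> fst (hd ws) \<noteq> fst p) \<and> (\<forall>m. Suc m < length ws \<longrightarrow> fst (ws ! m) \<noteq> fst (ws ! Suc m))"
    (is "(\<forall>m. ?P m) \<longleftrightarrow> ?R")
  proof
    assume l: "\<forall>m. ?P m"
    have "ws = [] \<or> fst (hd ws) \<noteq> fst p" using spec[OF l, of 0] by (cases ws) auto
    moreover have "Suc m < length ws \<longrightarrow> fst (ws ! m) \<noteq> fst (ws ! Suc m)" for m
      using spec[OF l, of "Suc m"] by auto
    ultimately show ?R by blast
  next
    assume r: ?R
    show "\<forall>m. ?P m"
    proof
      fix m show "?P m" using r by (cases m; cases ws) auto
    qed
  qed
  thus ?thesis by (auto simp: reduced_word_def)
qed

lemma red_append: "red (us @ vs) \<longleftrightarrow> red us \<and> red vs \<and>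
    (us = [] \<or> vs = [] \<or> fst (last us) \<noteq> fst (hd vs))"
  by (induction us) (auto simp: red_Cons)

lemma wp_closed [simp]: "red ws \<Longrightarrow> wp ws \<in> carrier G"
  by (induction ws) (auto simp: red_Cons)

lemma wp_append: "red us \<Longrightarrow> red vs \<Longrightarrow> wp (us @ vs) = wp us \<otimes> wp vs"
  by (induction us) (auto simp: red_Cons m_assoc)

definition winv :: "('i \<times> 'a) list \<Rightarrow> ('i \<times> 'a) list" where
  "winv ws = rev (map (\<lambda>(i, a). (i, inv a)) ws)"

lemma winv_Nil [simp]: "winv [] = []"
  and winv_Cons: "winv (p # ws) = winv ws @ [(fst p, inv (snd p))]"
  and winv_append: "winv (us @ vs) = winv vs @ winv us"
  and length_winv [simp]: "length (winv ws) = length ws"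
  and winv_eq_Nil [simp]: "winv ws = [] \<longleftrightarrow> ws = []"
  by (simp_all add: winv_def case_prod_beta)

lemma fst_last_winv: "ws \<noteq> [] \<Longrightarrow> fst (last (winv ws)) = fst (hd ws)"
  by (cases ws) (simp_all add: winv_Cons)

lemma fst_hd_winv: "ws \<noteq> [] \<Longrightarrow> fst (hd (winv ws)) = fst (last ws)"
  by (cases ws rule: rev_cases) (simp_all add: winv_append winv_Cons)

lemma red_winv: "red ws \<Longrightarrow> red (winv ws)"
proof (induction ws)
  case (Cons p ws)
  hence p: "fst p \<in> I" "snd p \<in> H (fst p)" "snd p \<noteq> \<one>" "red ws"
    "ws = [] \<or> fst (hd ws) \<noteq> fst p" by (auto simp: red_Cons)
  moreover have "inv (snd p) \<noteq> \<one>" using p by (metis H_closed inv_eq_1_iff)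
  ultimately show ?case using Cons.IH
    by (cases "ws = []") (auto simp: winv_Cons red_append red_Cons fst_last_winv)
qed simp

lemma wp_winv: "red ws \<Longrightarrow> wp (winv ws) = inv (wp ws)"
proof (induction ws)
  case (Cons p ws)
  hence "fst p \<in> I" "snd p \<in> H (fst p)" "red ws" "red [(fst p, inv (snd p))]"
    by (auto simp: red_Cons)
  thus ?case using Cons by (simp add: winv_Cons wp_append red_winv inv_mult_group)
qed simp

lemma red_wp_ne_one: "red ws \<Longrightarrow> ws \<noteq> [] \<Longrightarrow> wp ws \<noteq> \<one>"
  using is_fp by (auto simp: is_free_product_def)

text \<open>If the first letters differed, \<open>winv us @ vs\<close>, with the two first letters
  merged when they lie in one factor, would be a nonempty reduced word with product one. Hence they
  agree and can be stripped.\<close>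

lemma wp_inj: "red us \<Longrightarrow> red vs \<Longrightarrow> wp us = wp vs \<Longrightarrow> us = vs"
proof (induction us arbitrary: vs)
  case Nil
  thus ?case using red_wp_ne_one[of vs] by auto
next
  case (Cons p us)
  have pI: "fst p \<in> I" "snd p \<in> H (fst p)" "snd p \<noteq> \<one>" "red us" "us = [] \<or> fst (hd us) \<noteq> fst p"
    using Cons.prems(1) by (auto simp: red_Cons)
  show ?case
  proof (cases vs)
    case Nil
    thus ?thesis using Cons.prems red_wp_ne_one[of "p # us"] by auto
  next
    case (Cons q vs')
    have qI: "fst q \<in> I" "snd q \<in> H (fst q)" "snd q \<noteq> \<one>" "red vs'" "vs' = [] \<or> fst (hd vs') \<noteq> fst q"
      using Cons.prems(2) Cons by (auto simp: red_Cons)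
    have eq: "snd p \<otimes> wp us = snd q \<otimes> wp vs'" using Cons.prems(3) Cons by simp
    have ij: "fst p = fst q"
    proof (rule ccontr)
      assume ne: "fst p \<noteq> fst q"
      have r: "red (winv (p # us) @ (q # vs'))"
        using Cons.prems(1,2) Cons ne red_winv[of "p # us"]
        by (auto simp: red_append fst_last_winv)
      have "wp (winv (p # us) @ (q # vs')) = inv (wp (p # us)) \<otimes> wp (q # vs')"
        using Cons.prems(1,2) Cons by (simp only: wp_append red_winv wp_winv)
      also have "\<dots> = \<one>" using Cons.prems Cons by (metis l_inv wp_closed)
      finally show False using red_wp_ne_one[OF r] by simp
    qed
    have ab: "snd p = snd q"
    proof (rule ccontr)
      assume ne: "snd p \<noteq> snd q"
      let ?c = "inv (snd p) \<otimes> snd q"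
      have c: "?c \<in> H (fst p)" using pI qI ij by auto
      have c1: "?c \<noteq> \<one>"
        using ne pI qI by (metis H_closed inv_closed inv_equality inv_inv)
      have r: "red (winv us @ (fst p, ?c) # vs')"
        using pI qI c c1 ij by (cases "us = []") (auto simp: red_append red_Cons red_winv fst_last_winv)
      have r1: "red [(fst p, ?c)]" using pI c c1 by (simp add: red_Cons)
      have "wp (winv us @ (fst p, ?c) # vs') = inv (wp us) \<otimes> wp ((fst p, ?c) # vs')"
        using r pI by (simp add: wp_append red_append wp_winv)
      also have "\<dots> = inv (snd p \<otimes> wp us) \<otimes> (snd q \<otimes> wp vs')"
        using pI qI by (simp add: inv_mult_group m_assoc)
      also have "\<dots> = \<one>" using eq pI qI by simp
      finally show False using red_wp_ne_one[OF r] by simp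
    qed
    have "wp us = wp vs'" using eq ab pI qI by simp
    hence "us = vs'" using Cons.IH pI qI by blast
    thus ?thesis using Cons ij ab by (simp add: prod_eq_iff)
  qed
qed

definition lmul :: "'i \<Rightarrow> 'a \<Rightarrow> ('i \<times> 'a) list \<Rightarrow> ('i \<times> 'a) list" where
  "lmul i a ws = (if a = \<one> then ws else case ws of [] \<Rightarrow> [(i, a)]
     | q # vs \<Rightarrow> if fst q = i then (if a \<otimes> snd q = \<one> then vs else (i, a \<otimes> snd q) # vs)
               else (i, a) # q # vs)"

lemma red_lmul: "i \<in> I \<Longrightarrow> a \<in> H i \<Longrightarrow> red ws \<Longrightarrow> red (lmul i a ws)"
  by (cases ws) (auto simp: lmul_def red_Cons)

lemma wp_lmul: "i \<in> I \<Longrightarrow> a \<in> H i \<Longrightarrow> red ws \<Longrightarrow> wp (lmul i a ws) = a \<otimes> wp ws"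
proof (cases ws)
  case (Cons q vs)
  assume *: "i \<in> I" "a \<in> H i" "red ws"
  hence q: "fst q \<in> I" "snd q \<in> H (fst q)" "red vs" using Cons by (auto simp: red_Cons)
  have "a \<otimes> snd q = \<one> \<Longrightarrow> a \<otimes> (snd q \<otimes> wp vs) = wp vs" if "fst q = i"
    using * q that by (metis H_closed l_one m_assoc wp_closed)
  thus ?thesis using * q Cons by (auto simp: lmul_def m_assoc)
qed (auto simp: lmul_def)

lemma red_mult_ex:
  assumes "red us" "red vs" shows "\<exists>ws. red ws \<and> wp ws = wp us \<otimes> wp vs"
  using assms
proof (induction us)
  case (Cons p us)
  hence p: "fst p \<in> I" "snd p \<in> H (fst p)" "red us" by (auto simp: red_Cons)
  then obtain ws where ws: "red ws" "wp ws = wp us \<otimes> wp vs" using Cons by blast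
  have "red (lmul (fst p) (snd p) ws)" "wp (lmul (fst p) (snd p) ws) = wp (p # us) \<otimes> wp vs"
    using p ws Cons.prems by (auto simp: red_lmul wp_lmul m_assoc)
  thus ?case by blast
qed auto

lemma red_letter: "i \<in> I \<Longrightarrow> a \<in> H i \<Longrightarrow> \<exists>ws. red ws \<and> wp ws = a"
  by (cases "a = \<one>") (auto intro: exI[of _ "[]"] exI[of _ "[(i, a)]"] simp: red_Cons)

lemma red_ex:
  assumes "g \<in> carrier G" shows "\<exists>ws. red ws \<and> wp ws = g"
proof -
  have "g \<in> generate G (\<Union>i\<in>I. H i)" using assms is_fp by (simp add: is_free_product_def)
  thus ?thesis
  proof (induction rule: generate.induct)
    case one
    thus ?case by (auto intro: exI[of _ "[]"])
  next
    case (incl h)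
    thus ?case using red_letter by auto
  next
    case (inv h)
    thus ?case using red_letter H_inv by auto
  next
    case (eng h1 h2)
    thus ?case using red_mult_ex by metis
  qed
qed

definition nf :: "'a \<Rightarrow> ('i \<times> 'a) list" where
  "nf g = (THE ws. red ws \<and> wp ws = g)"

lemma nf_unique: "red ws \<Longrightarrow> wp ws = g \<Longrightarrow> nf g = ws"
  unfolding nf_def using wp_inj by blast

lemma nf_wp [simp]: "red ws \<Longrightarrow> nf (wp ws) = ws"
  using nf_unique by blast

lemma red_nf [simp]: "g \<in> carrier G \<Longrightarrow> red (nf g)"
  and wp_nf [simp]: "g \<in> carrier G \<Longrightarrow> wp (nf g) = g"
  using red_ex nf_unique by metis+

lemma nf_one [simp]: "nf \<one> = []"
  using nf_unique[of "[]"] by simp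

lemma nf_eq_Nil [simp]: "g \<in> carrier G \<Longrightarrow> nf g = [] \<longleftrightarrow> g = \<one>"
  by (metis nf_one wp_nf word_prod_Nil)

lemma nf_letter: "i \<in> I \<Longrightarrow> a \<in> H i \<Longrightarrow> a \<noteq> \<one> \<Longrightarrow> nf a = [(i, a)]"
  by (rule nf_unique) (auto simp: red_Cons)

lemma nf_inv: "g \<in> carrier G \<Longrightarrow> nf (inv g) = winv (nf g)"
  by (rule nf_unique) (auto simp: red_winv wp_winv)

lemma nf_lmul: "i \<in> I \<Longrightarrow> a \<in> H i \<Longrightarrow> g \<in> carrier G \<Longrightarrow> nf (a \<otimes> g) = lmul i a (nf g)"
  by (rule nf_unique) (auto simp: red_lmul wp_lmul)

lemma nf_append: "g \<in> carrier G \<Longrightarrow> h \<in> carrier G \<Longrightarrow>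
    nf g = [] \<or> nf h = [] \<or> fst (last (nf g)) \<noteq> fst (hd (nf h)) \<Longrightarrow> nf (g \<otimes> h) = nf g @ nf h"
  by (rule nf_unique) (auto simp: red_append wp_append)

text \<open>Cancellation eats a piece \<open>c\<close> and stops at a junction where at most two
  letters of one factor merge. Every defect estimate for a code read off normal forms rests on this
  shape: \<open>c\<close> enters both words, once inverted, and only \<open>m1\<close>,
  \<open>m2\<close>, \<open>m3\<close> stay unmatched.\<close>

lemma red_mult_form:
  assumes "red us" "red vs"
  shows "\<exists>p c s m1 m2 m3. us = p @ m1 @ c \<and> vs = winv c @ m2 @ s \<and> red (p @ m3 @ s) \<and>
     wp (p @ m3 @ s) = wp us \<otimes> wp vs \<and>
     (m1 = [] \<and> m2 = [] \<and> m3 = [] \<or>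
      (\<exists>i a b. m1 = [(i, a)] \<and> m2 = [(i, b)] \<and> m3 = [(i, a \<otimes> b)]))"
  using assms
proof (induction us arbitrary: vs rule: rev_induct)
  case Nil
  thus ?case by (auto intro!: exI[of _ "[]"] simp: exI[of _ vs])
next
  case (snoc x us)
  obtain i a where x: "x = (i, a)" by (cases x)
  have us: "red us" "i \<in> I" "a \<in> H i" "a \<noteq> \<one>" "us = [] \<or> fst (last us) \<noteq> i"
    using snoc.prems x by (auto simp: red_append red_Cons)
  show ?case
  proof (cases "vs = [] \<or> fst (hd vs) \<noteq> i")
    case True
    hence "red (us @ [x] @ vs)" using snoc.prems x us by (auto simp: red_append red_Cons)
    moreover have "wp (us @ [x] @ vs) = wp (us @ [x]) \<otimes> wp vs"
      using snoc.prems by (metis append_assoc wp_append)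
    ultimately show ?thesis
      by (intro exI[of _ "us @ [x]"] exI[of _ "[]"] exI[of _ vs]) auto
  next
    case False
    then obtain b ws where vs: "vs = (i, b) # ws" by (cases vs) auto
    have b: "b \<in> H i" "b \<noteq> \<one>" "red ws" "ws = [] \<or> fst (hd ws) \<noteq> i"
      using snoc.prems vs by (auto simp: red_Cons)
    have e: "wp (us @ [x]) = wp us \<otimes> a" using us x by (simp add: wp_append red_Cons)
    show ?thesis
    proof (cases "a \<otimes> b = \<one>")
      case ab: True
      hence bi: "b = inv a" using us b by (metis H_closed inv_equality inv_inv r_inv l_inv inv_closed)
      obtain p c s m1 m2 m3 where IH: "us = p @ m1 @ c" "ws = winv c @ m2 @ s" "red (p @ m3 @ s)"
        "wp (p @ m3 @ s) = wp us \<otimes> wp ws"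
        "m1 = [] \<and> m2 = [] \<and> m3 = [] \<or> (\<exists>i a b. m1 = [(i, a)] \<and> m2 = [(i, b)] \<and> m3 = [(i, a \<otimes> b)])"
        using snoc.IH[OF us(1) b(3)] by blast
      have "wp (us @ [x]) \<otimes> wp vs = wp us \<otimes> ((a \<otimes> b) \<otimes> wp ws)"
        using e vs us b by (simp add: m_assoc)
      hence w: "wp (p @ m3 @ s) = wp (us @ [x]) \<otimes> wp vs" using ab b IH by simp
      show ?thesis
        by (rule exI[of _ p], rule exI[of _ "c @ [x]"], rule exI[of _ s],
            rule exI[of _ m1], rule exI[of _ m2], rule exI[of _ m3])
          (use IH w vs bi x in \<open>auto simp: winv_append winv_Cons\<close>)
    next
      case ab: False
      have r: "red (us @ [(i, a \<otimes> b)] @ ws)"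
        using us b ab by (auto simp: red_append red_Cons)
      have "wp (us @ [(i, a \<otimes> b)] @ ws) = wp us \<otimes> wp ((i, a \<otimes> b) # ws)"
        using r us by (subst wp_append) (auto simp: red_append)
      also have "\<dots> = wp (us @ [x]) \<otimes> wp vs" using e vs us b by (simp add: m_assoc)
      finally have w: "wp (us @ [(i, a \<otimes> b)] @ ws) = wp (us @ [x]) \<otimes> wp vs" .
      show ?thesis
        by (rule exI[of _ us], rule exI[of _ "[]"], rule exI[of _ ws], rule exI[of _ "[x]"],
            rule exI[of _ "[(i, b)]"], rule exI[of _ "[(i, a \<otimes> b)]"])
          (use r w x vs in auto)
    qed
  qed
qed

lemma nf_mult_form:
  assumes "g \<in> carrier G" "h \<in> carrier G"
  obtains p c s m1 m2 m3 where "nf g = p @ m1 @ c" "nf h = winv c @ m2 @ s" "nf (g \<otimes> h) = p @ m3 @ s"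
    "m1 = [] \<and> m2 = [] \<and> m3 = [] \<or> (\<exists>i a b. m1 = [(i, a)] \<and> m2 = [(i, b)] \<and> m3 = [(i, a \<otimes> b)])"
proof -
  obtain p c s m1 m2 m3 where *: "nf g = p @ m1 @ c" "nf h = winv c @ m2 @ s" "red (p @ m3 @ s)"
    "wp (p @ m3 @ s) = wp (nf g) \<otimes> wp (nf h)"
    "m1 = [] \<and> m2 = [] \<and> m3 = [] \<or> (\<exists>i a b. m1 = [(i, a)] \<and> m2 = [(i, b)] \<and> m3 = [(i, a \<otimes> b)])"
    using red_mult_form[OF red_nf[OF assms(1)] red_nf[OF assms(2)]] by blast
  have "wp (p @ m3 @ s) = g \<otimes> h" using *(4) assms by simp
  hence "nf (g \<otimes> h) = p @ m3 @ s" using nf_unique[OF *(3)] by blast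
  with *(1,2,5) show thesis using that by blast
qed

definition extend :: "('c, 'd) monoid_scheme \<Rightarrow> ('i \<Rightarrow> 'a \<Rightarrow> 'c) \<Rightarrow> 'a \<Rightarrow> 'c" where
  "extend K f g = word_prod K (map (\<lambda>(i, a). (i, f i a)) (nf g))"

definition letter_homs :: "('c, 'd) monoid_scheme \<Rightarrow> ('i \<Rightarrow> 'a \<Rightarrow> 'c) \<Rightarrow> bool" where
  "letter_homs K f \<longleftrightarrow> (\<forall>i\<in>I. f i \<in> hom (G\<lparr>carrier := H i\<rparr>) K)"

lemma letter_homsD:
  assumes "letter_homs K f" "i \<in> I" "a \<in> H i"
  shows "f i a \<in> carrier K" and "b \<in> H i \<Longrightarrow> f i (a \<otimes> b) = f i a \<otimes>\<^bsub>K\<^esub> f i b"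
  using assms by (auto simp: letter_homs_def hom_def)

lemma letter_homs_one:
  assumes "group K" "letter_homs K f" "i \<in> I" shows "f i \<one> = \<one>\<^bsub>K\<^esub>"
  using letter_homsD[OF assms(2,3), of \<one>] assms(3)
  by (metis H_one assms(1) group.l_cancel_one group.is_monoid l_one monoid.one_closed one_closed)

lemma extend_word_closed:
  assumes "group K" "letter_homs K f" "red ws"
  shows "word_prod K (map (\<lambda>(i, a). (i, f i a)) ws) \<in> carrier K"
proof -
  interpret K: group K by fact
  show ?thesis using assms(3)
    by (induction ws) (auto simp: word_prod_def red_Cons letter_homsD[OF assms(2)])
qed

lemma extend_closed: "group K \<Longrightarrow> letter_homs K f \<Longrightarrow> g \<in> carrier G \<Longrightarrow> extend K f g \<in> carrier K"
  unfolding extend_def by (rule extend_word_closed) simp_all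

text \<open>Left multiplication by a letter changes the normal form only at its head, so for a
  letter multiplicativity is a short case distinction; \<open>extend_hom\<close> follows by
  induction on the left factor.\<close>

lemma extend_lmul:
  assumes K: "group K" and f: "letter_homs K f" and i: "i \<in> I" "a \<in> H i" and g: "g \<in> carrier G"
  shows "extend K f (a \<otimes> g) = f i a \<otimes>\<^bsub>K\<^esub> extend K f g"
proof -
  interpret K: group K by fact
  have fa: "f i a \<in> carrier K" using letter_homsD f i by blast
  have ex: "extend K f g \<in> carrier K" using extend_closed K f g by blast
  have f1: "f i \<one> = \<one>\<^bsub>K\<^esub>" using letter_homs_one K f i by blast
  show ?thesis
  proof (cases "a = \<one> \<or> nf g = [] \<or> fst (hd (nf g)) \<noteq> i")
    case True
    thus ?thesis using nf_lmul[OF i g] fa ex f1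
      by (cases "nf g") (auto simp: extend_def lmul_def word_prod_def)
  next
    case False
    then obtain b ws where n: "nf g = (i, b) # ws" by (cases "nf g") auto
    have b: "b \<in> H i" "red ws" using n red_nf[OF g] by (auto simp: red_Cons)
    have w: "word_prod K (map (\<lambda>(i, a). (i, f i a)) ws) \<in> carrier K" (is "?w \<in> _")
      using extend_word_closed K f b by blast
    have fb: "f i b \<in> carrier K" "f i (a \<otimes> b) = f i a \<otimes>\<^bsub>K\<^esub> f i b" using letter_homsD f i b by blast+
    have e: "extend K f g = f i b \<otimes>\<^bsub>K\<^esub> ?w" by (simp add: extend_def n word_prod_def)
    show ?thesis
    proof (cases "a \<otimes> b = \<one>")
      case True
      hence "extend K f (a \<otimes> g) = ?w" using nf_lmul[OF i g] n False
        by (simp add: extend_def lmul_def)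
      moreover have "f i a \<otimes>\<^bsub>K\<^esub> f i b = \<one>\<^bsub>K\<^esub>" using True fb f1 by simp
      ultimately show ?thesis using e fa fb w by (metis K.l_one K.m_assoc)
    next
      case nt: False
      thus ?thesis using nf_lmul[OF i g] n False fb e fa w
        by (simp add: extend_def lmul_def word_prod_def K.m_assoc)
    qed
  qed
qed

lemma letter_induct [consumes 1, case_names one letter]:
  assumes "g \<in> carrier G" "P \<one>"
    "\<And>i a g. i \<in> I \<Longrightarrow> a \<in> H i \<Longrightarrow> g \<in> carrier G \<Longrightarrow> P g \<Longrightarrow> P (a \<otimes> g)"
  shows "P g"
proof -
  have "red ws \<Longrightarrow> P (wp ws)" for ws
  proof (induction ws)
    case (Cons p ws)
    thus ?case using assms(3)[of "fst p" "snd p" "wp ws"] by (simp add: red_Cons)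
  qed (simp add: assms(2))
  thus ?thesis using assms(1) red_nf wp_nf by metis
qed

lemma extend_hom:
  assumes K: "group K" and f: "letter_homs K f"
  shows "extend K f \<in> hom G K"
proof (rule homI)
  interpret K: group K by fact
  fix g h assume g: "g \<in> carrier G" and h: "h \<in> carrier G"
  show "extend K f g \<in> carrier K" using extend_closed K f g by blast
  show "extend K f (g \<otimes> h) = extend K f g \<otimes>\<^bsub>K\<^esub> extend K f h"
    using g
  proof (induction rule: letter_induct)
    case one
    have "extend K f \<one> = \<one>\<^bsub>K\<^esub>" by (simp add: extend_def word_prod_def)
    thus ?case using h extend_closed[OF K f] by simp
  next
    case (letter i a g)
    thus ?case using h extend_closed[OF K f] letter_homsD(1)[OF f]
      by (simp add: m_assoc extend_lmul[OF K f] K.m_assoc)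
  qed
qed

lemma extend_letter:
  assumes K: "group K" and f: "letter_homs K f" and i: "i \<in> I" "a \<in> H i"
  shows "extend K f a = f i a"
proof -
  interpret K: group K by fact
  have "extend K f (a \<otimes> \<one>) = f i a \<otimes>\<^bsub>K\<^esub> extend K f \<one>" using extend_lmul[OF K f i] by simp
  thus ?thesis using i letter_homsD(1)[OF f i] by (simp add: extend_def word_prod_def)
qed

lemma hom_eq_on_letters:
  assumes K: "group K" and f: "f \<in> hom G K" "f' \<in> hom G K"
    and l: "\<And>i a. i \<in> I \<Longrightarrow> a \<in> H i \<Longrightarrow> f a = f' a" and g: "g \<in> carrier G"
  shows "f g = f' g"
  using g
proof (induction rule: letter_induct)
  case one
  thus ?case using hom_one[OF f(1) group_axioms K] hom_one[OF f(2) group_axioms K] by simp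
next
  case (letter i a g)
  thus ?case using hom_mult[OF f(1)] hom_mult[OF f(2)] l by simp
qed

end

section \<open>Homogenization and linear independence\<close>

text \<open>Comparing \<open>a (m * n)\<close> both with \<open>m\<close> times \<open>a n\<close>
  and with \<open>n\<close> times \<open>a m\<close> shows that the quotients at \<open>m\<close>
  and \<open>n\<close> differ by at most \<open>D / m + D / n\<close>. The estimate against
  \<open>L\<close> is the limit of this in \<open>m\<close>.\<close>

lemma almost_additive_limit:
  fixes a :: "nat \<Rightarrow> real"
  assumes D: "\<And>m n. \<bar>a (m + n) - a m - a n\<bar> \<le> D"
  obtains L where "(\<lambda>n. a n / real n) \<longlonglongrightarrow> L" "\<And>n. \<bar>a n - real n * L\<bar> \<le> D"
proof -
  have D0: "\<bar>a 0\<bar> \<le> D" using D[of 0 0] by simp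
  hence Dn: "D \<ge> 0" by linarith
  have mult: "\<bar>a (Suc m * n) - real (Suc m) * a n\<bar> \<le> real m * D" for m n
  proof (induction m)
    case (Suc m)
    have "a (Suc (Suc m) * n) = a (Suc m * n + n)" by (simp add: algebra_simps)
    hence "\<bar>a (Suc (Suc m) * n) - a (Suc m * n) - a n\<bar> \<le> D" using D[of "Suc m * n" n] by simp
    thus ?case using Suc by (simp add: algebra_simps)
  qed simp
  have step: "\<bar>a (m * n) / real (m * n) - a n / real n\<bar> \<le> D / real n" if "m > 0" "n > 0" for m n
  proof -
    obtain m' where m: "m = Suc m'" using \<open>m > 0\<close> gr0_implies_Suc by blast
    have "\<bar>a (m * n) - real m * a n\<bar> \<le> real m * D"
    proof -
      have "\<bar>a (m * n) - real m * a n\<bar> \<le> real m' * D" using mult[of m' n] m by simp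
      also have "\<dots> \<le> real m * D" using m Dn by (intro mult_right_mono) auto
      finally show ?thesis .
    qed
    moreover have "a (m * n) / real (m * n) - a n / real n = (a (m * n) - real m * a n) / (real m * real n)"
      using that by (simp add: field_simps)
    ultimately have "\<bar>a (m * n) / real (m * n) - a n / real n\<bar> \<le> (real m * D) / (real m * real n)"
      by (simp only: abs_divide abs_mult abs_of_nat) (intro divide_right_mono, auto)
    also have "\<dots> = D / real n" using that by simp
    finally show ?thesis .
  qed
  have pair: "\<bar>a m / real m - a n / real n\<bar> \<le> D / real m + D / real n" if "m > 0" "n > 0" for m n
    using step[of m n] step[of n m] that by (simp add: mult.commute)
  have "Cauchy (\<lambda>n. a n / real n)"
  proof (rule metric_CauchyI)
    fix e :: real assume e: "e > 0"
    obtain M :: nat where M: "real M > 2 * D / e + 1" using reals_Archimedean2 by blast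
    have "2 * D / e \<ge> 0" using Dn e by simp
    hence M0: "M > 0" using M by linarith
    have small: "D / real m < e / 2" if "m \<ge> M" for m
    proof -
      have "2 * D / e < real m" using M that by linarith
      hence "2 * D < real m * e" using e by (simp add: field_simps)
      thus ?thesis using M0 that by (simp add: field_simps)
    qed
    show "\<exists>M. \<forall>m\<ge>M. \<forall>n\<ge>M. dist (a m / real m) (a n / real n) < e"
    proof (intro exI allI impI)
      fix m n assume "M \<le> m" "M \<le> n"
      thus "dist (a m / real m) (a n / real n) < e"
        using pair[of m n] small[of m] small[of n] M0 unfolding dist_real_def by linarith
    qed
  qed
  then obtain L where L: "(\<lambda>n. a n / real n) \<longlonglongrightarrow> L"
    using Cauchy_convergent convergent_def by blast
  have "\<bar>a n - real n * L\<bar> \<le> D" for n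
  proof (cases "n = 0")
    case False
    have "(\<lambda>m. \<bar>a m / real m - a n / real n\<bar> - D / real m) \<longlonglongrightarrow> \<bar>L - a n / real n\<bar> - 0"
      by (intro tendsto_intros L lim_const_over_n)
    moreover have "\<forall>\<^sub>F m in sequentially. \<bar>a m / real m - a n / real n\<bar> - D / real m \<le> D / real n"
      using eventually_gt_at_top[of 0]
    proof eventually_elim
      case (elim m)
      thus ?case using pair[of m n] False by linarith
    qed
    ultimately have "\<bar>L - a n / real n\<bar> - 0 \<le> D / real n"
      by (rule tendsto_upperbound) simp
    hence "real n * \<bar>L - a n / real n\<bar> \<le> D" using False by (simp add: field_simps)
    moreover have "real n * \<bar>L - a n / real n\<bar> = \<bar>real n * (L - a n / real n)\<bar>" by (simp add: abs_mult)
    moreover have "real n * (L - a n / real n) = real n * L - a n" using False by (simp add: field_simps)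
    ultimately show ?thesis by (simp add: abs_minus_commute)
  qed (use D0 in simp)
  thus thesis using L that by blast
qed

lemma zero_if_multiples_bounded:
  fixes x :: real assumes "\<And>n::nat. real n * \<bar>x\<bar> \<le> C" shows "x = 0"
proof (rule ccontr)
  assume "x \<noteq> 0"
  then obtain n :: nat where "real n > C / \<bar>x\<bar>" using reals_Archimedean2 by blast
  thus False using assms[of n] \<open>x \<noteq> 0\<close> by (simp add: field_simps)
qed

definition homogenization :: "('a, 'b) monoid_scheme \<Rightarrow> ('a \<Rightarrow> real) \<Rightarrow> 'a \<Rightarrow> real" where
  "homogenization G h g = lim (\<lambda>n. h (g [^]\<^bsub>G\<^esub> (n::nat)) / real n)"

context group
begin

lemma homogenization_approx:
  assumes D: "\<And>g k. g \<in> carrier G \<Longrightarrow> k \<in> carrier G \<Longrightarrow> \<bar>h g + h k - h (g \<otimes> k)\<bar> \<le> D"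
    and g: "g \<in> carrier G"
  shows "\<bar>h (g [^] (n::nat)) - real n * homogenization G h g\<bar> \<le> D"
proof -
  have "\<bar>h (g [^] (m + n)) - h (g [^] m) - h (g [^] n)\<bar> \<le> D" for m n :: nat
    using D[of "g [^] m" "g [^] n"] g by (simp add: nat_pow_mult)
  then obtain L where L: "(\<lambda>n. h (g [^] (n::nat)) / real n) \<longlonglongrightarrow> L"
    "\<And>n::nat. \<bar>h (g [^] n) - real n * L\<bar> \<le> D"
    using almost_additive_limit[of "\<lambda>n. h (g [^] n)" D] by blast
  thus ?thesis unfolding homogenization_def using limI by metis
qed

lemma homogenization_zero:
  assumes D: "\<And>g k. g \<in> carrier G \<Longrightarrow> k \<in> carrier G \<Longrightarrow> \<bar>h g + h k - h (g \<otimes> k)\<bar> \<le> D"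
    and g: "g \<in> carrier G" and C: "\<And>n::nat. \<bar>h (g [^] n)\<bar> \<le> C"
  shows "homogenization G h g = 0"
proof (rule zero_if_multiples_bounded[where C = "C + D"])
  fix n :: nat
  have "real n * \<bar>homogenization G h g\<bar> = \<bar>real n * homogenization G h g\<bar>" by (simp add: abs_mult)
  also have "\<dots> \<le> C + D" using homogenization_approx[OF D g, where n = n] C[of n] by linarith
  finally show "real n * \<bar>homogenization G h g\<bar> \<le> C + D" .
qed

text \<open>The factor \<open>c\<close> has two uses: 1 for automorphisms, -1 for passing to the
  inverse of an element.\<close>

lemma homogenization_eqI:
  assumes D: "\<And>g k. g \<in> carrier G \<Longrightarrow> k \<in> carrier G \<Longrightarrow> \<bar>h g + h k - h (g \<otimes> k)\<bar> \<le> D"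
    and g: "g \<in> carrier G" "g' \<in> carrier G"
    and C: "\<And>n::nat. \<bar>h (g' [^] n) - c * h (g [^] n)\<bar> \<le> C"
  shows "homogenization G h g' = c * homogenization G h g"
proof -
  have "homogenization G h g' - c * homogenization G h g = 0"
  proof (rule zero_if_multiples_bounded[where C = "C + D + \<bar>c\<bar> * D"])
    fix n :: nat
    have "\<bar>c * h (g [^] n) - c * (real n * homogenization G h g)\<bar> \<le> \<bar>c\<bar> * D"
      using homogenization_approx[OF D g(1), where n = n]
      by (metis abs_ge_zero abs_mult mult_left_mono right_diff_distrib)
    moreover have "real n * \<bar>homogenization G h g' - c * homogenization G h g\<bar> =
        \<bar>real n * homogenization G h g' - c * (real n * homogenization G h g)\<bar>"
    proof -
      have "real n * homogenization G h g' - c * (real n * homogenization G h g) =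
          real n * (homogenization G h g' - c * homogenization G h g)" by (simp add: algebra_simps)
      thus ?thesis by (simp add: abs_mult)
    qed
    ultimately show "real n * \<bar>homogenization G h g' - c * homogenization G h g\<bar> \<le> C + D + \<bar>c\<bar> * D"
      using homogenization_approx[OF D g(2), where n = n] C[of n] by linarith
  qed
  thus ?thesis by simp
qed

lemma homogenization_quasimorphism:
  assumes "quasimorphism G h"
  shows "quasimorphism G (homogenization G h)"
proof -
  obtain D where D: "\<And>g k. g \<in> carrier G \<Longrightarrow> k \<in> carrier G \<Longrightarrow> \<bar>h g + h k - h (g \<otimes> k)\<bar> \<le> D"
    using assms by (auto simp: quasimorphism_def)
  have a: "\<bar>h g - homogenization G h g\<bar> \<le> D" if "g \<in> carrier G" for g
    using homogenization_approx[OF D that, where n = 1] that by simp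
  have "\<bar>homogenization G h g + homogenization G h k - homogenization G h (g \<otimes> k)\<bar> \<le> 4 * D"
    if "g \<in> carrier G" "k \<in> carrier G" for g k
    using a[OF that(1)] a[OF that(2)] a[of "g \<otimes> k"] D[OF that] that by simp
  moreover have "D \<ge> 0" using a[of \<one>] by simp
  ultimately show ?thesis unfolding quasimorphism_def by (intro exI[of _ "4 * D"]) auto
qed

lemma homogenization_homogeneous:
  assumes "quasimorphism G h"
  shows "homogeneous_qm G (homogenization G h)"
proof -
  obtain D where D: "\<And>g k. g \<in> carrier G \<Longrightarrow> k \<in> carrier G \<Longrightarrow> \<bar>h g + h k - h (g \<otimes> k)\<bar> \<le> D"
    using assms by (auto simp: quasimorphism_def)
  have pos: "homogenization G h (g [^] m) = real m * homogenization G h g" if g: "g \<in> carrier G" for g and m :: nat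
  proof -
    have "homogenization G h (g [^] m) - real m * homogenization G h g = 0"
    proof (rule zero_if_multiples_bounded[where C = "2 * D"])
      fix n :: nat
      have "\<bar>h (g [^] (m * n)) - real n * homogenization G h (g [^] m)\<bar> \<le> D"
        using homogenization_approx[OF D, of "g [^] m" n] g by (simp add: nat_pow_pow)
      moreover have "\<bar>h (g [^] (m * n)) - real (m * n) * homogenization G h g\<bar> \<le> D"
        using homogenization_approx[OF D g, where n = "m * n"] by simp
      moreover have "real n * \<bar>homogenization G h (g [^] m) - real m * homogenization G h g\<bar> =
         \<bar>real n * homogenization G h (g [^] m) - real (m * n) * homogenization G h g\<bar>"
      proof -
        have "real n * homogenization G h (g [^] m) - real (m * n) * homogenization G h g =
          real n * (homogenization G h (g [^] m) - real m * homogenization G h g)" by (simp add: algebra_simps)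
        thus ?thesis by (simp add: abs_mult)
      qed
      ultimately show "real n * \<bar>homogenization G h (g [^] m) - real m * homogenization G h g\<bar> \<le> 2 * D"
        by linarith
    qed
    thus ?thesis by simp
  qed
  have neg: "homogenization G h (inv g) = - homogenization G h g" if g: "g \<in> carrier G" for g
  proof -
    have "\<bar>h ((inv g) [^] n) - (-1) * h (g [^] n)\<bar> \<le> D + \<bar>h \<one>\<bar>" for n :: nat
      using D[of "(inv g) [^] n" "g [^] n"] g by (simp add: nat_pow_inv)
    from homogenization_eqI[OF D g _ this] g show ?thesis by simp
  qed
  show ?thesis unfolding homogeneous_qm_def
  proof (intro ballI allI)
    fix g and n :: int assume g: "g \<in> carrier G"
    show "homogenization G h (g [^] n) = of_int n * homogenization G h g"
    proof (cases "n \<ge> 0")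
      case True
      then obtain m where n: "n = int m" using nonneg_int_cases by blast
      show ?thesis using pos[OF g, of m] by (simp add: n int_pow_int)
    next
      case False
      then obtain m where n: "n = - int m" by (metis int_cases2 of_nat_0_le_iff)
      have "g [^] n = inv (g [^] m)" using g by (simp add: n int_pow_neg int_pow_int)
      hence "homogenization G h (g [^] n) = - homogenization G h (g [^] m)" using neg g by simp
      also have "\<dots> = - (real m * homogenization G h g)" using pos[OF g, of m] by simp
      finally show ?thesis by (simp add: n)
    qed
  qed
qed

lemma homogenization_hom_invariant:
  assumes "quasimorphism G h" "\<phi> \<in> hom G G"
    and C: "\<And>g. g \<in> carrier G \<Longrightarrow> \<bar>h (\<phi> g) - h g\<bar> \<le> C" and g: "g \<in> carrier G"
  shows "homogenization G h (\<phi> g) = homogenization G h g"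
proof -
  obtain D where D: "\<And>g k. g \<in> carrier G \<Longrightarrow> k \<in> carrier G \<Longrightarrow> \<bar>h g + h k - h (g \<otimes> k)\<bar> \<le> D"
    using assms by (auto simp: quasimorphism_def)
  have "\<bar>h (\<phi> g [^] n) - 1 * h (g [^] n)\<bar> \<le> C" for n :: nat
    using C[of "g [^] n"] g hom_nat_pow[OF assms(2) g group_axioms] by (simp add: is_group)
  moreover have "\<phi> g \<in> carrier G" using hom_in_carrier[OF assms(2) g] .
  ultimately show ?thesis using homogenization_eqI[OF D g, of "\<phi> g" 1 C] by simp
qed

text \<open>The limit over powers kills bounded errors: almost invariance becomes invariance,
  boundedness on powers becomes vanishing. The matrix of the values \<open>\<psi> m (x m')\<close>
  is then diagonal with nonzero diagonal, whence independence. All three cases of the theorem end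
  here.\<close>

lemma independent_homogenizations:
  fixes h :: "nat \<Rightarrow> 'a \<Rightarrow> real" and x :: "nat \<Rightarrow> 'a" and L :: "'a set"
  assumes qm: "\<And>m. quasimorphism G (h m)"
    and aut: "\<And>m \<phi>. \<phi> \<in> auto G \<Longrightarrow> \<exists>C. \<forall>g\<in>carrier G. \<bar>h m (\<phi> g) - h m g\<bar> \<le> C"
    and L: "L \<subseteq> carrier G" "\<And>m g. g \<in> L \<Longrightarrow> \<exists>C. \<forall>n::nat. \<bar>h m (g [^] n)\<bar> \<le> C"
    and x: "\<And>m. x m \<in> carrier G" "\<And>m m'. m \<noteq> m' \<Longrightarrow> \<exists>C. \<forall>n::nat. \<bar>h m (x m' [^] n)\<bar> \<le> C"
      "\<And>m. \<exists>C. \<forall>n::nat. real n \<le> \<bar>h m (x m [^] n)\<bar> + C"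
  shows "\<exists>S. infinite S \<and> lin_indep_funs G S \<and>
      (\<forall>\<psi>\<in>S. quasimorphism G \<psi> \<and> homogeneous_qm G \<psi> \<and> aut_invariant G \<psi> \<and> (\<forall>g\<in>L. \<psi> g = 0))"
proof -
  define \<psi> where "\<psi> m = homogenization G (h m)" for m
  have "\<exists>D. \<forall>g\<in>carrier G. \<forall>k\<in>carrier G. \<bar>h m g + h m k - h m (g \<otimes> k)\<bar> \<le> D" for m
    using qm[of m] by (auto simp: quasimorphism_def)
  then obtain D where D: "\<And>m g k. g \<in> carrier G \<Longrightarrow> k \<in> carrier G \<Longrightarrow> \<bar>h m g + h m k - h m (g \<otimes> k)\<bar> \<le> D m"
    by metis
  have off: "\<psi> m (x m') = 0" if "m \<noteq> m'" for m m'
    using x(2)[OF that] homogenization_zero[of "h m" "D m" "x m'"] D x(1) unfolding \<psi>_def by blast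
  have diag: "\<psi> m (x m) \<noteq> 0" for m
  proof
    assume z: "\<psi> m (x m) = 0"
    obtain C where C: "\<And>n::nat. real n \<le> \<bar>h m (x m [^] n)\<bar> + C" using x(3) by blast
    have "\<bar>h m (x m [^] n)\<bar> \<le> D m" for n :: nat
      using homogenization_approx[of "h m" "D m" "x m" n] D x(1) z unfolding \<psi>_def by simp
    hence "real n \<le> D m + C" for n :: nat using C[of n] by (smt (verit))
    thus False using reals_Archimedean2[of "D m + C"] by (metis not_le)
  qed
  have inj: "inj \<psi>" using off diag by (metis injI)
  have indep: "lin_indep_funs G (range \<psi>)"
    unfolding lin_indep_funs_def
  proof (intro allI impI ballI)
    fix F c f assume *: "finite F \<and> F \<subseteq> range \<psi> \<and> (\<forall>g\<in>carrier G. (\<Sum>\<psi>\<in>F. c \<psi> * \<psi> g) = 0)" and f: "f \<in> F"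
    then obtain m where m: "f = \<psi> m" by blast
    have "(\<Sum>f'\<in>F. c f' * f' (x m)) = (\<Sum>f'\<in>{f}. c f' * f' (x m))"
    proof (intro sum.mono_neutral_right)
      show "\<forall>i\<in>F - {f}. c i * i (x m) = 0"
      proof
        fix i assume i: "i \<in> F - {f}"
        then obtain m' where "i = \<psi> m'" using * by blast
        thus "c i * i (x m) = 0" using i m off[of m' m] by auto
      qed
    qed (use * f in auto)
    thus "c f = 0" using * x(1) m diag[of m] by auto
  qed
  have "aut_invariant G (\<psi> m)" for m
    unfolding aut_invariant_def
  proof (intro ballI)
    fix \<phi> g assume p: "\<phi> \<in> auto G" and g: "g \<in> carrier G"
    obtain C where C: "\<And>g. g \<in> carrier G \<Longrightarrow> \<bar>h m (\<phi> g) - h m g\<bar> \<le> C" using aut[OF p] by blast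
    show "\<psi> m (\<phi> g) = \<psi> m g" unfolding \<psi>_def
      using homogenization_hom_invariant[OF qm _ C g] p by (simp add: auto_def)
  qed
  moreover have "\<psi> m g = 0" if "g \<in> L" for m g
    using L that homogenization_zero[of "h m" "D m" g] D unfolding \<psi>_def by blast
  ultimately show ?thesis
    using indep range_inj_infinite[OF inj] homogenization_quasimorphism[OF qm] homogenization_homogeneous[OF qm]
    by (intro exI[of _ "range \<psi>"]) (auto simp: \<psi>_def)
qed

end

section \<open>Almost invariant subsets of indecomposable groups\<close>

text \<open>An asymmetric ping-pong: \<open>Q\<close> throws the complement of \<open>Xs\<close>
  into \<open>Xs\<close>, and \<open>P\<close> throws \<open>Xs\<close> out of itself. So membership
  in \<open>Xs\<close> tells whether a product begins in \<open>Q\<close>. A product beginning in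
  \<open>P\<close> is not \<open>\<one>\<close>, since its remainder lies in \<open>Xs\<close> and
  cannot be the inverse of an element of \<open>P\<close>.\<close>

lemma (in group) ping_pong_free_product:
  assumes P: "subgroup P G" and Q: "subgroup Q G" and gen: "generate G (P \<union> Q) = carrier G"
    and one: "\<one> \<notin> Xs" and PX: "\<And>p. p \<in> P \<Longrightarrow> p \<noteq> \<one> \<Longrightarrow> p \<notin> Xs"
    and p: "\<And>p g. p \<in> P \<Longrightarrow> p \<noteq> \<one> \<Longrightarrow> g \<in> carrier G \<Longrightarrow> g \<in> Xs \<Longrightarrow> p \<otimes> g \<notin> Xs"
    and q: "\<And>q g. q \<in> Q \<Longrightarrow> q \<noteq> \<one> \<Longrightarrow> g \<in> carrier G \<Longrightarrow> g \<notin> Xs \<Longrightarrow> q \<otimes> g \<in> Xs"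
  shows "is_free_product G (UNIV :: bool set) (\<lambda>b. if b then P else Q)" (is "is_free_product G _ ?H")
proof -
  have "word_prod G ws \<in> carrier G \<and> (ws \<noteq> [] \<longrightarrow>
      word_prod G ws \<noteq> \<one> \<and> (word_prod G ws \<in> Xs \<longleftrightarrow> \<not> fst (hd ws)))" if "reduced_word G UNIV ?H ws" for ws
    using that
  proof (induction ws)
    case (Cons x ws)
    have x: "snd x \<in> ?H (fst x)" "snd x \<noteq> \<one>" and rd: "reduced_word G UNIV ?H ws"
      using Cons.prems unfolding reduced_word_def by (auto simp: all_conj_distrib)
    have ne: "ws = [] \<or> fst (hd ws) \<noteq> fst x"
    proof (cases ws)
      case (Cons y ys)
      have "Suc 0 < length (x # ws) \<longrightarrow> fst ((x # ws) ! 0) \<noteq> fst ((x # ws) ! Suc 0)"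
        using Cons.prems unfolding reduced_word_def by blast
      thus ?thesis using Cons by auto
    qed simp
    let ?w = "word_prod G ws"
    have w: "?w \<in> carrier G" using Cons.IH rd by blast
    have e: "word_prod G (x # ws) = snd x \<otimes> ?w" by (simp add: word_prod_def)
    have xc: "snd x \<in> carrier G" using x P Q by (auto split: if_splits dest: subgroup.mem_carrier)
    show ?case
    proof (cases "fst x")
      case True
      hence xp: "snd x \<in> P" using x by simp
      show ?thesis
      proof (cases "ws = []")
        case True
        thus ?thesis using e xc x PX[OF xp] \<open>fst x\<close> by (simp add: word_prod_def)
      next
        case False
        hence wX: "?w \<in> Xs" using Cons.IH rd ne \<open>fst x\<close> by blast
        have "snd x \<otimes> ?w \<noteq> \<one>"
        proof
          assume "snd x \<otimes> ?w = \<one>"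
          hence "?w = inv (snd x)" using xc w by (metis inv_closed inv_equality inv_inv)
          moreover have "inv (snd x) \<notin> Xs"
            using PX[OF subgroup.m_inv_closed[OF P xp]] x xc by (metis inv_eq_1_iff)
          ultimately show False using wX by simp
        qed
        thus ?thesis using e xc w p[OF xp x(2) w wX] \<open>fst x\<close> by simp
      qed
    next
      case False
      hence "?w \<notin> Xs" using Cons.IH rd ne one by (cases "ws = []") (auto simp: word_prod_def)
      hence "snd x \<otimes> ?w \<in> Xs" using q x False w by simp
      thus ?thesis using e xc w False one by auto
    qed
  qed (simp add: word_prod_def)
  moreover have "(\<Union>b\<in>UNIV. ?H b) = P \<union> Q" by auto
  ultimately show ?thesis using P Q gen is_group unfolding is_free_product_def by auto
qed

text \<open>A nested, almost invariant subset \<open>U\<close> plays the role of a half-space of the tree dual to its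
  translates: \<open>A\<close> and \<open>B\<close> below are the stabilisers of the two vertices of the edge \<open>U\<close>, and an
  element \<open>t\<close> moving one of them to the other turns the splitting into an HNN extension.\<close>

lemma (in group) indecomposable_almost_invariant:
  assumes fi: "freely_indecomposable G" and one: "\<one> \<notin> U"
    and N: "\<And>k g. k \<in> carrier G \<Longrightarrow> g \<in> carrier G \<Longrightarrow> k \<noteq> \<one> \<Longrightarrow> (g \<in> U) \<noteq> (inv k \<in> U) \<Longrightarrow>
        (k \<otimes> g \<in> U) = (k \<in> U)"
    and F: "\<And>k. k \<in> carrier G \<Longrightarrow> finite {g \<in> carrier G. (g \<in> U) \<noteq> (g \<otimes> k \<in> U)}"
    and k0: "k0 \<in> carrier G" "k0 \<in> U" "inv k0 \<notin> U"
  shows "infinite_cyclic G"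
proof -
  define V where "V = insert \<one> U"
  define A where "A = {a \<in> carrier G. \<forall>g\<in>carrier G. (g \<otimes> a \<in> U) = (g \<in> U)}"
  define B where "B = {b \<in> carrier G. \<forall>g\<in>carrier G. (g \<otimes> b \<in> V) = (g \<in> V)}"
  have stab: "subgroup {a \<in> carrier G. \<forall>g\<in>carrier G. (g \<otimes> a \<in> Xs) = (g \<in> Xs)} G" (is "subgroup ?S G") for Xs
  proof (rule subgroupI)
    show "?S \<subseteq> carrier G" by blast
    show "?S \<noteq> {}" by (auto intro: exI[of _ \<one>])
    fix a assume a: "a \<in> ?S"
    have "(g \<otimes> inv a \<in> Xs) = (g \<in> Xs)" if g: "g \<in> carrier G" for g
    proof -
      have "((g \<otimes> inv a) \<otimes> a \<in> Xs) = (g \<otimes> inv a \<in> Xs)" using a g by auto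
      thus ?thesis using a g by (simp add: m_assoc)
    qed
    thus "inv a \<in> ?S" using a by simp
    fix b assume "b \<in> ?S"
    thus "a \<otimes> b \<in> ?S" using a by (simp add: m_assoc[symmetric])
  qed
  have sA: "subgroup A G" and sB: "subgroup B G" using stab by (simp_all add: A_def B_def)
  \<comment> \<open>Nesting passes from \<open>U\<close> to \<open>V\<close>, as the two differ only
    at \<open>\<one>\<close>.\<close>
  have NX: "(m \<otimes> a \<in> Xs) = (m \<in> U)"
    if Xs: "Xs = U \<or> Xs = V" and m: "m \<in> carrier G" "m \<noteq> \<one>" and a: "a \<in> carrier G" and ne: "(a \<in> Xs) \<noteq> (inv m \<in> U)" for Xs m a
  proof (cases "a = \<one>")
    case True
    thus ?thesis using Xs m by (auto simp: V_def)
  next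
    case False
    hence U: "(a \<in> U) \<noteq> (inv m \<in> U)" using Xs ne by (auto simp: V_def)
    have "m \<otimes> a \<noteq> \<one>" using U m a by (metis inv_equality inv_inv inv_closed)
    thus ?thesis using Xs N[OF m(1) a m(2) U] by (auto simp: V_def)
  qed
  have fin: "finite {g \<in> carrier G. (g \<in> Xs) \<noteq> (g \<otimes> k \<in> Ys)}" (is "finite ?S")
    if "Xs = U \<or> Xs = V" "Ys = U \<or> Ys = V" "k \<in> carrier G" for Xs Ys k
  proof (rule finite_subset)
    show "?S \<subseteq> {g \<in> carrier G. (g \<in> U) \<noteq> (g \<otimes> k \<in> U)} \<union> {\<one>, inv k}"
      using that by (auto simp: V_def) (metis inv_equality)+
    show "finite ({g \<in> carrier G. (g \<in> U) \<noteq> (g \<otimes> k \<in> U)} \<union> {\<one>, inv k})" using F[OF that(3)] by simp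
  qed
  \<comment> \<open>The cardinality below counts the edges of the tree between a vertex of type
    \<open>Xs\<close> and a translate by \<open>k\<close> of one of type \<open>Ys\<close>. At
    distance zero \<open>k\<close> lies in \<open>A\<close> or in \<open>B\<close> or carries one
    end of the edge to the other; otherwise an edge \<open>g\<close> on the path splits
    \<open>k\<close> into \<open>inv g\<close> and \<open>g \<otimes> k\<close>, both of smaller
    distance.\<close>
  have generation: "carrier G \<subseteq> M" if M: "subgroup M G" "A \<subseteq> M" "B \<subseteq> M"
    "\<And>t. t \<in> carrier G \<Longrightarrow> (\<And>g. g \<in> carrier G \<Longrightarrow> (g \<otimes> t \<in> U) = (g \<in> V)) \<Longrightarrow> t \<in> M" for M
  proof -
    have "Xs = U \<or> Xs = V \<Longrightarrow> Ys = U \<or> Ys = V \<Longrightarrow> k \<in> carrier G \<Longrightarrow>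
        card {g \<in> carrier G. (g \<in> Xs) \<noteq> (g \<otimes> k \<in> Ys)} = n \<Longrightarrow> k \<in> M" for Xs Ys k n
    proof (induction n arbitrary: Xs Ys k rule: less_induct)
      case (less n)
      let ?S = "\<lambda>Xs Ys k. {g \<in> carrier G. (g \<in> Xs) \<noteq> (g \<otimes> k \<in> Ys)}"
      note k = \<open>k \<in> carrier G\<close>
      have fS: "finite (?S Xs Ys k)" using fin less.prems by blast
      show ?case
      proof (cases "?S Xs Ys k = {}")
        case True
        hence eq: "(g \<in> Xs) = (g \<otimes> k \<in> Ys)" if "g \<in> carrier G" for g using that by blast
        consider "Xs = U" "Ys = U" | "Xs = V" "Ys = V" | "Xs = V" "Ys = U" | "Xs = U" "Ys = V"
          using less.prems(1,2) by blast
        thus ?thesis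
        proof cases
          case 1 thus ?thesis using eq k M(2) by (auto simp: A_def)
        next
          case 2 thus ?thesis using eq k M(3) by (auto simp: B_def)
        next
          case 3 thus ?thesis using eq k M(4)[of k] by auto
        next
          case 4
          have "(g \<otimes> inv k \<in> U) = (g \<in> V)" if "g \<in> carrier G" for g
            using eq[of "g \<otimes> inv k"] that k 4 by (simp add: m_assoc)
          hence "inv k \<in> M" using M(4)[of "inv k"] k by simp
          thus ?thesis using M(1) k by (metis inv_inv subgroup.m_inv_closed)
        qed
      next
        case False
        then obtain g where g: "g \<in> carrier G" "(g \<in> Xs) \<noteq> (g \<otimes> k \<in> Ys)" by blast
        obtain N1 N2 where N12: "N1 = U \<or> N1 = V" "N2 = U \<or> N2 = V" "(\<one> \<in> N1) = (g \<in> Xs)" "(\<one> \<in> N2) = (g \<otimes> k \<in> Ys)"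
          using g one by (metis V_def insertI1)
        \<comment> \<open>The path does not backtrack: no edge \<open>h\<close> other than
          \<open>g\<close> separates \<open>g\<close> from both ends of the path.\<close>
        have key: "\<not> ((h \<in> Xs) \<noteq> (h \<otimes> inv g \<in> U) \<and> (h \<otimes> k \<in> Ys) \<noteq> (h \<otimes> inv g \<in> U))"
          if h: "h \<in> carrier G" "h \<noteq> g" for h
        proof -
          let ?m = "h \<otimes> inv g"
          have m: "?m \<in> carrier G" using h g by simp
          have m1: "?m \<noteq> \<one>" using h g by (metis inv_closed inv_equality inv_inv)
          have hg: "?m \<otimes> g = h" "?m \<otimes> (g \<otimes> k) = h \<otimes> k"
            using h g k by (simp_all add: inv_solve_left' m_assoc)
          have "(g \<in> Xs) \<noteq> (inv ?m \<in> U) \<or> (g \<otimes> k \<in> Ys) \<noteq> (inv ?m \<in> U)" using g by blast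
          thus ?thesis
            using NX[OF less.prems(1) m m1 g(1)] NX[OF less.prems(2) m m1, of "g \<otimes> k"] hg g k by auto
        qed
        have UV: "(h \<otimes> inv g \<in> N) = (h \<otimes> inv g \<in> U)" if "h \<in> carrier G" "h \<noteq> g" "N = U \<or> N = V" for h N
        proof -
          have "h \<otimes> inv g \<noteq> \<one>" using that g by (metis inv_closed inv_equality inv_inv)
          thus ?thesis using that by (auto simp: V_def)
        qed
        have s1: "?S Xs N1 (inv g) \<subset> ?S Xs Ys k"
        proof
          show "?S Xs N1 (inv g) \<subseteq> ?S Xs Ys k"
          proof
            fix h assume h: "h \<in> ?S Xs N1 (inv g)"
            have "h \<noteq> g" using h N12 g by auto
            thus "h \<in> ?S Xs Ys k" using h key[of h] UV[of h N1] N12 by auto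
          qed
          show "?S Xs N1 (inv g) \<noteq> ?S Xs Ys k"
          proof
            assume "?S Xs N1 (inv g) = ?S Xs Ys k"
            hence "g \<in> ?S Xs N1 (inv g)" using g by blast
            thus False using N12 g by simp
          qed
        qed
        have s2: "(\<lambda>h. h \<otimes> inv g) ` ?S Xs Ys k \<supset> ?S N2 Ys (g \<otimes> k)"
        proof
          show "?S N2 Ys (g \<otimes> k) \<subseteq> (\<lambda>h. h \<otimes> inv g) ` ?S Xs Ys k"
          proof
            fix h' assume h': "h' \<in> ?S N2 Ys (g \<otimes> k)"
            let ?h = "h' \<otimes> g"
            have h: "?h \<in> carrier G" "h' = ?h \<otimes> inv g" using h' g by (auto simp: m_assoc)
            have hk: "?h \<otimes> k = h' \<otimes> (g \<otimes> k)" using h' g k by (simp add: m_assoc)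
            have "?h \<noteq> g"
            proof
              assume "?h = g"
              hence "h' = \<one>" using h' g by (metis (no_types, lifting) l_one mem_Collect_eq one_closed right_cancel)
              thus False using h' N12 g k by simp
            qed
            hence "?h \<in> ?S Xs Ys k" using h' h hk key[of ?h] UV[of ?h N2] N12 by auto
            thus "h' \<in> (\<lambda>h. h \<otimes> inv g) ` ?S Xs Ys k" using h by blast
          qed
          show "?S N2 Ys (g \<otimes> k) \<noteq> (\<lambda>h. h \<otimes> inv g) ` ?S Xs Ys k"
          proof
            assume e: "?S N2 Ys (g \<otimes> k) = (\<lambda>h. h \<otimes> inv g) ` ?S Xs Ys k"
            have "\<one> \<in> (\<lambda>h. h \<otimes> inv g) ` ?S Xs Ys k" using g by (auto intro!: image_eqI[of _ _ g])
            hence "\<one> \<in> ?S N2 Ys (g \<otimes> k)" using e by simp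
            thus False using N12 g k by simp
          qed
        qed
        have c1: "card (?S Xs N1 (inv g)) < n"
          using psubset_card_mono[OF fS s1] less.prems by simp
        have "card (?S N2 Ys (g \<otimes> k)) < card ((\<lambda>h. h \<otimes> inv g) ` ?S Xs Ys k)"
          using psubset_card_mono[OF _ s2] fS by blast
        also have "\<dots> \<le> n" using card_image_le[OF fS] less.prems by simp
        finally have c2: "card (?S N2 Ys (g \<otimes> k)) < n" .
        have "inv g \<in> M" using less.IH[OF c1 less.prems(1) N12(1)] g by simp
        moreover have "g \<otimes> k \<in> M" using less.IH[OF c2 N12(2) less.prems(2)] g k by simp
        ultimately have "inv g \<otimes> (g \<otimes> k) \<in> M" using M(1) by (simp add: subgroup.m_closed)
        thus ?thesis using g k by (simp add: m_assoc[symmetric])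
      qed
    qed
    thus ?thesis by blast
  qed
  have Ac: "a \<in> carrier G" if "a \<in> A" for a using that by (simp add: A_def)
  have Bc: "b \<in> carrier G" if "b \<in> B" for b using that by (simp add: B_def)
  have AU: "a \<notin> U" if "a \<in> A" for a
  proof -
    have a: "a \<in> carrier G" "\<forall>g\<in>carrier G. (g \<otimes> a \<in> U) = (g \<in> U)"
      using that unfolding A_def by blast+
    hence "(\<one> \<otimes> a \<in> U) = (\<one> \<in> U)" by blast
    thus ?thesis using one a(1) by simp
  qed
  have BV: "b \<in> V" if "b \<in> B" for b
  proof -
    have b: "b \<in> carrier G" "\<forall>g\<in>carrier G. (g \<otimes> b \<in> V) = (g \<in> V)"
      using that unfolding B_def by blast+
    hence "(\<one> \<otimes> b \<in> V) = (\<one> \<in> V)" by blast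
    thus ?thesis using b(1) by (simp add: V_def)
  qed
  have sub_gen: "subgroup (generate G (P \<union> Q)) G" "P \<subseteq> generate G (P \<union> Q)" "Q \<subseteq> generate G (P \<union> Q)"
    if "subgroup P G" "subgroup Q G" for P Q
    using that generate_is_subgroup[of "P \<union> Q"] by (auto simp: subgroup.subset intro: generate.incl)
  have no_split: False
    if "P \<noteq> {\<one>}" "Q \<noteq> {\<one>}" "is_free_product G (UNIV :: bool set) (\<lambda>b. if b then P else Q)" for P Q
    using fi that unfolding freely_indecomposable_def by blast
  show ?thesis
  proof (cases "\<exists>t\<in>carrier G. \<forall>g\<in>carrier G. (g \<otimes> t \<in> U) = (g \<in> V)")
    \<comment> \<open>The two ends of the edge lie in different orbits, and \<open>A\<close> and
      \<open>B\<close> alone generate. Both are nontrivial, because neither is the whole group: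
      \<open>k0\<close> is not in \<open>A\<close> and \<open>inv k0\<close> is not in
      \<open>B\<close>.\<close>
    case False
    let ?M = "generate G (A \<union> B)"
    have "carrier G \<subseteq> ?M"
      by (rule generation) (use sub_gen[OF sA sB] False in auto)
    hence gen: "generate G (A \<union> B) = carrier G"
      using sub_gen(1)[OF sA sB] subgroup.subset by blast
    have "B \<noteq> {\<one>}"
    proof
      assume "B = {\<one>}"
      hence "A \<union> B \<subseteq> A" using subgroup.one_closed[OF sA] by blast
      hence "carrier G \<subseteq> A" using gen generate_subgroup_incl[OF _ sA] by metis
      thus False using k0 AU by blast
    qed
    moreover have "A \<noteq> {\<one>}"
    proof
      assume "A = {\<one>}"
      hence "A \<union> B \<subseteq> B" using subgroup.one_closed[OF sB] by blast
      hence "carrier G \<subseteq> B" using gen generate_subgroup_incl[OF _ sB] by metis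
      hence "inv k0 \<in> V" using k0 BV by blast
      hence "k0 = \<one>" using k0 by (metis V_def insertE inv_eq_1_iff)
      thus False using k0 one by simp
    qed
    moreover have "is_free_product G (UNIV :: bool set) (\<lambda>b. if b then A else B)"
    proof (rule ping_pong_free_product[OF sA sB gen one])
      fix p g assume p: "p \<in> A" "p \<noteq> \<one>" and g: "g \<in> carrier G" "g \<in> U"
      have "p \<in> carrier G" "inv p \<in> A" using p Ac subgroup.m_inv_closed[OF sA] by blast+
      thus "p \<otimes> g \<notin> U" using N[of p g] p g AU by blast
    next
      fix q g assume q: "q \<in> B" "q \<noteq> \<one>" and g: "g \<in> carrier G" "g \<notin> U"
      have qc: "q \<in> carrier G" "inv q \<in> B" "inv q \<noteq> \<one>"
        using q Bc[OF q(1)] subgroup.m_inv_closed[OF sB q(1)] by (simp_all add: inv_eq_1_iff)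
      have "inv q \<in> U" "q \<in> U" using BV[OF q(1)] BV[OF qc(2)] q qc(3) unfolding V_def by blast+
      thus "q \<otimes> g \<in> U" using N[of q g] q g qc by blast
    qed (use AU in auto)
    ultimately show ?thesis using no_split by blast
  next
    case True
    then obtain t where t: "t \<in> carrier G" "\<And>g. g \<in> carrier G \<Longrightarrow> (g \<otimes> t \<in> U) = (g \<in> V)" by blast
    have tU: "t \<in> U" using t(2)[of \<one>] t by (simp add: V_def)
    have tV: "inv t \<notin> V" using t(2)[of "inv t"] t one by simp
    hence itU: "inv t \<notin> U" and t1: "t \<noteq> \<one>" using one tU by (auto simp: V_def)
    define T where "T = range (\<lambda>n::int. t [^] n)"
    have sT: "subgroup T G" unfolding T_def
      using t by (intro subgroupI) (auto simp: int_pow_mult[symmetric] int_pow_neg[symmetric] simp flip: int_pow_neg)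
    have tT: "t \<in> T" unfolding T_def using t by (auto intro: image_eqI[of _ _ 1])
    define M where "M = generate G (A \<union> T)"
    have sM: "subgroup M G" "A \<subseteq> M" "T \<subseteq> M" using sub_gen[OF sA sT] by (auto simp: M_def)
    have "carrier G \<subseteq> M"
    proof (rule generation[OF sM(1,2)])
      show "B \<subseteq> M"
      proof
        fix b assume b: "b \<in> B"
        hence bc: "b \<in> carrier G" by (simp add: B_def)
        let ?a = "inv t \<otimes> b \<otimes> t"
        have "(g \<otimes> ?a \<in> U) = (g \<in> U)" if g: "g \<in> carrier G" for g
        proof -
          have "g \<otimes> ?a = ((g \<otimes> inv t) \<otimes> b) \<otimes> t" using g t bc by (simp add: m_assoc)
          hence "(g \<otimes> ?a \<in> U) = ((g \<otimes> inv t) \<otimes> b \<in> V)" using t g bc by simp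
          also have "\<dots> = (g \<otimes> inv t \<in> V)" using b g t by (simp add: B_def)
          also have "\<dots> = ((g \<otimes> inv t) \<otimes> t \<in> U)" using t(2)[of "g \<otimes> inv t"] g t by simp
          finally show ?thesis using g t by (simp add: m_assoc)
        qed
        hence "?a \<in> M" using sM(2) t bc by (auto simp: A_def)
        hence "t \<otimes> ?a \<otimes> inv t \<in> M" using sM tT by (meson subgroup.m_closed subgroup.m_inv_closed subsetD)
        moreover have "t \<otimes> ?a \<otimes> inv t = b" using t bc by (simp add: m_assoc) (simp add: m_assoc[symmetric])
        ultimately show "b \<in> M" by simp
      qed
    next
      fix t' assume t': "t' \<in> carrier G" "\<And>g. g \<in> carrier G \<Longrightarrow> (g \<otimes> t' \<in> U) = (g \<in> V)"
      have "(g \<otimes> (inv t \<otimes> t') \<in> U) = (g \<in> U)" if g: "g \<in> carrier G" for g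
      proof -
        have "(g \<otimes> (inv t \<otimes> t') \<in> U) = (g \<otimes> inv t \<in> V)"
          using t'(2)[of "g \<otimes> inv t"] g t t' by (simp add: m_assoc)
        also have "\<dots> = ((g \<otimes> inv t) \<otimes> t \<in> U)" using t(2)[of "g \<otimes> inv t"] g t by simp
        finally show ?thesis using g t by (simp add: m_assoc)
      qed
      hence "inv t \<otimes> t' \<in> M" using sM(2) t t' by (auto simp: A_def)
      hence "t \<otimes> (inv t \<otimes> t') \<in> M" using sM tT by (meson subgroup.m_closed subsetD)
      thus "t' \<in> M" using t t' by (simp add: m_assoc[symmetric])
    qed
    hence gen: "generate G (A \<union> T) = carrier G"
      using sM(1) subgroup.subset unfolding M_def by blast
    \<comment> \<open>Positive powers of \<open>t\<close> push everything outside \<open>W\<close>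
      into \<open>U\<close>, negative ones push everything outside \<open>U\<close> into
      \<open>W\<close>. Nontrivial elements of \<open>A\<close> move the union of the two off
      itself, so ping-pong is played with \<open>U \<union> W\<close>.\<close>
    define W where "W = {g \<in> carrier G. t \<otimes> g \<notin> U}"
    have stepU: "t \<otimes> g \<in> U" if "g \<in> carrier G" "g \<in> U" for g
      using N[of t g] that t t1 itU tU by blast
    have WU: "W \<inter> U = {}" using stepU by (auto simp: W_def)
    have posU: "t [^] Suc n \<otimes> g \<in> U" if g: "g \<in> carrier G" "g \<notin> W" for n g
    proof (induction n)
      case 0
      thus ?case using g t by (simp add: W_def)
    next
      case (Suc n)
      have "t [^] Suc (Suc n) \<otimes> g = t \<otimes> (t [^] Suc n \<otimes> g)"
        using t g nat_pow_mult[OF t(1), of 1 "Suc n"] by (simp add: m_assoc[symmetric])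
      thus ?case using stepU[OF _ Suc] t g by (metis m_closed nat_pow_closed)
    qed
    have negW: "inv (t [^] Suc n) \<otimes> g \<in> W" if g: "g \<in> carrier G" "g \<notin> U" for n g
    proof (induction n)
      case 0
      thus ?case using g t by (simp add: W_def m_assoc[symmetric])
    next
      case (Suc n)
      let ?y = "inv (t [^] Suc n) \<otimes> g"
      have y: "?y \<in> carrier G" "?y \<notin> U" using Suc WU g t by auto
      have "inv (t [^] Suc (Suc n)) \<otimes> g = inv t \<otimes> ?y"
        using t g by (simp add: inv_mult_group[symmetric] m_assoc[symmetric] nat_pow_Suc2[symmetric])
      thus ?case using y t by (simp add: W_def m_assoc[symmetric])
    qed
    have oneW: "\<one> \<notin> W" using tU t by (simp add: W_def)
    have tp: "t [^] Suc n \<noteq> \<one>" for n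
      using posU[OF one_closed oneW, of n] one r_one[OF nat_pow_closed[OF t(1), of "Suc n"]] by metis
    have tn1: "n = 0" if "t [^] (n::int) = \<one>" for n
    proof (rule ccontr)
      assume n: "n \<noteq> 0"
      then obtain m where "n = int (Suc m) \<or> n = - int (Suc m)"
        by (metis int_cases2 of_nat_0 not0_implies_Suc minus_zero)
      thus False using that tp[of m] t
        by (metis int_pow_int int_pow_neg inv_eq_1_iff nat_pow_closed)
    qed
    show ?thesis
    proof (cases "A = {\<one>}")
      case True
      hence "A \<union> T = T" using subgroup.one_closed[OF sT] by blast
      hence "carrier G = T" using gen generate_subgroup_incl[OF _ sT, of T] subgroup.subset[OF sT] by (metis order_refl subset_antisym)
      moreover have "inj (\<lambda>n::int. t [^] n)"
      proof (rule injI)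
        fix m n :: int assume "t [^] m = t [^] n"
        hence "t [^] (m - n) = \<one>" using t by (metis int_pow_closed int_pow_diff r_inv)
        thus "m = n" using tn1[of "m - n"] by simp
      qed
      ultimately have "(\<lambda>n::int. t [^] n) \<in> iso integer_group G"
        using t by (auto simp: iso_def hom_def bij_betw_def T_def int_pow_mult integer_group_def)
      hence "integer_group \<cong> G" by (auto simp: is_iso_def)
      hence "G \<cong> integer_group" by (rule group.iso_sym[OF group_integer_group])
      thus ?thesis by (simp add: infinite_cyclic_def)
    next
      case False
      have fp: "is_free_product G (UNIV :: bool set) (\<lambda>b. if b then A else T)"
      proof (rule ping_pong_free_product[OF sA sT gen, of "U \<union> W"])
        show "\<one> \<notin> U \<union> W" using one oneW by simp
        have taU: "t \<otimes> a \<in> U" if "a \<in> A" for a using that t tU by (simp add: A_def)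
        show "p \<notin> U \<union> W" if "p \<in> A" "p \<noteq> \<one>" for p
          using AU taU that by (auto simp: W_def)
        have atV: "a \<otimes> inv t \<notin> V" if a: "a \<in> A" for a
        proof -
          have "a \<in> carrier G" using a by (simp add: A_def)
          hence "(a \<in> U) = (a \<otimes> inv t \<in> V)" using t(2)[of "a \<otimes> inv t"] t by (simp add: m_assoc)
          thus ?thesis using AU[OF a] by simp
        qed
        have tatU: "t \<otimes> a \<otimes> inv t \<in> U" if a: "a \<in> A" "a \<noteq> \<one>" for a
        proof -
          have ac: "a \<in> carrier G" using a by (simp add: A_def)
          have "(t \<otimes> a \<otimes> inv t \<otimes> t \<in> U) = (t \<otimes> a \<otimes> inv t \<in> V)" using t ac by simp
          hence "t \<otimes> a \<otimes> inv t \<in> V" using taU[OF a(1)] t ac by (simp add: m_assoc)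
          moreover have "t \<otimes> a \<otimes> inv t \<noteq> \<one>"
          proof
            assume "t \<otimes> a \<otimes> inv t = \<one>"
            hence "t \<otimes> a = t" using t ac by (metis inv_closed inv_equality inv_inv m_closed)
            thus False using a t ac by (metis l_cancel_one r_cancel_one' r_one right_cancel l_cancel one_closed)
          qed
          ultimately show ?thesis by (simp add: V_def)
        qed
        fix p g assume p: "p \<in> A" "p \<noteq> \<one>" and g: "g \<in> carrier G" "g \<in> U \<union> W"
        have pc: "p \<in> carrier G" "inv p \<in> A" "inv p \<noteq> \<one>"
          using p Ac[OF p(1)] subgroup.m_inv_closed[OF sA p(1)] by (simp_all add: inv_eq_1_iff)
        show "p \<otimes> g \<notin> U \<union> W"
        proof (cases "g \<in> U")
          case True
          have "p \<otimes> g \<notin> U" using N[of p g] p g True AU pc by blast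
          moreover have "t \<otimes> (p \<otimes> g) \<in> U"
          proof -
            have "inv (t \<otimes> p) = inv p \<otimes> inv t" using t pc by (simp add: inv_mult_group)
            hence "inv (t \<otimes> p) \<notin> U" using atV[OF pc(2)] by (simp add: V_def)
            moreover have "t \<otimes> p \<noteq> \<one>" using taU[OF p(1)] one by metis
            ultimately have "t \<otimes> p \<otimes> g \<in> U" using N[of "t \<otimes> p" g] True g t pc taU[OF p(1)] by blast
            thus ?thesis using t pc g by (simp add: m_assoc)
          qed
          ultimately show ?thesis by (auto simp: W_def)
        next
          case False
          hence y: "t \<otimes> g \<notin> U" using g by (simp add: W_def)
          have "inv (p \<otimes> inv t) = t \<otimes> inv p" using t pc by (simp add: inv_mult_group)
          hence "inv (p \<otimes> inv t) \<in> U" using taU[OF pc(2)] by simp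
          moreover have "p \<otimes> inv t \<noteq> \<one>" using atV[OF p(1)] by (auto simp: V_def)
          ultimately have "p \<otimes> inv t \<otimes> (t \<otimes> g) \<notin> U"
            using N[of "p \<otimes> inv t" "t \<otimes> g"] y g t pc atV[OF p(1)] unfolding V_def by blast
          moreover have "p \<otimes> inv t \<otimes> (t \<otimes> g) = p \<otimes> g" using t pc g by (metis inv_closed inv_solve_left m_assoc m_closed)
          moreover have "t \<otimes> (p \<otimes> g) \<in> U"
          proof -
            let ?k = "t \<otimes> p \<otimes> inv t"
            have "inv ?k = t \<otimes> inv p \<otimes> inv t" using t pc by (simp add: inv_mult_group m_assoc)
            hence "inv ?k \<in> U" using tatU[OF pc(2,3)] by simp
            moreover have "?k \<in> U" using tatU[OF p] .
            moreover have "?k \<noteq> \<one>" using tatU[OF p] one by metis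
            ultimately have "?k \<otimes> (t \<otimes> g) \<in> U" using N[of ?k "t \<otimes> g"] y g t pc by simp
            moreover have "?k \<otimes> (t \<otimes> g) = t \<otimes> (p \<otimes> g)" using t pc g by (metis inv_closed inv_solve_left m_assoc m_closed)
            ultimately show ?thesis by simp
          qed
          ultimately show ?thesis by (auto simp: W_def)
        qed
      next
        fix q g assume q: "q \<in> T" "q \<noteq> \<one>" and g: "g \<in> carrier G" "g \<notin> U \<union> W"
        obtain n :: int where n: "q = t [^] n" using q by (auto simp: T_def)
        have "n \<noteq> 0" using n q by auto
        then obtain m where "n = int (Suc m) \<or> n = - int (Suc m)"
          by (metis int_cases2 of_nat_0 not0_implies_Suc minus_zero)
        hence "q = t [^] Suc m \<or> q = inv (t [^] Suc m)" using n t by (metis int_pow_int int_pow_neg)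
        thus "q \<otimes> g \<in> U \<union> W" using posU[of g m] negW[of g m] g by auto
      qed
      have "T \<noteq> {\<one>}" using tT t1 by blast
      thus ?thesis using no_split[OF False _ fp] by blast
    qed
  qed
qed

section \<open>Images of factors under automorphisms\<close>

lemma (in group) inv_mult_cancel [simp]:
  assumes "a \<in> carrier G" "b \<in> carrier G"
  shows "inv a \<otimes> (a \<otimes> b) = b" "a \<otimes> (inv a \<otimes> b) = b"
  using assms by (simp_all add: m_assoc[symmetric])

text \<open>An element of least positive value generates, by division with remainder. This keeps a
  factor that is not infinite cyclic from being mapped into one that is.\<close>

lemma infinite_cyclic_embedded:
  assumes K: "group K" and e: "e \<in> hom K integer_group" "inj_on e (carrier K)" and nt: "carrier K \<noteq> {\<one>\<^bsub>K\<^esub>}"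
  shows "infinite_cyclic K"
proof -
  interpret K: group K by fact
  have em: "e (a \<otimes>\<^bsub>K\<^esub> b) = e a + e b" if "a \<in> carrier K" "b \<in> carrier K" for a b
    using hom_mult[OF e(1) that] by simp
  have e1: "e \<one>\<^bsub>K\<^esub> = 0" using em[of "\<one>\<^bsub>K\<^esub>" "\<one>\<^bsub>K\<^esub>"] by simp
  have ei: "e (inv\<^bsub>K\<^esub> a) = - e a" if "a \<in> carrier K" for a
    using em[of a "inv\<^bsub>K\<^esub> a"] that e1 by simp
  have en: "e (a [^]\<^bsub>K\<^esub> (n::nat)) = int n * e a" if "a \<in> carrier K" for a n
    by (induction n) (simp_all add: e1 em that algebra_simps)
  have ez: "e (a [^]\<^bsub>K\<^esub> (n::int)) = n * e a" if "a \<in> carrier K" for a n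
    using that by (cases n rule: int_cases2) (simp_all add: K.int_pow_neg int_pow_int en ei)
  obtain a where a: "a \<in> carrier K" "a \<noteq> \<one>\<^bsub>K\<^esub>" using nt K.one_closed by blast
  have "e a \<noteq> 0" using a e(2) e1 by (metis K.one_closed inj_onD)
  hence "\<exists>b\<in>carrier K. e b > 0" using a ei[of a] by (metis K.inv_closed linorder_neqE_linordered_idom neg_0_less_iff_less)
  hence ex: "\<exists>d. \<exists>b\<in>carrier K. e b = int (Suc d)"
    by (metis gr0_implies_Suc zero_less_imp_eq_int)
  define d where "d = (LEAST d. \<exists>b\<in>carrier K. e b = int (Suc d))"
  obtain b where b: "b \<in> carrier K" "e b = int (Suc d)" using LeastI_ex[OF ex] unfolding d_def by blast
  have least: "d \<le> d'" if "c \<in> carrier K" "e c = int (Suc d')" for c d'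
    unfolding d_def using that by (intro Least_le) blast
  have gen: "c = b [^]\<^bsub>K\<^esub> (e c div e b)" if c: "c \<in> carrier K" for c
  proof -
    let ?r = "c \<otimes>\<^bsub>K\<^esub> inv\<^bsub>K\<^esub> (b [^]\<^bsub>K\<^esub> (e c div e b))"
    have r: "e ?r = e c mod e b" using c b by (simp add: em ei ez minus_div_mult_eq_mod)
    have "e c mod e b = 0"
    proof (rule ccontr)
      assume "e c mod e b \<noteq> 0"
      moreover have "0 \<le> e c mod e b" "e c mod e b < int (Suc d)" using b by simp_all
      ultimately obtain d' where d': "e c mod e b = int (Suc d')"
        by (metis gr0_implies_Suc zero_less_imp_eq_int less_le)
      hence "d \<le> d'" using least[of ?r d'] r c b by simp
      thus False using \<open>e c mod e b < int (Suc d)\<close> d' by simp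
    qed
    hence "e ?r = e \<one>\<^bsub>K\<^esub>" using r e1 by simp
    hence "?r = \<one>\<^bsub>K\<^esub>" using e(2) c b by (intro inj_onD[OF e(2)]) auto
    thus ?thesis using c b by (metis K.int_pow_closed K.inv_closed K.inv_equality K.inv_inv)
  qed
  have "(\<lambda>n::int. b [^]\<^bsub>K\<^esub> n) \<in> iso integer_group K"
  proof -
    have "inj (\<lambda>n::int. b [^]\<^bsub>K\<^esub> n)" using ez[OF b(1)] b by (intro injI) (metis mult_cancel_right of_nat_0_eq_iff nat.simps(3))
    moreover have "range (\<lambda>n::int. b [^]\<^bsub>K\<^esub> n) = carrier K" using gen b by auto
    ultimately show ?thesis using b by (auto simp: iso_def hom_def bij_betw_def K.int_pow_mult integer_group_def)
  qed
  hence "integer_group \<cong> K" by (auto simp: is_iso_def)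
  hence "K \<cong> integer_group" by (rule group.iso_sym[OF group_integer_group])
  thus ?thesis by (simp add: infinite_cyclic_def)
qed

context free_prod
begin

text \<open>A half-space in the tree of the free product. Pulled back along an embedding it supplies
  the set \<open>U\<close> of \<open>indecomposable_almost_invariant\<close>:
  \<open>starts_mult\<close> is its nesting, \<open>starts_finite\<close> its almost
  invariance.\<close>

definition starts :: "'i \<Rightarrow> 'a \<Rightarrow> bool" where
  "starts i g \<longleftrightarrow> nf g \<noteq> [] \<and> fst (hd (nf g)) = i"

lemma starts_inv: "g \<in> carrier G \<Longrightarrow> starts i (inv g) \<longleftrightarrow> nf g \<noteq> [] \<and> fst (last (nf g)) = i"
  by (auto simp: starts_def nf_inv fst_hd_winv)

lemma starts_mult:
  assumes "k \<in> carrier G" "g \<in> carrier G" "k \<noteq> \<one>" "starts i g \<noteq> starts i (inv k)"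
  shows "starts i (k \<otimes> g) = starts i k"
proof -
  have "nf k \<noteq> []" using assms by simp
  moreover have "nf (k \<otimes> g) = nf k @ nf g"
    using assms by (intro nf_append) (auto simp: starts_inv, auto simp: starts_def)
  ultimately show ?thesis by (simp add: starts_def)
qed

text \<open>A letter on the right touches only the last letter of the normal form. It can influence
  the first one only for the two excluded elements, which is why right translation changes the
  half-space by a finite set.\<close>

lemma starts_mult_letter:
  assumes j: "j \<in> I" "a \<in> H j" and g: "g \<in> carrier G" "g \<noteq> \<one>" "g \<noteq> inv a"
  shows "starts i (g \<otimes> a) = starts i g"
proof (cases "a = \<one>")
  case False
  obtain us x where n: "nf g = us @ [x]" using g by (metis nf_eq_Nil rev_exhaust)
  obtain l b where x: "x = (l, b)" by (cases x)
  have r: "red us" "l \<in> I" "b \<in> H l" "b \<noteq> \<one>" "us = [] \<or> fst (last us) \<noteq> l"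
    using red_nf[OF g(1)] n x by (auto simp: red_append red_Cons)
  have ge: "g = wp us \<otimes> b" using wp_nf[OF g(1)] n x r by (simp add: wp_append red_Cons)
  show ?thesis
  proof (cases "l = j")
    case False
    have "nf (g \<otimes> a) = nf g @ nf a"
      using g j \<open>a \<noteq> \<one>\<close> False n x by (intro nf_append) (auto simp: nf_letter)
    thus ?thesis using n by (cases us) (simp_all add: starts_def)
  next
    case True
    have ga: "g \<otimes> a = wp us \<otimes> (b \<otimes> a)" using ge r j by (simp add: m_assoc)
    show ?thesis
    proof (cases "b \<otimes> a = \<one>")
      case ba: True
      hence "g \<otimes> a = wp us" using ga r by simp
      hence "nf (g \<otimes> a) = us" using r by simp
      moreover have "us \<noteq> []"
      proof
        assume "us = []"
        hence "g = b" using ge r by simp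
        moreover have "b = inv a" using ba r j True by (metis H_closed inv_equality)
        ultimately show False using g by simp
      qed
      ultimately show ?thesis using n by (simp add: starts_def)
    next
      case ba: False
      have "nf (g \<otimes> a) = us @ [(j, b \<otimes> a)]"
        using r j True ba ga by (intro nf_unique) (auto simp: red_append red_Cons wp_append)
      thus ?thesis using n x True by (cases us) (simp_all add: starts_def)
    qed
  qed
qed (use g in simp)

lemma starts_finite:
  assumes "k \<in> carrier G" shows "finite {g \<in> carrier G. starts i g \<noteq> starts i (g \<otimes> k)}"
  using assms
proof (induction rule: letter_induct)
  case one
  have "{g \<in> carrier G. starts i g \<noteq> starts i (g \<otimes> \<one>)} = {}" by auto
  thus ?case by (metis finite.emptyI)
next
  case (letter j a k)
  let ?S = "{g \<in> carrier G. starts i g \<noteq> starts i (g \<otimes> k)}"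
  have a: "a \<in> carrier G" using letter by simp
  have "{g \<in> carrier G. starts i g \<noteq> starts i (g \<otimes> (a \<otimes> k))} \<subseteq> {\<one>, inv a} \<union> (\<lambda>g. g \<otimes> inv a) ` ?S"
  proof
    fix g assume g: "g \<in> {g \<in> carrier G. starts i g \<noteq> starts i (g \<otimes> (a \<otimes> k))}"
    show "g \<in> {\<one>, inv a} \<union> (\<lambda>g. g \<otimes> inv a) ` ?S"
    proof (cases "g \<in> {\<one>, inv a}")
      case False
      hence "starts i (g \<otimes> a) = starts i g" using letter g by (intro starts_mult_letter[of j]) auto
      moreover have "g \<otimes> (a \<otimes> k) = (g \<otimes> a) \<otimes> k" using g a letter by (simp add: m_assoc)
      ultimately have "g \<otimes> a \<in> ?S" using g a by auto
      moreover have "g = (g \<otimes> a) \<otimes> inv a" using g a by (simp add: m_assoc)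
      ultimately show ?thesis by blast
    qed blast
  qed
  thus ?case by (rule finite_subset) (use letter in simp)
qed

lemma strip_left:
  assumes i: "i \<in> I" and g: "g \<in> carrier G"
  shows "\<exists>a\<in>H i. \<exists>v\<in>carrier G. g = a \<otimes> v \<and> (nf v = [] \<or> fst (hd (nf v)) \<noteq> i) \<and>
      (nf v \<noteq> [] \<longrightarrow> last (nf v) = last (nf g))"
proof (cases "starts i g")
  case True
  then obtain a ws where n: "nf g = (i, a) # ws" unfolding starts_def by (cases "nf g") auto
  hence r: "a \<in> H i" "red ws" "ws = [] \<or> fst (hd ws) \<noteq> i"
    using red_nf[OF g] by (auto simp: red_Cons)
  have "g = a \<otimes> wp ws" using wp_nf[OF g] n by simp
  thus ?thesis using r n by (intro bexI[of _ a] bexI[of _ "wp ws"]) auto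
next
  case False
  thus ?thesis using i g by (intro bexI[of _ \<one>] bexI[of _ g]) (auto simp: starts_def)
qed

lemma strip_both:
  assumes i: "i \<in> I" and g: "g \<in> carrier G"
  shows "\<exists>a\<in>H i. \<exists>b\<in>H i. \<exists>v\<in>carrier G. g = a \<otimes> v \<otimes> b \<and>
      (nf v = [] \<or> fst (hd (nf v)) \<noteq> i \<and> fst (last (nf v)) \<noteq> i)"
proof -
  obtain a w where aw: "a \<in> H i" "w \<in> carrier G" "g = a \<otimes> w" "nf w = [] \<or> fst (hd (nf w)) \<noteq> i"
    using strip_left[OF i g] by blast
  obtain b v where bv: "b \<in> H i" "v \<in> carrier G" "inv w = b \<otimes> v" "nf v = [] \<or> fst (hd (nf v)) \<noteq> i"
    "nf v \<noteq> [] \<longrightarrow> last (nf v) = last (nf (inv w))"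
    using strip_left[OF i inv_closed[OF aw(2)]] by blast
  have bc: "b \<in> carrier G" "a \<in> carrier G" using aw bv i by auto
  have "w = inv (b \<otimes> v)" using bv aw by (metis inv_inv)
  hence w: "w = inv v \<otimes> inv b" using bv bc by (simp add: inv_mult_group)
  have g': "g = a \<otimes> inv v \<otimes> inv b" using aw w bv bc by (simp add: m_assoc)
  have c: "nf (inv v) = [] \<or> fst (hd (nf (inv v))) \<noteq> i \<and> fst (last (nf (inv v))) \<noteq> i"
  proof (cases "nf v = []")
    case True
    thus ?thesis using bv by (simp add: nf_inv)
  next
    case False
    have "fst (last (nf v)) = fst (last (nf (inv w)))" using bv False by simp
    moreover have "nf (inv w) = winv (nf w)" using aw nf_inv by blast
    moreover have "nf w \<noteq> []"
    proof
      assume "nf w = []"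
      hence "b \<otimes> v = \<one>" using bv aw by simp
      hence "v = inv b" using bv bc by (metis inv_closed inv_equality inv_inv)
      hence "v \<in> H i" using bv i by simp
      hence "nf v = [(i, v)] \<or> v = \<one>" using i nf_letter by blast
      thus False using False bv by auto
    qed
    ultimately have "fst (last (nf v)) = fst (hd (nf w))" by (simp add: fst_last_winv)
    thus ?thesis using False bv aw \<open>nf w \<noteq> []\<close> by (simp add: nf_inv fst_hd_winv fst_last_winv)
  qed
  show ?thesis
    by (rule bexI[of _ a], rule bexI[of _ "inv b"], rule bexI[of _ "inv v"]) (use g' c aw bv i in auto)
qed

lemma letter_nf_length: "i \<in> I \<Longrightarrow> a \<in> H i \<Longrightarrow> length (nf a) \<le> 1"
  using nf_letter[of i a] by (cases "a = \<one>") auto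

text \<open>Factors are malnormal: once the part of \<open>g\<close> in \<open>H i\<close> is
  stripped, a nonempty remainder surrounds the letter without cancellation, and the conjugate is too
  long to be a letter.\<close>

lemma conj_letter:
  assumes "i \<in> I" "l \<in> I" "a \<in> H i" "a \<noteq> \<one>" "g \<in> carrier G" "inv g \<otimes> a \<otimes> g \<in> H l"
  shows "l = i \<and> g \<in> H i"
proof -
  obtain b v where bv: "b \<in> H i" "v \<in> carrier G" "g = b \<otimes> v" "nf v = [] \<or> fst (hd (nf v)) \<noteq> i"
    using strip_left[OF assms(1,5)] by blast
  have c: "a \<in> carrier G" "b \<in> carrier G" using assms bv by auto
  let ?a = "inv b \<otimes> a \<otimes> b"
  have a': "?a \<in> H i" using assms bv by simp
  have a1: "?a \<noteq> \<one>"
  proof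
    assume "?a = \<one>"
    hence "a \<otimes> b = b" using c by (metis inv_closed inv_equality inv_inv m_assoc m_closed r_inv)
    thus False using assms c by (metis l_one one_closed right_cancel)
  qed
  have e: "inv g \<otimes> a \<otimes> g = inv v \<otimes> ?a \<otimes> v" using bv c by (simp add: inv_mult_group m_assoc)
  show ?thesis
  proof (cases "nf v = []")
    case True
    hence v: "v = \<one>" using bv by simp
    hence "?a \<in> H l" using e assms c by simp
    hence "nf ?a = [(l, ?a)]" "nf ?a = [(i, ?a)]" using nf_letter a1 a' assms by blast+
    thus ?thesis using v bv c by simp
  next
    case False
    have n1: "nf (?a \<otimes> v) = [(i, ?a)] @ nf v"
      using nf_append[of ?a v] nf_letter[OF assms(1) a' a1] bv c by auto
    have "nf (inv v \<otimes> (?a \<otimes> v)) = nf (inv v) @ ([(i, ?a)] @ nf v)"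
      unfolding n1[symmetric] using False bv c n1 by (intro nf_append) (auto simp: nf_inv fst_last_winv)
    moreover have "inv v \<otimes> (?a \<otimes> v) = inv g \<otimes> a \<otimes> g" using e bv c by (simp add: m_assoc)
    ultimately have "length (nf (inv g \<otimes> a \<otimes> g)) \<ge> 2" using False by (simp add: Suc_le_eq)
    thus ?thesis using letter_nf_length[OF assms(2,6)] by simp
  qed
qed

text \<open>Cyclic reduction. The outcomes are the elliptic elements, conjugate to a letter, and the
  hyperbolic ones, which begin and end in different factors; \<open>kurosh\<close> rules out the
  latter.\<close>

lemma conj_reduce:
  assumes "g \<in> carrier G" "g \<noteq> \<one>"
  shows "\<exists>t\<in>carrier G. nf (inv t \<otimes> g \<otimes> t) \<noteq> [] \<and> (length (nf (inv t \<otimes> g \<otimes> t)) = 1 \<or>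
      fst (hd (nf (inv t \<otimes> g \<otimes> t))) \<noteq> fst (last (nf (inv t \<otimes> g \<otimes> t))))"
  using assms
proof (induction "length (nf g)" arbitrary: g rule: less_induct)
  case less
  have n0: "nf g \<noteq> []" using less.prems by simp
  show ?case
  proof (cases "length (nf g) = 1 \<or> fst (hd (nf g)) \<noteq> fst (last (nf g))")
    case True
    thus ?thesis using n0 less.prems by (intro bexI[of _ \<one>]) auto
  next
    case False
    obtain i a ws where n: "nf g = (i, a) # ws" using n0 by (cases "nf g") auto
    hence "ws \<noteq> []" using False by auto
    then obtain vs b where w: "ws = vs @ [(i, b)]" using False n
      by (cases ws rule: rev_cases) auto
    have r: "i \<in> I" "a \<in> H i" "b \<in> H i" "red vs" "red ws" "vs = [] \<or> fst (last vs) \<noteq> i" "red [(i, b)]"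
      using red_nf[OF less.prems(1)] n w by (auto simp: red_Cons red_append)
    have ge: "g = a \<otimes> (wp vs \<otimes> b)" using wp_nf[OF less.prems(1)] n w r by (simp add: wp_append)
    let ?g = "inv a \<otimes> g \<otimes> a"
    have g': "?g = wp vs \<otimes> (b \<otimes> a)" using ge r by (simp add: m_assoc)
    have "length (nf ?g) < length (nf g)"
    proof (cases "b \<otimes> a = \<one>")
      case True
      thus ?thesis using g' r n w by simp
    next
      case False
      hence "nf ?g = vs @ [(i, b \<otimes> a)]" unfolding g'
        using r by (intro nf_unique) (auto simp: red_append red_Cons wp_append)
      thus ?thesis using n w by simp
    qed
    moreover have "?g \<noteq> \<one>"
    proof
      assume "?g = \<one>"
      hence "g \<otimes> a = a" using r less.prems(1) by (metis H_closed inv_closed inv_equality inv_inv m_assoc m_closed r_inv)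
      thus False using r less.prems by (metis H_closed l_one one_closed right_cancel)
    qed
    ultimately obtain t where t: "t \<in> carrier G" "nf (inv t \<otimes> ?g \<otimes> t) \<noteq> [] \<and> (length (nf (inv t \<otimes> ?g \<otimes> t)) = 1 \<or>
      fst (hd (nf (inv t \<otimes> ?g \<otimes> t))) \<noteq> fst (last (nf (inv t \<otimes> ?g \<otimes> t))))"
      using less.hyps[of ?g] less.prems r by auto
    have "inv t \<otimes> ?g \<otimes> t = inv (a \<otimes> t) \<otimes> g \<otimes> (a \<otimes> t)"
      using t r less.prems by (simp add: inv_mult_group m_assoc)
    thus ?thesis using t r by (intro bexI[of _ "a \<otimes> t"]) auto
  qed
qed

text \<open>A special case of the Kurosh subgroup theorem. A hyperbolic element in the image is a
  \<open>k0\<close> for the pulled back half-space and would make \<open>K\<close> infinite cyclic.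
  So all elements are elliptic; and if two of them fixed different vertices of the tree, a
  hyperbolic element could be formed from them.\<close>

lemma kurosh:
  assumes K: "group K" and f: "f \<in> hom K G" "inj_on f (carrier K)"
    and fi: "freely_indecomposable K" and ni: "\<not> infinite_cyclic K"
  shows "\<exists>t\<in>carrier G. \<exists>i\<in>I. \<forall>k\<in>carrier K. inv t \<otimes> f k \<otimes> t \<in> H i"
proof -
  interpret K: group K by fact
  have fc: "f k \<in> carrier G" if "k \<in> carrier K" for k using hom_in_carrier[OF f(1) that] .
  have fm: "f (k \<otimes>\<^bsub>K\<^esub> k') = f k \<otimes> f k'" if "k \<in> carrier K" "k' \<in> carrier K" for k k'
    using hom_mult[OF f(1) that] .
  have f1: "f \<one>\<^bsub>K\<^esub> = \<one>" using hom_one[OF f(1) K group_axioms] .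
  define c where "c t k = inv t \<otimes> f k \<otimes> t" for t k
  have cc: "c t k \<in> carrier G" if "t \<in> carrier G" "k \<in> carrier K" for t k
    using that fc by (simp add: c_def)
  have cm: "c t (k \<otimes>\<^bsub>K\<^esub> k') = c t k \<otimes> c t k'" if "t \<in> carrier G" "k \<in> carrier K" "k' \<in> carrier K" for t k k'
    using that fc by (simp add: c_def fm m_assoc)
  have c1: "c t \<one>\<^bsub>K\<^esub> = \<one>" if "t \<in> carrier G" for t using that f1 by (simp add: c_def)
  have ci: "c t (inv\<^bsub>K\<^esub> k) = inv (c t k)" if "t \<in> carrier G" "k \<in> carrier K" for t k
    using cm[of t "inv\<^bsub>K\<^esub> k" k] that c1 cc by (metis K.inv_closed K.l_inv inv_equality)
  have cinj: "k = k'" if "t \<in> carrier G" "k \<in> carrier K" "k' \<in> carrier K" "c t k = c t k'" for t k k'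
  proof -
    have "f k = f k'" using that fc unfolding c_def by (metis inv_closed l_cancel m_closed right_cancel)
    thus ?thesis using inj_onD[OF f(2)] that by blast
  qed
  have nohyp: False
    if t: "t \<in> carrier G" and k: "k \<in> carrier K" "nf (c t k) \<noteq> []" "fst (hd (nf (c t k))) \<noteq> fst (last (nf (c t k)))" for t k
  proof -
    define i where "i = fst (hd (nf (c t k)))"
    define U where "U = {k \<in> carrier K. starts i (c t k)}"
    have "infinite_cyclic K"
    proof (rule K.indecomposable_almost_invariant[OF fi, of U k])
      show "\<one>\<^bsub>K\<^esub> \<notin> U" using c1[OF t] by (simp add: U_def starts_def)
    next
      fix k g assume *: "k \<in> carrier K" "g \<in> carrier K" "k \<noteq> \<one>\<^bsub>K\<^esub>" "(g \<in> U) \<noteq> (inv\<^bsub>K\<^esub> k \<in> U)"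
      have "c t k \<noteq> \<one>" using cinj[OF t, of k "\<one>\<^bsub>K\<^esub>"] * c1[OF t] by auto
      thus "(k \<otimes>\<^bsub>K\<^esub> g \<in> U) = (k \<in> U)"
        using starts_mult[of "c t k" "c t g" i] * t by (simp add: U_def cc cm ci)
    next
      fix k assume k: "k \<in> carrier K"
      have "c t ` {g \<in> carrier K. (g \<in> U) \<noteq> (g \<otimes>\<^bsub>K\<^esub> k \<in> U)} \<subseteq> {g \<in> carrier G. starts i g \<noteq> starts i (g \<otimes> c t k)}"
        using t k by (auto simp: U_def cc cm)
      moreover have "inj_on (c t) {g \<in> carrier K. (g \<in> U) \<noteq> (g \<otimes>\<^bsub>K\<^esub> k \<in> U)}"
        using cinj[OF t] by (auto intro: inj_onI)
      ultimately show "finite {g \<in> carrier K. (g \<in> U) \<noteq> (g \<otimes>\<^bsub>K\<^esub> k \<in> U)}"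
        using starts_finite[OF cc[OF t k]] inj_on_finite by blast
    next
      show "k \<in> carrier K" by fact
      show "k \<in> U" using k by (simp add: U_def starts_def i_def)
      show "inv\<^bsub>K\<^esub> k \<notin> U" using k t by (simp add: U_def ci starts_inv cc i_def)
    qed
    thus False using ni by simp
  qed
  obtain k1 where k1: "k1 \<in> carrier K" "k1 \<noteq> \<one>\<^bsub>K\<^esub>"
    using fi K.one_closed by (auto simp: freely_indecomposable_def)
  have "f k1 \<noteq> \<one>" using k1 f1 inj_onD[OF f(2)] by fastforce
  then obtain t where t: "t \<in> carrier G" "nf (c t k1) \<noteq> []" "length (nf (c t k1)) = 1"
    using conj_reduce[OF fc[OF k1(1)]] nohyp[OF _ k1(1)] unfolding c_def by blast
  then obtain i w where n: "nf (c t k1) = [(i, w)]" by (auto simp: length_Suc_conv)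
  have iw: "i \<in> I" "w \<in> H i" "w \<noteq> \<one>" using red_nf[OF cc[OF t(1) k1(1)]] n by (auto simp: red_Cons)
  have w: "c t k1 = w" using wp_nf[OF cc[OF t(1) k1(1)]] n iw by simp
  have "c t k \<in> H i" if k: "k \<in> carrier K" for k
  proof (rule ccontr)
    assume no: "c t k \<notin> H i"
    obtain a b v where abv: "a \<in> H i" "b \<in> H i" "v \<in> carrier G" "c t k = a \<otimes> v \<otimes> b"
      "nf v = [] \<or> fst (hd (nf v)) \<noteq> i \<and> fst (last (nf v)) \<noteq> i"
      using strip_both[OF iw(1) cc[OF t(1) k]] by blast
    have car: "a \<in> carrier G" "b \<in> carrier G" "w \<in> carrier G" using abv iw by auto
    have nv: "nf v \<noteq> []"
    proof
      assume "nf v = []"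
      hence "v = \<one>" using abv by simp
      thus False using no abv iw car by simp
    qed
    have cta: "c (t \<otimes> a) k' = inv a \<otimes> c t k' \<otimes> a" if "k' \<in> carrier K" for k'
      using t car fc[OF that] by (simp add: c_def inv_mult_group m_assoc)
    have ta: "t \<otimes> a \<in> carrier G" using t car by simp
    show False
    \<comment> \<open>After conjugation by \<open>a\<close> the element reads
      \<open>v \<otimes> (b \<otimes> a)\<close>. It is hyperbolic unless \<open>b\<close> and
      \<open>a\<close> cancel, and in that case multiplying by the letter coming from
      \<open>k1\<close> makes it so.\<close>
    proof (cases "b \<otimes> a = \<one>")
      case False
      have "c (t \<otimes> a) k = v \<otimes> (b \<otimes> a)" using cta[OF k] abv car by (simp add: m_assoc)
      moreover have "nf (v \<otimes> (b \<otimes> a)) = nf v @ [(i, b \<otimes> a)]"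
        using nf_append[of v "b \<otimes> a"] nf_letter[OF iw(1), of "b \<otimes> a"] False abv nv car iw by auto
      ultimately show False using nohyp[OF ta k] abv nv by simp
    next
      case True
      let ?w = "inv a \<otimes> w \<otimes> a"
      have w1: "?w \<noteq> \<one>"
      proof
        assume "?w = \<one>"
        hence "w \<otimes> a = a" using car by (metis inv_closed inv_equality inv_inv m_assoc m_closed r_inv)
        thus False using iw car by (metis l_one one_closed right_cancel)
      qed
      have wH: "?w \<in> H i" using abv iw by simp
      have "c (t \<otimes> a) (k1 \<otimes>\<^bsub>K\<^esub> k) = ?w \<otimes> (inv a \<otimes> c t k \<otimes> a)"
        using cm[OF ta k1(1) k] cta[OF k] cta[OF k1(1)] w by simp
      also have "inv a \<otimes> c t k \<otimes> a = v" using True abv car by (simp add: m_assoc)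
      finally have "c (t \<otimes> a) (k1 \<otimes>\<^bsub>K\<^esub> k) = ?w \<otimes> v" .
      moreover have "nf (?w \<otimes> v) = [(i, ?w)] @ nf v"
        using nf_append[of ?w v] nf_letter[OF iw(1) wH w1] abv nv car by auto
      ultimately show False using nohyp[OF ta, of "k1 \<otimes>\<^bsub>K\<^esub> k"] abv nv k k1 by auto
    qed
  qed
  thus ?thesis using t(1) iw(1) unfolding c_def by blast
qed

end

section \<open>Counting quasimorphisms on lists\<close>

definition occ :: "'s list \<Rightarrow> 's list \<Rightarrow> nat" where
  "occ W xs = card {m. m + length W \<le> length xs \<and> take (length W) (drop m xs) = W}"

lemma occ_finite [simp]: "finite {m. m + length W \<le> length xs \<and> Q m}"
  by (rule finite_subset[of _ "{..length xs}"]) auto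

lemma occ_le: "occ W xs \<le> Suc (length xs)"
proof -
  have "occ W xs \<le> card {..length xs}" unfolding occ_def by (rule card_mono) auto
  thus ?thesis by simp
qed

lemma occ_append:
  assumes W: "W \<noteq> []"
  shows "occ W xs + occ W ys \<le> occ W (xs @ ys)" "occ W (xs @ ys) \<le> occ W xs + occ W ys + length W"
proof -
  let ?n = "length W"
  let ?S = "\<lambda>xs. {m. m + ?n \<le> length xs \<and> take ?n (drop m xs) = W}"
  let ?Sh = "(\<lambda>m. m + length xs) ` ?S ys"
  have n0: "?n > 0" using W by simp
  have l: "?S xs \<subseteq> ?S (xs @ ys)" by auto
  have r: "?Sh \<subseteq> ?S (xs @ ys)" by auto
  have cs: "card ?Sh = occ W ys" by (simp add: occ_def card_image)
  let ?M = "{m. m < length xs \<and> length xs < m + ?n}"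
  have "?S (xs @ ys) \<subseteq> ?S xs \<union> ?Sh \<union> ?M"
  proof
    fix m assume m: "m \<in> ?S (xs @ ys)"
    consider "m + ?n \<le> length xs" | "m \<ge> length xs" | "m < length xs" "length xs < m + ?n" by linarith
    thus "m \<in> ?S xs \<union> ?Sh \<union> ?M"
    proof cases
      case 2
      hence "m = (m - length xs) + length xs" "m - length xs \<in> ?S ys" using m by auto
      thus ?thesis by blast
    qed (use m in auto)
  qed
  hence "occ W (xs @ ys) \<le> card (?S xs \<union> ?Sh \<union> ?M)"
    unfolding occ_def by (rule card_mono[rotated]) auto
  also have "\<dots> \<le> card (?S xs \<union> ?Sh) + card ?M" by (rule card_Un_le)
  also have "\<dots> \<le> card (?S xs) + card ?Sh + card ?M"
    using card_Un_le[of "?S xs" ?Sh] by simp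
  also have "card ?M \<le> card {length xs - ?n ..< length xs}"
    by (rule card_mono) auto
  finally show "occ W (xs @ ys) \<le> occ W xs + occ W ys + ?n" using cs by (simp add: occ_def)
  have "?S xs \<inter> ?Sh = {}" using n0 by auto
  hence "occ W xs + occ W ys = card (?S xs \<union> ?Sh)"
    using cs by (simp add: card_Un_disjoint occ_def)
  also have "\<dots> \<le> occ W (xs @ ys)" unfolding occ_def using l r by (intro card_mono occ_finite) auto
  finally show "occ W xs + occ W ys \<le> occ W (xs @ ys)" .
qed

lemma occ_Cons:
  assumes W: "W \<noteq> []"
  shows "occ W (x # xs) = (if take (length W) (x # xs) = W then 1 else 0) + occ W xs"
proof -
  let ?S = "\<lambda>xs. {m. m + length W \<le> length xs \<and> take (length W) (drop m xs) = W}"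
  have n0: "length W > 0" using W by simp
  have tk: "length W \<le> Suc (length xs)" if "take (length W) (x # xs) = W"
    using arg_cong[OF that, of length] by simp
  have S: "?S (x # xs) = (if take (length W) (x # xs) = W then {0} else {}) \<union> Suc ` ?S xs"
  proof (intro equalityI subsetI)
    fix m assume m: "m \<in> ?S (x # xs)"
    show "m \<in> (if take (length W) (x # xs) = W then {0} else {}) \<union> Suc ` ?S xs"
      using m by (cases m) auto
  next
    fix m assume "m \<in> (if take (length W) (x # xs) = W then {0} else {}) \<union> Suc ` ?S xs"
    thus "m \<in> ?S (x # xs)" using tk by (auto split: if_splits)
  qed
  have "card (?S (x # xs)) = card (if take (length W) (x # xs) = W then {0::nat} else {}) + card (Suc ` ?S xs)"
    unfolding S by (rule card_Un_disjoint) auto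
  thus ?thesis by (simp add: occ_def card_image)
qed

lemma occ_Nil: "W \<noteq> [] \<Longrightarrow> occ W [] = 0"
  by (simp add: occ_def)

lemma occ_rev_le: "occ W xs \<le> occ (rev W) (rev xs)"
  unfolding occ_def
proof (rule card_inj_on_le[of "\<lambda>m. length xs - length W - m"])
  let ?S = "{m. m + length W \<le> length xs \<and> take (length W) (drop m xs) = W}"
  show "inj_on (\<lambda>m. length xs - length W - m) ?S"
    by (rule inj_onI) auto
  show "(\<lambda>m. length xs - length W - m) ` ?S \<subseteq>
     {m. m + length (rev W) \<le> length (rev xs) \<and> take (length (rev W)) (drop m (rev xs)) = rev W}"
  proof (intro subsetI, elim imageE)
    fix k m assume k: "k = length xs - length W - m" and m: "m \<in> ?S"
    have "drop k (rev xs) = rev (take (m + length W) xs)" using k m by (simp add: drop_rev add.commute)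
    also have "take (m + length W) xs = take m xs @ W" using m by (simp add: take_add)
    finally have "take (length (rev W)) (drop k (rev xs)) = rev W" by simp
    thus "k \<in> {m. m + length (rev W) \<le> length (rev xs) \<and> take (length (rev W)) (drop m (rev xs)) = rev W}"
      using k m by auto
  qed
qed simp

lemma occ_rev: "occ W (rev xs) = occ (rev W) xs"
  using occ_rev_le[of W "rev xs"] occ_rev_le[of "rev W" xs] by simp

text \<open>Recording only which neighbours agree makes the code blind to every injective
  relabelling of the entries, such as an isomorphism between factors induces.\<close>

fun adj :: "'s list \<Rightarrow> bool list" where
  "adj (x # y # zs) = (x = y) # adj (y # zs)"
| "adj _ = []"

lemma length_adj: "length (adj xs) = length xs - 1"
  by (induction xs rule: adj.induct) auto

lemma adj_append: "xs \<noteq> [] \<Longrightarrow> ys \<noteq> [] \<Longrightarrow> adj (xs @ ys) = adj xs @ [last xs = hd ys] @ adj ys"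
proof (induction xs rule: adj.induct)
  case ("2_2" v)
  thus ?case by (cases ys) auto
qed auto

lemma adj_rev: "adj (rev xs) = rev (adj xs)"
proof (induction xs rule: adj.induct)
  case (1 x y zs)
  have "adj (rev (x # y # zs)) = adj (rev (y # zs) @ [x])" by simp
  also have "\<dots> = adj (rev (y # zs)) @ [y = x]" by (subst adj_append) auto
  finally show ?case using 1 by auto
qed auto

lemma adj_map: "inj_on f (set xs) \<Longrightarrow> adj (map f xs) = adj xs"
proof (induction xs rule: adj.induct)
  case (1 x y zs)
  hence "inj_on f (set (y # zs))" "(f x = f y) = (x = y)" by (auto simp: inj_on_def)
  thus ?case using 1 by simp
qed auto

text \<open>Antisymmetrised so that reversing a list changes the sign. Inversion in the group
  reverses codes, and the two cancelled pieces of a product have to contribute zero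
  together.\<close>

definition brooks :: "bool list \<Rightarrow> 's list \<Rightarrow> real" where
  "brooks W xs = real (occ W (adj xs)) - real (occ (rev W) (adj xs))"

lemma brooks_append:
  assumes W: "W \<noteq> []"
  shows "\<bar>brooks W (xs @ ys) - brooks W xs - brooks W ys\<bar> \<le> 2 * real (length W) + 2"
proof (cases "xs = [] \<or> ys = []")
  case True
  thus ?thesis using W by (auto simp: brooks_def occ_Nil)
next
  case False
  hence e: "adj (xs @ ys) = adj xs @ ([last xs = hd ys] @ adj ys)" using adj_append by auto
  have b: "occ V [c] \<le> 1" if "V \<noteq> []" for V :: "bool list" and c
    using that by (simp add: occ_Cons occ_Nil)
  have "occ V (adj xs) + occ V (adj ys) \<le> occ V (adj (xs @ ys)) \<and>
     occ V (adj (xs @ ys)) \<le> occ V (adj xs) + occ V (adj ys) + 2 * length V + 1" if "V \<noteq> []" for V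
    unfolding e using occ_append[OF that, of "adj xs" "[last xs = hd ys] @ adj ys"]
      occ_append[OF that, of "[last xs = hd ys]" "adj ys"] b[OF that, of "last xs = hd ys"] by linarith
  from this[of W] this[of "rev W"] W have
    "real (occ W (adj xs)) + real (occ W (adj ys)) \<le> real (occ W (adj (xs @ ys)))"
    "real (occ W (adj (xs @ ys))) \<le> real (occ W (adj xs)) + real (occ W (adj ys)) + 2 * real (length W) + 1"
    "real (occ (rev W) (adj xs)) + real (occ (rev W) (adj ys)) \<le> real (occ (rev W) (adj (xs @ ys)))"
    "real (occ (rev W) (adj (xs @ ys))) \<le> real (occ (rev W) (adj xs)) + real (occ (rev W) (adj ys)) + 2 * real (length W) + 1"
    by simp_all
  thus ?thesis unfolding brooks_def by linarith
qed

lemma brooks_rev: "inj_on f (set xs) \<Longrightarrow> brooks W (rev (map f xs)) = - brooks W xs"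
  by (simp add: brooks_def adj_rev adj_map occ_rev)

lemma brooks_map: "inj_on f (set xs) \<Longrightarrow> brooks W (map f xs) = brooks W xs"
  by (simp add: brooks_def adj_map)

lemma brooks_bound: "\<bar>brooks W xs\<bar> \<le> real (length xs) + 1"
  using occ_le[of W "adj xs"] occ_le[of "rev W" "adj xs"] length_adj[of xs]
  unfolding brooks_def by (cases "length xs") auto

text \<open>Brooks' argument for an arbitrary code: \<open>c\<close> and its relabelled reversal
  have opposite values, the middle parts have bounded length, and each concatenation costs a bounded
  error. The map \<open>f\<close> is the effect of inversion on one entry.\<close>

lemma brooks_code_quasimorphism:
  fixes \<alpha> :: "'a \<Rightarrow> 's list"
  assumes W: "W \<noteq> []"
    and Q: "\<And>g h. g \<in> carrier G \<Longrightarrow> h \<in> carrier G \<Longrightarrow> \<exists>p c s m1 m2 m3. \<alpha> g = p @ m1 @ c \<and>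
      \<alpha> h = rev (map f c) @ m2 @ s \<and> \<alpha> (g \<otimes>\<^bsub>G\<^esub> h) = p @ m3 @ s \<and>
      length m1 \<le> L \<and> length m2 \<le> L \<and> length m3 \<le> L"
    and f: "inj_on f A" "\<And>g. g \<in> carrier G \<Longrightarrow> set (\<alpha> g) \<subseteq> A"
  shows "quasimorphism G (\<lambda>g. brooks W (\<alpha> g))"
proof -
  let ?E = "2 * real (length W) + 2"
  have "\<bar>brooks W (\<alpha> g) + brooks W (\<alpha> h) - brooks W (\<alpha> (g \<otimes>\<^bsub>G\<^esub> h))\<bar> \<le> 6 * ?E + 3 * (real L + 1)"
    if gh: "g \<in> carrier G" "h \<in> carrier G" for g h
  proof -
    obtain p c s m1 m2 m3 where q: "\<alpha> g = p @ m1 @ c" "\<alpha> h = rev (map f c) @ m2 @ s"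
      "\<alpha> (g \<otimes>\<^bsub>G\<^esub> h) = p @ m3 @ s" "length m1 \<le> L" "length m2 \<le> L" "length m3 \<le> L"
      using Q[OF gh] by blast
    have "set c \<subseteq> A" using f(2)[OF gh(1)] q(1) by auto
    hence "brooks W (rev (map f c)) = - brooks W c" using brooks_rev f(1) inj_on_subset by metis
    moreover have "\<bar>brooks W m\<bar> \<le> real L + 1" if "length m \<le> L" for m :: "'s list"
      using brooks_bound[of W m] that by linarith
    note this[OF q(4)] this[OF q(5)] this[OF q(6)]
    moreover have "\<bar>brooks W (xs @ ms @ zs) - brooks W xs - brooks W ms - brooks W zs\<bar> \<le> 2 * ?E" for xs ms zs :: "'s list"
      using brooks_append[OF W, of xs "ms @ zs"] brooks_append[OF W, of ms zs] by (smt (verit))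
    note this[of p m1 c] this[of "rev (map f c)" m2 s] this[of p m3 s]
    ultimately show ?thesis unfolding q(1-3) by (smt (verit))
  qed
  thus ?thesis unfolding quasimorphism_def
    by (intro exI[of _ "6 * ?E + 3 * (real L + 1)"]) auto
qed

text \<open>The framing by \<open>False\<close> makes both runs maximal: under \<open>adj\<close>
  the pattern marks a run of exactly \<open>a + 1\<close> equal letters followed by one of exactly
  \<open>b + 1\<close>.\<close>

definition pattern :: "nat \<Rightarrow> nat \<Rightarrow> bool list" where
  "pattern a b = False # replicate a True @ False # replicate b True @ [False]"

lemma pattern_ne [simp]: "pattern a b \<noteq> []"
  by (simp add: pattern_def)

lemma rev_pattern: "rev (pattern a b) = pattern b a"
  by (simp add: pattern_def)

text \<open>A third entry is required because \<open>blocks\<close> puts \<open>False\<close> in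
  front of each run: the \<open>False\<close> that closes the pattern is the opening of the next
  block.\<close>

fun consec :: "nat \<Rightarrow> nat \<Rightarrow> nat list \<Rightarrow> nat" where
  "consec a b (x # y # z # zs) = of_bool (x = a \<and> y = b) + consec a b (y # z # zs)"
| "consec a b _ = 0"

abbreviation blocks :: "nat list \<Rightarrow> bool list" where
  "blocks rs \<equiv> concat (map (\<lambda>r. False # replicate r True) rs)"

lemma occ_pattern_True: "occ (pattern a b) (replicate k True @ xs) = occ (pattern a b) xs"
  by (induction k) (simp_all add: occ_Cons pattern_def)

lemma True_run_eq:
  "replicate a True @ False # xs = replicate b True @ False # ys \<longleftrightarrow> a = b \<and> xs = ys"
  by (induction a arbitrary: b) (case_tac b; auto)+

lemma True_run_ne: "replicate a True @ False # xs \<noteq> replicate b True"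
  by (metis in_set_conv_decomp in_set_replicate)

lemma take_eq_iff: "take (length W) xs = W \<longleftrightarrow> (\<exists>ys. xs = W @ ys)"
  by (metis append_eq_conv_conj append_take_drop_id)

lemma occ_blocks: "occ (pattern a b) (blocks rs) = consec a b rs"
proof (induction rs)
  case Nil
  thus ?case by (simp add: occ_Nil)
next
  case (Cons r rs)
  have "take (length (pattern a b)) (False # replicate r True @ blocks rs) = pattern a b \<longleftrightarrow>
      r = a \<and> (\<exists>y z. rs = b # y # z)"
  proof (cases rs)
    case Nil
    have "\<nexists>ys. replicate r True = replicate a True @ False # ys" using True_run_ne by metis
    thus ?thesis using Nil unfolding take_eq_iff by (simp add: pattern_def)
  next
    case (Cons r2 rs2)
    show ?thesis
    proof (cases rs2)
      case Nil
      have "\<nexists>ys. replicate r2 True = replicate b True @ False # ys" using True_run_ne by metis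
      thus ?thesis using Cons Nil unfolding take_eq_iff
        by (auto simp: pattern_def True_run_eq)
    next
      case (Cons r3 rs3)
      thus ?thesis using \<open>rs = r2 # rs2\<close> unfolding take_eq_iff
        by (auto simp: pattern_def True_run_eq)
    qed
  qed
  hence "occ (pattern a b) (blocks (r # rs)) =
      (if r = a \<and> (\<exists>y z. rs = b # y # z) then 1 else 0) + occ (pattern a b) (replicate r True @ blocks rs)"
    by (simp add: occ_Cons)
  also have "occ (pattern a b) (replicate r True @ blocks rs) = consec a b rs"
    using Cons by (simp add: occ_pattern_True)
  finally show ?case
    by (cases rs; cases "tl rs") (auto simp: of_bool_def)
qed

text \<open>Runs of \<open>p + 1\<close> to \<open>p + 4\<close> equal letters show under
  \<open>adj\<close> as runs of \<open>p\<close> to \<open>p + 3\<close> times \<open>True\<close>.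
  With \<open>p\<close> a multiple of four the residue modulo four fixes the place in the period,
  and words for different \<open>p\<close> share no run length.\<close>

definition cyc_word :: "nat \<Rightarrow> 's \<Rightarrow> 's \<Rightarrow> 's list" where
  "cyc_word p u v = replicate (p + 1) u @ replicate (p + 2) v @ replicate (p + 3) u @ replicate (p + 4) v"

lemma adj_replicate: "adj (replicate (Suc n) x) = replicate n True"
  by (induction n) auto

lemma adj_cyc_word:
  assumes "u \<noteq> v"
  shows "adj (concat (replicate (Suc n) (cyc_word p u v))) =
     replicate p True @ blocks ([p + 1, p + 2, p + 3] @ concat (replicate n [p, p + 1, p + 2, p + 3]))"
proof -
  have ap: "adj (replicate (Suc p) x @ ys) = replicate p True @ [x = hd ys] @ adj ys" if "ys \<noteq> []" for p ys and x :: 's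
    using that adj_append[of "replicate (Suc p) x" ys] adj_replicate[of p x] by simp
  have hd1: "adj (replicate (Suc a) x @ replicate (Suc b) y @ zs) = replicate a True @ [x = y] @ adj (replicate (Suc b) y @ zs)"
    for a b zs and x y :: 's
    using ap[of "replicate (Suc b) y @ zs" a x] by simp
  have cw: "adj (cyc_word p u v @ zs) = replicate p True @ blocks [p + 1, p + 2] @ False # adj (replicate (Suc (p + 3)) v @ zs)" for zs
  proof -
    have r: "cyc_word p u v @ zs = replicate (Suc p) u @ replicate (Suc (p + 1)) v @
        replicate (Suc (p + 2)) u @ replicate (Suc (p + 3)) v @ zs"
      by (simp add: cyc_word_def numeral_eq_Suc)
    show ?thesis unfolding r hd1 using assms by simp
  qed
  show ?thesis
  proof (induction n)
    case 0
    thus ?case using cw[of "[]"] adj_replicate[of "p + 3" v] by simp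
  next
    case (Suc n)
    let ?Z = "concat (replicate (Suc n) (cyc_word p u v))"
    have h: "hd ?Z = u" "?Z \<noteq> []" by (simp_all add: cyc_word_def)
    have "adj (concat (replicate (Suc (Suc n)) (cyc_word p u v))) =
        replicate p True @ blocks [p + 1, p + 2] @ False # adj (replicate (Suc (p + 3)) v @ ?Z)"
      using cw[of ?Z] by simp
    also have "adj (replicate (Suc (p + 3)) v @ ?Z) = replicate (p + 3) True @ [False] @ adj ?Z"
      using ap[of ?Z "p + 3" v] h assms by simp
    finally show ?case unfolding Suc by simp
  qed
qed

lemma consec_periodic:
  "consec a b ([q, r, s] @ concat (replicate n [p, q, r, s])) = of_bool (q = a \<and> r = b) +
    n * (of_bool (r = a \<and> s = b) + of_bool (s = a \<and> p = b) + of_bool (p = a \<and> q = b) + of_bool (q = a \<and> r = b))"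
proof (induction n)
  case (Suc n)
  have "consec a b ([q, r, s] @ concat (replicate (Suc n) [p, q, r, s])) =
     of_bool (q = a \<and> r = b) + (of_bool (r = a \<and> s = b) + (of_bool (s = a \<and> p = b) + (of_bool (p = a \<and> q = b) +
     consec a b ([q, r, s] @ concat (replicate n [p, q, r, s])))))"
    by (simp del: of_bool_conj)
  thus ?case unfolding Suc by (simp only: mult_Suc ac_simps)
qed simp

text \<open>The first run of a power has no \<open>False\<close> in front, so one of
  \<open>n\<close> occurrences is lost. The reversed pattern would need a run followed by one
  shorter by exactly one; the periodic sequence descends only by three.\<close>

lemma brooks_cyc_word:
  assumes "u \<noteq> v"
  shows "brooks (pattern (4 * m) (4 * m + 1)) (concat (replicate n (cyc_word (4 * k) u v))) =
      (if m = k then real (n - 1) else 0)"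
proof (cases n)
  case 0
  thus ?thesis by (simp add: brooks_def occ_Nil)
next
  case (Suc n')
  have ar: "4 * m \<noteq> 4 * k + 1" "4 * m \<noteq> 4 * k + 2" "4 * m \<noteq> 4 * k + 3" "4 * m + 1 \<noteq> 4 * k"
    "4 * m + 1 \<noteq> 4 * k + 2" "4 * m + 1 \<noteq> 4 * k + 3"
    by presburger+
  show ?thesis unfolding brooks_def rev_pattern Suc adj_cyc_word[OF assms] occ_pattern_True occ_blocks consec_periodic
    using ar by auto
qed

lemma quasimorphism_hom:
  assumes "quasimorphism K h" "f \<in> hom G K"
  shows "quasimorphism G (\<lambda>g. h (f g))"
proof -
  obtain D where D: "D \<ge> 0" "\<And>g k. g \<in> carrier K \<Longrightarrow> k \<in> carrier K \<Longrightarrow> \<bar>h g + h k - h (g \<otimes>\<^bsub>K\<^esub> k)\<bar> \<le> D"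
    using assms(1) by (auto simp: quasimorphism_def)
  have "\<bar>h (f g) + h (f k) - h (f (g \<otimes>\<^bsub>G\<^esub> k))\<bar> \<le> D" if "g \<in> carrier G" "k \<in> carrier G" for g k
    using D(2)[of "f g" "f k"] hom_in_carrier[OF assms(2)] hom_mult[OF assms(2) that] that by simp
  thus ?thesis using D(1) unfolding quasimorphism_def by auto
qed

lemma quasimorphism_sum:
  assumes "finite A" "\<And>a. a \<in> A \<Longrightarrow> quasimorphism G (h a)"
  shows "quasimorphism G (\<lambda>g. \<Sum>a\<in>A. h a g)"
  using assms
proof (induction A)
  case empty
  thus ?case by (auto simp: quasimorphism_def intro: exI[of _ 0])
next
  case (insert x A)
  obtain D where D: "D \<ge> 0" "\<And>g k. g \<in> carrier G \<Longrightarrow> k \<in> carrier G \<Longrightarrow>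
      \<bar>(\<Sum>a\<in>A. h a g) + (\<Sum>a\<in>A. h a k) - (\<Sum>a\<in>A. h a (g \<otimes>\<^bsub>G\<^esub> k))\<bar> \<le> D"
    using insert by (auto simp: quasimorphism_def)
  obtain D' where D': "D' \<ge> 0" "\<And>g k. g \<in> carrier G \<Longrightarrow> k \<in> carrier G \<Longrightarrow> \<bar>h x g + h x k - h x (g \<otimes>\<^bsub>G\<^esub> k)\<bar> \<le> D'"
    using insert.prems[of x] by (auto simp: quasimorphism_def)
  have "\<bar>(\<Sum>a\<in>insert x A. h a g) + (\<Sum>a\<in>insert x A. h a k) - (\<Sum>a\<in>insert x A. h a (g \<otimes>\<^bsub>G\<^esub> k))\<bar> \<le> D + D'"
    if "g \<in> carrier G" "k \<in> carrier G" for g k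
    using D(2)[OF that] D'(2)[OF that] insert.hyps by simp
  thus ?case using D(1) D'(1) unfolding quasimorphism_def by (intro exI[of _ "D + D'"]) auto
qed

lemma sum_bounded_change:
  fixes f f' :: "'c \<Rightarrow> 'g \<Rightarrow> real"
  assumes "finite A" "\<And>a. a \<in> A \<Longrightarrow> \<exists>C. \<forall>g\<in>S. \<bar>f a g - f' a g\<bar> \<le> C"
  shows "\<exists>C. \<forall>g\<in>S. \<bar>(\<Sum>a\<in>A. f a g) - (\<Sum>a\<in>A. f' a g)\<bar> \<le> C"
  using assms
proof (induction A)
  case (insert x A)
  obtain C where C: "\<forall>g\<in>S. \<bar>(\<Sum>a\<in>A. f a g) - (\<Sum>a\<in>A. f' a g)\<bar> \<le> C" using insert by blast
  obtain C' where C': "\<forall>g\<in>S. \<bar>f x g - f' x g\<bar> \<le> C'" using insert.prems[of x] by blast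
  have "\<bar>(\<Sum>a\<in>insert x A. f a g) - (\<Sum>a\<in>insert x A. f' a g)\<bar> \<le> C + C'" if "g \<in> S" for g
  proof -
    have "\<bar>(\<Sum>a\<in>A. f a g) - (\<Sum>a\<in>A. f' a g)\<bar> \<le> C" "\<bar>f x g - f' x g\<bar> \<le> C'" using C C' that by auto
    thus ?thesis using insert.hyps by simp
  qed
  thus ?case by blast
qed auto

section \<open>Conjugation and automorphisms\<close>

context group
begin

definition cj :: "'a \<Rightarrow> 'a \<Rightarrow> 'a" where
  "cj t a = t \<otimes> a \<otimes> inv t"

lemma cj_closed [simp]: "t \<in> carrier G \<Longrightarrow> a \<in> carrier G \<Longrightarrow> cj t a \<in> carrier G"
  by (simp add: cj_def)

lemma cj_mult: "t \<in> carrier G \<Longrightarrow> a \<in> carrier G \<Longrightarrow> b \<in> carrier G \<Longrightarrow> cj t (a \<otimes> b) = cj t a \<otimes> cj t b"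
  by (simp add: cj_def m_assoc l_inv inv_mult_cancel)

lemma cj_one [simp]: "t \<in> carrier G \<Longrightarrow> cj t \<one> = \<one>"
  by (simp add: cj_def)

lemma cj_cj: "s \<in> carrier G \<Longrightarrow> t \<in> carrier G \<Longrightarrow> a \<in> carrier G \<Longrightarrow> cj s (cj t a) = cj (s \<otimes> t) a"
  by (simp add: cj_def m_assoc inv_mult_group)

lemma cj_cancel [simp]: "t \<in> carrier G \<Longrightarrow> a \<in> carrier G \<Longrightarrow> cj (inv t) (cj t a) = a"
  "t \<in> carrier G \<Longrightarrow> a \<in> carrier G \<Longrightarrow> cj t (cj (inv t) a) = a"
  by (simp_all add: cj_def m_assoc)

lemma cj_inj: "t \<in> carrier G \<Longrightarrow> a \<in> carrier G \<Longrightarrow> b \<in> carrier G \<Longrightarrow> cj t a = cj t b \<Longrightarrow> a = b"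
  by (metis cj_cancel(1))

lemma cj_hom: "t \<in> carrier G \<Longrightarrow> f \<in> hom K G \<Longrightarrow> (\<lambda>g. cj t (f g)) \<in> hom K G"
  by (auto simp: hom_def cj_mult Pi_iff)

lemma quasimorphism_cj:
  assumes "quasimorphism G h" "s \<in> carrier G"
  shows "\<exists>C. \<forall>g\<in>carrier G. \<bar>h (cj s g) - h g\<bar> \<le> C"
proof -
  obtain D where D: "D \<ge> 0" "\<And>g k. g \<in> carrier G \<Longrightarrow> k \<in> carrier G \<Longrightarrow> \<bar>h g + h k - h (g \<otimes> k)\<bar> \<le> D"
    using assms(1) by (auto simp: quasimorphism_def)
  have "\<bar>h (cj s g) - h g\<bar> \<le> 2 * D + \<bar>h s\<bar> + \<bar>h (inv s)\<bar>" if g: "g \<in> carrier G" for g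
  proof -
    have "\<bar>h s + h g - h (s \<otimes> g)\<bar> \<le> D" "\<bar>h (s \<otimes> g) + h (inv s) - h (s \<otimes> g \<otimes> inv s)\<bar> \<le> D"
      using D(2) assms(2) g by simp_all
    thus ?thesis unfolding cj_def by linarith
  qed
  thus ?thesis by blast
qed

lemma auto_hom: "\<phi> \<in> auto G \<Longrightarrow> \<phi> \<in> hom G G"
  and auto_bij: "\<phi> \<in> auto G \<Longrightarrow> bij_betw \<phi> (carrier G) (carrier G)"
  by (auto simp: auto_def Bij_def)

lemma auto_inverse:
  assumes "\<phi> \<in> auto G"
  obtains \<phi>' where "\<phi>' \<in> hom G G" "inj_on \<phi>' (carrier G)" "\<And>g. g \<in> carrier G \<Longrightarrow> \<phi>' (\<phi> g) = g"
    "\<And>g. g \<in> carrier G \<Longrightarrow> \<phi> (\<phi>' g) = g"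
proof
  have iso: "\<phi> \<in> iso G G" using auto_hom[OF assms] auto_bij[OF assms] by (simp add: iso_def)
  show "inv_into (carrier G) \<phi> \<in> hom G G" using iso_set_sym[OF iso] by (simp add: iso_def)
  show "inj_on (inv_into (carrier G) \<phi>) (carrier G)" using iso_set_sym[OF iso] by (auto simp: iso_def bij_betw_def)
  show "inv_into (carrier G) \<phi> (\<phi> g) = g" if "g \<in> carrier G" for g
    using auto_bij[OF assms] that by (simp add: bij_betw_def)
  show "\<phi> (inv_into (carrier G) \<phi> g) = g" if "g \<in> carrier G" for g
    using auto_bij[OF assms] that by (simp add: bij_betw_def f_inv_into_f)
qed

end

section \<open>Automorphisms permute the factors that are not infinite cyclic\<close>

context free_prod
begin

definition noncyc :: "'i set" where
  "noncyc = {i \<in> I. \<not> infinite_cyclic (G\<lparr>carrier := H i\<rparr>)}"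

definition indecomposable_factors :: bool where
  "indecomposable_factors \<longleftrightarrow> (\<forall>i\<in>I. freely_indecomposable (G\<lparr>carrier := H i\<rparr>))"

lemma noncyc_I: "i \<in> noncyc \<Longrightarrow> i \<in> I"
  by (simp add: noncyc_def)

lemma H_nontrivial:
  assumes "indecomposable_factors" "i \<in> I"
  obtains a where "a \<in> H i" "a \<noteq> \<one>"
proof -
  have "H i \<noteq> {\<one>}" using assms by (auto simp: indecomposable_factors_def freely_indecomposable_def)
  thus thesis using that H_one[OF assms(2)] by blast
qed

lemma H_group: "i \<in> I \<Longrightarrow> group (G\<lparr>carrier := H i\<rparr>)"
  by (rule subgroup.subgroup_is_group[OF H_subgroup group_axioms])

lemma H_restrict_hom: "i \<in> I \<Longrightarrow> f \<in> hom G K \<Longrightarrow> f \<in> hom (G\<lparr>carrier := H i\<rparr>) K"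
  by (auto simp: hom_def)

text \<open>\<open>kurosh\<close> puts the image of \<open>H i\<close> inside a conjugate of some
  \<open>H j\<close> and, for the inverse automorphism, \<open>H j\<close> inside a conjugate of
  some \<open>H l\<close>. The composite conjugates a nontrivial letter of \<open>H i\<close> into
  \<open>H l\<close>, so malnormality gives \<open>l = i\<close> and turns both inclusions into
  equalities.\<close>

lemma auto_conj_factor:
  assumes fi: indecomposable_factors and phi: "\<phi> \<in> auto G" and i: "i \<in> noncyc"
  shows "\<exists>j\<in>noncyc. \<exists>t\<in>carrier G. \<phi> ` H i = cj t ` H j"
proof -
  obtain \<psi> where \<psi>: "\<psi> \<in> hom G G" "inj_on \<psi> (carrier G)" "\<And>g. g \<in> carrier G \<Longrightarrow> \<psi> (\<phi> g) = g"
    "\<And>g. g \<in> carrier G \<Longrightarrow> \<phi> (\<psi> g) = g" using auto_inverse[OF phi] by blast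
  note \<phi> = auto_hom[OF phi]
  have \<phi>c: "\<phi> g \<in> carrier G" if "g \<in> carrier G" for g using hom_in_carrier[OF \<phi> that] .
  have \<psi>c: "\<psi> g \<in> carrier G" if "g \<in> carrier G" for g using hom_in_carrier[OF \<psi>(1) that] .
  have \<phi>inj: "inj_on \<phi> (carrier G)" using auto_bij[OF phi] by (simp add: bij_betw_def)
  have iI: "i \<in> I" using i noncyc_I by blast
  have HC: "H l \<subseteq> carrier G" if "l \<in> I" for l using that H_closed by blast
  have kur: "\<exists>t\<in>carrier G. \<exists>j\<in>I. \<forall>a\<in>H l. inv t \<otimes> f a \<otimes> t \<in> H j"
    if "l \<in> noncyc" "f \<in> hom G G" "inj_on f (carrier G)" for f l
  proof -
    have l: "l \<in> I" using that noncyc_I by blast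
    have "inj_on f (carrier (G\<lparr>carrier := H l\<rparr>))" using inj_on_subset[OF that(3) HC[OF l]] by simp
    thus ?thesis
      using kurosh[OF H_group[OF l] H_restrict_hom[OF l that(2)]] that fi l
      by (simp add: noncyc_def indecomposable_factors_def)
  qed
  obtain t j where t: "t \<in> carrier G" "j \<in> I" "\<And>a. a \<in> H i \<Longrightarrow> inv t \<otimes> \<phi> a \<otimes> t \<in> H j"
    using kur[OF i \<phi> \<phi>inj] by blast
  have t': "cj (inv t) (\<phi> a) \<in> H j" if "a \<in> H i" for a using t that by (simp add: cj_def)
  have cinj: "inj_on (\<lambda>a. cj (inv t) (\<phi> a)) (H i)"
    using \<phi>inj HC[OF iI] t(1) \<phi>c by (intro inj_onI) (metis cj_inj inj_onD inv_closed subsetD)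
  \<comment> \<open>Only then does \<open>kurosh\<close> apply to \<open>H j\<close> and the inverse
    automorphism.\<close>
  have j: "j \<in> noncyc"
  proof (rule ccontr)
    assume "j \<notin> noncyc"
    then obtain e where e: "e \<in> iso (G\<lparr>carrier := H j\<rparr>) integer_group"
      using t(2) by (auto simp: noncyc_def infinite_cyclic_def is_iso_def)
    let ?f = "\<lambda>a. e (cj (inv t) (\<phi> a))"
    have em: "e (x \<otimes> y) = e x + e y" if "x \<in> H j" "y \<in> H j" for x y
      using e that by (auto simp: iso_def hom_def integer_group_def)
    have "?f \<in> hom (G\<lparr>carrier := H i\<rparr>) integer_group"
      using iI t t' \<phi>c hom_mult[OF \<phi>] em by (auto simp: hom_def cj_mult integer_group_def)
    moreover have "inj_on ?f (carrier (G\<lparr>carrier := H i\<rparr>))"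
    proof -
      have "inj_on e (H j)" using e by (auto simp: iso_def bij_betw_def)
      hence "inj_on e ((\<lambda>a. cj (inv t) (\<phi> a)) ` H i)" using t' by (auto intro: inj_on_subset)
      from comp_inj_on[OF cinj this] show ?thesis by (simp add: o_def)
    qed
    moreover have "carrier (G\<lparr>carrier := H i\<rparr>) \<noteq> {\<one>\<^bsub>G\<lparr>carrier := H i\<rparr>\<^esub>}"
      using H_nontrivial[OF fi iI] by auto
    ultimately have "infinite_cyclic (G\<lparr>carrier := H i\<rparr>)"
      using infinite_cyclic_embedded[OF H_group[OF iI]] by blast
    thus False using i by (simp add: noncyc_def)
  qed
  obtain s l where s: "s \<in> carrier G" "l \<in> I" "\<And>b. b \<in> H j \<Longrightarrow> inv s \<otimes> \<psi> b \<otimes> s \<in> H l"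
    using kur[OF j \<psi>(1,2)] by blast
  have s': "cj (inv s) (\<psi> b) \<in> H l" if "b \<in> H j" for b using s that by (simp add: cj_def)
  have pc: "\<psi> (cj r b) = cj (\<psi> r) (\<psi> b)" if "r \<in> carrier G" "b \<in> carrier G" for r b
    using that \<psi>c hom_mult[OF \<psi>(1)] group_hom.hom_inv[of G G \<psi> r] \<psi>(1)
    by (simp add: cj_def group_hom_def group_hom_axioms_def is_group)
  obtain a where a: "a \<in> H i" "a \<noteq> \<one>" using H_nontrivial[OF fi iI] by blast
  have aC: "a \<in> carrier G" using a iI by simp
  let ?b = "cj (inv t) (\<phi> a)"
  have b: "?b \<in> H j" "?b \<in> carrier G" using t' a t aC \<phi>c by auto
  have "a = \<psi> (cj t ?b)" using \<psi>(3) aC t \<phi>c by simp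
  hence ab: "a = cj (\<psi> t) (\<psi> ?b)" using pc t b by simp
  let ?g = "\<psi> t \<otimes> s"
  have gC: "?g \<in> carrier G" "\<psi> t \<in> carrier G" using t s \<psi>c by auto
  have cjg: "cj (inv ?g) (cj (\<psi> t) x) = cj (inv s) x" if "x \<in> carrier G" for x
    using that gC s by (simp add: cj_def inv_mult_group m_assoc)
  have "cj (inv ?g) a = cj (inv s) (\<psi> ?b)" using cjg[of "\<psi> ?b"] ab \<psi>c[OF b(2)] by metis
  hence "inv ?g \<otimes> a \<otimes> ?g \<in> H l" using s'[OF b(1)] gC by (simp add: cj_def)
  hence gH: "l = i" "?g \<in> H i" using conj_letter[OF iI s(2) a gC(1)] by auto
  have "\<phi> ` H i = cj t ` H j"
  proof (intro equalityI subsetI)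
    fix x assume "x \<in> \<phi> ` H i"
    then obtain c where c: "c \<in> H i" "x = \<phi> c" by blast
    have "x = cj t (cj (inv t) (\<phi> c))" using c t iI \<phi>c by simp
    thus "x \<in> cj t ` H j" using t'[OF c(1)] by blast
  next
    fix x assume "x \<in> cj t ` H j"
    then obtain d where d: "d \<in> H j" "x = cj t d" by blast
    have dC: "d \<in> carrier G" using d t by simp
    let ?c = "cj ?g (cj (inv s) (\<psi> d))"
    have "?c = cj (\<psi> t) (\<psi> d)" using gC s \<psi>c[OF dC] by (simp add: cj_cj m_assoc)
    also have "\<dots> = \<psi> x" using pc d t dC by simp
    finally have "x = \<phi> ?c" using \<psi>(4)[of x] d t dC by simp
    moreover have "?c \<in> H i" using gH s'[OF d(1)] iI by (simp add: cj_def)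
    ultimately show "x \<in> \<phi> ` H i" by blast
  qed
  thus ?thesis using j t by blast
qed

text \<open>Different factors are not conjugate, so the map on indices is injective, hence a
  bijection of a finite set.\<close>

lemma auto_factor_permutation:
  assumes fi: indecomposable_factors and phi: "\<phi> \<in> auto G" and fin: "finite I"
  obtains \<sigma> t where "bij_betw \<sigma> noncyc noncyc" "\<And>i. i \<in> noncyc \<Longrightarrow> t i \<in> carrier G"
    "\<And>i. i \<in> noncyc \<Longrightarrow> \<phi> ` H i = cj (t i) ` H (\<sigma> i)"
proof -
  obtain \<sigma> t where st: "\<And>i. i \<in> noncyc \<Longrightarrow> \<sigma> i \<in> noncyc \<and> t i \<in> carrier G \<and> \<phi> ` H i = cj (t i) ` H (\<sigma> i)"
  proof -
    have "\<exists>p. \<forall>i\<in>noncyc. fst (p i) \<in> noncyc \<and> snd (p i) \<in> carrier G \<and> \<phi> ` H i = cj (snd (p i)) ` H (fst (p i))"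
    proof (intro bchoice ballI)
      fix i assume "i \<in> noncyc"
      then obtain j t where "j \<in> noncyc" "t \<in> carrier G" "\<phi> ` H i = cj t ` H j"
        using auto_conj_factor[OF fi phi] by blast
      thus "\<exists>y. fst y \<in> noncyc \<and> snd y \<in> carrier G \<and> \<phi> ` H i = cj (snd y) ` H (fst y)"
        by (intro exI[of _ "(j, t)"]) simp
    qed
    then obtain p where "\<And>i. i \<in> noncyc \<Longrightarrow> fst (p i) \<in> noncyc \<and> snd (p i) \<in> carrier G \<and> \<phi> ` H i = cj (snd (p i)) ` H (fst (p i))"
      by blast
    thus thesis by (rule that[of "\<lambda>i. fst (p i)" "\<lambda>i. snd (p i)"])
  qed
  obtain \<psi> where \<psi>: "\<psi> \<in> hom G G" "inj_on \<psi> (carrier G)" "\<And>g. g \<in> carrier G \<Longrightarrow> \<psi> (\<phi> g) = g"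
    "\<And>g. g \<in> carrier G \<Longrightarrow> \<phi> (\<psi> g) = g" using auto_inverse[OF phi] by blast
  have \<psi>c: "\<psi> g \<in> carrier G" if "g \<in> carrier G" for g using hom_in_carrier[OF \<psi>(1) that] .
  have pc: "\<psi> (cj r b) = cj (\<psi> r) (\<psi> b)" if "r \<in> carrier G" "b \<in> carrier G" for r b
    using that \<psi>c hom_mult[OF \<psi>(1)] group_hom.hom_inv[of G G \<psi> r] \<psi>(1)
    by (simp add: cj_def group_hom_def group_hom_axioms_def is_group)
  have "inj_on \<sigma> noncyc"
  proof (rule inj_onI)
    fix i i' assume i: "i \<in> noncyc" "i' \<in> noncyc" and e: "\<sigma> i = \<sigma> i'"
    have iI: "i \<in> I" "i' \<in> I" "\<sigma> i \<in> I" using i st noncyc_I by blast+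
    obtain a where a: "a \<in> H i" "a \<noteq> \<one>" using H_nontrivial[OF fi iI(1)] by blast
    have "\<phi> a \<in> cj (t i) ` H (\<sigma> i)" using st[OF i(1)] a by blast
    then obtain b where b: "b \<in> H (\<sigma> i)" "\<phi> a = cj (t i) b" by blast
    hence "cj (t i') b \<in> \<phi> ` H i'" using st[OF i(2)] e by simp
    then obtain a' where a': "a' \<in> H i'" "\<phi> a' = cj (t i') b" by (metis imageE)
    have C: "a \<in> carrier G" "a' \<in> carrier G" "b \<in> carrier G" "t i \<in> carrier G" "t i' \<in> carrier G"
      using a a' b iI st i by auto
    have 1: "a = cj (\<psi> (t i)) (\<psi> b)" using \<psi>(3)[of a] b pc C by metis
    have 2: "a' = cj (\<psi> (t i')) (\<psi> b)" using \<psi>(3)[of a'] a' pc C by metis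
    let ?g = "\<psi> (t i) \<otimes> inv (\<psi> (t i'))"
    have gC: "?g \<in> carrier G" "\<psi> (t i) \<in> carrier G" "\<psi> (t i') \<in> carrier G" using \<psi>c C by auto
    have "inv ?g \<otimes> a \<otimes> ?g = a'" unfolding 1 2 using gC \<psi>c[OF C(3)]
      by (simp add: cj_def inv_mult_group m_assoc)
    hence "inv ?g \<otimes> a \<otimes> ?g \<in> H i'" using a' by simp
    thus "i = i'" using conj_letter[OF iI(1,2) a gC(1)] by blast
  qed
  moreover have "\<sigma> ` noncyc \<subseteq> noncyc" using st by blast
  moreover have "finite noncyc" using fin by (simp add: noncyc_def)
  ultimately have "bij_betw \<sigma> noncyc noncyc" by (simp add: bij_betw_def endo_inj_surj)
  thus thesis using that st by blast
qed

section \<open>Retractions onto subfamilies of factors\<close>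

definition ret :: "'i set \<Rightarrow> 'a \<Rightarrow> 'a" where
  "ret S = extend G (\<lambda>i a. if i \<in> S then a else \<one>)"

lemma ret_letter_homs: "letter_homs G (\<lambda>i a. if i \<in> S then a else \<one>)"
  by (auto simp: letter_homs_def hom_def)

lemma ret_hom: "ret S \<in> hom G G"
  unfolding ret_def using extend_hom[OF group_axioms ret_letter_homs] .

lemma ret_closed [simp]: "g \<in> carrier G \<Longrightarrow> ret S g \<in> carrier G"
  using hom_in_carrier[OF ret_hom] .

lemma ret_mult: "g \<in> carrier G \<Longrightarrow> h \<in> carrier G \<Longrightarrow> ret S (g \<otimes> h) = ret S g \<otimes> ret S h"
  using hom_mult[OF ret_hom] .

lemma ret_one [simp]: "ret S \<one> = \<one>"
  using hom_one[OF ret_hom group_axioms group_axioms] .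

lemma ret_letter: "i \<in> I \<Longrightarrow> a \<in> H i \<Longrightarrow> ret S a = (if i \<in> S then a else \<one>)"
  unfolding ret_def using extend_letter[OF group_axioms ret_letter_homs] .

lemma ret_inv: "g \<in> carrier G \<Longrightarrow> ret S (inv g) = inv (ret S g)"
  using group_hom.hom_inv[of G G "ret S" g] ret_hom by (simp add: group_hom_def group_hom_axioms_def is_group)

lemma ret_cj: "t \<in> carrier G \<Longrightarrow> a \<in> carrier G \<Longrightarrow> ret S (cj t a) = cj (ret S t) (ret S a)"
  by (simp add: cj_def ret_mult ret_inv)

lemma ret_id: "g \<in> carrier G \<Longrightarrow> fst ` set (nf g) \<subseteq> S \<Longrightarrow> ret S g = g"
proof -
  have "red ws \<Longrightarrow> fst ` set ws \<subseteq> S \<Longrightarrow> ret S (wp ws) = wp ws" for ws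
    by (induction ws) (auto simp: red_Cons ret_mult ret_letter)
  thus "g \<in> carrier G \<Longrightarrow> fst ` set (nf g) \<subseteq> S \<Longrightarrow> ret S g = g" by (metis red_nf wp_nf)
qed

lemma set_lmul: "fst ` set (lmul i a ws) \<subseteq> insert i (fst ` set ws)"
  by (cases ws) (auto simp: lmul_def)

lemma nf_ret: "g \<in> carrier G \<Longrightarrow> fst ` set (nf (ret S g)) \<subseteq> S \<inter> fst ` set (nf g)"
proof -
  have "red ws \<Longrightarrow> fst ` set (nf (ret S (wp ws))) \<subseteq> S \<inter> fst ` set ws" for ws
  proof (induction ws)
    case (Cons p ws)
    hence p: "fst p \<in> I" "snd p \<in> H (fst p)" "red ws" by (auto simp: red_Cons)
    have IH: "fst ` set (nf (ret S (wp ws))) \<subseteq> S \<inter> fst ` set ws" using Cons p by blast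
    have e: "ret S (wp (p # ws)) = (if fst p \<in> S then snd p else \<one>) \<otimes> ret S (wp ws)"
      using p by (simp add: ret_mult ret_letter)
    show ?case
    proof (cases "fst p \<in> S")
      case True
      hence n: "nf (ret S (wp (p # ws))) = lmul (fst p) (snd p) (nf (ret S (wp ws)))"
        using e p by (simp add: nf_lmul)
      have "fst ` set (nf (ret S (wp (p # ws)))) \<subseteq> insert (fst p) (fst ` set (nf (ret S (wp ws))))"
        unfolding n by (rule set_lmul)
      also have "\<dots> \<subseteq> insert (fst p) (S \<inter> fst ` set ws)" using IH by (rule insert_mono)
      also have "\<dots> \<subseteq> S \<inter> fst ` set (p # ws)" using True by auto
      finally show ?thesis .
    next
      case False
      hence "ret S (wp (p # ws)) = ret S (wp ws)" using e p by simp
      thus ?thesis using IH by auto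
    qed
  qed simp
  thus "g \<in> carrier G \<Longrightarrow> fst ` set (nf (ret S g)) \<subseteq> S \<inter> fst ` set (nf g)" by (metis red_nf wp_nf)
qed

lemma red_single_index:
  assumes "red ws" "fst ` set ws \<subseteq> {i}" shows "length ws \<le> 1"
proof (cases ws)
  case (Cons p vs)
  thus ?thesis using assms by (cases vs) (auto simp: red_Cons)
qed simp

text \<open>The flag tells whether the leftmost block lies in \<open>H i\<close>; the empty product
  carries both flags, so that a block of either kind may be put in front of it.\<close>

inductive alt :: "'i \<Rightarrow> 'a set \<Rightarrow> bool \<Rightarrow> 'a \<Rightarrow> bool" for i C where
  alt_one: "alt i C b \<one>"
| alt_H: "alt i C False g \<Longrightarrow> a \<in> H i \<Longrightarrow> a \<noteq> \<one> \<Longrightarrow> alt i C True (a \<otimes> g)"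
| alt_C: "alt i C True g \<Longrightarrow> c \<in> C \<Longrightarrow> c \<noteq> \<one> \<Longrightarrow> alt i C False (c \<otimes> g)"

text \<open>By \<open>ends\<close>, applied also to inverses, nontrivial elements of
  \<open>C\<close> neither begin nor end in factor \<open>i\<close>. So alternating products of
  \<open>H i\<close> and \<open>C\<close> do not cancel, and one that is a single letter of another
  factor is a single block from \<open>C\<close>.\<close>

lemma letter_in_generate:
  assumes i: "i \<in> I" and C: "subgroup C G"
    and ends: "\<And>c. c \<in> C \<Longrightarrow> c \<noteq> \<one> \<Longrightarrow> \<not> starts i c"
    and g: "g \<in> generate G (H i \<union> C)" "g \<in> H l" "l \<in> I" "l \<noteq> i"
  shows "g \<in> C"
proof -
  have CC: "c \<in> carrier G" if "c \<in> C" for c using subgroup.mem_carrier[OF C that] .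
  have main: "x \<in> carrier G \<and> (x = \<one> \<or> (if b then starts i x else \<not> starts i x \<and>
      (\<exists>c n. c \<in> C \<and> c \<noteq> \<one> \<and> n \<in> carrier G \<and> x = c \<otimes> n \<and> nf x = nf c @ nf n)))" if "alt i C b x" for b x
    using that
  proof (induction)
    case (alt_H g a)
    hence "nf (a \<otimes> g) = (i, a) # nf g" using i nf_append[of a g] nf_letter[OF i] by (auto simp: starts_def)
    thus ?case using alt_H i by (simp add: starts_def)
  next
    case (alt_C g c)
    have cC: "c \<in> carrier G" using CC alt_C by blast
    have "\<not> starts i (inv c)" using ends[of "inv c"] alt_C subgroup.m_inv_closed[OF C] cC by (metis inv_eq_1_iff)
    hence lc: "fst (last (nf c)) \<noteq> i" using starts_inv[OF cC] cC alt_C by simp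
    have "nf g = [] \<or> fst (hd (nf g)) = i" using alt_C by (auto simp: starts_def)
    hence "nf (c \<otimes> g) = nf c @ nf g" using cC alt_C lc by (intro nf_append) auto
    moreover have "nf c \<noteq> []" using cC alt_C by simp
    moreover have "\<not> starts i (c \<otimes> g)" using calculation ends[of c] alt_C by (simp add: starts_def)
    ultimately show ?case using cC alt_C by auto
  qed simp
  have cl: "\<exists>b'. alt i C b' (y \<otimes> x)" if y: "y \<in> H i \<union> C" and x: "alt i C b x" for y x b
  proof (cases "y = \<one>")
    case True
    thus ?thesis using x main by auto
  next
    case False
    have yC: "y \<in> carrier G" using y i CC by auto
    show ?thesis
    proof (cases "y \<in> H i")
      case True
      show ?thesis using x
      proof (cases rule: alt.cases)
        case alt_one
        thus ?thesis using alt_H[of i C \<one> y] alt.alt_one True False yC by auto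
      next
        case (alt_H g a)
        have gC: "g \<in> carrier G" using main[OF alt_H(3)] by simp
        have e: "y \<otimes> x = (y \<otimes> a) \<otimes> g" using alt_H yC gC i by (simp add: m_assoc)
        show ?thesis
        proof (cases "y \<otimes> a = \<one>")
          case ya: True
          thus ?thesis using e alt_H gC by auto
        next
          case ya: False
          thus ?thesis using e alt.alt_H[OF alt_H(3), of "y \<otimes> a"] True alt_H i by auto
        qed
      next
        case (alt_C g c)
        thus ?thesis using alt.alt_H[of i C x y] x True False by auto
      qed
    next
      case nH: False
      hence yc: "y \<in> C" using y by simp
      show ?thesis using x
      proof (cases rule: alt.cases)
        case alt_one
        thus ?thesis using alt.alt_C[of i C \<one> y] alt.alt_one yc False yC by auto
      next
        case (alt_H g a)
        thus ?thesis using alt.alt_C[of i C x y] x yc False by auto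
      next
        case (alt_C g c)
        have gC: "g \<in> carrier G" using main[OF alt_C(3)] by simp
        have e: "y \<otimes> x = (y \<otimes> c) \<otimes> g" using alt_C yC gC CC by (simp add: m_assoc)
        show ?thesis
        proof (cases "y \<otimes> c = \<one>")
          case ya: True
          thus ?thesis using e alt_C gC by auto
        next
          case ya: False
          thus ?thesis using e alt.alt_C[OF alt_C(3), of "y \<otimes> c"] yc alt_C subgroup.m_closed[OF C] by auto
        qed
      qed
    qed
  qed
  have cl2: "\<exists>b. alt i C b (y \<otimes> x)" if "y \<in> generate G (H i \<union> C)" "alt i C b x" for y x b
    using that
  proof (induction arbitrary: x b rule: generate.induct)
    case one
    thus ?case using main by auto
  next
    case (inv h)
    hence "inv h \<in> H i \<union> C" using i subgroup.m_inv_closed[OF C] by auto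
    thus ?case using cl inv by blast
  next
    case (eng h1 h2)
    have "h1 \<in> carrier G" "h2 \<in> carrier G"
      using eng generate_in_carrier[of "H i \<union> C"] i CC H_closed by blast+
    hence "h1 \<otimes> h2 \<otimes> x = h1 \<otimes> (h2 \<otimes> x)" using main[OF eng.prems] by (simp add: m_assoc)
    thus ?case using eng by metis
  qed (use cl in blast)
  have gC: "g \<in> carrier G" using g by simp
  obtain b where b: "alt i C b g" using cl2[OF g(1) alt_one] gC by auto
  show ?thesis
  proof (cases "g = \<one>")
    case True
    thus ?thesis using subgroup.one_closed[OF C] by simp
  next
    case False
    hence n: "nf g = [(l, g)]" using nf_letter g by blast
    hence "\<not> starts i g" using g by (simp add: starts_def)
    then obtain c n' where cn: "c \<in> C" "c \<noteq> \<one>" "n' \<in> carrier G" "g = c \<otimes> n'" "nf g = nf c @ nf n'"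
      using main[OF b] False by (auto split: if_splits)
    have "nf c \<noteq> []" using cn CC by simp
    hence "nf n' = []" using cn n by (cases "nf c") auto
    thus ?thesis using cn CC by simp
  qed
qed

lemma generate_cj_subset:
  assumes "i \<in> I" "p \<in> H i" "C \<subseteq> carrier G"
  shows "generate G (H i \<union> cj p ` C) \<subseteq> generate G (H i \<union> C)"
proof (rule generate_subgroup_incl)
  show s: "subgroup (generate G (H i \<union> C)) G" by (rule generate_is_subgroup) (use assms H_closed in blast)
  have "cj p c \<in> generate G (H i \<union> C)" if "c \<in> C" for c
    unfolding cj_def using assms that by (intro generate.eng generate.incl) auto
  thus "H i \<union> cj p ` C \<subseteq> generate G (H i \<union> C)" by (auto intro: generate.incl)
qed

lemma subgroup_cj: "subgroup C G \<Longrightarrow> t \<in> carrier G \<Longrightarrow> subgroup (cj t ` C) G"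
proof (rule subgroupI)
  assume C: "subgroup C G" and t: "t \<in> carrier G"
  have cC: "c \<in> carrier G" if "c \<in> C" for c using subgroup.mem_carrier[OF C that] .
  show "cj t ` C \<subseteq> carrier G" "cj t ` C \<noteq> {}" using cC t subgroup.one_closed[OF C] by auto
  fix x assume "x \<in> cj t ` C"
  then obtain c where c: "c \<in> C" "x = cj t c" by blast
  have "inv x = cj t (inv c)" using c cC t by (simp add: cj_def inv_mult_group m_assoc)
  thus "inv x \<in> cj t ` C" using c subgroup.m_inv_closed[OF C] by auto
  fix y assume "y \<in> cj t ` C"
  then obtain d where d: "d \<in> C" "y = cj t d" by blast
  have "x \<otimes> y = cj t (c \<otimes> d)" using c d cC t by (simp add: cj_mult)
  thus "x \<otimes> y \<in> cj t ` C" using c d subgroup.m_closed[OF C] by auto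
qed

text \<open>Strip from \<open>w\<close> its beginning in \<open>H i\<close> and its end in
  \<open>H j\<close>; the generated subgroup does not shrink. If something is left, the conjugate of
  \<open>H j\<close> by it has only long nontrivial elements, none beginning in \<open>H i\<close>,
  and \<open>letter_in_generate\<close> would place the single letter \<open>b\<close> among
  them.\<close>

lemma conj_generate:
  assumes i: "i \<in> I" "j \<in> I" "i \<noteq> j" and w: "w \<in> carrier G"
    and b: "b \<in> H j" "b \<noteq> \<one>" "b \<in> generate G (H i \<union> cj w ` H j)"
  shows "\<exists>p\<in>H i. \<exists>q\<in>H j. w = p \<otimes> q"
proof -
  obtain p v where pv: "p \<in> H i" "v \<in> carrier G" "w = p \<otimes> v" "nf v = [] \<or> fst (hd (nf v)) \<noteq> i"
    using strip_left[OF i(1) w] by blast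
  obtain q' u' where qu: "q' \<in> H j" "u' \<in> carrier G" "inv v = q' \<otimes> u'" "nf u' = [] \<or> fst (hd (nf u')) \<noteq> j"
    "nf u' \<noteq> [] \<longrightarrow> last (nf u') = last (nf (inv v))"
    using strip_left[OF i(2) inv_closed[OF pv(2)]] by blast
  define q u where "q = inv q'" and "u = inv u'"
  have C: "p \<in> carrier G" "q \<in> carrier G" "q' \<in> carrier G" "u \<in> carrier G" using pv qu i by (auto simp: q_def u_def)
  have "v = inv (q' \<otimes> u')" using qu pv by (metis inv_inv)
  hence v: "v = u \<otimes> q" using qu C by (simp add: inv_mult_group q_def u_def)
  have q: "q \<in> H j" using qu i by (simp add: q_def)
  show ?thesis
  proof (cases "u = \<one>")
    case True
    thus ?thesis using pv v q C by auto
  next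
    case False
    hence u'1: "u' \<noteq> \<one>" using qu by (auto simp: u_def)
    have nu: "nf u = winv (nf u')" "nf u' \<noteq> []" using qu u'1 by (simp_all add: u_def nf_inv)
    have lu: "fst (last (nf u)) \<noteq> j" using nu qu by (simp add: fst_last_winv)
    have v1: "nf v \<noteq> []"
    proof
      assume "nf v = []"
      hence "q' \<otimes> u' = \<one>" using qu pv by simp
      hence "u' = inv q'" using C qu by (metis inv_closed inv_equality inv_inv)
      hence "u' \<in> H j" using qu i by simp
      hence "nf u' = [(j, u')]" using nf_letter u'1 i by blast
      thus False using qu by simp
    qed
    have "fst (hd (nf u)) = fst (last (nf u'))" using nu by (simp add: fst_hd_winv)
    also have "\<dots> = fst (last (nf (inv v)))" using qu nu by simp
    also have "\<dots> = fst (hd (nf v))" using pv v1 by (simp add: nf_inv fst_last_winv)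
    finally have hu: "fst (hd (nf u)) \<noteq> i" using pv v1 by simp
    have nfc: "nf (cj u d) = nf u @ [(j, d)] @ winv (nf u)" if d: "d \<in> H j" "d \<noteq> \<one>" for d
    proof -
      have dC: "d \<in> carrier G" using d i by simp
      have 1: "nf (d \<otimes> inv u) = [(j, d)] @ winv (nf u)"
        using nf_append[of d "inv u"] dC C nf_letter[OF i(2) d] nu lu by (simp add: nf_inv fst_hd_winv)
      have "nf (u \<otimes> (d \<otimes> inv u)) = nf u @ nf (d \<otimes> inv u)"
        using dC C 1 lu by (intro nf_append) auto
      thus ?thesis using 1 dC C by (simp add: cj_def m_assoc)
    qed
    let ?C = "cj u ` H j"
    have sC: "subgroup ?C G" using subgroup_cj[OF H_subgroup[OF i(2)] C(4)] .
    have wq: "cj w ` H j = cj p ` ?C"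
    proof -
      have "cj w d = cj p (cj u (cj q d))" if "d \<in> H j" for d
        using that C i pv v qu by (simp add: cj_cj m_assoc)
      moreover have "cj q ` H j = H j"
      proof (intro equalityI subsetI)
        fix x assume "x \<in> cj q ` H j"
        thus "x \<in> H j" using q i by (auto simp: cj_def)
      next
        fix x assume x: "x \<in> H j"
        hence "x = cj q (cj q' x)" using i C by (simp add: q_def cj_def m_assoc)
        moreover have "cj q' x \<in> H j" using x qu i by (simp add: cj_def)
        ultimately show "x \<in> cj q ` H j" by blast
      qed
      moreover have "cj w ` H j = (\<lambda>d. cj p (cj u d)) ` (cj q ` H j)"
        unfolding image_image using calculation(1) by (intro image_cong) auto
      ultimately show ?thesis by (simp add: image_image)
    qed
    have "b \<in> generate G (H i \<union> ?C)"
      using b(3) generate_cj_subset[OF i(1) pv(1) subgroup.subset[OF sC]] wq by auto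
    moreover have "\<not> starts i c" if c: "c \<in> ?C" "c \<noteq> \<one>" for c
    proof -
      obtain d where d: "d \<in> H j" "c = cj u d" using c(1) by (rule imageE)
      hence "d \<noteq> \<one>" using c C by auto
      thus ?thesis using d nfc[of d] hu nu by (simp add: starts_def)
    qed
    ultimately have "b \<in> ?C" using letter_in_generate[OF i(1) sC _ _ b(1) i(2)] i(3) by blast
    then obtain d where d: "d \<in> H j" "b = cj u d" by blast
    hence "d \<noteq> \<one>" using b C by auto
    hence "length (nf b) \<ge> 2" using d nfc[of d] nu by (simp add: Suc_le_eq)
    thus ?thesis using letter_nf_length[OF i(2) b(1)] by simp
  qed
qed

lemma image_in_generate:
  assumes h: "h \<in> hom G G" and k: "\<And>l a. l \<in> I \<Longrightarrow> l \<notin> S \<Longrightarrow> a \<in> H l \<Longrightarrow> h a = \<one>"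
    and g: "g \<in> carrier G"
  shows "h g \<in> generate G (\<Union>l\<in>S \<inter> I. h ` H l)"
  using g
proof (induction rule: letter_induct)
  case one
  thus ?case using hom_one[OF h group_axioms group_axioms] by (simp add: generate.one)
next
  case (letter i a g)
  have "h a \<in> generate G (\<Union>l\<in>S \<inter> I. h ` H l)"
    using letter k[of i a] by (cases "i \<in> S") (auto intro: generate.incl generate.one)
  thus ?case using letter hom_mult[OF h, of a g] by (simp add: generate.eng)
qed

lemma nf_letterwise:
  assumes h: "h \<in> hom G G" and \<sigma>: "inj_on \<sigma> S" "\<And>l. l \<in> S \<Longrightarrow> \<sigma> l \<in> I"
    and hH: "\<And>l a. l \<in> S \<Longrightarrow> a \<in> H l \<Longrightarrow> h a \<in> H (\<sigma> l)" "\<And>l. l \<in> S \<Longrightarrow> inj_on h (H l)"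
    and g: "g \<in> carrier G" "fst ` set (nf g) \<subseteq> S"
  shows "nf (h g) = map (\<lambda>(l, a). (\<sigma> l, h a)) (nf g)"
proof -
  let ?m = "map (\<lambda>(l, a). (\<sigma> l, h a))"
  have h1: "h \<one> = \<one>" using hom_one[OF h group_axioms group_axioms] .
  have "red ws \<Longrightarrow> fst ` set ws \<subseteq> S \<Longrightarrow> red (?m ws) \<and> wp (?m ws) = h (wp ws)" for ws
  proof (induction ws)
    case (Cons p ws)
    have p: "fst p \<in> I" "snd p \<in> H (fst p)" "snd p \<noteq> \<one>" "red ws" "ws = [] \<or> fst (hd ws) \<noteq> fst p" "fst p \<in> S"
      "fst ` set ws \<subseteq> S" using Cons.prems by (auto simp: red_Cons)
    have "h (snd p) \<noteq> \<one>" using hH(2)[OF p(6)] p h1 H_one by (metis inj_onD)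
    moreover have "ws \<noteq> [] \<longrightarrow> fst (hd (?m ws)) \<noteq> \<sigma> (fst p)"
      using p \<sigma>(1) by (cases ws) (auto dest: inj_onD)
    moreover have "?m (p # ws) = (\<sigma> (fst p), h (snd p)) # ?m ws" by (simp add: case_prod_beta)
    moreover have "red (?m ws)" "wp (?m ws) = h (wp ws)" using Cons.IH p by blast+
    ultimately show ?case using p \<sigma>(2)[OF p(6)] hH(1)[OF p(6,2)] hom_mult[OF h, of "snd p" "wp ws"]
      by (simp add: red_Cons) blast
  qed (simp add: h1)
  hence "red (?m (nf g))" "wp (?m (nf g)) = h g" using g by auto
  thus ?thesis using nf_unique by blast
qed

section \<open>Codes of normal forms and test words\<close>

definition code :: "'i \<Rightarrow> 'a \<Rightarrow> 'a list" where
  "code i g = map snd (filter (\<lambda>p. fst p = i) (nf g))"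

lemma code_in: "g \<in> carrier G \<Longrightarrow> set (code i g) \<subseteq> carrier G"
  using red_nf[of g] unfolding code_def reduced_word_def by auto

lemma filter_winv: "map snd (filter (\<lambda>p. fst p = i) (winv ws)) = rev (map (\<lambda>a. inv a) (map snd (filter (\<lambda>p. fst p = i) ws)))"
  by (induction ws) (auto simp: winv_Cons)

lemma code_quasimorphism:
  assumes "W \<noteq> []" shows "quasimorphism G (\<lambda>g. brooks W (code i g))"
proof (rule brooks_code_quasimorphism[OF assms, where f = "\<lambda>a. inv a" and A = "carrier G" and L = 1])
  fix g h assume "g \<in> carrier G" "h \<in> carrier G"
  then obtain p c s m1 m2 m3 where *: "nf g = p @ m1 @ c" "nf h = winv c @ m2 @ s" "nf (g \<otimes> h) = p @ m3 @ s"
    "m1 = [] \<and> m2 = [] \<and> m3 = [] \<or> (\<exists>i a b. m1 = [(i, a)] \<and> m2 = [(i, b)] \<and> m3 = [(i, a \<otimes> b)])"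
    using nf_mult_form by metis
  let ?f = "\<lambda>ws :: ('i \<times> 'a) list. map snd (filter (\<lambda>p. fst p = i) ws)"
  show "\<exists>p c s m1 m2 m3. code i g = p @ m1 @ c \<and> code i h = rev (map (\<lambda>a. inv a) c) @ m2 @ s \<and>
      code i (g \<otimes> h) = p @ m3 @ s \<and> length m1 \<le> 1 \<and> length m2 \<le> 1 \<and> length m3 \<le> 1"
    by (rule exI[of _ "?f p"], rule exI[of _ "?f c"], rule exI[of _ "?f s"], rule exI[of _ "?f m1"],
        rule exI[of _ "?f m2"], rule exI[of _ "?f m3"])
      (use *(4) in \<open>auto simp: code_def *(1,2,3) filter_winv\<close>)
qed (use code_in inv_inj in \<open>auto simp: inj_on_def\<close>)

lemma brooks_short: "length xs \<le> 1 \<Longrightarrow> W \<noteq> [] \<Longrightarrow> brooks W xs = 0"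
  by (cases xs) (auto simp: brooks_def occ_Nil)

lemma brooks_code_short:
  assumes "g \<in> carrier G" "length (nf g) \<le> 1" "W \<noteq> []" shows "brooks W (code i g) = 0"
  using assms by (intro brooks_short) (auto simp: code_def intro: order_trans[OF length_filter_le])

text \<open>The constant letter \<open>b\<close> behind each entry keeps the word reduced, also
  across the seams of a power, so the entries from the first factor can be prescribed at
  will.\<close>

definition spread :: "'i \<Rightarrow> 'i \<Rightarrow> 'a \<Rightarrow> 'a list \<Rightarrow> ('i \<times> 'a) list" where
  "spread i j b us = concat (map (\<lambda>u. [(i, u), (j, b)]) us)"

lemma red_spread:
  assumes "i \<in> I" "j \<in> I" "i \<noteq> j" "b \<in> H j" "b \<noteq> \<one>" "set us \<subseteq> H i - {\<one>}"
  shows "red (spread i j b us)"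
  using assms(6)
proof (induction us)
  case (Cons u us)
  have "us = [] \<or> fst (hd (spread i j b us)) = i" by (cases us) (auto simp: spread_def)
  thus ?case using Cons assms by (auto simp: spread_def red_Cons)
qed (simp add: spread_def)

lemma spread_append: "spread i j b (us @ vs) = spread i j b us @ spread i j b vs"
  by (simp add: spread_def)

lemma spread_pow:
  assumes "i \<in> I" "j \<in> I" "i \<noteq> j" "b \<in> H j" "b \<noteq> \<one>" "set us \<subseteq> H i - {\<one>}"
  shows "nf (wp (spread i j b us) [^] (n::nat)) = spread i j b (concat (replicate n us))"
proof -
  have s: "set (concat (replicate n us)) \<subseteq> H i - {\<one>}" for n using assms(6) by auto
  have "wp (spread i j b us) [^] n = wp (spread i j b (concat (replicate n us)))"
  proof (induction n)
    case 0
    thus ?case by (simp add: spread_def)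
  next
    case (Suc n)
    have "wp (spread i j b us) [^] Suc n = wp (spread i j b us) \<otimes> wp (spread i j b us) [^] n"
      by (rule nat_pow_Suc2) (use red_spread[OF assms] in simp)
    thus ?case using Suc red_spread[OF assms] red_spread[OF assms(1-5) s, of n]
      by (simp add: spread_append wp_append)
  qed
  thus ?thesis using red_spread[OF assms(1-5) s] by simp
qed

lemma code_spread: "i \<noteq> j \<Longrightarrow> map snd (filter (\<lambda>p. fst p = i) (spread i j b us)) = us"
  "i \<noteq> j \<Longrightarrow> map snd (filter (\<lambda>p. fst p = j) (spread i j b us)) = replicate (length us) b"
  by (induction us) (auto simp: spread_def)

lemma set_spread: "fst ` set (spread i j b us) \<subseteq> {i, j}"
  by (auto simp: spread_def)

end

lemma brooks_replicate: "brooks (pattern a b) (replicate n x) = 0"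
proof (cases n)
  case 0
  thus ?thesis by (simp add: brooks_def occ_Nil)
next
  case (Suc m)
  have "occ (pattern a b) (replicate m True) = 0" for a b using occ_pattern_True[of a b m "[]"] by (simp add: occ_Nil)
  thus ?thesis unfolding Suc brooks_def adj_replicate rev_pattern by simp
qed

section \<open>No infinite cyclic factor\<close>

lemma hom_comp: "f \<in> hom G K \<Longrightarrow> h \<in> hom K L \<Longrightarrow> (\<lambda>g. h (f g)) \<in> hom G L"
  by (auto simp: hom_def Pi_iff)

context free_prod
begin

lemma cj_H: "i \<in> I \<Longrightarrow> p \<in> H i \<Longrightarrow> cj p ` H i = H i"
proof (intro equalityI subsetI)
  fix x assume i: "i \<in> I" "p \<in> H i" and x: "x \<in> H i"
  have "x = cj p (cj (inv p) x)" "cj (inv p) x \<in> H i" using i x by (simp_all add: cj_def m_assoc)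
  thus "x \<in> cj p ` H i" by blast
qed (auto simp: cj_def)

lemma ret_ret: "g \<in> carrier G \<Longrightarrow> ret S (ret S g) = ret S g"
  using ret_id[of "ret S g" S] nf_ret[of g S] by simp

lemma ret_auto_conj:
  assumes phi: "\<phi> \<in> auto G" and l: "l \<in> I" "l' \<in> I" "t \<in> carrier G" "\<phi> ` H l = cj t ` H l'" and a: "a \<in> H l"
  shows "l' \<in> S \<Longrightarrow> \<exists>b\<in>H l'. \<phi> a = cj t b \<and> ret S (\<phi> a) = cj (ret S t) b" "l' \<notin> S \<Longrightarrow> ret S (\<phi> a) = \<one>"
proof -
  have "\<phi> a \<in> cj t ` H l'" using l(4) a by blast
  then obtain b where b: "b \<in> H l'" "\<phi> a = cj t b" by blast
  have "ret S (\<phi> a) = cj (ret S t) (ret S b)" using b l by (simp add: ret_cj)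
  thus "l' \<in> S \<Longrightarrow> \<exists>b\<in>H l'. \<phi> a = cj t b \<and> ret S (\<phi> a) = cj (ret S t) b" "l' \<notin> S \<Longrightarrow> ret S (\<phi> a) = \<one>"
    using b l ret_letter[OF l(2) b(1)] by auto
qed

lemma ret_auto_factors:
  assumes phi: "\<phi> \<in> auto G" and S: "\<And>l a. l \<in> I \<Longrightarrow> l \<notin> S \<Longrightarrow> a \<in> H l \<Longrightarrow> ret S' (\<phi> a) = \<one>" and g: "g \<in> carrier G"
  shows "ret S' (\<phi> g) = ret S' (\<phi> (ret S g))"
proof -
  have 1: "(\<lambda>g. ret S' (\<phi> g)) \<in> hom G G"
    by (rule hom_comp[OF auto_hom[OF phi] ret_hom])
  have 2: "(\<lambda>g. ret S' (\<phi> (ret S g))) \<in> hom G G"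
    by (rule hom_comp[OF ret_hom 1])
  have p1: "\<phi> \<one> = \<one>" using hom_one[OF auto_hom[OF phi] group_axioms group_axioms] .
  show ?thesis
    by (rule hom_eq_on_letters[OF group_axioms 1 2 _ g]) (auto simp: ret_letter S p1)
qed

text \<open>Modulo the other factors and up to one conjugation, \<open>\<phi>\<close> carries
  \<open>H i\<close> onto \<open>H i'\<close> and \<open>H j\<close> onto the conjugate of
  \<open>H j'\<close> by some \<open>w\<close>. Surjectivity and \<open>conj_generate\<close> force
  \<open>w = p \<otimes> q\<close>, and a conjugation by \<open>inv p\<close> makes both images
  standard.\<close>

lemma pair_standard:
  assumes phi: "\<phi> \<in> auto G" and i: "i \<in> I" "j \<in> I" "i \<noteq> j" and i': "i' \<in> I" "j' \<in> I" "i' \<noteq> j'"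
    and t: "t \<in> carrier G" "t' \<in> carrier G" "\<phi> ` H i = cj t ` H i'" "\<phi> ` H j = cj t' ` H j'"
    and other: "\<And>l a. l \<in> I \<Longrightarrow> l \<notin> {i, j} \<Longrightarrow> a \<in> H l \<Longrightarrow> ret {i', j'} (\<phi> a) = \<one>"
    and b: "b \<in> H j'" "b \<noteq> \<one>"
  shows "\<exists>s h. s \<in> carrier G \<and> h \<in> hom G G \<and>
    (\<forall>g\<in>carrier G. ret {i', j'} (\<phi> g) = cj s (h (ret {i, j} g))) \<and>
    h ` H i = H i' \<and> h ` H j = H j' \<and> inj_on h (H i) \<and> inj_on h (H j)"
proof -
  let ?S = "{i, j}" and ?S' = "{i', j'}"
  define \<theta> where "\<theta> g = ret ?S' (\<phi> g)" for g
  define u v where "u = ret ?S' t" and "v = ret ?S' t'"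
  have \<phi>c: "\<phi> g \<in> carrier G" if "g \<in> carrier G" for g using hom_in_carrier[OF auto_hom[OF phi] that] .
  have \<theta>c: "\<theta> g \<in> carrier G" if "g \<in> carrier G" for g using \<phi>c that by (simp add: \<theta>_def)
  have uC: "u \<in> carrier G" "v \<in> carrier G" using t by (auto simp: u_def v_def)
  have \<theta>h: "\<theta> \<in> hom G G" unfolding \<theta>_def[abs_def] by (rule hom_comp[OF auto_hom[OF phi] ret_hom])
  have di: "\<exists>c\<in>H i'. \<phi> a = cj t c \<and> \<theta> a = cj u c" if "a \<in> H i" for a
    using ret_auto_conj(1)[OF phi i(1) i'(1) t(1,3) that] by (simp add: \<theta>_def u_def)
  have dj: "\<exists>c\<in>H j'. \<phi> a = cj t' c \<and> \<theta> a = cj v c" if "a \<in> H j" for a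
    using ret_auto_conj(1)[OF phi i(2) i'(2) t(2,4) that] by (simp add: \<theta>_def v_def)
  have \<theta>i: "\<theta> ` H i = cj u ` H i'"
  proof (intro equalityI subsetI)
    fix x assume "x \<in> cj u ` H i'"
    then obtain c where c: "c \<in> H i'" "x = cj u c" by blast
    hence "cj t c \<in> \<phi> ` H i" using t by blast
    then obtain a where a: "a \<in> H i" "cj t c = \<phi> a" by blast
    then obtain c' where c': "c' \<in> H i'" "\<phi> a = cj t c'" "\<theta> a = cj u c'" using di by blast
    have "c' = c" using cj_inj[OF t(1), of c' c] c' c a i' by simp
    hence "x = \<theta> a" using c c' by simp
    thus "x \<in> \<theta> ` H i" using a by blast
  qed (use di in blast)
  have \<theta>j: "\<theta> ` H j = cj v ` H j'"
  proof (intro equalityI subsetI)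
    fix x assume "x \<in> cj v ` H j'"
    then obtain c where c: "c \<in> H j'" "x = cj v c" by blast
    hence "cj t' c \<in> \<phi> ` H j" using t by blast
    then obtain a where a: "a \<in> H j" "cj t' c = \<phi> a" by blast
    then obtain c' where c': "c' \<in> H j'" "\<phi> a = cj t' c'" "\<theta> a = cj v c'" using dj by blast
    have "c' = c" using cj_inj[OF t(2), of c' c] c' c a i' by simp
    hence "x = \<theta> a" using c c' by simp
    thus "x \<in> \<theta> ` H j" using a by blast
  qed (use dj in blast)
  have \<phi>inj: "inj_on \<phi> (carrier G)" using auto_bij[OF phi] by (simp add: bij_betw_def)
  have \<theta>inji: "inj_on \<theta> (H i)"
  proof (rule inj_onI)
    fix a a' assume a: "a \<in> H i" "a' \<in> H i" "\<theta> a = \<theta> a'"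
    obtain c where c: "c \<in> H i'" "\<phi> a = cj t c" "\<theta> a = cj u c" using di[OF a(1)] by blast
    obtain c' where c': "c' \<in> H i'" "\<phi> a' = cj t c'" "\<theta> a' = cj u c'" using di[OF a(2)] by blast
    hence "c = c'" using cj_inj[OF uC(1), of c c'] a i' c c' by simp
    thus "a = a'" using c c' inj_onD[OF \<phi>inj, of a a'] a i by simp
  qed
  have \<theta>injj: "inj_on \<theta> (H j)"
  proof (rule inj_onI)
    fix a a' assume a: "a \<in> H j" "a' \<in> H j" "\<theta> a = \<theta> a'"
    obtain c where c: "c \<in> H j'" "\<phi> a = cj t' c" "\<theta> a = cj v c" using dj[OF a(1)] by blast
    obtain c' where c': "c' \<in> H j'" "\<phi> a' = cj t' c'" "\<theta> a' = cj v c'" using dj[OF a(2)] by blast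
    hence "c = c'" using cj_inj[OF uC(2), of c c'] a i' c c' by simp
    thus "a = a'" using c c' inj_onD[OF \<phi>inj, of a a'] a i by simp
  qed
  define h1 where "h1 g = cj (inv u) (\<theta> g)" for g
  define w where "w = inv u \<otimes> v"
  have wC: "w \<in> carrier G" using uC by (simp add: w_def)
  have h1h: "h1 \<in> hom G G" using cj_hom[OF inv_closed[OF uC(1)] \<theta>h] by (simp add: h1_def[abs_def])
  have cju: "cj (inv u) ` (cj r ` A) = cj (inv u \<otimes> r) ` A" if "r \<in> carrier G" "A \<subseteq> carrier G" for r A
    using that uC by (auto simp: image_image cj_cj intro!: image_cong)
  have Hc: "H l \<subseteq> carrier G" if "l \<in> I" for l using that by auto
  have h1i: "h1 ` H i = H i'"
  proof -
    have "h1 ` H i = cj (inv u) ` (\<theta> ` H i)" by (simp add: h1_def image_image)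
    also have "\<dots> = cj (inv u) ` (cj u ` H i')" by (simp add: \<theta>i)
    also have "\<dots> = cj \<one> ` H i'" using cju[OF uC(1) Hc[OF i'(1)]] uC by simp
    finally show ?thesis using cj_H[OF i'(1) H_one[OF i'(1)]] by simp
  qed
  have h1j: "h1 ` H j = cj w ` H j'"
  proof -
    have "h1 ` H j = cj (inv u) ` (\<theta> ` H j)" by (simp add: h1_def image_image)
    thus ?thesis using cju[OF uC(2) Hc[OF i'(2)]] by (simp add: \<theta>j w_def)
  qed
  have bC: "b \<in> carrier G" using b i' by simp
  \<comment> \<open>A preimage witnessing that \<open>b\<close> lies in the subgroup generated by
    the two images, as \<open>conj_generate\<close> demands.\<close>
  obtain g0 where g0: "g0 \<in> carrier G" "\<phi> g0 = cj u b"
    using auto_bij[OF phi] uC bC by (metis bij_betw_def cj_closed imageE)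
  have "ret ?S' u = u" using ret_ret t by (simp add: u_def)
  hence "\<theta> g0 = cj u b" using g0 uC bC ret_letter[OF i'(2) b(1)] by (simp add: \<theta>_def ret_cj)
  hence "h1 g0 = b" using uC bC by (simp add: h1_def)
  moreover have "h1 g0 \<in> generate G (\<Union>l\<in>?S \<inter> I. h1 ` H l)"
    by (rule image_in_generate[OF h1h _ g0(1)]) (use other uC in \<open>simp add: h1_def \<theta>_def\<close>)
  moreover have "(\<Union>l\<in>?S \<inter> I. h1 ` H l) = H i' \<union> cj w ` H j'" using i h1i h1j by auto
  ultimately have "b \<in> generate G (H i' \<union> cj w ` H j')" by simp
  then obtain p q where pq: "p \<in> H i'" "q \<in> H j'" "w = p \<otimes> q" using conj_generate[OF i' wC b] by blast
  have pC: "p \<in> carrier G" "q \<in> carrier G" using pq i' by auto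
  define h where "h g = cj (inv p) (h1 g)" for g
  have hh: "h \<in> hom G G" using cj_hom[OF inv_closed[OF pC(1)] h1h] by (simp add: h_def[abs_def])
  have hi: "h ` H i = H i'"
  proof -
    have "h ` H i = cj (inv p) ` (h1 ` H i)" by (simp add: h_def image_image)
    thus ?thesis using h1i cj_H[OF i'(1) H_inv[OF i'(1) pq(1)]] by simp
  qed
  have hj: "h ` H j = H j'"
  proof -
    have "h ` H j = cj (inv p) ` (h1 ` H j)" by (simp add: h_def image_image)
    also have "\<dots> = cj (inv p) ` cj w ` H j'" by (simp add: h1j)
    also have "\<dots> = cj q ` H j'" using pq pC Hc[OF i'(2)]
      by (auto simp: image_image cj_cj subset_iff intro!: image_cong)
    finally show ?thesis using cj_H[OF i'(2) pq(2)] by simp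
  qed
  have hinj: "inj_on h A" if A: "inj_on \<theta> A" "A \<subseteq> carrier G" for A
  proof (rule inj_onI)
    fix x y assume xy: "x \<in> A" "y \<in> A" "h x = h y"
    have C: "\<theta> x \<in> carrier G" "\<theta> y \<in> carrier G" using xy A \<theta>c by auto
    have "h1 x = h1 y" using xy(3) cj_inj[of "inv p" "h1 x" "h1 y"] pC C uC by (simp add: h_def h1_def)
    hence "\<theta> x = \<theta> y" using cj_inj[of "inv u" "\<theta> x" "\<theta> y"] C uC by (simp add: h1_def)
    thus "x = y" using inj_onD[OF A(1)] xy by blast
  qed
  have fac: "ret ?S' (\<phi> g) = cj (u \<otimes> p) (h (ret ?S g))" if g: "g \<in> carrier G" for g
  proof -
    have "\<theta> (ret ?S g) = cj u (h1 (ret ?S g))" using uC \<theta>c g by (simp add: h1_def)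
    also have "h1 (ret ?S g) = cj p (h (ret ?S g))" using pC uC \<theta>c g by (simp add: h_def h1_def)
    finally have "\<theta> (ret ?S g) = cj (u \<otimes> p) (h (ret ?S g))"
      using cj_cj[OF uC(1) pC(1), of "h (ret ?S g)"] hom_in_carrier[OF hh] g by simp
    moreover have "ret ?S' (\<phi> g) = ret ?S' (\<phi> (ret ?S g))"
      by (rule ret_auto_factors[OF phi _ g]) (rule other)
    hence "ret ?S' (\<phi> g) = \<theta> (ret ?S g)" by (simp add: \<theta>_def)
    ultimately show ?thesis by simp
  qed
  have "u \<otimes> p \<in> carrier G" using uC pC by simp
  thus ?thesis
    using hh fac hi hj hinj[OF \<theta>inji Hc[OF i(1)]] hinj[OF \<theta>injj Hc[OF i(2)]] by blast
qed

lemma letter_pow_in: "i \<in> I \<Longrightarrow> a \<in> H i \<Longrightarrow> a [^] (n::nat) \<in> H i"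
  by (induction n) simp_all

lemma ret_letter_short: "i \<in> I \<Longrightarrow> a \<in> H i \<Longrightarrow> length (nf (ret S a)) \<le> 1"
  using letter_nf_length by (auto simp: ret_letter)

text \<open>By \<open>pair_standard\<close> the code changes by a conjugation, which costs a bounded
  amount, and by an injective relabelling, which \<open>adj\<close> does not see.\<close>

lemma code_pair_invariant:
  assumes "\<phi> \<in> auto G" "i \<in> I" "j \<in> I" "i \<noteq> j" "i' \<in> I" "j' \<in> I" "i' \<noteq> j'"
    "t \<in> carrier G" "t' \<in> carrier G" "\<phi> ` H i = cj t ` H i'" "\<phi> ` H j = cj t' ` H j'"
    "\<And>l a. l \<in> I \<Longrightarrow> l \<notin> {i, j} \<Longrightarrow> a \<in> H l \<Longrightarrow> ret {i', j'} (\<phi> a) = \<one>"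
    "b \<in> H j'" "b \<noteq> \<one>" and W: "W \<noteq> []"
  shows "\<exists>C. \<forall>g\<in>carrier G. \<bar>brooks W (code i' (ret {i', j'} (\<phi> g))) - brooks W (code i (ret {i, j} g))\<bar> \<le> C"
proof -
  have "\<exists>s h. s \<in> carrier G \<and> h \<in> hom G G \<and>
    (\<forall>g\<in>carrier G. ret {i', j'} (\<phi> g) = cj s (h (ret {i, j} g))) \<and>
    h ` H i = H i' \<and> h ` H j = H j' \<and> inj_on h (H i) \<and> inj_on h (H j)"
    by (rule pair_standard[OF assms(1-11) _ assms(13,14)]) (rule assms(12))
  then obtain s h where sh0: "s \<in> carrier G \<and> h \<in> hom G G \<and>
    (\<forall>g\<in>carrier G. ret {i', j'} (\<phi> g) = cj s (h (ret {i, j} g))) \<and>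
    h ` H i = H i' \<and> h ` H j = H j' \<and> inj_on h (H i) \<and> inj_on h (H j)"
    by (elim exE)
  hence sh: "s \<in> carrier G" "h \<in> hom G G"
    "\<And>g. g \<in> carrier G \<Longrightarrow> ret {i', j'} (\<phi> g) = cj s (h (ret {i, j} g))"
    "h ` H i = H i'" "h ` H j = H j'" "inj_on h (H i)" "inj_on h (H j)"
    by simp_all
  obtain C where C: "\<forall>g\<in>carrier G. \<bar>brooks W (code i' (cj s g)) - brooks W (code i' g)\<bar> \<le> C"
    using quasimorphism_cj[OF code_quasimorphism[OF W] sh(1)] by blast
  have "brooks W (code i' (h (ret {i, j} g))) = brooks W (code i (ret {i, j} g))" if g: "g \<in> carrier G" for g
  proof -
    let ?g = "ret {i, j} g" and ?\<sigma> = "\<lambda>l. if l = i then i' else j'"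
    have gc: "?g \<in> carrier G" "fst ` set (nf ?g) \<subseteq> {i, j}" using nf_ret[OF g, of "{i, j}"] g by auto
    have n: "nf (h ?g) = map (\<lambda>(l, a). (?\<sigma> l, h a)) (nf ?g)"
      by (rule nf_letterwise[OF sh(2) _ _ _ _ gc]) (use assms sh in \<open>auto simp: inj_on_def\<close>)
    have "map snd (filter (\<lambda>p. fst p = i') (map (\<lambda>(l, a). (?\<sigma> l, h a)) ws)) =
        map h (map snd (filter (\<lambda>p. fst p = i) ws))" if "fst ` set ws \<subseteq> {i, j}" for ws
      using that assms(4,7) by (induction ws) auto
    hence "code i' (h ?g) = map h (code i ?g)" using gc(2) by (simp add: code_def n)
    moreover have "set (code i ?g) \<subseteq> H i"
      using red_nf[OF gc(1)] by (auto simp: code_def reduced_word_def)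
    ultimately show ?thesis using brooks_map[of h "code i ?g" W] sh(6) inj_on_subset by metis
  qed
  hence "\<bar>brooks W (code i' (ret {i', j'} (\<phi> g))) - brooks W (code i (ret {i, j} g))\<bar> \<le> C"
    if "g \<in> carrier G" for g
    using C sh(3)[OF that] hom_in_carrier[OF sh(2), of "ret {i, j} g"] that by (metis ret_closed)
  thus ?thesis by blast
qed

text \<open>All ordered pairs of factors are summed because an automorphism permutes them. The test
  words need two different nontrivial letters in one factor; this is where a factor other than Z/2
  enters.\<close>

lemma quasimorphisms_no_cyclic_factor:
  assumes fi: indecomposable_factors and fin: "finite I" and nc: "noncyc = I"
    and i: "i \<in> I" "j \<in> I" "i \<noteq> j" and uv: "u \<in> H i" "v \<in> H i" "u \<noteq> \<one>" "v \<noteq> \<one>" "u \<noteq> v" and b: "b \<in> H j" "b \<noteq> \<one>"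
  shows "\<exists>S. infinite S \<and> lin_indep_funs G S \<and>
      (\<forall>\<psi>\<in>S. quasimorphism G \<psi> \<and> homogeneous_qm G \<psi> \<and> aut_invariant G \<psi> \<and> (\<forall>g\<in>\<Union>(H ` I). \<psi> g = 0))"
proof -
  define P where "P = {(k, l). k \<in> I \<and> l \<in> I \<and> k \<noteq> l}"
  define W where "W m = pattern (4 * m) (4 * m + 1)" for m
  define f where "f m k l g = brooks (W m) (code k (ret {k, l} g))" for m k l g
  define h where "h m g = (\<Sum>(k, l)\<in>P. f m k l g)" for m g
  define x where "x m = wp (spread i j b (cyc_word (4 * m) u v))" for m
  have finP: "finite P" by (rule finite_subset[of _ "I \<times> I"]) (auto simp: P_def fin)
  have W: "W m \<noteq> []" for m by (simp add: W_def)
  have cw: "set (cyc_word (4 * m) u v) \<subseteq> H i - {\<one>}" for m using uv by (auto simp: cyc_word_def)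
  have xc: "x m \<in> carrier G" for m using red_spread[OF i b cw] by (simp add: x_def)
  have xpow: "h m (x m' [^] n) = (if m = m' then real (n - 1) else 0)" for m m' and n :: nat
  proof -
    let ?g = "x m' [^] n"
    let ?us = "concat (replicate n (cyc_word (4 * m') u v))"
    have gC: "?g \<in> carrier G" using xc by simp
    have nfg: "nf ?g = spread i j b ?us" unfolding x_def by (rule spread_pow[OF i b cw])
    have rid: "ret {i, j} ?g = ?g" using ret_id[OF gC] nfg set_spread by metis
    have 1: "f m i j ?g = (if m = m' then real (n - 1) else 0)"
      unfolding f_def rid code_def nfg code_spread(1)[OF i(3)] W_def using brooks_cyc_word[OF uv(5)] .
    \<comment> \<open>All letters of the test word in \<open>H j\<close> equal \<open>b\<close>, so
      this code shows no \<open>False\<close>.\<close>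
    have 2: "f m j i ?g = 0"
    proof -
      have "ret {j, i} ?g = ?g" using rid by (simp add: insert_commute)
      thus ?thesis unfolding f_def code_def nfg code_spread(2)[OF i(3)] W_def
        by (simp add: code_def nfg code_spread(2)[OF i(3)] brooks_replicate)
    qed
    \<comment> \<open>Any other pair shares at most one index with \<open>{i, j}\<close>, and at
      most one letter survives the retraction.\<close>
    have 3: "f m k l ?g = 0" if kl: "(k, l) \<in> P" "(k, l) \<noteq> (i, j)" "(k, l) \<noteq> (j, i)" for k l
    proof -
      have "fst ` set (nf (ret {k, l} ?g)) \<subseteq> {k, l} \<inter> {i, j}"
        using nf_ret[OF gC, of "{k, l}", unfolded nfg] set_spread[of i j b ?us] by blast
      moreover have "{k, l} \<inter> {i, j} \<subseteq> {if k = i \<or> k = j then k else l}"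
        using kl i(3) by (auto simp: P_def)
      ultimately have "fst ` set (nf (ret {k, l} ?g)) \<subseteq> {if k = i \<or> k = j then k else l}" by (rule order_trans)
      hence "length (nf (ret {k, l} ?g)) \<le> 1"
        by (rule red_single_index[OF red_nf[OF ret_closed[OF gC]]])
      thus ?thesis unfolding f_def using brooks_code_short gC W by simp
    qed
    have "h m ?g = (\<Sum>(k, l)\<in>{(i, j)}. f m k l ?g)"
      unfolding h_def
    proof (rule sum.mono_neutral_right[OF finP])
      show "{(i, j)} \<subseteq> P" using i by (simp add: P_def)
      show "\<forall>a\<in>P - {(i, j)}. (case a of (k, l) \<Rightarrow> f m k l ?g) = 0"
      proof
        fix a assume a: "a \<in> P - {(i, j)}"
        obtain k l where "a = (k, l)" by (cases a)
        thus "(case a of (k, l) \<Rightarrow> f m k l ?g) = 0"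
          using 2 3[of k l] a by (cases "(k, l) = (j, i)") auto
      qed
    qed
    thus ?thesis using 1 by simp
  qed
  show ?thesis
  proof (rule independent_homogenizations[of h "\<Union>(H ` I)" x])
    fix m
    show "quasimorphism G (h m)"
      unfolding h_def f_def
      by (rule quasimorphism_sum[OF finP]) (auto intro: quasimorphism_hom[OF code_quasimorphism[OF W] ret_hom])
    fix \<phi> assume phi: "\<phi> \<in> auto G"
    obtain \<sigma> t where st: "bij_betw \<sigma> noncyc noncyc" "\<And>i. i \<in> noncyc \<Longrightarrow> t i \<in> carrier G"
      "\<And>i. i \<in> noncyc \<Longrightarrow> \<phi> ` H i = cj (t i) ` H (\<sigma> i)"
      using auto_factor_permutation[OF fi phi fin] by blast
    have sI: "\<sigma> k \<in> I" if "k \<in> I" for k using st(1) nc that by (auto simp: bij_betw_def)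
    have sinj: "\<sigma> k = \<sigma> l \<longleftrightarrow> k = l" if "k \<in> I" "l \<in> I" for k l
      using st(1) nc that by (auto simp: bij_betw_def inj_on_def)
    have bij: "bij_betw (map_prod \<sigma> \<sigma>) P P"
    proof -
      have "inj_on (map_prod \<sigma> \<sigma>) P" by (auto simp: inj_on_def P_def sinj)
      moreover have "map_prod \<sigma> \<sigma> ` P \<subseteq> P" by (auto simp: P_def sinj sI)
      ultimately show ?thesis using finP by (simp add: bij_betw_def endo_inj_surj)
    qed
    have e: "h m (\<phi> g) = (\<Sum>(k, l)\<in>P. f m (\<sigma> k) (\<sigma> l) (\<phi> g))" for g
      unfolding h_def using sum.reindex_bij_betw[OF bij, of "\<lambda>(k, l). f m k l (\<phi> g)"]
      by (simp add: case_prod_beta)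
    have "\<exists>C. \<forall>g\<in>carrier G. \<bar>f m (\<sigma> (fst a)) (\<sigma> (snd a)) (\<phi> g) - f m (fst a) (snd a) g\<bar> \<le> C" if a: "a \<in> P" for a
    proof -
      obtain k l where kl: "a = (k, l)" "k \<in> I" "l \<in> I" "k \<noteq> l" using a by (auto simp: P_def)
      obtain c where c: "c \<in> H (\<sigma> l)" "c \<noteq> \<one>" using H_nontrivial[OF fi sI[OF kl(3)]] by blast
      have other: "ret {\<sigma> k, \<sigma> l} (\<phi> d) = \<one>" if "l' \<in> I" "l' \<notin> {k, l}" "d \<in> H l'" for l' d
        using ret_auto_conj(2)[OF phi that(1) sI[OF that(1)] _ _ that(3)] st(2,3)[of l'] nc that kl by (simp add: sinj)
      show ?thesis unfolding kl(1) f_def fst_conv snd_conv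
        by (rule code_pair_invariant[OF phi kl(2-4) sI[OF kl(2)] sI[OF kl(3)] _ _ _ _ _ other c W])
          (use st nc kl sinj in auto)
    qed
    thus "\<exists>C. \<forall>g\<in>carrier G. \<bar>h m (\<phi> g) - h m g\<bar> \<le> C"
      using sum_bounded_change[OF finP, of "carrier G" "\<lambda>a g. f m (\<sigma> (fst a)) (\<sigma> (snd a)) (\<phi> g)" "\<lambda>a g. f m (fst a) (snd a) g"]
      unfolding e unfolding h_def by (simp add: case_prod_beta)
  next
    show "\<Union>(H ` I) \<subseteq> carrier G" by auto
  next
    fix m g assume "g \<in> \<Union>(H ` I)"
    then obtain l where l: "l \<in> I" "g \<in> H l" by blast
    have "f m k k' (g [^] n) = 0" for k k' and n :: nat
      unfolding f_def using l letter_pow_in[OF l, of n] W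
      by (intro brooks_code_short ret_letter_short[of l]) auto
    hence "h m (g [^] n) = 0" for n :: nat by (simp add: h_def)
    thus "\<exists>C. \<forall>n::nat. \<bar>h m (g [^] n)\<bar> \<le> C" by (intro exI[of _ 0]) simp
  next
    show "x m \<in> carrier G" for m by (rule xc)
    show "\<exists>C. \<forall>n::nat. \<bar>h m (x m' [^] n)\<bar> \<le> C" if "m \<noteq> m'" for m m'
      using that by (intro exI[of _ 0]) (simp add: xpow)
    show "\<exists>C. \<forall>n::nat. real n \<le> \<bar>h m (x m [^] n)\<bar> + C" for m
      by (intro exI[of _ 1]) (auto simp: xpow)
  qed
qed

end

section \<open>One infinite cyclic factor\<close>

text \<open>A power of the cyclic generator contributes one sign per unit of its exponent: an
  automorphism may replace the generator by its product with a letter of another factor, which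
  breaks the power up.\<close>

definition signs :: "int \<Rightarrow> bool list" where
  "signs n = replicate (nat \<bar>n\<bar>) (n > 0)"

lemma signs_neg: "signs (- n) = rev (map Not (signs n))"
  by (cases "n = 0") (auto simp: signs_def)

lemma signs_add: "\<exists>x c y. signs n = x @ c \<and> signs m = rev (map Not c) @ y \<and> signs (n + m) = x @ y"
proof -
  consider "n \<ge> 0" "m \<ge> 0" | "n \<le> 0" "m \<le> 0" | "n > 0" "m < 0" "n + m \<ge> 0" | "n > 0" "m < 0" "n + m < 0" |
    "n < 0" "m > 0" "n + m \<le> 0" | "n < 0" "m > 0" "n + m > 0" by linarith
  thus ?thesis
  proof cases
    case 1
    hence "signs (n + m) = signs n @ signs m" by (auto simp: signs_def nat_add_distrib replicate_add)
    thus ?thesis by (intro exI[of _ "signs n"] exI[of _ "[]"] exI[of _ "signs m"]) simp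
  next
    case 2
    hence "nat \<bar>n + m\<bar> = nat \<bar>n\<bar> + nat \<bar>m\<bar>" by linarith
    hence "signs (n + m) = signs n @ signs m" using 2 by (auto simp: signs_def replicate_add[symmetric])
    thus ?thesis by (intro exI[of _ "signs n"] exI[of _ "[]"] exI[of _ "signs m"]) simp
  next
    case 3
    hence "nat \<bar>n\<bar> = nat \<bar>n + m\<bar> + nat \<bar>m\<bar>" by linarith
    hence "signs n = replicate (nat \<bar>n + m\<bar>) True @ replicate (nat \<bar>m\<bar>) True"
      using 3 by (simp add: signs_def replicate_add[symmetric])
    moreover have "signs (n + m) = replicate (nat \<bar>n + m\<bar>) True" using 3 by (cases "n + m = 0") (auto simp: signs_def)
    ultimately show ?thesis using 3
      by (intro exI[of _ "signs (n + m)"] exI[of _ "replicate (nat \<bar>m\<bar>) True"] exI[of _ "[]"]) (simp add: signs_def)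
  next
    case 4
    hence "nat \<bar>m\<bar> = nat \<bar>n\<bar> + nat \<bar>n + m\<bar>" by linarith
    hence "signs m = replicate (nat \<bar>n\<bar>) False @ replicate (nat \<bar>n + m\<bar>) False"
      using 4 by (simp add: signs_def replicate_add[symmetric])
    thus ?thesis using 4
      by (intro exI[of _ "[]"] exI[of _ "signs n"] exI[of _ "signs (n + m)"]) (simp add: signs_def)
  next
    case 5
    hence "nat \<bar>n\<bar> = nat \<bar>n + m\<bar> + nat \<bar>m\<bar>" by linarith
    hence "signs n = replicate (nat \<bar>n + m\<bar>) False @ replicate (nat \<bar>m\<bar>) False"
      using 5 by (simp add: signs_def replicate_add[symmetric])
    moreover have "signs (n + m) = replicate (nat \<bar>n + m\<bar>) False" using 5 by (auto simp: signs_def)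
    ultimately show ?thesis using 5
      by (intro exI[of _ "signs (n + m)"] exI[of _ "replicate (nat \<bar>m\<bar>) False"] exI[of _ "[]"]) (simp add: signs_def)
  next
    case 6
    hence "nat \<bar>m\<bar> = nat \<bar>n\<bar> + nat \<bar>n + m\<bar>" by linarith
    hence "signs m = replicate (nat \<bar>n\<bar>) True @ replicate (nat \<bar>n + m\<bar>) True"
      using 6 by (simp add: signs_def replicate_add[symmetric])
    thus ?thesis using 6
      by (intro exI[of _ "[]"] exI[of _ "signs n"] exI[of _ "signs (n + m)"]) (simp add: signs_def)
  qed
qed

lemma signs_step: "s = (n \<ge> 0) \<Longrightarrow> signs ((if s then 1 else -1) + n) = s # signs n" if "n \<noteq> 0 \<or> s" for n
proof -
  assume s: "s = (n \<ge> 0)"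
  have "nat \<bar>(if s then 1 else -1) + n\<bar> = Suc (nat \<bar>n\<bar>)" using s that by (auto simp: Suc_nat_eq_nat_zadd1)
  thus ?thesis using s that by (cases "n = 0") (auto simp: signs_def)
qed

context free_prod
begin

definition cyc_gen :: "'i \<Rightarrow> 'a \<Rightarrow> bool" where
  "cyc_gen z \<zeta> \<longleftrightarrow> z \<in> I \<and> \<zeta> \<in> H z \<and> (\<forall>a\<in>H z. \<exists>n::int. a = \<zeta> [^] n) \<and> (\<forall>n::int. \<zeta> [^] n = \<one> \<longrightarrow> n = 0)"

lemma cyc_gen_ex:
  assumes z: "z \<in> I" and c: "infinite_cyclic (G\<lparr>carrier := H z\<rparr>)"
  shows "\<exists>\<zeta>. cyc_gen z \<zeta>"
proof -
  have "integer_group \<cong> G\<lparr>carrier := H z\<rparr>"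
    using c group.iso_sym[OF H_group[OF z]] by (simp add: infinite_cyclic_def)
  then obtain f where f: "f \<in> iso integer_group (G\<lparr>carrier := H z\<rparr>)" by (auto simp: is_iso_def)
  have fH: "f n \<in> H z" for n using f by (auto simp: iso_def hom_def integer_group_def)
  have fm: "f (m + n) = f m \<otimes> f n" for m n using f by (auto simp: iso_def hom_def integer_group_def)
  have fb: "bij_betw f UNIV (H z)" using f by (auto simp: iso_def integer_group_def)
  have fC: "f n \<in> carrier G" for n using fH z by simp
  have f0: "f 0 = \<one>" using fm[of 0 0] fC[of 0] by (metis add_0 l_cancel_one' one_closed r_one)
  have nat: "f (int n) = f 1 [^] n" for n
  proof (induction n)
    case (Suc n)
    thus ?case using fm[of "int n" 1] by (simp add: add.commute)
  qed (simp add: f0)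
  have int: "f n = f 1 [^] n" for n :: int
  proof (cases n rule: int_cases2)
    case (nonneg m)
    thus ?thesis using nat by (simp add: int_pow_int)
  next
    case (nonpos m)
    have "f (- int m) \<otimes> f (int m) = \<one>" using fm[of "- int m" "int m"] f0 by simp
    hence "f (- int m) = inv (f (int m))" using fC by (metis inv_equality)
    thus ?thesis using nonpos nat fC by (simp add: int_pow_neg int_pow_int)
  qed
  have "cyc_gen z (f 1)" unfolding cyc_gen_def
  proof (intro conjI ballI allI impI)
    fix a assume "a \<in> H z"
    hence "a \<in> range f" using fb by (simp add: bij_betw_def)
    then obtain n where "a = f n" by blast
    thus "\<exists>n::int. a = f 1 [^] n" using int by blast
  next
    fix n :: int assume "f 1 [^] n = \<one>"
    hence "f n = f 0" unfolding f0 by (rule trans[OF int[of n]])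
    moreover have "inj f" using fb by (simp add: bij_betw_def)
    ultimately show "n = 0" by (rule injD[rotated])
  qed (use z fH in auto)
  thus ?thesis by blast
qed

end

locale free_prod_cyclic = free_prod G I H for G (structure) and I :: "'i set" and H +
  fixes z :: 'i and \<zeta> :: 'a
  assumes cg: "cyc_gen z \<zeta>"
begin

lemma z_I [simp]: "z \<in> I" and zeta_H [simp]: "\<zeta> \<in> H z"
  using cg by (simp_all add: cyc_gen_def)

lemma zeta_closed [simp]: "\<zeta> \<in> carrier G"
  using H_closed[OF z_I zeta_H] .

lemma zeta_pow_inj: "\<zeta> [^] (m::int) = \<zeta> [^] n \<Longrightarrow> m = n"
proof -
  assume "\<zeta> [^] m = \<zeta> [^] n"
  hence "\<zeta> [^] (m - n) = \<one>" by (metis int_pow_closed int_pow_diff r_inv zeta_closed)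
  hence "m - n = 0" using cg unfolding cyc_gen_def by blast
  thus "m = n" by simp
qed

definition expo :: "'a \<Rightarrow> int" where
  "expo a = (THE n. a = \<zeta> [^] n)"

lemma expo_pow [simp]: "expo (\<zeta> [^] (n::int)) = n"
  unfolding expo_def using zeta_pow_inj by blast

lemma zeta_expo: "a \<in> H z \<Longrightarrow> \<zeta> [^] expo a = a"
  using cg expo_pow by (metis cyc_gen_def)

lemma expo_mult: "a \<in> H z \<Longrightarrow> b \<in> H z \<Longrightarrow> expo (a \<otimes> b) = expo a + expo b"
  by (metis expo_pow int_pow_mult zeta_closed zeta_expo)

lemma expo_inv: "a \<in> H z \<Longrightarrow> expo (inv a) = - expo a"
  by (metis expo_pow int_pow_neg zeta_closed zeta_expo)

lemma expo_zero: "a \<in> H z \<Longrightarrow> expo a = 0 \<longleftrightarrow> a = \<one>"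
  by (metis expo_pow int_pow_0 zeta_expo)

lemma expo_zeta [simp]: "expo \<zeta> = 1" "expo (inv \<zeta>) = -1"
  using expo_pow[of 1] expo_inv[of \<zeta>] by simp_all

definition zs :: "bool \<Rightarrow> 'a" where
  "zs s = (if s then \<zeta> else inv \<zeta>)"

lemma zs_H [simp]: "zs s \<in> H z" and zs_closed [simp]: "zs s \<in> carrier G"
  and expo_zs: "expo (zs s) = (if s then 1 else -1)" and zs_inv: "inv (zs s) = zs (\<not> s)"
  by (auto simp: zs_def)

definition zc :: "('i \<times> 'a) list \<Rightarrow> bool list" where
  "zc ws = concat (map (\<lambda>p. if fst p = z then signs (expo (snd p)) else []) ws)"

abbreviation zcode :: "'a \<Rightarrow> bool list" where
  "zcode g \<equiv> zc (nf g)"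

lemma zc_append: "zc (us @ vs) = zc us @ zc vs" and zc_Nil [simp]: "zc [] = []"
  and zc_Cons: "zc (p # ws) = (if fst p = z then signs (expo (snd p)) else []) @ zc ws"
  by (simp_all add: zc_def)

lemma zc_winv: "red ws \<Longrightarrow> zc (winv ws) = rev (map Not (zc ws))"
proof (induction ws)
  case (Cons p ws)
  thus ?case by (auto simp: red_Cons winv_Cons zc_append zc_Cons expo_inv signs_neg)
qed simp

text \<open>With one entry per unit of exponent, the merging of two powers of \<open>\<zeta>\<close>
  is pure cancellation and concatenation, by \<open>signs_add\<close>. Nothing is left in the
  middle, hence \<open>L = 0\<close>.\<close>

lemma zcode_quasimorphism:
  assumes "W \<noteq> []" shows "quasimorphism G (\<lambda>g. brooks W (zcode g))"
proof (rule brooks_code_quasimorphism[OF assms, where f = Not and A = UNIV and L = 0])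
  fix g h assume gh: "g \<in> carrier G" "h \<in> carrier G"
  obtain p c s m1 m2 m3 where *: "nf g = p @ m1 @ c" "nf h = winv c @ m2 @ s" "nf (g \<otimes> h) = p @ m3 @ s"
    "m1 = [] \<and> m2 = [] \<and> m3 = [] \<or> (\<exists>i a b. m1 = [(i, a)] \<and> m2 = [(i, b)] \<and> m3 = [(i, a \<otimes> b)])"
    using nf_mult_form[OF gh] by metis
  have rd: "red c" "red m1" "red m2" using red_nf[OF gh(1)] red_nf[OF gh(2)] * by (auto simp: red_append)
  have "\<exists>x d y. zc m1 = x @ d \<and> zc m2 = rev (map Not d) @ y \<and> zc m3 = x @ y"
    using *(4)
  proof
    assume "m1 = [] \<and> m2 = [] \<and> m3 = []"
    thus ?thesis by simp
  next
    assume "\<exists>i a b. m1 = [(i, a)] \<and> m2 = [(i, b)] \<and> m3 = [(i, a \<otimes> b)]"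
    then obtain i a b where m: "m1 = [(i, a)]" "m2 = [(i, b)]" "m3 = [(i, a \<otimes> b)]" by blast
    show ?thesis
    proof (cases "i = z")
      case True
      hence "expo (a \<otimes> b) = expo a + expo b" using rd m by (auto simp: red_Cons expo_mult)
      thus ?thesis using signs_add[of "expo a" "expo b"] m True by (simp add: zc_Cons)
    qed (simp add: m zc_Cons)
  qed
  then obtain x d y where xdy: "zc m1 = x @ d" "zc m2 = rev (map Not d) @ y" "zc m3 = x @ y" by blast
  show "\<exists>p c s m1 m2 m3. zcode g = p @ m1 @ c \<and> zcode h = rev (map Not c) @ m2 @ s \<and>
      zcode (g \<otimes> h) = p @ m3 @ s \<and> length m1 \<le> 0 \<and> length m2 \<le> 0 \<and> length m3 \<le> 0"
    by (rule exI[of _ "zc p @ x"], rule exI[of _ "d @ zc c"], rule exI[of _ "y @ zc s"],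
        rule exI[of _ "[]"], rule exI[of _ "[]"], rule exI[of _ "[]"])
      (use rd in \<open>simp add: *(1,2,3) zc_append zc_winv xdy\<close>)
qed (auto simp: inj_on_def)

lemma zcode_letter_mult:
  assumes "l \<in> I" "l \<noteq> z" "a \<in> H l" "h \<in> carrier G"
  shows "zcode (a \<otimes> h) = zcode h"
  unfolding nf_lmul[OF assms(1,3,4)] using assms(2) by (cases "nf h") (auto simp: lmul_def zc_Cons)

text \<open>\<open>\<not> zstart (\<not> s) h\<close> is the condition that \<open>zs s\<close> may
  be put in front of \<open>h\<close> without cancellation.\<close>

definition zstart :: "bool \<Rightarrow> 'a \<Rightarrow> bool" where
  "zstart s h \<longleftrightarrow> starts z h \<and> (expo (snd (hd (nf h))) > 0) = s"

lemma zstart_mult: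
  assumes h: "h \<in> carrier G" and ns: "\<not> zstart (\<not> s) h"
  shows "zcode (zs s \<otimes> h) = s # zcode h" "zstart s (zs s \<otimes> h)"
proof -
  have z1: "zs s \<noteq> \<one>" using expo_zs[of s] expo_zero[OF zs_H[of s]] by (auto split: if_splits)
  have nfm: "nf (zs s \<otimes> h) = lmul z (zs s) (nf h)" by (rule nf_lmul[OF z_I zs_H h])
  have "zcode (zs s \<otimes> h) = s # zcode h \<and> zstart s (zs s \<otimes> h)"
  proof (cases "starts z h")
    case False
    hence n: "nf (zs s \<otimes> h) = (z, zs s) # nf h" using nfm z1 by (cases "nf h") (auto simp: lmul_def starts_def)
    have "signs (expo (zs s)) = [s]" by (auto simp: expo_zs signs_def)
    thus ?thesis by (simp add: n zc_Cons zstart_def starts_def expo_zs)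
  next
    case True
    then obtain b ws where n: "nf h = (z, b) # ws" by (cases "nf h") (auto simp: starts_def)
    have b: "b \<in> H z" "b \<noteq> \<one>" using red_nf[OF h] n by (auto simp: red_Cons)
    have s: "s = (expo b > 0)" using ns True n by (auto simp: zstart_def)
    have b0: "expo b \<noteq> 0" using b expo_zero by blast
    have e: "expo (zs s \<otimes> b) = (if s then 1 else -1) + expo b" using b by (simp add: expo_mult expo_zs)
    have ne: "expo (zs s \<otimes> b) \<noteq> 0" using e s b0 by auto
    hence "zs s \<otimes> b \<noteq> \<one>" using b by (metis H_mult expo_zero z_I zs_H)
    hence n': "nf (zs s \<otimes> h) = (z, zs s \<otimes> b) # ws" using nfm n z1 by (simp add: lmul_def)
    have "signs (expo (zs s \<otimes> b)) = s # signs (expo b)" unfolding e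
      using signs_step[of "expo b" s] s b0 by auto
    moreover have "(expo (zs s \<otimes> b) > 0) = s" unfolding e using s b0 by auto
    ultimately show ?thesis by (simp add: n n' zc_Cons zstart_def starts_def)
  qed
  thus "zcode (zs s \<otimes> h) = s # zcode h" "zstart s (zs s \<otimes> h)" by auto
qed

text \<open>The subgroup generated by \<open>H j\<close> and \<open>\<zeta>\<close> is treated as an
  HNN extension of \<open>H j\<close> with stable letter \<open>\<zeta>\<close>: a single stable
  letter is split off, where the normal form would group a whole power. This is the induction scheme
  of \<open>zcode_twist\<close>.\<close>

lemma hnn_step:
  assumes j: "j \<in> I" "j \<noteq> z" and g: "g \<in> carrier G" "fst ` set (nf g) \<subseteq> {z, j}"
  shows "g \<in> H j \<or> (\<exists>a\<in>H j. \<exists>s. \<exists>g1\<in>carrier G. fst ` set (nf g1) \<subseteq> {z, j} \<and> g = a \<otimes> (zs s \<otimes> g1) \<and>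
      \<not> zstart (\<not> s) g1 \<and> zcode g = s # zcode g1)"
proof -
  have "\<exists>a\<in>H j. \<exists>v. red v \<and> g = a \<otimes> wp v \<and> fst ` set v \<subseteq> {z, j} \<and> (v = [] \<or> fst (hd v) = z)"
  proof (cases "starts j g")
    case True
    then obtain a ws where n: "nf g = (j, a) # ws" by (cases "nf g") (auto simp: starts_def)
    have "a \<in> H j" "red ws" "ws = [] \<or> fst (hd ws) \<noteq> j" "g = a \<otimes> wp ws"
      using red_nf[OF g(1)] wp_nf[OF g(1)] n by (auto simp: red_Cons)
    moreover have "fst ` set ws \<subseteq> {z, j}" using g n by auto
    moreover have "ws = [] \<or> fst (hd ws) = z" using calculation by (cases ws) auto
    ultimately show ?thesis by blast
  next
    case False
    hence "nf g = [] \<or> fst (hd (nf g)) = z" using g(2) by (cases "nf g") (auto simp: starts_def)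
    thus ?thesis using g j by (intro bexI[of _ \<one>] exI[of _ "nf g"]) auto
  qed
  then obtain a v where av: "a \<in> H j" "red v" "g = a \<otimes> wp v" "fst ` set v \<subseteq> {z, j}" "v = [] \<or> fst (hd v) = z" by blast
  show ?thesis
  proof (cases v)
    case Nil
    thus ?thesis using av j by simp
  next
    case (Cons p ws)
    then obtain b where v: "v = (z, b) # ws" using av by (cases p) auto
    have b: "b \<in> H z" "b \<noteq> \<one>" "red ws" "ws = [] \<or> fst (hd ws) \<noteq> z" using av v by (auto simp: red_Cons)
    have b0: "expo b \<noteq> 0" using b expo_zero by blast
    define s where "s = (expo b > 0)"
    define g1 where "g1 = zs (\<not> s) \<otimes> wp v"
    have vC: "wp v \<in> carrier G" using av by simp
    have g1C: "g1 \<in> carrier G" using vC by (simp add: g1_def)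
    have z1: "zs (\<not> s) \<noteq> \<one>" using expo_zs[of "\<not> s"] expo_zero[OF zs_H[of "\<not> s"]] by (auto split: if_splits)
    have n1: "nf g1 = (if zs (\<not> s) \<otimes> b = \<one> then ws else (z, zs (\<not> s) \<otimes> b) # ws)"
      unfolding g1_def nf_lmul[OF z_I zs_H vC] nf_wp[OF av(2)] unfolding v using z1 by (simp add: lmul_def)
    have e: "expo (zs (\<not> s) \<otimes> b) = (if s then -1 else 1) + expo b" using b by (simp add: expo_mult expo_zs)
    have ns: "\<not> zstart (\<not> s) g1"
    proof
      assume z: "zstart (\<not> s) g1"
      show False
      proof (cases "zs (\<not> s) \<otimes> b = \<one>")
        case True
        thus False using z n1 b(4) by (auto simp: zstart_def starts_def)
      next
        case False
        hence "expo (zs (\<not> s) \<otimes> b) \<noteq> 0" using b by (metis H_mult expo_zero z_I zs_H)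
        thus False using z n1 False e b0 by (auto simp: zstart_def starts_def s_def split: if_splits)
      qed
    qed
    have "zs s \<otimes> g1 = wp v"
    proof -
      have "zs s = inv (zs (\<not> s))" by (simp add: zs_inv)
      thus ?thesis unfolding g1_def using vC by simp
    qed
    hence ge: "g = a \<otimes> (zs s \<otimes> g1)" using av by simp
    moreover have "zcode g = s # zcode g1"
      unfolding ge using zcode_letter_mult[OF j av(1), of "zs s \<otimes> g1"] zstart_mult(1)[OF g1C ns] g1C by simp
    moreover have "fst ` set (nf g1) \<subseteq> {z, j}" using n1 av v by auto
    ultimately show ?thesis using av g1C ns by blast
  qed
qed

text \<open>The substitution inserts letters of \<open>H j'\<close> next to the stable letters.
  Opposite stable letters could cancel in the image only across a trivial element of
  \<open>H j'\<close>; up to conjugation by \<open>c\<close> that element is the image of an element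
  of \<open>H j\<close>, so the original word would have cancelled there already.\<close>

lemma zcode_twist:
  assumes j: "j \<in> I" "j \<noteq> z" "j' \<in> I" "j' \<noteq> z" and h: "h \<in> hom G G"
    and hj: "\<And>a. a \<in> H j \<Longrightarrow> h a \<in> H j'" "\<And>a. a \<in> H j \<Longrightarrow> h a = \<one> \<Longrightarrow> a = \<one>"
    and c: "c \<in> H j'" "h \<zeta> = zs \<epsilon> \<otimes> c"
    and g: "g \<in> carrier G" "fst ` set (nf g) \<subseteq> {z, j}"
  shows "zcode (h g) = map (\<lambda>b. b = \<epsilon>) (zcode g)"
proof -
  \<comment> \<open>Corrections around the image of a stable letter: \<open>c\<close> follows a
    positive one, \<open>inv c\<close> precedes a negative one.\<close>
  define k k' where "k s = (if s then c else \<one>)" and "k' s = (if s then \<one> else inv c)" for s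
  have cC: "c \<in> carrier G" using c j by simp
  have kH: "k s \<in> H j'" "k' s \<in> H j'" for s using c j by (auto simp: k_def k'_def)
  have kC: "k s \<in> carrier G" "k' s \<in> carrier G" for s using cC by (auto simp: k_def k'_def)
  have hc: "h x \<in> carrier G" if "x \<in> carrier G" for x using hom_in_carrier[OF h that] .
  have hm: "h (x \<otimes> y) = h x \<otimes> h y" if "x \<in> carrier G" "y \<in> carrier G" for x y using hom_mult[OF h that] .
  have hi: "h (inv x) = inv (h x)" if "x \<in> carrier G" for x
    using group_hom.hom_inv[of G G h x] h that by (simp add: group_hom_def group_hom_axioms_def is_group)
  have hz: "h (zs s) = k' s \<otimes> zs (s = \<epsilon>) \<otimes> k s" for s
  proof (cases s)
    case False
    have "h (zs s) = inv (zs \<epsilon> \<otimes> c)" using False c by (simp add: zs_def hi)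
    also have "\<dots> = inv c \<otimes> zs (\<not> \<epsilon>)" using cC by (simp add: inv_mult_group zs_inv)
    finally show ?thesis using False cC by (simp add: k_def k'_def)
  qed (use c cC in \<open>simp add: k_def k'_def, simp add: zs_def\<close>)
  \<comment> \<open>The second conjunct is the invariant that carries the induction: behind the
    correction \<open>k s\<close>, the image does not begin with a stable letter that would cancel
    the next one on the left.\<close>
  have "zcode (h g) = map (\<lambda>b. b = \<epsilon>) (zcode g) \<and> (\<forall>s. \<not> zstart (\<not> s) g \<longrightarrow> \<not> zstart (s \<noteq> \<epsilon>) (k s \<otimes> h g))"
    using g
  proof (induction "length (zcode g)" arbitrary: g rule: less_induct)
    case less
    consider "g \<in> H j" | a s g1 where "a \<in> H j" "g1 \<in> carrier G" "fst ` set (nf g1) \<subseteq> {z, j}"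
      "g = a \<otimes> (zs s \<otimes> g1)" "\<not> zstart (\<not> s) g1" "zcode g = s # zcode g1"
      using hnn_step[OF j(1,2) less.prems] by blast
    thus ?case
    proof cases
      case 1
      have zl: "zcode a = []" "\<not> starts z a" if "a \<in> H l" "l \<in> I" "l \<noteq> z" for a l
        using that nf_letter[of l a] by (cases "a = \<one>"; simp add: zc_Cons starts_def)+
      have "k s \<otimes> h g \<in> H j'" for s using kH hj(1)[OF 1] j by simp
      thus ?thesis using zl[OF 1 j(1,2)] zl[OF hj(1)[OF 1] j(3,4)] zl(2)[OF _ j(3,4)] by (auto simp: zstart_def)
    next
      case 2
      have aC: "a \<in> carrier G" using 2 j by simp
      have haC: "h a \<in> H j'" "h a \<in> carrier G" using hj 2 hc aC by auto
      have IH: "zcode (h g1) = map (\<lambda>b. b = \<epsilon>) (zcode g1)" "\<not> zstart (s \<noteq> \<epsilon>) (k s \<otimes> h g1)"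
        using less.hyps[of g1] 2 by auto
      define Y where "Y = k s \<otimes> h g1"
      define Z where "Z = zs (s = \<epsilon>) \<otimes> Y"
      have YC: "Y \<in> carrier G" using kC hc 2 by (simp add: Y_def)
      have ZC: "Z \<in> carrier G" using YC by (simp add: Z_def)
      have ns: "\<not> zstart (\<not> (s = \<epsilon>)) Y" using IH(2) by (simp add: Y_def)
      have Zp: "zcode Z = (s = \<epsilon>) # zcode Y" "zstart (s = \<epsilon>) Z" unfolding Z_def using zstart_mult[OF YC ns] by auto
      have Yc: "zcode Y = zcode (h g1)" unfolding Y_def using zcode_letter_mult[OF j(3,4) kH(1)] hc 2 by simp
      have hg: "h g = (h a \<otimes> k' s) \<otimes> Z"
      proof -
        have "h g = h a \<otimes> (h (zs s) \<otimes> h g1)" using 2 aC by (simp add: hm)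
        thus ?thesis using hz[of s] haC kC hc[OF 2(2)] by (simp add: Z_def Y_def m_assoc)
      qed
      have 1: "zcode (h g) = map (\<lambda>b. b = \<epsilon>) (zcode g)"
        unfolding hg using zcode_letter_mult[OF j(3,4), of "h a \<otimes> k' s" Z] haC kH ZC j Zp Yc IH 2 by simp
      have "\<not> zstart (s' \<noteq> \<epsilon>) (k s' \<otimes> h g)" if s': "\<not> zstart (\<not> s') g" for s'
      proof
        assume zz: "zstart (s' \<noteq> \<epsilon>) (k s' \<otimes> h g)"
        let ?d = "k s' \<otimes> h a \<otimes> k' s"
        have dH: "?d \<in> H j'" using kH haC j by simp
        have dZ: "k s' \<otimes> h g = ?d \<otimes> Z" unfolding hg using kC haC ZC by (simp add: m_assoc)
        have d1: "?d = \<one>"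
        proof (rule ccontr)
          assume "?d \<noteq> \<one>"
          moreover have "\<not> starts j' Z" using Zp(2) j by (auto simp: zstart_def starts_def)
          ultimately have "nf (?d \<otimes> Z) = (j', ?d) # nf Z"
            using nf_append[of ?d Z] nf_letter[OF j(3) dH] ZC dH j by (auto simp: starts_def)
          thus False using zz dZ j by (simp add: zstart_def starts_def)
        qed
        hence "k s' \<otimes> h g = Z" using dZ ZC by simp
        hence ss: "s = (\<not> s')" using zz Zp(2) by (auto simp: zstart_def)
        have "h a = \<one>"
        proof (cases s')
          case True
          hence "c \<otimes> h a \<otimes> inv c = \<one>" using d1 ss by (simp add: k_def k'_def)
          hence "cj c (h a) = cj c \<one>" using cC by (simp add: cj_def)
          thus ?thesis using cj_inj[OF cC haC(2)] by simp
        qed (use d1 ss haC in \<open>simp add: k_def k'_def\<close>)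
        hence "a = \<one>" using hj(2)[OF 2(1)] by blast
        hence "g = zs s \<otimes> g1" using 2 by simp
        hence "zstart s g" using zstart_mult(2)[OF 2(2,5)] by simp
        thus False using s' ss by simp
      qed
      thus ?thesis using 1 by blast
    qed
  qed
  thus ?thesis by blast
qed

end

context free_prod
begin

lemma wp_rep_append:
  assumes "red ms" "ms \<noteq> []" "fst (hd ms) \<noteq> fst (last ms)"
  shows "red (concat (replicate n ms)) \<and> wp (concat (replicate n ms)) = wp ms [^] n \<and>
     (n > 0 \<longrightarrow> concat (replicate n ms) \<noteq> [] \<and> hd (concat (replicate n ms)) = hd ms \<and> last (concat (replicate n ms)) = last ms)"
proof (induction n)
  case (Suc n)
  let ?r = "concat (replicate n ms)"
  have r: "red (ms @ ?r)" using Suc assms by (cases "n = 0") (auto simp: red_append)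
  have "wp (ms @ ?r) = wp ms \<otimes> wp ms [^] n" using Suc assms by (simp add: wp_append)
  hence "wp (ms @ ?r) = wp ms [^] Suc n" using assms nat_pow_Suc2[of "wp ms" n] by simp
  thus ?case using r Suc assms by (cases "n = 0") auto
qed simp

text \<open>If the outer letters \<open>a\<close> and \<open>b\<close> do not cancel, a power merely
  merges them at each seam. If they do, \<open>g\<close> is the conjugate by \<open>a\<close> of the
  shorter \<open>m\<close>, whose ends avoid factor \<open>i\<close>, and the claim for
  \<open>m\<close> comes from induction or from \<open>wp_rep_append\<close>. The clause on lengths
  lets \<open>cyc_generate\<close> infer that a power equal to a letter has a letter as its
  base.\<close>

lemma power_same_ends:
  assumes g: "g \<in> carrier G" "nf g \<noteq> []" "fst (hd (nf g)) = i" "fst (last (nf g)) = i"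
  shows "g [^] (n::nat) = \<one> \<or> (nf (g [^] n) \<noteq> [] \<and> fst (hd (nf (g [^] n))) = i \<and> fst (last (nf (g [^] n))) = i \<and>
      (length (nf g) > 1 \<longrightarrow> length (nf (g [^] n)) > 1))"
  using g
proof (induction "length (nf g)" arbitrary: g i rule: less_induct)
  case less
  note g = less.prems
  show ?case
  proof (cases "n = 0")
    case True
    thus ?thesis by simp
  next
    case n0: False
    obtain a ws where n: "nf g = (i, a) # ws" using g by (cases "nf g") auto
    have a: "i \<in> I" "a \<in> H i" "a \<noteq> \<one>" "red ws" "ws = [] \<or> fst (hd ws) \<noteq> i"
      using red_nf[OF g(1)] n by (auto simp: red_Cons)
    show ?thesis
    proof (cases "ws = []")
      case True
      hence "g = a" using wp_nf[OF g(1)] n a by simp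
      hence gH: "g [^] n \<in> H i" using a by (induction n) auto
      show ?thesis using nf_letter[OF a(1) gH] n True by auto
    next
      case False
      then obtain ms b where w: "ws = ms @ [(i, b)]" using g n by (cases ws rule: rev_cases) auto
      have b: "b \<in> H i" "b \<noteq> \<one>" "red ms" "ms = [] \<or> fst (last ms) \<noteq> i" using a w by (auto simp: red_append red_Cons)
      have ms: "ms \<noteq> []" using a w by auto
      have hms: "fst (hd ms) \<noteq> i" "fst (last ms) \<noteq> i" using a b w ms by auto
      define m where "m = wp ms"
      have C: "a \<in> carrier G" "b \<in> carrier G" "m \<in> carrier G" using a b by (auto simp: m_def)
      have ge: "g = a \<otimes> (m \<otimes> b)" using wp_nf[OF g(1)] n w b a by (simp add: wp_append red_Cons m_def)
      define c where "c = b \<otimes> a"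
      have cH: "c \<in> H i" using a b by (simp add: c_def)
      obtain n' where n': "n = Suc n'" using n0 not0_implies_Suc by blast
      show ?thesis
      proof (cases "c = \<one>")
        case c1: False
        have L: "red (ms @ concat (replicate k ((i, c) # ms)) @ [(i, b)]) \<and>
            wp (ms @ concat (replicate k ((i, c) # ms)) @ [(i, b)]) = m \<otimes> b \<otimes> g [^] k" for k
        proof (induction k)
          case 0
          thus ?case using b ms hms a C by (simp add: red_append red_Cons wp_append m_def)
        next
          case (Suc k)
          let ?t = "ms @ concat (replicate k ((i, c) # ms)) @ [(i, b)]"
          have e: "ms @ concat (replicate (Suc k) ((i, c) # ms)) @ [(i, b)] = ms @ ((i, c) # ?t)" by simp
          have t: "red ((i, c) # ?t)" using Suc a cH c1 hms ms by (simp add: red_Cons)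
          have "wp (ms @ ((i, c) # ?t)) = m \<otimes> (c \<otimes> (m \<otimes> b \<otimes> g [^] k))"
            using Suc b t by (subst wp_append) (auto simp: m_def)
          also have "\<dots> = m \<otimes> b \<otimes> (g \<otimes> g [^] k)" using C g(1) by (simp add: c_def ge m_assoc)
          also have "g \<otimes> g [^] k = g [^] Suc k" using nat_pow_Suc2[OF g(1)] by simp
          finally show ?case unfolding e using t b ms hms by (simp add: red_append)
        qed
        let ?t = "ms @ concat (replicate n' ((i, c) # ms)) @ [(i, b)]"
        have "nf (g [^] n) = (i, a) # ?t"
        proof (rule nf_unique)
          show "red ((i, a) # ?t)" using L[of n'] a ms hms by (simp add: red_Cons)
          have "wp ((i, a) # ?t) = a \<otimes> (m \<otimes> b \<otimes> g [^] n')" using L[of n'] by simp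
          also have "\<dots> = g \<otimes> g [^] n'" using C g(1) by (simp add: ge m_assoc)
          finally show "wp ((i, a) # ?t) = g [^] n" using nat_pow_Suc2[OF g(1)] n' by simp
        qed
        thus ?thesis by simp
      next
        case c1: True
        have bi: "b = inv a" using c1 C by (metis c_def inv_equality)
        have gc: "g = cj a m" using ge bi C by (simp add: cj_def m_assoc)
        have gp: "g [^] k = cj a (m [^] k)" for k :: nat
          by (induction k) (use C in \<open>simp_all add: gc cj_mult\<close>)
        have "m [^] n = \<one> \<or> (nf (m [^] n) \<noteq> [] \<and> fst (hd (nf (m [^] n))) \<noteq> i \<and> fst (last (nf (m [^] n))) \<noteq> i)"
        proof (cases "fst (hd ms) = fst (last ms)")
          case True
          have nm: "nf m = ms" using b by (simp add: m_def)
          show ?thesis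
            using less.hyps[of m "fst (hd ms)"] n w nm C(3) ms True hms by auto
        next
          case False
          have "nf (m [^] n) = concat (replicate n ms)"
            using wp_rep_append[OF b(3) ms False, of n] by (intro nf_unique) (auto simp: m_def)
          thus ?thesis using wp_rep_append[OF b(3) ms False, of n] n0 hms by simp
        qed
        thus ?thesis
        proof
          assume "m [^] n = \<one>"
          thus ?thesis using gp C by simp
        next
          assume mn: "nf (m [^] n) \<noteq> [] \<and> fst (hd (nf (m [^] n))) \<noteq> i \<and> fst (last (nf (m [^] n))) \<noteq> i"
          have ia: "inv a \<in> H i" "inv a \<noteq> \<one>" using a C by (auto simp: inv_eq_1_iff)
          have 1: "nf (m [^] n \<otimes> inv a) = nf (m [^] n) @ [(i, inv a)]"
            using nf_append[of "m [^] n" "inv a"] nf_letter[OF a(1) ia] mn C by auto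
          have "nf (a \<otimes> (m [^] n \<otimes> inv a)) = [(i, a)] @ (nf (m [^] n) @ [(i, inv a)])"
            using nf_append[of a "m [^] n \<otimes> inv a"] nf_letter[OF a(1-3)] mn C 1 by auto
          hence "nf (g [^] n) = [(i, a)] @ (nf (m [^] n) @ [(i, inv a)])"
            using gp[of n] C by (simp add: cj_def m_assoc)
          thus ?thesis using mn by simp
        qed
      qed
    qed
  qed
qed

lemma power_same_ends_int:
  assumes g: "g \<in> carrier G" "nf g \<noteq> []" "fst (hd (nf g)) = i" "fst (last (nf g)) = i"
  shows "g [^] (n::int) = \<one> \<or> (nf (g [^] n) \<noteq> [] \<and> fst (hd (nf (g [^] n))) = i \<and> fst (last (nf (g [^] n))) = i \<and>
      (length (nf g) > 1 \<longrightarrow> length (nf (g [^] n)) > 1))"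
proof (cases n rule: int_cases2)
  case (nonneg k)
  thus ?thesis using power_same_ends[OF g, of k] by (simp add: int_pow_int)
next
  case (nonpos k)
  have e: "g [^] n = inv (g [^] k)" using nonpos g(1) by (simp add: int_pow_neg int_pow_int)
  show ?thesis
  proof (cases "g [^] k = \<one>")
    case True
    thus ?thesis using e by simp
  next
    case False
    thus ?thesis unfolding e using power_same_ends[OF g, of k] g(1)
      by (simp add: nf_inv fst_hd_winv fst_last_winv inv_eq_1_iff)
  qed
qed

end

context free_prod_cyclic
begin

text \<open>After both ends in \<open>H j\<close> are stripped from \<open>w\<close>, the nontrivial
  powers of the remainder \<open>v\<close> begin in factor \<open>z\<close>, and
  \<open>letter_in_generate\<close> makes \<open>\<zeta>\<close> a power of \<open>v\<close>. Then
  \<open>v\<close> is itself a letter, and its exponent divides one.\<close>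

lemma cyc_generate:
  assumes j: "j \<in> I" "j \<noteq> z" and w: "w \<in> carrier G" "fst ` set (nf w) \<subseteq> {z, j}"
    and gen: "\<zeta> \<in> generate G (H j \<union> range (\<lambda>n::int. w [^] n))"
  shows "\<exists>a\<in>H j. \<exists>b\<in>H j. \<exists>s. w = a \<otimes> zs s \<otimes> b"
proof -
  obtain a b v where abv: "a \<in> H j" "b \<in> H j" "v \<in> carrier G" "w = a \<otimes> v \<otimes> b"
      "nf v = [] \<or> fst (hd (nf v)) \<noteq> j \<and> fst (last (nf v)) \<noteq> j"
    using strip_both[OF j(1) w(1)] by blast
  have C: "a \<in> carrier G" "b \<in> carrier G" using abv j by auto
  let ?C = "range (\<lambda>n::int. v [^] n)"
  have sC: "subgroup ?C G"
    using abv by (intro subgroupI) (auto simp: int_pow_mult[symmetric] int_pow_neg[symmetric] simp flip: int_pow_neg)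
  have HC: "H j \<union> ?C \<subseteq> carrier G" using j abv by auto
  have sM: "subgroup (generate G (H j \<union> ?C)) G" by (rule generate_is_subgroup[OF HC])
  have vM: "v \<in> generate G (H j \<union> ?C)"
    using abv by (intro generate.incl UnI2) (auto intro: range_eqI[of _ _ "1::int"])
  have wM: "w \<in> generate G (H j \<union> ?C)" unfolding abv(4)
    using abv by (intro subgroup.m_closed[OF sM] vM) (auto intro: generate.incl)
  have "w [^] (n::int) \<in> generate G (H j \<union> ?C)" for n
    using subgroup_int_pow_closed[OF sM wM] .
  hence "generate G (H j \<union> range (\<lambda>n::int. w [^] n)) \<subseteq> generate G (H j \<union> ?C)"
    by (intro generate_subgroup_incl[OF _ sM]) (auto intro: generate.incl)
  hence zM: "\<zeta> \<in> generate G (H j \<union> ?C)" using gen by blast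
  have ze: "\<zeta> \<noteq> \<one>" using expo_zero[OF zeta_H] by simp
  have v1: "nf v \<noteq> []"
  proof
    assume "nf v = []"
    hence "v = \<one>" using abv by simp
    hence "H j \<union> ?C \<subseteq> H j" using j by auto
    hence "\<zeta> \<in> H j" using zM generate_subgroup_incl[OF _ H_subgroup[OF j(1)]] by blast
    thus False using nf_letter[OF j(1) _ ze] nf_letter[OF z_I zeta_H ze] j by simp
  qed
  have "v = inv a \<otimes> w \<otimes> inv b" using abv C by (simp add: m_assoc)
  moreover have "ret {z, j} (inv a \<otimes> w \<otimes> inv b) = inv a \<otimes> w \<otimes> inv b"
    using ret_letter[OF j(1), of "inv a"] ret_letter[OF j(1), of "inv b"] abv j ret_id[OF w] w C
    by (simp add: ret_mult)
  ultimately have "ret {z, j} v = v" by simp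
  hence vs: "fst ` set (nf v) \<subseteq> {z, j}" using nf_ret[OF abv(3), of "{z, j}"] by auto
  have "hd (nf v) \<in> set (nf v)" "last (nf v) \<in> set (nf v)" using v1 by auto
  hence "fst (hd (nf v)) \<in> {z, j}" "fst (last (nf v)) \<in> {z, j}" using vs by blast+
  hence ends: "fst (hd (nf v)) = z" "fst (last (nf v)) = z" using abv(5) v1 by auto
  note pw = power_same_ends_int[OF abv(3) v1 ends]
  have "\<not> starts j c" if "c \<in> ?C" "c \<noteq> \<one>" for c
    using that pw j by (auto simp: starts_def)
  hence "\<zeta> \<in> ?C" using letter_in_generate[OF j(1) sC _ zM zeta_H z_I] j by auto
  then obtain n :: int where n: "\<zeta> = v [^] n" by blast
  have "nf \<zeta> = [(z, \<zeta>)]" using nf_letter ze by simp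
  hence "length (nf v) \<le> 1" using pw[of n] n ze by (metis length_Cons list.size(3) not_less One_nat_def less_irrefl)
  then obtain y where y: "nf v = [(z, y)]" using v1 ends by (cases "nf v") (auto simp: prod_eq_iff)
  have yH0: "y \<in> H z" using red_nf[OF abv(3)] y by (simp add: red_Cons)
  have yH: "y \<in> H z" "v = y" using wp_nf[OF abv(3)] y yH0 H_closed[OF z_I yH0] by simp_all
  let ?m = "expo y"
  have vm: "v = \<zeta> [^] ?m" using zeta_expo yH by simp
  have "\<zeta> = (\<zeta> [^] ?m) [^] n" using n unfolding vm[symmetric] .
  also have "\<dots> = \<zeta> [^] (?m * n)" by (simp add: int_pow_pow)
  finally have "\<zeta> [^] (1::int) = \<zeta> [^] (?m * n)" using int_pow_1[OF zeta_closed] by metis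
  hence "?m * n = 1" using zeta_pow_inj by metis
  hence "?m = 1 \<or> ?m = -1" using zmult_eq_1_iff by blast
  hence "v = zs True \<or> v = zs False" using vm by (auto simp: zs_def int_pow_neg)
  thus ?thesis using abv by blast
qed

text \<open>The counterpart of \<open>pair_standard\<close> and \<open>code_pair_invariant\<close>:
  up to conjugation and modulo the other factors \<open>H j\<close> goes into \<open>H j'\<close>,
  and by \<open>cyc_generate\<close> the generator goes to its plus or minus first power times an
  element of \<open>H j'\<close>. So \<open>zcode_twist\<close> applies.\<close>

lemma zcode_pair_invariant:
  assumes phi: "\<phi> \<in> auto G" and j: "j \<in> I" "j \<noteq> z" "j' \<in> I" "j' \<noteq> z"
    and t: "t \<in> carrier G" "\<phi> ` H j = cj t ` H j'"
    and other: "\<And>l a. l \<in> I \<Longrightarrow> l \<notin> {z, j} \<Longrightarrow> a \<in> H l \<Longrightarrow> ret {z, j'} (\<phi> a) = \<one>" and W: "W \<noteq> []"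
  shows "\<exists>C. \<forall>g\<in>carrier G. \<bar>brooks W (zcode (ret {z, j'} (\<phi> g))) - brooks W (zcode (ret {z, j} g))\<bar> \<le> C"
proof -
  let ?S = "{z, j}" and ?S' = "{z, j'}"
  define \<theta> where "\<theta> g = ret ?S' (\<phi> g)" for g
  define v where "v = ret ?S' t"
  have \<phi>c: "\<phi> g \<in> carrier G" if "g \<in> carrier G" for g using hom_in_carrier[OF auto_hom[OF phi] that] .
  have \<theta>c: "\<theta> g \<in> carrier G" if "g \<in> carrier G" for g using \<phi>c that by (simp add: \<theta>_def)
  have vC: "v \<in> carrier G" using t by (simp add: v_def)
  have rv: "ret ?S' v = v" using ret_ret t by (simp add: v_def)
  have \<theta>h: "\<theta> \<in> hom G G" unfolding \<theta>_def[abs_def] by (rule hom_comp[OF auto_hom[OF phi] ret_hom])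
  have dj: "\<exists>c\<in>H j'. \<phi> a = cj t c \<and> \<theta> a = cj v c" if "a \<in> H j" for a
    using ret_auto_conj(1)[OF phi j(1,3) t that] by (simp add: \<theta>_def v_def)
  define h1 where "h1 g = cj (inv v) (\<theta> g)" for g
  have h1h: "h1 \<in> hom G G" using cj_hom[OF inv_closed[OF vC] \<theta>h] by (simp add: h1_def[abs_def])
  have h1c: "h1 g \<in> carrier G" if "g \<in> carrier G" for g using hom_in_carrier[OF h1h that] .
  have h1j: "\<exists>c\<in>H j'. \<phi> a = cj t c \<and> h1 a = c" if "a \<in> H j" for a
  proof -
    obtain c where c: "c \<in> H j'" "\<phi> a = cj t c" "\<theta> a = cj v c" using dj[OF \<open>a \<in> H j\<close>] by blast
    thus ?thesis using vC j by (intro bexI[of _ c]) (auto simp: h1_def)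
  qed
  define w where "w = h1 \<zeta>"
  have wC: "w \<in> carrier G" using h1c by (simp add: w_def)
  have "ret ?S' w = w"
  proof -
    have "ret ?S' (\<theta> \<zeta>) = \<theta> \<zeta>" using ret_ret \<phi>c by (simp add: \<theta>_def)
    thus ?thesis using \<theta>c vC rv by (simp add: w_def h1_def ret_cj ret_inv)
  qed
  hence wS: "fst ` set (nf w) \<subseteq> ?S'" using nf_ret[OF wC, of ?S'] by auto
  obtain g0 where g0: "g0 \<in> carrier G" "\<phi> g0 = cj v \<zeta>"
    using auto_bij[OF phi] vC by (metis bij_betw_def cj_closed imageE zeta_closed)
  have "\<theta> g0 = cj v \<zeta>" using g0 vC rv ret_letter[OF z_I zeta_H] by (simp add: \<theta>_def ret_cj)
  hence h1g: "h1 g0 = \<zeta>" using vC by (simp add: h1_def)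
  have "h1 g0 \<in> generate G (\<Union>l\<in>?S \<inter> I. h1 ` H l)"
    by (rule image_in_generate[OF h1h _ g0(1)]) (use other vC in \<open>simp add: h1_def \<theta>_def\<close>)
  moreover have "(\<Union>l\<in>?S \<inter> I. h1 ` H l) \<subseteq> H j' \<union> range (\<lambda>n::int. w [^] n)"
  proof -
    have "h1 a \<in> range (\<lambda>n::int. w [^] n)" if "a \<in> H z" for a
    proof -
      have "h1 a = h1 (\<zeta> [^] expo a)" using zeta_expo[OF that] by simp
      also have "\<dots> = w [^] expo a" unfolding w_def using hom_int_pow[OF h1h zeta_closed group_axioms group_axioms] by simp
      finally show ?thesis by blast
    qed
    thus ?thesis using h1j by auto
  qed
  ultimately have "\<zeta> \<in> generate G (H j' \<union> range (\<lambda>n::int. w [^] n))"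
    using mono_generate h1g by blast
  then obtain a b s where ab: "a \<in> H j'" "b \<in> H j'" "w = a \<otimes> zs s \<otimes> b"
    using cyc_generate[OF j(3,4) wC wS] by blast
  have C: "a \<in> carrier G" "b \<in> carrier G" using ab j by auto
  define h where "h g = cj (inv a) (h1 g)" for g
  have hh: "h \<in> hom G G" using cj_hom[OF inv_closed[OF C(1)] h1h] by (simp add: h_def[abs_def])
  have hz: "h \<zeta> = zs s \<otimes> (b \<otimes> a)" using ab C by (simp add: h_def w_def[symmetric] cj_def m_assoc)
  have hj: "h x \<in> H j'" if "x \<in> H j" for x
    using h1j[OF that] ab j by (auto simp: h_def cj_def)
  have hj1: "x = \<one>" if x: "x \<in> H j" "h x = \<one>" for x
  proof -
    obtain c where c: "c \<in> H j'" "\<phi> x = cj t c" "h1 x = c" using h1j[OF x(1)] by blast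
    have cC: "c \<in> carrier G" "x \<in> carrier G" using c x j by auto
    have "cj (inv a) c = cj (inv a) \<one>" using x c C by (simp add: h_def)
    hence "c = \<one>" using cj_inj[of "inv a" c \<one>] C cC by simp
    hence "\<phi> x = \<one>" using c t by simp
    hence "\<phi> x = \<phi> \<one>" using hom_one[OF auto_hom[OF phi] group_axioms group_axioms] by simp
    thus ?thesis using auto_bij[OF phi] cC by (auto simp: bij_betw_def dest: inj_onD)
  qed
  have fac: "ret ?S' (\<phi> g) = cj (v \<otimes> a) (h (ret ?S g))" if g: "g \<in> carrier G" for g
  proof -
    have "\<theta> (ret ?S g) = cj v (h1 (ret ?S g))" using vC \<theta>c g by (simp add: h1_def)
    also have "h1 (ret ?S g) = cj a (h (ret ?S g))" using C h1c g by (simp add: h_def)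
    finally have "\<theta> (ret ?S g) = cj (v \<otimes> a) (h (ret ?S g))"
      using cj_cj[OF vC C(1), of "h (ret ?S g)"] hom_in_carrier[OF hh] g by simp
    moreover have "ret ?S' (\<phi> g) = ret ?S' (\<phi> (ret ?S g))"
      by (rule ret_auto_factors[OF phi _ g]) (rule other)
    ultimately show ?thesis by (simp add: \<theta>_def)
  qed
  have "v \<otimes> a \<in> carrier G" using vC C by simp
  then obtain K where K: "\<forall>g\<in>carrier G. \<bar>brooks W (zcode (cj (v \<otimes> a) g)) - brooks W (zcode g)\<bar> \<le> K"
    using quasimorphism_cj[OF zcode_quasimorphism[OF W]] by blast
  have "\<bar>brooks W (zcode (ret ?S' (\<phi> g))) - brooks W (zcode (ret ?S g))\<bar> \<le> K" if g: "g \<in> carrier G" for g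
  proof -
    let ?g = "ret ?S g"
    have gc: "?g \<in> carrier G" "fst ` set (nf ?g) \<subseteq> {z, j}" using nf_ret[OF g, of ?S] g by auto
    have ba: "b \<otimes> a \<in> H j'" using ab j by simp
    have "zcode (h ?g) = map (\<lambda>b. b = s) (zcode ?g)"
      by (rule zcode_twist[OF j hh _ _ ba hz gc]) (use hj hj1 in auto)
    moreover have "inj_on (\<lambda>b. b = s) (set (zcode ?g))" by (auto simp: inj_on_def)
    ultimately have "brooks W (zcode (h ?g)) = brooks W (zcode ?g)" using brooks_map by metis
    moreover have "\<bar>brooks W (zcode (cj (v \<otimes> a) (h ?g))) - brooks W (zcode (h ?g))\<bar> \<le> K"
      using K hom_in_carrier[OF hh gc(1)] by blast
    ultimately show ?thesis using fac[OF g] by simp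
  qed
  thus ?thesis by blast
qed

lemma quasimorphisms_one_cyclic_factor:
  assumes fi: indecomposable_factors and fin: "finite I" and nc: "noncyc = I - {z}" and j: "j \<in> noncyc"
  shows "\<exists>S. infinite S \<and> lin_indep_funs G S \<and>
      (\<forall>\<psi>\<in>S. quasimorphism G \<psi> \<and> homogeneous_qm G \<psi> \<and> aut_invariant G \<psi> \<and> (\<forall>g\<in>\<Union>(H ` I). \<psi> g = 0))"
proof -
  have jI: "j \<in> I" "j \<noteq> z" using j nc by auto
  obtain b where b: "b \<in> H j" "b \<noteq> \<one>" using H_nontrivial[OF fi jI(1)] by blast
  define W where "W m = pattern (4 * m) (4 * m + 1)" for m
  define f where "f m k g = brooks (W m) (zcode (ret {z, k} g))" for m k g
  define h where "h m g = (\<Sum>k\<in>noncyc. f m k g)" for m g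
  define x where "x m = wp (spread z j b (cyc_word (4 * m) \<zeta> (inv \<zeta>)))" for m
  have finP: "finite noncyc" using fin by (simp add: noncyc_def)
  have W: "W m \<noteq> []" for m by (simp add: W_def)
  have ze: "\<zeta> \<noteq> \<one>" using expo_zero[OF zeta_H] by simp
  hence ze': "inv \<zeta> \<noteq> \<one>" by (metis inv_eq_1_iff zeta_closed)
  have zj: "z \<noteq> j" using jI by simp
  have cw: "set (cyc_word (4 * m) \<zeta> (inv \<zeta>)) \<subseteq> H z - {\<one>}" for m using ze ze' by (auto simp: cyc_word_def simp del: inv_eq_1_iff)
  have xc: "x m \<in> carrier G" for m using red_spread[OF z_I jI(1) zj b cw] by (simp add: x_def)
  have zspread: "zc (spread z j b us) = map (\<lambda>a. a = \<zeta>) us" if "set us \<subseteq> {\<zeta>, inv \<zeta>}" for us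
    using that
  proof (induction us)
    case (Cons a us)
    have "inv \<zeta> \<noteq> \<zeta>" using expo_zeta by (metis one_neq_neg_one)
    hence "signs (expo a) = [a = \<zeta>]" using Cons.prems by (auto simp: signs_def)
    thus ?case using Cons jI by (simp add: spread_def zc_Cons)
  qed (simp add: spread_def)
  have xpow: "h m (x m' [^] n) = (if m = m' then real (n - 1) else 0)" for m m' and n :: nat
  proof -
    let ?g = "x m' [^] n"
    let ?us = "concat (replicate n (cyc_word (4 * m') \<zeta> (inv \<zeta>)))"
    have gC: "?g \<in> carrier G" using xc by simp
    have nfg: "nf ?g = spread z j b ?us" unfolding x_def by (rule spread_pow[OF z_I jI(1) zj b cw])
    have rid: "ret {z, j} ?g = ?g" by (rule ret_id[OF gC]) (unfold nfg, rule set_spread)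
    have us: "set ?us \<subseteq> {\<zeta>, inv \<zeta>}" by (auto simp: cyc_word_def)
    have "inj_on (\<lambda>a. a = \<zeta>) {\<zeta>, inv \<zeta>}" by (auto simp: inj_on_def)
    hence inj: "inj_on (\<lambda>a. a = \<zeta>) (set ?us)" using us by (rule inj_on_subset)
    have ne: "\<zeta> \<noteq> inv \<zeta>" using expo_zeta by (metis one_neq_neg_one)
    have 1: "f m j ?g = (if m = m' then real (n - 1) else 0)"
      unfolding f_def rid nfg zspread[OF us] brooks_map[OF inj] W_def using brooks_cyc_word[OF ne] .
    \<comment> \<open>Once the letters \<open>b\<close> are killed, only a power of
      \<open>\<zeta>\<close> is left, and its code is constant.\<close>
    have 3: "f m k ?g = 0" if kl: "k \<in> noncyc" "k \<noteq> j" for k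
    proof -
      have "fst ` set (nf (ret {z, k} ?g)) \<subseteq> {z, k} \<inter> {z, j}"
        using nf_ret[OF gC, of "{z, k}", unfolded nfg] set_spread[of z j b ?us] by blast
      also have "\<dots> \<subseteq> {z}" using kl by auto
      finally have s1: "fst ` set (nf (ret {z, k} ?g)) \<subseteq> {z}" .
      hence "length (nf (ret {z, k} ?g)) \<le> 1"
        by (rule red_single_index[OF red_nf[OF ret_closed[OF gC]]])
      hence "\<exists>m s. zcode (ret {z, k} ?g) = replicate m s"
        using s1 by (cases "nf (ret {z, k} ?g)") (auto simp: zc_Cons signs_def)
      thus ?thesis unfolding f_def W_def using brooks_replicate by metis
    qed
    have "h m ?g = (\<Sum>k\<in>{j}. f m k ?g)"
      unfolding h_def by (rule sum.mono_neutral_right[OF finP]) (use 3 j in auto)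
    thus ?thesis using 1 by simp
  qed
  show ?thesis
  proof (rule independent_homogenizations[of h "\<Union>(H ` I)" x])
    fix m
    show "quasimorphism G (h m)"
      unfolding h_def f_def
      by (rule quasimorphism_sum[OF finP]) (rule quasimorphism_hom[OF zcode_quasimorphism[OF W] ret_hom])
    fix \<phi> assume phi: "\<phi> \<in> auto G"
    obtain \<sigma> t where st: "bij_betw \<sigma> noncyc noncyc" "\<And>i. i \<in> noncyc \<Longrightarrow> t i \<in> carrier G"
      "\<And>i. i \<in> noncyc \<Longrightarrow> \<phi> ` H i = cj (t i) ` H (\<sigma> i)"
      using auto_factor_permutation[OF fi phi fin] by blast
    have sI: "\<sigma> k \<in> noncyc" if "k \<in> noncyc" for k using st(1) that by (auto simp: bij_betw_def)
    have sinj: "\<sigma> k = \<sigma> l \<longleftrightarrow> k = l" if "k \<in> noncyc" "l \<in> noncyc" for k l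
      using st(1) that by (auto simp: bij_betw_def inj_on_def)
    have e: "h m (\<phi> g) = (\<Sum>k\<in>noncyc. f m (\<sigma> k) (\<phi> g))" for g
      unfolding h_def using sum.reindex_bij_betw[OF st(1), of "\<lambda>k. f m k (\<phi> g)"] by simp
    have "\<exists>C. \<forall>g\<in>carrier G. \<bar>f m (\<sigma> k) (\<phi> g) - f m k g\<bar> \<le> C" if k: "k \<in> noncyc" for k
    proof -
      have other: "ret {z, \<sigma> k} (\<phi> d) = \<one>" if l: "l \<in> I" "l \<notin> {z, k}" "d \<in> H l" for l d
      proof -
        have ln: "l \<in> noncyc" using l nc by simp
        have "\<sigma> l \<notin> {z, \<sigma> k}" using sinj[OF ln k] sI[OF ln] l nc by auto
        thus ?thesis using ret_auto_conj(2)[OF phi l(1) noncyc_I[OF sI[OF ln]] st(2)[OF ln] st(3)[OF ln] l(3)] by simp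
      qed
      show ?thesis unfolding f_def
        by (rule zcode_pair_invariant[OF phi _ _ _ _ st(2)[OF k] st(3)[OF k] other W])
          (use k sI[OF k] nc in auto)
    qed
    thus "\<exists>C. \<forall>g\<in>carrier G. \<bar>h m (\<phi> g) - h m g\<bar> \<le> C"
      unfolding e unfolding h_def by (intro sum_bounded_change[OF finP]) auto
  next
    show "\<Union>(H ` I) \<subseteq> carrier G" by auto
  next
    fix m g assume "g \<in> \<Union>(H ` I)"
    then obtain l where l: "l \<in> I" "g \<in> H l" by blast
    have "f m k (g [^] n) = 0" for k and n :: nat
    proof -
      have "length (nf (ret {z, k} (g [^] n))) \<le> 1" by (rule ret_letter_short[OF l(1) letter_pow_in[OF l]])
      hence "\<exists>m s. zcode (ret {z, k} (g [^] n)) = replicate m s"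
        by (cases "nf (ret {z, k} (g [^] n))") (auto simp: zc_Cons signs_def intro: exI[of _ 0])
      thus ?thesis unfolding f_def W_def using brooks_replicate by metis
    qed
    hence "h m (g [^] n) = 0" for n :: nat by (simp add: h_def)
    thus "\<exists>C. \<forall>n::nat. \<bar>h m (g [^] n)\<bar> \<le> C" by (intro exI[of _ 0]) simp
  next
    show "x m \<in> carrier G" for m by (rule xc)
    show "\<exists>C. \<forall>n::nat. \<bar>h m (x m' [^] n)\<bar> \<le> C" if "m \<noteq> m'" for m m'
      using that by (intro exI[of _ 0]) (simp add: xpow)
    show "\<exists>C. \<forall>n::nat. real n \<le> \<bar>h m (x m [^] n)\<bar> + C" for m
      by (intro exI[of _ 1]) (auto simp: xpow)
  qed
qed

end

section \<open>Winding numbers around cusps\<close>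

type_synonym vec = "int \<times> int"

definition det :: "vec \<Rightarrow> vec \<Rightarrow> int" where
  "det a b = fst a * snd b - snd a * fst b"

definition cusps :: "vec set" where
  "cusps = {v. coprime (fst v) (snd v) \<and> (snd v > 0 \<or> snd v = 0 \<and> fst v = 1)}"

text \<open>A cusp \<open>p/q\<close> is stored as the primitive vector \<open>(p, q)\<close> with \<open>q > 0\<close>, and \<open>\<infinity>\<close> as \<open>(1, 0)\<close>.  After moving \<open>e\<close>
  to \<open>\<infinity>\<close>, \<open>wnd e a b\<close> is the signed distance from \<open>a\<close> to \<open>b\<close> in units of \<open>6\<close>, the width of the cusp of the
  once-punctured torus group generated by \<open>x\<close> and \<open>y\<close>; it is \<open>0\<close> if \<open>e\<close> is \<open>a\<close> or \<open>b\<close>.\<close>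

definition wnd :: "vec \<Rightarrow> vec \<Rightarrow> vec \<Rightarrow> real" where
  "wnd e a b = det a b / (6 * det e a * det b e)"

lemma det_swap: "det b a = - det a b"
  by (simp add: det_def algebra_simps)

lemma det_self [simp]: "det a a = 0"
  by (simp add: det_def)

lemma det_zero_iff:
  assumes "a \<in> cusps" "b \<in> cusps" shows "det a b = 0 \<longleftrightarrow> a = b"
proof
  assume "det a b = 0"
  hence e: "fst a * snd b = snd a * fst b" by (simp add: det_def)
  have ca: "coprime (fst a) (snd a)" "coprime (fst b) (snd b)" using assms by (auto simp: cusps_def)
  have "snd a dvd fst a * snd b" using e by simp
  hence 1: "snd a dvd snd b" using ca(1) by (simp add: coprime_commute coprime_dvd_mult_right_iff)
  have "snd b dvd snd a * fst b" using e by (metis dvd_triv_right)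
  hence 2: "snd b dvd snd a" using ca(2) by (simp add: coprime_commute coprime_dvd_mult_left_iff)
  have s: "snd a = snd b" using 1 2 assms by (auto simp: cusps_def intro: zdvd_antisym_nonneg)
  show "a = b"
  proof (cases "snd a = 0")
    case True
    thus ?thesis using s assms by (auto simp: cusps_def prod_eq_iff)
  next
    case False
    hence "fst a = fst b" using e s by simp
    thus ?thesis using s by (simp add: prod_eq_iff)
  qed
qed simp

lemma det_ge_1: "a \<in> cusps \<Longrightarrow> b \<in> cusps \<Longrightarrow> a \<noteq> b \<Longrightarrow> 1 \<le> \<bar>det a b\<bar>"
  using det_zero_iff[of a b] by linarith

lemma wnd_swap: "wnd e b a = - wnd e a b"
  unfolding wnd_def det_swap[of b a] det_swap[of e a] det_swap[of e b] by (simp add: ac_simps)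

lemma wnd_self [simp]: "wnd e a a = 0" "wnd e e a = 0" "wnd e a e = 0"
  by (simp_all add: wnd_def)

lemma wnd_add:
  assumes "det e a \<noteq> 0" "det e b \<noteq> 0" "det e c \<noteq> 0"
  shows "wnd e a c = wnd e a b + wnd e b c"
proof -
  \<comment> \<open>The Pluecker relation for four vectors in the plane.\<close>
  have "det a b * det e c + det b c * det e a = det a c * det e b"
    by (simp add: det_def algebra_simps)
  hence p: "real_of_int (det a b) * det e c + real_of_int (det b c) * det e a = real_of_int (det a c) * det e b"
    by (metis of_int_add of_int_mult)
  have w: "wnd e x y = - real_of_int (det x y) / (6 * det e x * det e y)" for x y
    by (simp add: wnd_def det_swap[of y e])
  have "wnd e a b + wnd e b c = - (real_of_int (det a b) * det e c + real_of_int (det b c) * det e a) / (6 * det e a * det e b * det e c)"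
    unfolding w using assms by (simp add: field_simps)
  also have "\<dots> = wnd e a c" unfolding p w using assms by (simp add: field_simps)
  finally show ?thesis by simp
qed

lemma wnd_add_cusp:
  assumes "e \<in> cusps" "a \<in> cusps" "b \<in> cusps" "c \<in> cusps" "a \<noteq> e" "b \<noteq> e" "c \<noteq> e"
  shows "wnd e a c = wnd e a b + wnd e b c"
  using assms by (intro wnd_add) (auto simp: det_zero_iff)

lemma abs_wnd: "\<bar>wnd e a b\<bar> = \<bar>det a b\<bar> / (6 * \<bar>det e a\<bar> * \<bar>det b e\<bar>)"
  by (simp add: wnd_def abs_mult)

text \<open>All determinants except the one of \<open>u\<close> and \<open>v\<close> cancel in the
  product. This is an exact form of Behrstock's inequality: if \<open>b\<close> is far from
  \<open>v\<close> as seen from \<open>u\<close>, it is close to \<open>u\<close> as seen from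
  \<open>v\<close>.\<close>

lemma behrstock:
  assumes "u \<in> cusps" "v \<in> cusps" "b \<in> cusps" "u \<noteq> v" "b \<noteq> u" "b \<noteq> v"
  shows "\<bar>wnd u v b\<bar> * \<bar>wnd v u b\<bar> = 1 / (36 * (real_of_int (det u v))\<^sup>2)" (is "_ = ?r")
    and "1 / (36 * (real_of_int (det u v))\<^sup>2) > 0" and "1 / (36 * (real_of_int (det u v))\<^sup>2) \<le> 1 / 36"
proof -
  have n: "det u v \<noteq> 0" "det u b \<noteq> 0" "det v b \<noteq> 0" using assms by (auto simp: det_zero_iff)
  show "\<bar>wnd u v b\<bar> * \<bar>wnd v u b\<bar> = ?r"
    using n unfolding abs_wnd det_swap[of b u] det_swap[of b v] det_swap[of v u]
    by (simp add: field_simps power2_eq_square)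
  show "?r > 0" using n by simp
  have "1 \<le> \<bar>det u v\<bar>" using n by linarith
  hence "1 \<le> (det u v)\<^sup>2" by (metis abs_power2 one_le_power power2_abs)
  hence "1 \<le> (real_of_int (det u v))\<^sup>2" by (metis of_int_1_le_iff of_int_power)
  thus "?r \<le> 1 / 36" by (intro frac_le) auto
qed

lemma behrstock_le:
  assumes "u \<in> cusps" "v \<in> cusps" "b \<in> cusps" "u \<noteq> v" "x > 0" "\<bar>wnd u v b\<bar> \<ge> x"
  shows "\<bar>wnd v u b\<bar> \<le> 1 / (36 * x)"
proof -
  have nb: "b \<noteq> u" "b \<noteq> v" using assms by auto
  have "x * \<bar>wnd v u b\<bar> \<le> \<bar>wnd u v b\<bar> * \<bar>wnd v u b\<bar>" using assms by (intro mult_right_mono) auto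
  also have "\<dots> \<le> 1 / 36" using behrstock[OF assms(1-4) nb] by linarith
  finally show ?thesis using assms(5) by (simp add: field_simps)
qed

text \<open>No third cusp sees a full turn between the two. The threshold is an integer so that
  every \<open>winding_map\<close> preserves the relation.\<close>

definition adjc :: "vec \<Rightarrow> vec \<Rightarrow> bool" where
  "adjc c d \<longleftrightarrow> c \<noteq> d \<and> (\<forall>e\<in>cusps. e \<noteq> c \<longrightarrow> e \<noteq> d \<longrightarrow> \<bar>wnd e c d\<bar> < 1)"

lemma adjc_sym: "adjc c d = adjc d c"
  unfolding adjc_def using wnd_swap by (metis abs_minus_cancel)

section \<open>Integer matrices and other maps that respect winding\<close>

type_synonym mat = "int \<times> int \<times> int \<times> int"

fun mdet :: "mat \<Rightarrow> int" where
  "mdet (a, b, c, d) = a * d - b * c"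

fun mapp :: "mat \<Rightarrow> vec \<Rightarrow> vec" where
  "mapp (a, b, c, d) (x, y) = (a * x + b * y, c * x + d * y)"

definition nrm :: "vec \<Rightarrow> vec" where
  "nrm v = (if snd v > 0 \<or> snd v = 0 \<and> fst v > 0 then v else - v)"

definition mv :: "mat \<Rightarrow> vec \<Rightarrow> vec" where
  "mv M v = nrm (mapp M v)"

lemma nrm_cases: "nrm v = v \<or> nrm v = - v"
  by (simp add: nrm_def)

lemma det_minus [simp]: "det (- a) b = - det a b" "det a (- b) = - det a b"
  by (simp_all add: det_def)

lemma wnd_minus [simp]: "wnd (- e) a b = wnd e a b" "wnd e (- a) b = wnd e a b" "wnd e a (- b) = wnd e a b"
  by (simp_all add: wnd_def)

lemma wnd_nrm [simp]: "wnd (nrm e) a b = wnd e a b" "wnd e (nrm a) b = wnd e a b" "wnd e a (nrm b) = wnd e a b"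
  using nrm_cases by (metis wnd_minus)+

lemma det_mapp: "det (mapp M a) (mapp M b) = mdet M * det a b"
  by (cases M; cases a; cases b) (simp add: det_def algebra_simps)

lemma wnd_mapp: "mdet M = 1 \<or> mdet M = -1 \<Longrightarrow> wnd (mapp M e) (mapp M a) (mapp M b) = mdet M * wnd e a b"
  by (auto simp: wnd_def det_mapp)

lemma wnd_mv: "mdet M = 1 \<or> mdet M = -1 \<Longrightarrow> wnd (mv M e) (mv M a) (mv M b) = mdet M * wnd e a b"
  by (simp add: mv_def wnd_mapp)

lemma nrm_cusp: "coprime (fst v) (snd v) \<Longrightarrow> nrm v \<in> cusps"
  by (cases v) (auto simp: nrm_def cusps_def)

lemma cusp_nrm: "v \<in> cusps \<Longrightarrow> nrm v = v"
  by (auto simp: nrm_def cusps_def)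

lemma nrm_minus: "v \<noteq> 0 \<Longrightarrow> nrm (- v) = nrm v"
  by (cases v) (auto simp: nrm_def zero_prod_def)

lemma mapp_minus: "mapp M (- v) = - mapp M v"
  by (cases M; cases v) simp

definition madj :: "mat \<Rightarrow> mat" where
  "madj M = (case M of (a, b, c, d) \<Rightarrow> (d, - b, - c, a))"

lemma mapp_madj: "mapp (madj M) (mapp M v) = (mdet M * fst v, mdet M * snd v)"
  by (cases M; cases v) (simp add: madj_def algebra_simps)

lemma mdet_madj [simp]: "mdet (madj M) = mdet M"
  by (cases M) (simp add: madj_def algebra_simps)

lemma madj_madj [simp]: "madj (madj M) = M"
  by (cases M) (simp add: madj_def)

lemma mapp_coprime:
  assumes "mdet M = 1 \<or> mdet M = -1" "coprime (fst v) (snd v)"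
  shows "coprime (fst (mapp M v)) (snd (mapp M v))"
proof (rule coprimeI)
  fix k assume k: "k dvd fst (mapp M v)" "k dvd snd (mapp M v)"
  have "k dvd fst (mapp (madj M) (mapp M v)) \<and> k dvd snd (mapp (madj M) (mapp M v))"
    using k by (cases "madj M"; cases "mapp M v") auto
  hence "k dvd fst v" "k dvd snd v" unfolding mapp_madj using assms(1) by auto
  thus "is_unit k" using assms(2) coprime_common_divisor by blast
qed

lemma mv_cusp: "mdet M = 1 \<or> mdet M = -1 \<Longrightarrow> v \<in> cusps \<Longrightarrow> mv M v \<in> cusps"
  unfolding mv_def by (rule nrm_cusp, rule mapp_coprime) (auto simp: cusps_def)

lemma mv_madj:
  assumes "mdet M = 1 \<or> mdet M = -1" "v \<in> cusps"
  shows "mv (madj M) (mv M v) = v"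
proof -
  have v0: "v \<noteq> 0" using assms(2) by (auto simp: cusps_def)
  have e: "mapp (madj M) (mapp M v) = v \<or> mapp (madj M) (mapp M v) = - v"
    using assms(1) mapp_madj[of M v] by (cases v) auto
  have "mapp (madj M) (mv M v) = v \<or> mapp (madj M) (mv M v) = - v"
    unfolding mv_def[of M] using nrm_cases[of "mapp M v"] e mapp_minus by (metis minus_minus)
  thus ?thesis unfolding mv_def[of "madj M"] using cusp_nrm[OF assms(2)] nrm_minus[OF v0] by auto
qed

text \<open>Only strict comparisons with integers are preserved, because the map inverting
  \<open>x\<close> is not fractional linear and distorts the real value of a winding. The sign
  \<open>\<eta>\<close> tells whether orientation is kept.\<close>

definition winding_map :: "real \<Rightarrow> (vec \<Rightarrow> vec) \<Rightarrow> bool" where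
  "winding_map \<eta> f \<longleftrightarrow> (\<eta> = 1 \<or> \<eta> = -1) \<and> bij_betw f cusps cusps \<and>
     (\<forall>e\<in>cusps. \<forall>a\<in>cusps. \<forall>b\<in>cusps. \<forall>k::int.
        (\<eta> * wnd (f e) (f a) (f b) > k) = (wnd e a b > k) \<and> (\<eta> * wnd (f e) (f a) (f b) < k) = (wnd e a b < k))"

lemma mv_winding_map:
  assumes "mdet M = 1 \<or> mdet M = -1" shows "winding_map (mdet M) (mv M)"
proof -
  have "bij_betw (mv M) cusps cusps"
  proof (rule bij_betw_byWitness[where f' = "mv (madj M)"])
    show "\<forall>a\<in>cusps. mv (madj M) (mv M a) = a" using mv_madj[OF assms] by blast
    show "\<forall>a\<in>cusps. mv M (mv (madj M) a) = a" using mv_madj[of "madj M"] assms by simp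
    show "mv M ` cusps \<subseteq> cusps" "mv (madj M) ` cusps \<subseteq> cusps" using mv_cusp[of M] mv_cusp[of "madj M"] assms by auto
  qed
  thus ?thesis unfolding winding_map_def using assms by (auto simp: wnd_mv)
qed

lemma winding_map_cusp: "winding_map \<eta> f \<Longrightarrow> a \<in> cusps \<Longrightarrow> f a \<in> cusps"
  by (auto simp: winding_map_def bij_betw_def)

lemma winding_map_inj: "winding_map \<eta> f \<Longrightarrow> a \<in> cusps \<Longrightarrow> b \<in> cusps \<Longrightarrow> f a = f b \<longleftrightarrow> a = b"
  by (auto simp: winding_map_def bij_betw_def inj_on_def)

lemma winding_map_adjc:
  assumes f: "winding_map \<eta> f" and c: "c \<in> cusps" "d \<in> cusps"
  shows "adjc (f c) (f d) = adjc c d"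
proof -
  have s: "f ` cusps = cusps" using f by (simp add: winding_map_def bij_betw_def)
  have "\<bar>wnd (f e) (f c) (f d)\<bar> < 1 \<longleftrightarrow> \<bar>wnd e c d\<bar> < 1" if "e \<in> cusps" for e
  proof -
    have "(\<eta> * wnd (f e) (f c) (f d) > (-1::int)) = (wnd e c d > (-1::int))"
      "(\<eta> * wnd (f e) (f c) (f d) < (1::int)) = (wnd e c d < (1::int))"
      using f c that unfolding winding_map_def by blast+
    moreover have "\<bar>\<eta> * wnd (f e) (f c) (f d)\<bar> = \<bar>wnd (f e) (f c) (f d)\<bar>"
      using f by (auto simp: winding_map_def)
    ultimately show ?thesis by (simp add: abs_less_iff) linarith
  qed
  hence "(\<forall>e\<in>cusps. e \<noteq> c \<longrightarrow> e \<noteq> d \<longrightarrow> \<bar>wnd e c d\<bar> < 1) \<longleftrightarrow>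
      (\<forall>e\<in>f ` cusps. e \<noteq> f c \<longrightarrow> e \<noteq> f d \<longrightarrow> \<bar>wnd e (f c) (f d)\<bar> < 1)"
    using winding_map_inj[OF f _ c(1)] winding_map_inj[OF f _ c(2)] by auto
  thus ?thesis unfolding adjc_def s using winding_map_inj[OF f c] by simp
qed

text \<open>The transvection fixing \<open>e\<close>; it shifts the winding coordinate around \<open>e\<close> by \<open>k\<close>.\<close>

definition shear :: "int \<Rightarrow> vec \<Rightarrow> mat" where
  "shear k e = (1 - 6 * k * fst e * snd e, 6 * k * fst e * fst e, - 6 * k * snd e * snd e, 1 + 6 * k * fst e * snd e)"

lemma mdet_shear [simp]: "mdet (shear k e) = 1"
  by (simp add: shear_def algebra_simps)

lemma mapp_shear: "mapp (shear k e) v = (fst v + 6 * k * det e v * fst e, snd v + 6 * k * det e v * snd e)"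
  by (cases v) (simp add: shear_def det_def algebra_simps)

lemma mv_shear_fix: "e \<in> cusps \<Longrightarrow> mv (shear k e) e = e"
  by (simp add: mv_def mapp_shear cusp_nrm)

lemma wnd_shear:
  assumes "det e v \<noteq> 0" shows "wnd e v (mv (shear k e) v) = k"
proof -
  let ?w = "mapp (shear k e) v"
  have 1: "det v ?w = - 6 * k * det e v * det e v" by (simp add: mapp_shear det_def algebra_simps)
  have 2: "det ?w e = - det e v" by (simp add: mapp_shear det_def algebra_simps)
  have "wnd e v (mv (shear k e) v) = wnd e v ?w" by (simp add: mv_def)
  thus ?thesis using assms unfolding wnd_def 1 2 by (simp add: field_simps)
qed

text \<open>Shearing \<open>d\<close> around \<open>c\<close> by \<open>j\<close> gives a cusp
  \<open>w\<close> adjacent to \<open>c\<close> whose coordinate at \<open>c\<close> lies between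
  those of \<open>x\<close> and \<open>z\<close>. If \<open>m\<close> saw both \<open>x\<close> and
  \<open>z\<close> at least a full turn from \<open>c\<close>, \<open>behrstock\<close> would put
  both within \<open>r\<close> of \<open>m\<close> in the coordinate at \<open>c\<close>; but
  \<open>w\<close>, less than a turn from \<open>c\<close> as seen from \<open>m\<close>, is farther
  than \<open>r\<close> and cannot lie between them.\<close>

lemma barrier:
  assumes C: "c \<in> cusps" "d \<in> cusps" "m \<in> cusps" "x \<in> cusps" "z \<in> cusps"
    and dc: "adjc d c" and m: "m \<noteq> c" "\<not> adjc m c" and xb: "\<bar>wnd m c x\<bar> > 1"
    and j: "min (wnd c d x) (wnd c d z) \<le> of_int j" "of_int j \<le> max (wnd c d x) (wnd c d z)"
  shows "\<bar>wnd m c z\<bar> < 1"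
proof (rule ccontr)
  assume "\<not> \<bar>wnd m c z\<bar> < 1"
  hence zb: "\<bar>wnd m c z\<bar> \<ge> 1" by simp
  have ne: "x \<noteq> m" "x \<noteq> c" "z \<noteq> m" "z \<noteq> c" using xb zb by auto
  have d: "d \<noteq> c" using dc by (simp add: adjc_def)
  define w where "w = mv (shear j c) d"
  have wC: "w \<in> cusps" using C by (simp add: w_def mv_cusp)
  have aw: "adjc w c"
    using winding_map_adjc[OF mv_winding_map[of "shear j c"], of d c] dc C by (simp add: w_def mv_shear_fix)
  have wc: "w \<noteq> c" using aw by (simp add: adjc_def)
  have wm: "w \<noteq> m" using aw m(2) by auto
  have wj: "wnd c d w = j" unfolding w_def using C d by (intro wnd_shear) (simp add: det_zero_iff)
  define r where "r = 1 / (36 * (real_of_int (det m c))\<^sup>2)"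
  have r0: "r > 0" using behrstock(2)[OF C(3,1,4)] ne m by (simp add: r_def)
  have bx: "\<bar>wnd m c x\<bar> * \<bar>wnd c m x\<bar> = r" using behrstock(1)[OF C(3,1,4)] ne m by (simp add: r_def)
  have bz: "\<bar>wnd m c z\<bar> * \<bar>wnd c m z\<bar> = r" using behrstock(1)[OF C(3,1,5)] ne m by (simp add: r_def)
  have bw: "\<bar>wnd m c w\<bar> * \<bar>wnd c m w\<bar> = r" using behrstock(1)[OF C(3,1) wC] wm wc m by (simp add: r_def)
  have "\<bar>wnd m w c\<bar> < 1" using aw C m(1) wm by (auto simp: adjc_def)
  hence w1: "\<bar>wnd m c w\<bar> < 1" using wnd_swap[of m w c] by simp
  have "\<bar>wnd c m w\<bar> > r"
  proof (rule ccontr)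
    assume *: "\<not> \<bar>wnd c m w\<bar> > r"
    have "r \<le> \<bar>wnd m c w\<bar> * r" using bw * by (metis abs_ge_zero mult_left_mono not_less)
    thus False using w1 r0 by simp
  qed
  moreover have "\<bar>wnd c m x\<bar> \<le> r"
  proof -
    have "1 * \<bar>wnd c m x\<bar> \<le> \<bar>wnd m c x\<bar> * \<bar>wnd c m x\<bar>" using xb by (intro mult_right_mono) auto
    thus ?thesis using bx by simp
  qed
  moreover have "\<bar>wnd c m z\<bar> \<le> r"
  proof -
    have "1 * \<bar>wnd c m z\<bar> \<le> \<bar>wnd m c z\<bar> * \<bar>wnd c m z\<bar>" using zb by (intro mult_right_mono) auto
    thus ?thesis using bz by simp
  qed
  moreover have "wnd c d y = wnd c d m + wnd c m y" if "y \<in> cusps" "y \<noteq> c" for y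
    using wnd_add_cusp[of c d m y] that C d m by simp
  note this[OF C(4) ne(2)] this[OF C(5) ne(4)] this[OF wC wc]
  ultimately show False using j wj by (smt (verit))
qed

text \<open>The sign \<open>\<epsilon>\<close> is the common sense of the two turns. Both senses are
  counted, since a map that reverses orientation exchanges them. The bounds are integers, as
  \<open>winding_map\<close> requires.\<close>

definition triples :: "nat \<Rightarrow> nat \<Rightarrow> vec \<Rightarrow> vec \<Rightarrow> (real \<times> vec \<times> vec) set" where
  "triples p q a b = {(\<epsilon>, c, d). (\<epsilon> = 1 \<or> \<epsilon> = -1) \<and> c \<in> cusps \<and> d \<in> cusps \<and> adjc c d \<and>
     real p < \<epsilon> * wnd c a d \<and> \<epsilon> * wnd c a d < real p + 1 \<and> real q < \<epsilon> * wnd d c b \<and> \<epsilon> * wnd d c b < real q + 1}"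

lemma winding_map_triples:
  assumes f: "winding_map \<eta> f" and a: "a \<in> cusps" "b \<in> cusps"
  shows "card (triples p q (f a) (f b)) = card (triples p q a b)"
proof -
  define F where "F = (\<lambda>(\<epsilon>::real, c, d). (\<eta> * \<epsilon>, f c, f d))"
  have \<eta>: "\<eta> = 1 \<or> \<eta> = -1" using f by (simp add: winding_map_def)
  have s: "f ` cusps = cusps" using f by (simp add: winding_map_def bij_betw_def)
  have w: "real k < (\<eta> * \<epsilon>) * wnd (f e) (f x) (f y) \<longleftrightarrow> real k < \<epsilon> * wnd e x y"
    "(\<eta> * \<epsilon>) * wnd (f e) (f x) (f y) < real k + 1 \<longleftrightarrow> \<epsilon> * wnd e x y < real k + 1"
    if "e \<in> cusps" "x \<in> cusps" "y \<in> cusps" "\<epsilon> = 1 \<or> \<epsilon> = -1" for e x y \<epsilon> k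
  proof -
    have A: "(\<eta> * wnd (f e) (f x) (f y) > real_of_int k) = (wnd e x y > real_of_int k)"
      "(\<eta> * wnd (f e) (f x) (f y) < real_of_int k) = (wnd e x y < real_of_int k)" for k :: int
      using f that(1-3) unfolding winding_map_def by blast+
    show "real k < (\<eta> * \<epsilon>) * wnd (f e) (f x) (f y) \<longleftrightarrow> real k < \<epsilon> * wnd e x y"
      using that(4) A(1)[of "int k"] A(2)[of "- int k"] by auto
    show "(\<eta> * \<epsilon>) * wnd (f e) (f x) (f y) < real k + 1 \<longleftrightarrow> \<epsilon> * wnd e x y < real k + 1"
      using that(4) A(2)[of "int k + 1"] A(1)[of "- int k - 1"] by auto
  qed
  have "bij_betw F (triples p q a b) (triples p q (f a) (f b))"
    unfolding bij_betw_def
  proof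
    show "inj_on F (triples p q a b)"
      using \<eta> winding_map_inj[OF f] by (auto simp: inj_on_def F_def triples_def)
    show "F ` triples p q a b = triples p q (f a) (f b)"
    proof (intro equalityI subsetI)
      fix t assume "t \<in> F ` triples p q a b"
      then obtain u where u: "u \<in> triples p q a b" "t = F u" by blast
      obtain \<epsilon> c d where "u = (\<epsilon>, c, d)" by (cases u)
      hence t: "t = (\<eta> * \<epsilon>, f c, f d)" "(\<epsilon>, c, d) \<in> triples p q a b" using u by (simp_all add: F_def)
      thus "t \<in> triples p q (f a) (f b)"
        using \<eta> a w winding_map_adjc[OF f] winding_map_cusp[OF f] by (auto simp: triples_def)
    next
      fix t assume t: "t \<in> triples p q (f a) (f b)"
      obtain \<epsilon> c' d' where t1: "t = (\<epsilon>, c', d')" "\<epsilon> = 1 \<or> \<epsilon> = -1" "c' \<in> cusps" "d' \<in> cusps"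
        using t by (auto simp: triples_def)
      have "c' \<in> f ` cusps" "d' \<in> f ` cusps" using t1 s by simp_all
      then obtain c d where cd: "c \<in> cusps" "d \<in> cusps" "c' = f c" "d' = f d" by blast
      define \<delta> where "\<delta> = \<eta> * \<epsilon>"
      have \<delta>: "\<epsilon> = \<eta> * \<delta>" "\<delta> = 1 \<or> \<delta> = -1" using \<eta> t1(2) by (auto simp: \<delta>_def)
      have t2: "t = (\<eta> * \<delta>, f c, f d)" using t1 cd \<delta> by simp
      hence "t = F (\<delta>, c, d)" by (simp add: F_def)
      moreover have "(\<delta>, c, d) \<in> triples p q a b"
        using t \<delta>(2) cd(1,2) a w winding_map_adjc[OF f] unfolding t2 triples_def by simp
      ultimately show "t \<in> F ` triples p q a b" by blast
    qed
  qed
  thus ?thesis using bij_betw_same_card by metis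
qed

lemma finite_bounded_dets:
  assumes ab: "det a b \<noteq> 0"
  shows "finite {c. \<bar>det a c\<bar> \<le> N \<and> \<bar>det b c\<bar> \<le> N}" (is "finite ?S")
proof -
  have "inj_on (\<lambda>c. (det a c, det b c)) ?S"
  proof (rule inj_onI)
    fix c d assume "(det a c, det b c) = (det a d, det b d)"
    hence e: "fst a * (snd c - snd d) = snd a * (fst c - fst d)" "fst b * (snd c - snd d) = snd b * (fst c - fst d)"
      by (auto simp: det_def algebra_simps)
    have "det a b * (snd c - snd d) = snd b * (fst a * (snd c - snd d)) - snd a * (fst b * (snd c - snd d))"
      by (simp add: det_def algebra_simps)
    also have "\<dots> = 0" unfolding e by (simp add: algebra_simps)
    finally have s: "snd c = snd d" using ab by simp
    have "det a b * (fst c - fst d) = fst a * (snd b * (fst c - fst d)) - fst b * (snd a * (fst c - fst d))"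
      by (simp add: det_def algebra_simps)
    also have "\<dots> = 0" unfolding e[symmetric] by (simp add: algebra_simps)
    finally have "fst c = fst d" using ab by simp
    thus "c = d" using s by (simp add: prod_eq_iff)
  qed
  moreover have "(\<lambda>c. (det a c, det b c)) ` ?S \<subseteq> {- N..N} \<times> {- N..N}" by auto
  ultimately show ?thesis using inj_on_finite by blast
qed

text \<open>In \<open>triples p q a b\<close> the cusps \<open>c\<close>, \<open>d\<close> are passed by the geodesic from \<open>a\<close> to \<open>b\<close> with
  large winding; such cusps are linearly ordered by \<open>\<bar>det a c\<bar>\<close>.\<close>

definition big :: "vec \<Rightarrow> vec \<Rightarrow> vec \<Rightarrow> bool" where
  "big a b c \<longleftrightarrow> c \<in> cusps \<and> \<bar>wnd c a b\<bar> > 29 / 10"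

lemma big_ne: "big a b c \<Longrightarrow> c \<noteq> a \<and> c \<noteq> b"
  by (auto simp: big_def)

text \<open>Each defining winding exceeds 3, and \<open>behrstock\<close> bounds the missing part,
  towards \<open>b\<close> for \<open>c\<close> and towards \<open>a\<close> for \<open>d\<close>,
  by \<open>1 / 108\<close>. The constant \<open>29 / 10\<close> in \<open>big\<close> leaves room
  for this loss.\<close>

lemma triples_big:
  assumes ab: "a \<in> cusps" "b \<in> cusps" and pq: "p \<ge> 3" "q \<ge> 3" and t: "(\<epsilon>, c, d) \<in> triples p q a b"
  shows "a \<noteq> b" "big a b c" "big a b d" "\<bar>det a c\<bar> < \<bar>det a d\<bar>"
proof -
  have *: "\<epsilon> = 1 \<or> \<epsilon> = -1" "c \<in> cusps" "d \<in> cusps" "adjc c d" "real p < \<epsilon> * wnd c a d" "real q < \<epsilon> * wnd d c b"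
    using t by (auto simp: triples_def)
  have 1: "\<bar>wnd c a d\<bar> > 3" "\<bar>wnd d c b\<bar> > 3" using * pq by (auto simp: abs_if)
  have cd: "c \<noteq> d" using * by (simp add: adjc_def)
  have ne: "a \<noteq> c" "a \<noteq> d" "b \<noteq> c" "b \<noteq> d" using 1 by auto
  have 2: "\<bar>wnd c d b\<bar> \<le> 1 / (36 * 3)"
    using behrstock_le[of d c b 3] * ab cd 1 by auto
  have "\<bar>wnd c d a\<bar> > 3" using 1 wnd_swap[of c a d] by simp
  hence "\<bar>wnd d c a\<bar> \<le> 1 / (36 * 3)"
    using behrstock_le[of c d a 3] * ab cd by auto
  hence 3: "\<bar>wnd d a c\<bar> \<le> 1 / (36 * 3)" using wnd_swap[of d c a] by simp
  have "wnd c a b = wnd c a d + wnd c d b" using wnd_add_cusp[of c a d b] * ab ne cd by auto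
  hence "\<bar>wnd c a b\<bar> > 29 / 10" using 1 2 by linarith
  thus b1: "big a b c" using * by (simp add: big_def)
  thus "a \<noteq> b" by (auto simp: big_def)
  have "wnd d a b = wnd d a c + wnd d c b" using wnd_add_cusp[of d a c b] * ab ne cd by auto
  hence "\<bar>wnd d a b\<bar> > 29 / 10" using 1 3 by linarith
  thus "big a b d" using * by (simp add: big_def)
  have d1: "1 \<le> \<bar>det c a\<bar>" "1 \<le> \<bar>det d c\<bar>" using det_ge_1 * ab ne cd by auto
  have "3 < real_of_int \<bar>det a d\<bar> / (6 * real_of_int \<bar>det c a\<bar> * real_of_int \<bar>det d c\<bar>)" using 1(1) unfolding abs_wnd by simp
  hence "3 * (6 * real_of_int \<bar>det c a\<bar> * real_of_int \<bar>det d c\<bar>) < real_of_int \<bar>det a d\<bar>"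
    using d1 by (subst (asm) pos_less_divide_eq) auto
  moreover have "real_of_int \<bar>det c a\<bar> * 1 \<le> real_of_int \<bar>det c a\<bar> * real_of_int \<bar>det d c\<bar>"
    using d1 by (intro mult_left_mono) auto
  ultimately have "real_of_int \<bar>det c a\<bar> < real_of_int \<bar>det a d\<bar>" using d1 by linarith
  thus "\<bar>det a c\<bar> < \<bar>det a d\<bar>" using det_swap[of a c] by simp
qed

text \<open>All determinants between different cusps are at least one in modulus, so the cusp
  farther from \<open>a\<close> sees \<open>a\<close> and the nearer one within
  \<open>1 / 6\<close>. Subtracting this from \<open>29 / 10\<close> leaves more than
  \<open>27 / 10\<close>, and \<open>behrstock\<close> turns that into \<open>1 / 36\<close> on the
  other side.\<close>

lemma big_order:
  assumes ab: "a \<in> cusps" "b \<in> cusps" and c: "big a b c" and d: "big a b d" and ne: "c \<noteq> d"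
    and le: "\<bar>det a c\<bar> \<le> \<bar>det a d\<bar>"
  shows "\<bar>wnd d a c\<bar> \<le> 1 / 6" "\<bar>wnd d c b\<bar> > 27 / 10" "\<bar>wnd c d b\<bar> \<le> 1 / 36" "\<bar>wnd c a d\<bar> > 27 / 10"
proof -
  have C: "c \<in> cusps" "d \<in> cusps" using c d by (auto simp: big_def)
  have n: "c \<noteq> a" "c \<noteq> b" "d \<noteq> a" "d \<noteq> b" using big_ne[OF c] big_ne[OF d] by auto
  have d1: "1 \<le> \<bar>det a d\<bar>" "1 \<le> \<bar>det c d\<bar>" using det_ge_1 C ab n ne by auto
  have "real_of_int \<bar>det a c\<bar> \<le> real_of_int \<bar>det a d\<bar> * 1" using le by simp
  also have "\<dots> \<le> real_of_int \<bar>det a d\<bar> * real_of_int \<bar>det c d\<bar>" using d1 by (intro mult_left_mono) auto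
  finally have "real_of_int \<bar>det a c\<bar> / (6 * real_of_int \<bar>det a d\<bar> * real_of_int \<bar>det c d\<bar>) \<le> 1 / 6"
    using d1 by (subst pos_divide_le_eq) auto
  thus 1: "\<bar>wnd d a c\<bar> \<le> 1 / 6" unfolding abs_wnd using det_swap[of d a] by simp
  have "wnd d a b = wnd d a c + wnd d c b" using wnd_add_cusp[of d a c b] C ab n ne by auto
  thus 2: "\<bar>wnd d c b\<bar> > 27 / 10" using 1 d unfolding big_def by linarith
  hence "\<bar>wnd d c b\<bar> \<ge> 1" by linarith
  thus 3: "\<bar>wnd c d b\<bar> \<le> 1 / 36" using behrstock_le[of d c b 1] C ab ne by auto
  have "wnd c a b = wnd c a d + wnd c d b" using wnd_add_cusp[of c a d b] C ab n ne by auto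
  thus "\<bar>wnd c a d\<bar> > 27 / 10" using 3 c unfolding big_def by linarith
qed

text \<open>Of \<open>29 / 10\<close> at most \<open>1 / 6\<close> is lost towards \<open>a\<close>
  and \<open>1 / 36\<close> towards \<open>b\<close>. A bound of 1 would exclude adjacency;
  \<open>bad_bound\<close> uses the full 2.\<close>

lemma big_between:
  assumes ab: "a \<in> cusps" "b \<in> cusps" and c: "big a b c" and d: "big a b d" and e: "big a b e"
    and ne: "c \<noteq> e" "d \<noteq> e" and le: "\<bar>det a c\<bar> \<le> \<bar>det a e\<bar>" "\<bar>det a e\<bar> \<le> \<bar>det a d\<bar>"
  shows "\<bar>wnd e c d\<bar> > 2"
proof -
  have C: "c \<in> cusps" "d \<in> cusps" "e \<in> cusps" using c d e by (auto simp: big_def)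
  have n: "a \<noteq> e" "b \<noteq> e" using big_ne[OF e] by auto
  have "wnd e a b = wnd e a c + wnd e c d + wnd e d b"
    using wnd_add_cusp[of e a c b] wnd_add_cusp[of e c d b] C ab n ne by auto
  moreover have "\<bar>wnd e a c\<bar> \<le> 1 / 6" using big_order(1)[OF ab c e] ne le by auto
  moreover have "\<bar>wnd e d b\<bar> \<le> 1 / 36" using big_order(3)[OF ab e d] ne le by auto
  ultimately show ?thesis using e unfolding big_def by linarith
qed

lemma big_between_not_adjc:
  assumes "a \<in> cusps" "b \<in> cusps" "big a b c" "big a b d" "big a b e" "c \<noteq> e" "d \<noteq> e"
    "\<bar>det a c\<bar> \<le> \<bar>det a e\<bar>" "\<bar>det a e\<bar> \<le> \<bar>det a d\<bar>"
  shows "\<not> adjc c d"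
  using big_between[OF assms] assms(5-7) by (auto simp: adjc_def big_def)

lemma big_det_inj:
  assumes ab: "a \<in> cusps" "b \<in> cusps" and c: "big a b c" and d: "big a b d" and e: "\<bar>det a c\<bar> = \<bar>det a d\<bar>"
  shows "c = d"
proof (rule ccontr)
  assume ne: "c \<noteq> d"
  have "\<bar>wnd d a c\<bar> \<le> 1 / 6" using big_order(1)[OF ab c d ne] e by simp
  moreover have "\<bar>wnd d a c\<bar> > 27 / 10" using big_order(4)[OF ab d c] ne e by simp
  ultimately show False by simp
qed

lemma finite_triples:
  assumes ab: "a \<in> cusps" "b \<in> cusps" and pq: "p \<ge> 3" "q \<ge> 3"
  shows "finite (triples p q a b)"
proof (cases "triples p q a b = {}")
  case False
  hence "a \<noteq> b" using triples_big[OF ab pq] by fast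
  hence dab: "det a b \<noteq> 0" using det_zero_iff[OF ab] by simp
  define N where "N = \<bar>det a b\<bar>"
  \<comment> \<open>A winding above 1 around \<open>c\<close> bounds both determinants with
    \<open>c\<close> by that of \<open>a\<close> and \<open>b\<close>.\<close>
  have bN: "\<bar>det a c\<bar> \<le> N \<and> \<bar>det b c\<bar> \<le> N" if c: "big a b c" for c
  proof -
    have C: "c \<in> cusps" "c \<noteq> a" "c \<noteq> b" using c big_ne[OF c] by (auto simp: big_def)
    have d1: "1 \<le> \<bar>det c a\<bar>" "1 \<le> \<bar>det b c\<bar>" using det_ge_1 C ab by auto
    have "1 < \<bar>wnd c a b\<bar>" using c unfolding big_def by linarith
    hence "1 < real_of_int \<bar>det a b\<bar> / (6 * real_of_int \<bar>det c a\<bar> * real_of_int \<bar>det b c\<bar>)"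
      unfolding abs_wnd by simp
    hence "6 * real_of_int \<bar>det c a\<bar> * real_of_int \<bar>det b c\<bar> < real_of_int \<bar>det a b\<bar>"
      using d1 by (subst (asm) pos_less_divide_eq) auto
    hence "6 * \<bar>det c a\<bar> * \<bar>det b c\<bar> < \<bar>det a b\<bar>" by (metis of_int_less_iff of_int_mult of_int_numeral)
    moreover have "\<bar>det c a\<bar> * 1 \<le> \<bar>det c a\<bar> * \<bar>det b c\<bar>" "1 * \<bar>det b c\<bar> \<le> \<bar>det c a\<bar> * \<bar>det b c\<bar>"
      using d1 by (intro mult_left_mono mult_right_mono; simp)+
    moreover have "0 \<le> \<bar>det c a\<bar> * \<bar>det b c\<bar>" by simp
    moreover have "6 * \<bar>det c a\<bar> * \<bar>det b c\<bar> = 6 * (\<bar>det c a\<bar> * \<bar>det b c\<bar>)" by simp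
    moreover have "\<bar>det a c\<bar> = \<bar>det c a\<bar>" using det_swap[of a c] by simp
    ultimately show ?thesis unfolding N_def by linarith
  qed
  let ?S = "{c. \<bar>det a c\<bar> \<le> N \<and> \<bar>det b c\<bar> \<le> N}"
  have "triples p q a b \<subseteq> {1, -1} \<times> (?S \<times> ?S)"
  proof
    fix t assume t: "t \<in> triples p q a b"
    obtain \<epsilon> c d where e: "t = (\<epsilon>, c, d)" by (cases t)
    have "\<epsilon> \<in> {1, -1}" using t e by (auto simp: triples_def)
    moreover have "c \<in> ?S" "d \<in> ?S" using triples_big(2,3)[OF ab pq, of \<epsilon> c d] t e bN by simp_all
    ultimately show "t \<in> {1, -1} \<times> (?S \<times> ?S)" using e by simp
  qed
  moreover have "finite ({1, -1 :: real} \<times> (?S \<times> ?S))" using finite_bounded_dets[OF dab] by simp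
  ultimately show ?thesis by (rule finite_subset)
qed simp

section \<open>Bounded defect of the count\<close>

definition bad :: "nat \<Rightarrow> nat \<Rightarrow> vec \<Rightarrow> vec \<Rightarrow> vec \<Rightarrow> (real \<times> vec \<times> vec) set" where
  "bad p q a b z = triples p q a b - triples p q a z - triples p q z b"

lemma seven_sorted:
  fixes S :: "int set" assumes "finite S" "card S \<ge> 7"
  obtains x where "\<And>i. i < (7::nat) \<Longrightarrow> x i \<in> S" "\<And>i j. i < j \<Longrightarrow> j < 7 \<Longrightarrow> x i < x j"
proof
  let ?l = "sorted_list_of_set S"
  have l: "length ?l \<ge> 7" using assms by simp
  show "?l ! i \<in> S" if "i < 7" for i using l that nth_mem[of i ?l] assms(1) by simp
  show "?l ! i < ?l ! j" if "i < j" "j < 7" for i j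
    using l that sorted_wrt_nth_less[OF strict_sorted_list_of_set[of S], of i j] by simp
qed

text \<open>Sort seven bad triples by distance from \<open>a\<close>. Number 0 is lost because
  \<open>b\<close> and \<open>z\<close> differ across an integer around its second cusp, number 6
  because \<open>a\<close> and \<open>z\<close> do so around its first. A cusp \<open>m\<close> from
  number 3 or 4 is adjacent to neither: number 1 bounds the second cusp of number 0, and numbers 2
  and 5 supply big cusps in between. By \<open>barrier\<close>, \<open>m\<close> then sees
  \<open>z\<close> less than one turn from both, although it sees more than two turns between
  them.\<close>

lemma bad_bound:
  assumes ab: "a \<in> cusps" "b \<in> cusps" "z \<in> cusps" and pq: "p \<ge> 3" "q \<ge> 3"
  shows "card (bad p q a b z) \<le> 6"
proof (rule ccontr)
  assume big7: "\<not> card (bad p q a b z) \<le> 6"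
  have fin: "finite (bad p q a b z)" using finite_triples[OF ab(1,2) pq] by (simp add: bad_def)
  define key where "key t = \<bar>det a (fst (snd t))\<bar>" for t :: "real \<times> vec \<times> vec"
  have tb: "big a b (fst (snd t))" "big a b (snd (snd t))" "\<bar>det a (fst (snd t))\<bar> < \<bar>det a (snd (snd t))\<bar>"
    "adjc (fst (snd t)) (snd (snd t))" if "t \<in> bad p q a b z" for t
  proof -
    obtain \<epsilon> c d where e: "t = (\<epsilon>, c, d)" by (cases t)
    have tr: "(\<epsilon>, c, d) \<in> triples p q a b" using that e by (simp add: bad_def)
    have "adjc c d" using tr by (simp add: triples_def)
    thus "big a b (fst (snd t))" "big a b (snd (snd t))" "\<bar>det a (fst (snd t))\<bar> < \<bar>det a (snd (snd t))\<bar>"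
      "adjc (fst (snd t)) (snd (snd t))"
      using triples_big[OF ab(1,2) pq tr] e by simp_all
  qed
  have nadj: "\<not> adjc c d" if "big a b c" "big a b d" "big a b e" "c \<noteq> e" "d \<noteq> e"
    "\<bar>det a c\<bar> \<le> \<bar>det a e\<bar>" "\<bar>det a e\<bar> \<le> \<bar>det a d\<bar>" for c d e
    by (rule big_between_not_adjc[OF ab(1,2) that])
  have inj: "inj_on key (bad p q a b z)"
  proof (rule inj_onI)
    fix t t' assume t: "t \<in> bad p q a b z" "t' \<in> bad p q a b z" and k: "key t = key t'"
    obtain \<epsilon> c d where e: "t = (\<epsilon>, c, d)" by (cases t)
    obtain \<epsilon>' c' d' where e': "t' = (\<epsilon>', c', d')" by (cases t')
    note T = tb[OF t(1), unfolded e, simplified] and T' = tb[OF t(2), unfolded e', simplified]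
    have cc: "c = c'" using big_det_inj[OF ab(1,2) T(1) T'(1)] k by (simp add: key_def e e')
    have dd: "d = d'"
    proof (rule ccontr)
      assume ne: "d \<noteq> d'"
      show False
      proof (cases "\<bar>det a d\<bar> \<le> \<bar>det a d'\<bar>")
        case True
        have "c' \<noteq> d" using T cc by auto
        thus False using nadj[OF T'(1) T'(2) T(2)] ne True T T' cc by auto
      next
        case False
        have "c \<noteq> d'" using T' cc by auto
        thus False using nadj[OF T(1) T(2) T'(2)] ne False T T' cc by auto
      qed
    qed
    have "\<epsilon> = 1 \<or> \<epsilon> = -1" "real p < \<epsilon> * wnd c a d" "\<epsilon>' = 1 \<or> \<epsilon>' = -1" "real p < \<epsilon>' * wnd c a d"
      using t e e' cc dd by (auto simp: bad_def triples_def)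
    hence "\<epsilon> = \<epsilon>'" by auto
    thus "t = t'" using e e' cc dd by simp
  qed
  have nxt: "\<bar>det a (snd (snd t))\<bar> \<le> key t'" if t: "t \<in> bad p q a b z" "t' \<in> bad p q a b z" "key t < key t'" for t t'
  proof (rule ccontr)
    assume no: "\<not> \<bar>det a (snd (snd t))\<bar> \<le> key t'"
    have "fst (snd t) \<noteq> fst (snd t')" "snd (snd t) \<noteq> fst (snd t')" using t no by (auto simp: key_def)
    thus False using nadj[OF tb(1,2)[OF t(1)] tb(1)[OF t(2)]] tb(4)[OF t(1)] t no by (simp add: key_def)
  qed
  have "card (key ` bad p q a b z) \<ge> 7" using big7 card_image[OF inj] by simp
  then obtain x where x: "\<And>i. i < (7::nat) \<Longrightarrow> x i \<in> key ` bad p q a b z" "\<And>i j. i < j \<Longrightarrow> j < 7 \<Longrightarrow> x i < x j"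
    using seven_sorted[of "key ` bad p q a b z"] fin by blast
  have "\<exists>t\<in>bad p q a b z. x i = key t" if "i < 7" for i using x(1)[OF that] by blast
  then obtain T where T: "\<And>i. i < 7 \<Longrightarrow> T i \<in> bad p q a b z" "\<And>i. i < 7 \<Longrightarrow> x i = key (T i)" by metis
  have kl: "key (T i) < key (T j)" if "i < j" "j < 7" for i j using x(2)[OF that] T(2) that by simp
  define C where "C i = fst (snd (T i))" for i
  have CB: "big a b (C i)" if "i < 7" for i using tb(1)[OF T(1)[OF that]] by (simp add: C_def)
  have Ck: "key (T i) = \<bar>det a (C i)\<bar>" for i by (simp add: key_def C_def)
  \<comment> \<open>Two candidates are kept so that one of them differs from
    \<open>z\<close>.\<close>
  define m where "m = (if C 3 = z then C 4 else C 3)"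
  define im where "im = (if C 3 = z then 4 else (3::nat))"
  have im: "m = C im" "im = 3 \<or> im = 4" by (auto simp: m_def im_def)
  have mb: "big a b m" and mC: "m \<in> cusps" using CB[of im] im by (auto simp: big_def)
  have C34: "C 3 \<noteq> C 4" using kl[of 3 4] by (auto simp: Ck)
  have mz: "m \<noteq> z" using C34 by (auto simp: m_def)
  obtain \<epsilon> c1 c2 where t0: "T 0 = (\<epsilon>, c1, c2)" by (cases "T 0")
  obtain \<epsilon>' g1 g2 where t6: "T 6 = (\<epsilon>', g1, g2)" by (cases "T 6")
  note B0 = T(1)[of 0, simplified] and B6 = T(1)[of 6, simplified]
  have c: "big a b c1" "big a b c2" "adjc c1 c2" using tb[OF B0] t0 by auto
  have g: "big a b g1" "big a b g2" "adjc g1 g2" using tb[OF B6] t6 by auto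
  have cu: "c1 \<in> cusps" "c2 \<in> cusps" "g1 \<in> cusps" "g2 \<in> cusps" using c g by (auto simp: big_def)
  have k01: "\<bar>det a c2\<bar> \<le> key (T 1)" using nxt[OF B0 T(1)[of 1]] kl[of 0 1] t0 by simp
  have k12: "\<bar>det a c2\<bar> < \<bar>det a (C 2)\<bar>" using k01 kl[of 1 2] by (simp add: Ck)
  have k2m: "\<bar>det a (C 2)\<bar> < \<bar>det a m\<bar>" using kl[of 2 im] im by (auto simp: Ck)
  have km5: "\<bar>det a m\<bar> < \<bar>det a (C 5)\<bar>" using kl[of im 5] im by (auto simp: Ck)
  have k56: "\<bar>det a (C 5)\<bar> < \<bar>det a g1\<bar>" using kl[of 5 6] t6 by (simp add: key_def C_def)
  have n1: "\<not> adjc c2 m" using nadj[OF c(2) mb CB[of 2]] k12 k2m by force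
  have n2: "\<not> adjc m g1" using nadj[OF mb g(1) CB[of 5]] km5 k56 by force
  have mc2: "c2 \<noteq> m" "m \<noteq> g1" using k12 k2m km5 k56 by auto
  have in0: "\<epsilon> = 1 \<or> \<epsilon> = -1" "real p < \<epsilon> * wnd c1 a c2" "\<epsilon> * wnd c1 a c2 < real p + 1"
    "real q < \<epsilon> * wnd c2 c1 b" "\<epsilon> * wnd c2 c1 b < real q + 1" "\<not> (real q < \<epsilon> * wnd c2 c1 z \<and> \<epsilon> * wnd c2 c1 z < real q + 1)"
    using B0 t0 cu c(3) by (auto simp: bad_def triples_def)
  have in6: "\<epsilon>' = 1 \<or> \<epsilon>' = -1" "real p < \<epsilon>' * wnd g1 a g2" "\<epsilon>' * wnd g1 a g2 < real p + 1"
    "\<not> (real p < \<epsilon>' * wnd g1 z g2 \<and> \<epsilon>' * wnd g1 z g2 < real p + 1)"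
    using B6 t6 cu g(3) by (auto simp: bad_def triples_def)
  \<comment> \<open>Passing from \<open>b\<close> to \<open>z\<close> leaves the interval from
    \<open>q\<close> to \<open>q + 1\<close>, so one of its end points, up to sign, separates the
    two windings.\<close>
  have "\<exists>j::int. min (wnd c2 c1 b) (wnd c2 c1 z) \<le> of_int j \<and> of_int j \<le> max (wnd c2 c1 b) (wnd c2 c1 z)"
  proof -
    consider "\<epsilon> * wnd c2 c1 z \<le> real q" | "real q + 1 \<le> \<epsilon> * wnd c2 c1 z" using in0(6) by linarith
    thus ?thesis
    proof cases
      case 1
      thus ?thesis using in0(1,4) by (intro exI[of _ "if \<epsilon> = 1 then int q else - int q"]) auto
    next
      case 2
      thus ?thesis using in0(1,5) by (intro exI[of _ "if \<epsilon> = 1 then int q + 1 else - int q - 1"]) auto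
    qed
  qed
  then obtain j :: int where j: "min (wnd c2 c1 b) (wnd c2 c1 z) \<le> of_int j" "of_int j \<le> max (wnd c2 c1 b) (wnd c2 c1 z)" by blast
  have xb: "\<bar>wnd m c2 b\<bar> > 1" using big_order(2)[OF ab(1,2) c(2) mb mc2(1)] k12 k2m by simp
  have r1: "\<bar>wnd m c2 z\<bar> < 1"
    using barrier[OF cu(2,1) mC ab(2,3) c(3) _ _ xb j] mc2 n1 adjc_sym by metis
  have "\<exists>j::int. min (wnd g1 g2 a) (wnd g1 g2 z) \<le> of_int j \<and> of_int j \<le> max (wnd g1 g2 a) (wnd g1 g2 z)"
  proof -
    have sw: "wnd g1 a g2 = - wnd g1 g2 a" "wnd g1 z g2 = - wnd g1 g2 z" using wnd_swap by blast+
    consider "\<epsilon>' * wnd g1 z g2 \<le> real p" | "real p + 1 \<le> \<epsilon>' * wnd g1 z g2" using in6(4) by linarith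
    thus ?thesis
    proof cases
      case 1
      thus ?thesis using in6(1,2) sw by (intro exI[of _ "if \<epsilon>' = 1 then - int p else int p"]) auto
    next
      case 2
      thus ?thesis using in6(1,3) sw by (intro exI[of _ "if \<epsilon>' = 1 then - int p - 1 else int p + 1"]) auto
    qed
  qed
  then obtain j' :: int where j': "min (wnd g1 g2 a) (wnd g1 g2 z) \<le> of_int j'" "of_int j' \<le> max (wnd g1 g2 a) (wnd g1 g2 z)" by blast
  have "\<bar>wnd m a g1\<bar> > 1" using big_order(4)[OF ab(1,2) mb g(1) mc2(2)] km5 k56 by simp
  hence xa: "\<bar>wnd m g1 a\<bar> > 1" using wnd_swap[of m a g1] by simp
  have ag: "adjc g2 g1" using g(3) adjc_sym by simp
  have r2: "\<bar>wnd m g1 z\<bar> < 1"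
    using barrier[OF cu(3,4) mC ab(1,3) ag mc2(2) n2 xa j'] .
  have "wnd m c2 g1 = wnd m c2 z + wnd m z g1"
    using wnd_add_cusp[of m c2 z g1] mC cu ab mc2 mz by auto
  hence "\<bar>wnd m c2 g1\<bar> < 2" using r1 r2 wnd_swap[of m z g1] by simp
  moreover have "\<bar>wnd m c2 g1\<bar> > 2"
    using big_between[OF ab(1,2) c(2) g(1) mb] mc2 k12 k2m km5 k56 by auto
  ultimately show False by simp
qed

definition tdiff :: "nat \<Rightarrow> nat \<Rightarrow> vec \<Rightarrow> vec \<Rightarrow> real" where
  "tdiff p q a b = real (card (triples p q a b)) - real (card (triples p q b a))"

text \<open>A triple belonging to both \<open>(a, z)\<close> and \<open>(z, b)\<close> would make
  \<open>z\<close> wind far around each of its two cusps as seen from the other, against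
  \<open>behrstock_le\<close>; so the two intersections are disjoint.\<close>

lemma triples_split:
  assumes ab: "a \<in> cusps" "b \<in> cusps" "z \<in> cusps" and pq: "p \<ge> 3" "q \<ge> 3"
  shows "\<exists>r\<le>6. card (triples p q a b) = card (triples p q a b \<inter> triples p q a z) +
     card (triples p q a b \<inter> triples p q z b) + r"
proof (intro exI conjI)
  let ?F = "triples p q"
  show "card (bad p q a b z) \<le> 6" by (rule bad_bound[OF ab pq])
  have fin: "finite (?F a b)" by (rule finite_triples[OF ab(1,2) pq])
  have dis: "?F a z \<inter> ?F z b = {}"
  proof (intro equals0I)
    fix t assume t: "t \<in> ?F a z \<inter> ?F z b"
    obtain \<epsilon> c d where e: "t = (\<epsilon>, c, d)" by (cases t)
    have *: "c \<in> cusps" "d \<in> cusps" "adjc c d" "\<epsilon> = 1 \<or> \<epsilon> = -1" "real p < \<epsilon> * wnd c z d" "real q < \<epsilon> * wnd d c z"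
      using t e by (auto simp: triples_def)
    have "\<bar>wnd c z d\<bar> > 3" "\<bar>wnd d c z\<bar> > 3" using * pq by (auto simp: abs_if)
    moreover have "\<bar>wnd c d z\<bar> \<le> 1 / (36 * 3)"
      using behrstock_le[of d c z 3] calculation * ab by (auto simp: adjc_def)
    ultimately show False using wnd_swap[of c z d] by simp
  qed
  have "?F a b = (?F a b \<inter> ?F a z) \<union> (?F a b \<inter> ?F z b) \<union> bad p q a b z" by (auto simp: bad_def)
  moreover have "card ((?F a b \<inter> ?F a z) \<union> (?F a b \<inter> ?F z b) \<union> bad p q a b z) =
      card ((?F a b \<inter> ?F a z) \<union> (?F a b \<inter> ?F z b)) + card (bad p q a b z)"
    by (rule card_Un_disjoint) (use fin in \<open>auto simp: bad_def\<close>)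
  moreover have "card ((?F a b \<inter> ?F a z) \<union> (?F a b \<inter> ?F z b)) = card (?F a b \<inter> ?F a z) + card (?F a b \<inter> ?F z b)"
    by (rule card_Un_disjoint) (use fin dis in auto)
  ultimately show "card (?F a b) = card (?F a b \<inter> ?F a z) + card (?F a b \<inter> ?F z b) + card (bad p q a b z)" by simp
qed

text \<open>Every intersection occurs twice with opposite signs. What is left is at most 6 for each
  of the six ordered pairs.\<close>

lemma tdiff_defect:
  assumes ab: "a \<in> cusps" "b \<in> cusps" "z \<in> cusps" and pq: "p \<ge> 3" "q \<ge> 3"
  shows "\<bar>tdiff p q a b + tdiff p q b z + tdiff p q z a\<bar> \<le> 36"
proof -
  let ?F = "triples p q"
  obtain r1 where r1: "r1 \<le> 6" "card (?F a b) = card (?F a b \<inter> ?F a z) + card (?F a b \<inter> ?F z b) + r1"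
    using triples_split[OF ab pq] by blast
  obtain r2 where r2: "r2 \<le> 6" "card (?F b z) = card (?F b z \<inter> ?F b a) + card (?F b z \<inter> ?F a z) + r2"
    using triples_split[OF ab(2,3,1) pq] by blast
  obtain r3 where r3: "r3 \<le> 6" "card (?F z a) = card (?F z a \<inter> ?F z b) + card (?F z a \<inter> ?F b a) + r3"
    using triples_split[OF ab(3,1,2) pq] by blast
  obtain r4 where r4: "r4 \<le> 6" "card (?F b a) = card (?F b a \<inter> ?F b z) + card (?F b a \<inter> ?F z a) + r4"
    using triples_split[OF ab(2,1,3) pq] by blast
  obtain r5 where r5: "r5 \<le> 6" "card (?F z b) = card (?F z b \<inter> ?F z a) + card (?F z b \<inter> ?F a b) + r5"
    using triples_split[OF ab(3,2,1) pq] by blast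
  obtain r6 where r6: "r6 \<le> 6" "card (?F a z) = card (?F a z \<inter> ?F a b) + card (?F a z \<inter> ?F b z) + r6"
    using triples_split[OF ab(1,3,2) pq] by blast
  note c = Int_commute[of "?F b a" "?F b z"] Int_commute[of "?F b a" "?F z a"] Int_commute[of "?F z b" "?F z a"]
    Int_commute[of "?F z b" "?F a b"] Int_commute[of "?F a z" "?F a b"] Int_commute[of "?F a z" "?F b z"]
  show ?thesis unfolding tdiff_def r1(2) r2(2) r3(2) r4(2)[unfolded c] r5(2)[unfolded c] r6(2)[unfolded c]
    using r1(1) r2(1) r3(1) r4(1) r5(1) r6(1) by simp
qed

lemma winding_map_tdiff:
  "winding_map \<eta> f \<Longrightarrow> a \<in> cusps \<Longrightarrow> b \<in> cusps \<Longrightarrow> tdiff p q (f a) (f b) = tdiff p q a b"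
  by (simp add: tdiff_def winding_map_triples)

lemma tdiff_swap: "tdiff p q b a = - tdiff p q a b"
  by (simp add: tdiff_def)

section \<open>The free group of rank two acting on the cusps\<close>

text \<open>A letter is a pair (is it \<open>y\<close>?, is the exponent positive?).  The four cusps \<open>\<infinity>, -1, 0, 1\<close> are the
  vertices of an ideal quadrilateral whose sides are paired by \<open>x\<close> and \<open>y\<close>; \<open>pos\<close> locates a cusp
  relative to it, the odd values being the four open arcs.\<close>

type_synonym letter = "bool \<times> bool"

text \<open>These matrices generate the commutator subgroup of the modular group, a free group of
  rank two; the quotient of the upper half-plane is the once-punctured torus whose cusp has width
  6.\<close>

fun lm :: "letter \<Rightarrow> mat" where
  "lm (False, True) = (2, 1, 1, 1)"
| "lm (False, False) = (1, -1, -1, 2)"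
| "lm (True, True) = (2, -1, -1, 1)"
| "lm (True, False) = (1, 1, 1, 2)"

definition linv :: "letter \<Rightarrow> letter" where
  "linv l = (fst l, \<not> snd l)"

lemma linv_linv [simp]: "linv (linv l) = l" and linv_ne [simp]: "linv l \<noteq> l" "l \<noteq> linv l"
  by (auto simp: linv_def prod_eq_iff)

lemma mdet_lm [simp]: "mdet (lm l) = 1"
  by (cases l rule: lm.cases) auto

lemma madj_lm: "madj (lm l) = lm (linv l)"
  by (cases l rule: lm.cases) (auto simp: madj_def linv_def)

lemma mv_lm_cancel [simp]: "v \<in> cusps \<Longrightarrow> mv (lm (linv l)) (mv (lm l) v) = v"
  "v \<in> cusps \<Longrightarrow> mv (lm l) (mv (lm (linv l)) v) = v"
  using mv_madj[of "lm l" v] mv_madj[of "lm (linv l)" v] by (simp_all add: madj_lm)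

lemma mv_lm_cusp [simp]: "v \<in> cusps \<Longrightarrow> mv (lm l) v \<in> cusps"
  by (simp add: mv_cusp)

fun qv :: "nat \<Rightarrow> vec" where
  "qv i = (if i = 0 then (1, 0) else if i = 1 then (-1, 1) else if i = 2 then (0, 1) else (1, 1))"

declare qv.simps [simp del]

lemma qv_cusp [simp]: "qv i \<in> cusps"
  by (simp add: qv.simps cusps_def)

text \<open>The reflection of the quadrilateral that exchanges the two sides paired by
  \<open>x\<close> and keeps each of those paired by \<open>y\<close>: it swaps
  \<open>\<infinity>\<close> with -1 and 0 with 1. On positions it is \<open>rho\<close>, on letters
  \<open>tl_l\<close>.\<close>

definition flip_i :: "nat \<Rightarrow> nat" where
  "flip_i i = (if i = 0 then 1 else if i = 1 then 0 else if i = 2 then 3 else 2)"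

definition tl_l :: "letter \<Rightarrow> letter" where
  "tl_l l = (if fst l then l else linv l)"

lemma tl_l_simps [simp]: "tl_l (tl_l l) = l" "tl_l (linv l) = linv (tl_l l)" "tl_l l = tl_l m \<longleftrightarrow> l = m"
  by (cases l; cases m; auto simp: tl_l_def linv_def)+

definition actc :: "letter list \<Rightarrow> vec \<Rightarrow> vec" where
  "actc w v = foldr (\<lambda>l. mv (lm l)) w v"

lemma actc_simps [simp]: "actc [] v = v" "actc (l # w) v = mv (lm l) (actc w v)"
  by (simp_all add: actc_def)

lemma actc_append: "actc (u @ w) v = actc u (actc w v)"
  by (simp add: actc_def)

lemma actc_cusp [simp]: "v \<in> cusps \<Longrightarrow> actc w v \<in> cusps"
  by (induction w) auto

definition pos :: "vec \<Rightarrow> nat" where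
  "pos v = (if snd v = 0 then 0 else if fst v > snd v then 1 else if fst v = snd v then 2 else if fst v > 0 then 3
     else if fst v = 0 then 4 else if fst v > - snd v then 5 else if fst v = - snd v then 6 else 7)"

fun arc :: "letter \<Rightarrow> nat" where
  "arc (False, True) = 1" | "arc (True, False) = 3" | "arc (False, False) = 5" | "arc (True, True) = 7"

text \<open>The ping-pong table: outside the arc of \<open>linv l\<close>, the position of an image
  under \<open>l\<close> depends only on the position of the cusp.\<close>

fun step :: "letter \<Rightarrow> nat \<Rightarrow> nat" where
  "step (False, True) k = (if k = 6 then 0 else if k = 4 then 2 else 1)"
| "step (True, True) k = (if k = 2 then 0 else if k = 4 then 6 else 7)"
| "step (False, False) k = (if k = 0 then 6 else if k = 2 then 4 else 5)"
| "step (True, False) k = (if k = 0 then 2 else if k = 6 then 4 else 3)"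

definition rho :: "nat \<Rightarrow> nat" where
  "rho k = (if k = 7 then 7 else 6 - k)"

lemma pos_le: "pos v \<le> 7"
  by (simp add: pos_def)

lemma arc_inj: "arc l = arc m \<longleftrightarrow> l = m"
  by (cases l rule: arc.cases; cases m rule: arc.cases) auto

lemma arc_odd: "odd (arc l)"
  by (cases l rule: arc.cases) auto

lemma rho_arc: "rho (arc l) = arc (tl_l l)"
  by (cases l rule: arc.cases) (auto simp: rho_def tl_l_def linv_def)

lemma pos_step:
  assumes "v \<in> cusps" "pos v \<noteq> arc (linv l)"
  shows "pos (mv (lm l) v) = step l (pos v)"
proof -
  obtain p q where v: "v = (p, q)" by (cases v)
  have c: "q > 0 \<or> q = 0 \<and> p = 1" using assms(1) v by (auto simp: cusps_def)
  note defs = mv_def nrm_def linv_def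
  consider "q = 0" "p = 1" | "q > 0" "p > q" | "q > 0" "p = q" | "q > 0" "p > 0" "p < q" | "q > 0" "p = 0" | "q > 0" "p < 0" "- q < p" | "q > 0" "p = - q" | "q > 0" "p < - q" using c by linarith
  thus ?thesis
  proof cases
    case 1
    hence pv: "pos v = 0" by (simp add: v pos_def)
    have "pos (mv (lm l) (p, q)) = step l 0" if "0 \<noteq> arc (linv l)"
      using that 1 by (cases l rule: lm.cases) (simp_all add: defs, simp_all add: pos_def)
    thus ?thesis using assms(2) pv by (simp add: v)
  next
    case 2
    hence pv: "pos v = 1" by (simp add: v pos_def)
    have "pos (mv (lm l) (p, q)) = step l 1" if "1 \<noteq> arc (linv l)"
      using that 2 by (cases l rule: lm.cases) (simp_all add: defs, simp_all add: pos_def)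
    thus ?thesis using assms(2) pv by (simp add: v)
  next
    case 3
    hence pv: "pos v = 2" by (simp add: v pos_def)
    have "pos (mv (lm l) (p, q)) = step l 2" if "2 \<noteq> arc (linv l)"
      using that 3 by (cases l rule: lm.cases) (simp_all add: defs, simp_all add: pos_def)
    thus ?thesis using assms(2) pv by (simp add: v)
  next
    case 4
    hence pv: "pos v = 3" by (simp add: v pos_def)
    have "pos (mv (lm l) (p, q)) = step l 3" if "3 \<noteq> arc (linv l)"
      using that 4 by (cases l rule: lm.cases) (simp_all add: defs, simp_all add: pos_def)
    thus ?thesis using assms(2) pv by (simp add: v)
  next
    case 5
    hence pv: "pos v = 4" by (simp add: v pos_def)
    have "pos (mv (lm l) (p, q)) = step l 4" if "4 \<noteq> arc (linv l)"
      using that 5 by (cases l rule: lm.cases) (simp_all add: defs, simp_all add: pos_def)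
    thus ?thesis using assms(2) pv by (simp add: v)
  next
    case 6
    hence pv: "pos v = 5" by (simp add: v pos_def)
    have "pos (mv (lm l) (p, q)) = step l 5" if "5 \<noteq> arc (linv l)"
      using that 6 by (cases l rule: lm.cases) (simp_all add: defs, simp_all add: pos_def)
    thus ?thesis using assms(2) pv by (simp add: v)
  next
    case 7
    hence pv: "pos v = 6" by (simp add: v pos_def)
    have "pos (mv (lm l) (p, q)) = step l 6" if "6 \<noteq> arc (linv l)"
      using that 7 by (cases l rule: lm.cases) (simp_all add: defs, simp_all add: pos_def)
    thus ?thesis using assms(2) pv by (simp add: v)
  next
    case 8
    hence pv: "pos v = 7" by (simp add: v pos_def)
    have "pos (mv (lm l) (p, q)) = step l 7" if "7 \<noteq> arc (linv l)"
      using that 8 by (cases l rule: lm.cases) (simp_all add: defs, simp_all add: pos_def)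
    thus ?thesis using assms(2) pv by (simp add: v)
  qed
qed

lemma step_values: "step l k = arc l \<or> even (step l k)"
  by (cases l rule: arc.cases) auto

lemma step_rho: "k \<le> 7 \<Longrightarrow> k \<noteq> arc (linv l) \<Longrightarrow> step (tl_l l) (rho k) = rho (step l k)"
  by (cases l rule: arc.cases) (auto simp: rho_def tl_l_def linv_def)

fun rd :: "letter list \<Rightarrow> bool" where
  "rd (l # m # w) = (m \<noteq> linv l \<and> rd (m # w))"
| "rd _ = True"

lemma rd_tl: "rd (l # w) \<Longrightarrow> rd w"
  by (cases w) auto

lemma pos_qv: "even (pos (qv i))" "pos (qv (flip_i i)) = rho (pos (qv i))"
  by (auto simp: pos_def qv.simps flip_i_def rho_def)

text \<open>A vertex moved by a reduced word is never found in the arc excluded by the next letter,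
  so its position is computed by \<open>step\<close> alone. The table commutes with the reflection
  \<open>rho\<close>, and the mirrored word runs in parallel.\<close>

lemma pos_word:
  assumes "rd w"
  shows "(w = [] \<longrightarrow> even (pos (actc w (qv i)))) \<and> (w \<noteq> [] \<longrightarrow> pos (actc w (qv i)) = arc (hd w) \<or> even (pos (actc w (qv i)))) \<and>
     pos (actc (map tl_l w) (qv (flip_i i))) = rho (pos (actc w (qv i)))"
  using assms
proof (induction w)
  case Nil
  thus ?case using pos_qv by simp
next
  case (Cons l w)
  have IH: "w = [] \<longrightarrow> even (pos (actc w (qv i)))" "w \<noteq> [] \<longrightarrow> pos (actc w (qv i)) = arc (hd w) \<or> even (pos (actc w (qv i)))"
    "pos (actc (map tl_l w) (qv (flip_i i))) = rho (pos (actc w (qv i)))"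
    using Cons rd_tl by blast+
  have ne: "pos (actc w (qv i)) \<noteq> arc (linv l)"
  proof (cases w)
    case Nil
    thus ?thesis using IH(1) arc_odd by metis
  next
    case (Cons m w')
    hence "m \<noteq> linv l" using Cons.prems by simp
    thus ?thesis using IH(2) Cons arc_odd arc_inj by (metis list.distinct(1) list.sel(1))
  qed
  have ps: "pos (actc (l # w) (qv i)) = step l (pos (actc w (qv i)))" using pos_step[OF _ ne] by simp
  have ne': "rho (pos (actc w (qv i))) \<noteq> arc (linv (tl_l l))"
  proof
    assume e: "rho (pos (actc w (qv i))) = arc (linv (tl_l l))"
    have "rho (rho k) = k" if "k \<le> 7" for k using that by (auto simp: rho_def)
    hence "pos (actc w (qv i)) = rho (arc (linv (tl_l l)))" using e pos_le by metis
    thus False using ne rho_arc[of "linv (tl_l l)"] by simp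
  qed
  have "pos (actc (map tl_l (l # w)) (qv (flip_i i))) = step (tl_l l) (rho (pos (actc w (qv i))))"
    using pos_step[of "actc (map tl_l w) (qv (flip_i i))" "tl_l l"] ne' IH(3) by simp
  thus ?case using ps step_rho[OF pos_le ne] step_values[of l "pos (actc w (qv i))"] by auto
qed

lemma pos_reflect: "rd w \<Longrightarrow> pos (actc (map tl_l w) (qv (flip_i i))) = rho (pos (actc w (qv i)))"
  using pos_word by blast

text \<open>Its sign is the cyclic orientation of three cusps; as each vector enters twice, the
  choice between \<open>v\<close> and \<open>- v\<close> is irrelevant.\<close>

definition tri :: "vec \<Rightarrow> vec \<Rightarrow> vec \<Rightarrow> int" where
  "tri a b c = det a b * det b c * det c a"

lemma tri_rot: "tri b c a = tri a b c"
  by (simp add: tri_def)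

lemma tri_minus [simp]: "tri (- a) b c = tri a b c" "tri a (- b) c = tri a b c" "tri a b (- c) = tri a b c"
  by (simp_all add: tri_def)

lemma tri_nrm [simp]: "tri (nrm a) b c = tri a b c" "tri a (nrm b) c = tri a b c" "tri a b (nrm c) = tri a b c"
  using nrm_cases by (metis tri_minus)+

lemma tri_mv: "mdet M = 1 \<Longrightarrow> tri (mv M a) (mv M b) (mv M c) = tri a b c"
  unfolding mv_def tri_nrm by (simp add: tri_def det_mapp)

lemma pos_less_det:
  assumes "v \<in> cusps" "w \<in> cusps" "pos v < pos w" shows "det v w > 0"
proof -
  obtain p q where v: "v = (p, q)" by (cases v)
  obtain r s where w: "w = (r, s)" by (cases w)
  have c: "q > 0 \<or> q = 0 \<and> p = 1" "s > 0 \<or> s = 0 \<and> r = 1" using assms v w by (auto simp: cusps_def)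
  have s: "s > 0" using assms(3) c by (auto simp: w pos_def)
  have thr: "det v w > 0" if "q > 0" "p \<ge> t * q" "r \<le> t * s" "p > t * q \<or> r < t * s" for t
  proof -
    have "p * s \<ge> (t * q) * s" "q * r \<le> q * (t * s)" using that s by (intro mult_right_mono mult_left_mono; simp)+
    moreover have "p * s > (t * q) * s \<or> q * r < q * (t * s)"
      using that s by (auto intro: mult_strict_right_mono mult_strict_left_mono)
    moreover have "(t * q) * s = q * (t * s)" by simp
    ultimately show ?thesis unfolding v w det_def by auto
  qed
  show ?thesis
  proof (cases "q = 0")
    case True
    thus ?thesis using c s by (simp add: v w det_def)
  next
    case False
    hence q: "q > 0" using c by auto
    show ?thesis using assms(3) thr[of 1] thr[of 0] thr[of "-1"] q s
      by (simp add: v w pos_def split: if_splits)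
  qed
qed

lemma even_pos_eq:
  assumes "v \<in> cusps" "w \<in> cusps" "pos v = pos w" "even (pos v)" shows "v = w"
proof -
  obtain p q where v: "v = (p, q)" by (cases v)
  obtain r s where w: "w = (r, s)" by (cases w)
  have c: "q > 0 \<or> q = 0 \<and> p = 1" "s > 0 \<or> s = 0 \<and> r = 1" and cp: "coprime p q" "coprime r s"
    using assms v w by (auto simp: cusps_def)
  have "det v w = 0" using assms(3,4) c by (auto simp: v w pos_def det_def split: if_splits)
  thus ?thesis using det_zero_iff assms by blast
qed

text \<open>Two cusps with a common position do not separate anything outside it, so the third cusp
  can be replaced by any other one with a different position.\<close>

lemma sgn_tri_outside:
  assumes "a \<in> cusps" "b \<in> cusps" "c \<in> cusps" "pos a = pos b" "pos c \<noteq> pos a"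
  shows "sgn (tri a b c) = - sgn (det a b)"
proof (cases "pos c < pos a")
  case True
  hence "det c a > 0" "det c b > 0" using pos_less_det assms by auto
  thus ?thesis using det_swap[of b c] by (simp add: tri_def sgn_mult)
next
  case False
  hence "det a c > 0" "det b c > 0" using pos_less_det assms by auto
  thus ?thesis using det_swap[of c a] by (simp add: tri_def sgn_mult)
qed

definition cyclic_less :: "nat \<Rightarrow> nat \<Rightarrow> nat \<Rightarrow> bool" where
  "cyclic_less i j k \<longleftrightarrow> i < j \<and> j < k \<or> j < k \<and> k < i \<or> k < i \<and> i < j"

lemma sgn_tri_distinct:
  assumes C: "a \<in> cusps" "b \<in> cusps" "c \<in> cusps" and d: "pos a \<noteq> pos b" "pos b \<noteq> pos c" "pos a \<noteq> pos c"
  shows "sgn (tri a b c) = (if cyclic_less (pos a) (pos b) (pos c) then -1 else 1)"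
proof -
  have s: "sgn (det v w) = (if pos v < pos w then 1 else -1)" if "v \<in> cusps" "w \<in> cusps" "pos v \<noteq> pos w" for v w
    using pos_less_det[of v w] pos_less_det[of w v] that det_swap[of v w] by (cases "pos v < pos w") auto
  show ?thesis unfolding tri_def sgn_mult s[OF C(1,2) d(1)] s[OF C(2,3) d(2)] s[OF C(3,1) d(3)[symmetric]] cyclic_less_def
    using d by auto
qed

lemma cyclic_less_rho:
  assumes "i \<le> 7" "j \<le> 7" "k \<le> 7" "i \<noteq> j" "j \<noteq> k" "i \<noteq> k"
  shows "cyclic_less (rho i) (rho j) (rho k) \<longleftrightarrow> \<not> cyclic_less i j k"
proof -
  have r7: "rho 7 = 7" and r: "rho a = 6 - a" "a \<le> 6" if "a \<le> 7" "a \<noteq> 7" for a using that by (auto simp: rho_def)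
  consider "i = 7" | "j = 7" | "k = 7" | "i \<noteq> 7" "j \<noteq> 7" "k \<noteq> 7" by blast
  thus ?thesis
  proof cases
    case 1
    hence "j \<le> 6" "k \<le> 6" using assms by auto
    thus ?thesis using assms 1 unfolding cyclic_less_def by (simp add: rho_def) linarith
  next
    case 2
    hence "i \<le> 6" "k \<le> 6" using assms by auto
    thus ?thesis using assms 2 unfolding cyclic_less_def by (simp add: rho_def) linarith
  next
    case 3
    hence "i \<le> 6" "j \<le> 6" using assms by auto
    thus ?thesis using assms 3 unfolding cyclic_less_def by (simp add: rho_def) linarith
  next
    case 4
    hence le: "i \<le> 6" "j \<le> 6" "k \<le> 6" using assms by auto
    have lt: "6 - a < 6 - b \<longleftrightarrow> b < a" if "a \<le> 6" "b \<le> 6" for a b :: nat using that by linarith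
    show ?thesis using assms 4 unfolding cyclic_less_def
      by (simp add: rho_def lt le) linarith
  qed
qed

lemma rho_inj: "i \<le> 7 \<Longrightarrow> j \<le> 7 \<Longrightarrow> i \<noteq> j \<Longrightarrow> rho i \<noteq> rho j"
  by (auto simp: rho_def)

lemma not_rd_split: "\<not> rd w \<Longrightarrow> \<exists>u l v. w = u @ [l, linv l] @ v"
proof (induction w rule: rd.induct)
  case (1 l m w)
  show ?case
  proof (cases "m = linv l")
    case True
    thus ?thesis by (intro exI[of _ "[]"] exI[of _ l] exI[of _ w]) simp
  next
    case False
    then obtain u l' v where "m # w = u @ [l', linv l'] @ v" using 1 by auto
    thus ?thesis by (intro exI[of _ "l # u"] exI[of _ l'] exI[of _ v]) simp
  qed
qed auto

lemma open_arc_hd: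
  assumes "rd w" "odd (pos (actc w (qv i)))"
  obtains l w' where "w = l # w'" "pos (actc w (qv i)) = arc l"
  using pos_word[OF assms(1), of i] assms(2) by (cases w) auto

text \<open>An end of the arc of \<open>l\<close> is the image under \<open>l\<close> of a vertex,
  compatibly with the reflection. In \<open>sgn_tri_reflect\<close> this end replaces a third cusp
  outside the arc, and after \<open>l\<close> is stripped it needs no word at all.\<close>

lemma arc_endpoint: "\<exists>k k'. mv (lm (linv l)) (qv k) = qv k' \<and> mv (lm (linv (tl_l l))) (qv (flip_i k)) = qv (flip_i k')"
proof (cases l rule: arc.cases)
  case 1
  thus ?thesis by (intro exI[of _ 0] exI[of _ 1]) (simp add: linv_def tl_l_def qv.simps flip_i_def mv_def nrm_def)
next
  case 2
  thus ?thesis by (intro exI[of _ 3] exI[of _ 0]) (simp add: linv_def tl_l_def qv.simps flip_i_def mv_def nrm_def)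
next
  case 3
  thus ?thesis by (intro exI[of _ 1] exI[of _ 0]) (simp add: linv_def tl_l_def qv.simps flip_i_def mv_def nrm_def)
next
  case 4
  thus ?thesis by (intro exI[of _ 0] exI[of _ 3]) (simp add: linv_def tl_l_def qv.simps flip_i_def mv_def nrm_def)
qed

text \<open>Replacing \<open>x\<close> by its inverse reverses the cyclic order of the cusps: equal arcs are resolved by
  stripping the common first letter.\<close>

lemma sgn_tri_reflect:
  "sgn (tri (actc (map tl_l w1) (qv (flip_i i1))) (actc (map tl_l w2) (qv (flip_i i2))) (actc (map tl_l w3) (qv (flip_i i3)))) =
   - sgn (tri (actc w1 (qv i1)) (actc w2 (qv i2)) (actc w3 (qv i3)))"
proof (induction "length w1 + length w2 + length w3" arbitrary: w1 w2 w3 i1 i2 i3 rule: less_induct)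
  case less
  let ?t = "\<lambda>w i. actc (map tl_l w) (qv (flip_i i))" and ?a = "\<lambda>w i. actc w (qv i)"
  have cancel: "actc (u @ [l, linv l] @ v) (qv i) = actc (u @ v) (qv i)" for u l v i by (simp add: actc_append)
  have red: ?case if n: "\<not> rd w1 \<or> \<not> rd w2 \<or> \<not> rd w3"
  proof -
    consider u l v where "w1 = u @ [l, linv l] @ v" | u l v where "w2 = u @ [l, linv l] @ v" | u l v where "w3 = u @ [l, linv l] @ v"
      using n not_rd_split by blast
    thus ?thesis
    proof cases
      case 1
      thus ?thesis using less[of "u @ v" w2 w3 i1 i2 i3] cancel[of u l v i1] cancel[of "map tl_l u" "tl_l l" "map tl_l v" "flip_i i1"] by simp
    next
      case 2
      thus ?thesis using less[of w1 "u @ v" w3 i1 i2 i3] cancel[of u l v i2] cancel[of "map tl_l u" "tl_l l" "map tl_l v" "flip_i i2"] by simp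
    next
      case 3
      thus ?thesis using less[of w1 w2 "u @ v" i1 i2 i3] cancel[of u l v i3] cancel[of "map tl_l u" "tl_l l" "map tl_l v" "flip_i i3"] by simp
    qed
  qed
  \<comment> \<open>Two cusps share an open arc, so their words begin with the same letter. If the
    third lies there too, all three are stripped. Otherwise it is first replaced by an end of the
    arc, which is stripped to a vertex with the empty word; the total length drops either
    way.\<close>
  have two: "sgn (tri (?t v1 j1) (?t v2 j2) (?t v3 j3)) = - sgn (tri (?a v1 j1) (?a v2 j2) (?a v3 j3))"
    if len: "length v1 + length v2 + length v3 = length w1 + length w2 + length w3"
      and r: "rd v1" "rd v2" "rd v3" and o: "odd (pos (?a v1 j1))" and e: "pos (?a v1 j1) = pos (?a v2 j2)"
    for v1 v2 v3 j1 j2 j3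
  proof -
    obtain l v1' where v1: "v1 = l # v1'" "pos (?a v1 j1) = arc l" using open_arc_hd[OF r(1) o] by blast
    obtain l' v2' where v2': "v2 = l' # v2'" "pos (?a v2 j2) = arc l'" using open_arc_hd[OF r(2)] o e by metis
    hence v2: "v2 = l # v2'" using v1 e arc_inj by metis
    have p1: "pos (?t v1 j1) = arc (tl_l l)" "pos (?t v2 j2) = arc (tl_l l)" "pos (?t v3 j3) = rho (pos (?a v3 j3))"
      using pos_reflect[OF r(1), of j1] pos_reflect[OF r(2), of j2] pos_reflect[OF r(3), of j3] v1(2) e rho_arc by metis+
    have rr: "rho (rho k) = k" if "k \<le> 7" for k using that by (auto simp: rho_def)
    show ?thesis
    proof (cases "pos (?a v3 j3) = pos (?a v1 j1)")
      case True
      obtain l3 v3' where v3': "v3 = l3 # v3'" "pos (?a v3 j3) = arc l3" using open_arc_hd[OF r(3)] o True by metis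
      hence v3: "v3 = l # v3'" using v1 True arc_inj by metis
      show ?thesis using less[of v1' v2' v3' j1 j2 j3] len unfolding v1(1) v2 v3 by (simp add: tri_mv)
    next
      case False
      have n3: "pos (?t v3 j3) \<noteq> pos (?t v1 j1)"
      proof
        assume "pos (?t v3 j3) = pos (?t v1 j1)"
        hence "rho (rho (pos (?a v3 j3))) = rho (arc (tl_l l))" using p1 by simp
        thus False using False v1(2) rr[OF pos_le] rho_arc by simp
      qed
      obtain k k' where kk: "mv (lm (linv l)) (qv k) = qv k'" "mv (lm (linv (tl_l l))) (qv (flip_i k)) = qv (flip_i k')"
        using arc_endpoint by blast
      have qk: "qv k = mv (lm l) (qv k')" "qv (flip_i k) = mv (lm (tl_l l)) (qv (flip_i k'))"
        using kk mv_lm_cancel(2) by (metis qv_cusp)+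
      have "pos (qv i) \<noteq> arc m" for i m using pos_qv(1) arc_odd by metis
      note ne = this
      have A: "sgn (tri (?a v1 j1) (?a v2 j2) (?a v3 j3)) = sgn (tri (?a v1 j1) (?a v2 j2) (qv k))"
        using sgn_tri_outside[of "?a v1 j1" "?a v2 j2" "?a v3 j3"] sgn_tri_outside[of "?a v1 j1" "?a v2 j2" "qv k"]
          e False ne[of k l] v1(2) by (simp del: actc_simps)
      have B: "sgn (tri (?t v1 j1) (?t v2 j2) (?t v3 j3)) = sgn (tri (?t v1 j1) (?t v2 j2) (qv (flip_i k)))"
        using sgn_tri_outside[of "?t v1 j1" "?t v2 j2" "?t v3 j3"] sgn_tri_outside[of "?t v1 j1" "?t v2 j2" "qv (flip_i k)"]
          p1 n3 ne[of "flip_i k" "tl_l l"] by (simp del: actc_simps)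
      have "sgn (tri (?t v1' j1) (?t v2' j2) (?t [] k')) = - sgn (tri (?a v1' j1) (?a v2' j2) (?a [] k'))"
        by (rule less) (use len v1 v2 in simp)
      thus ?thesis unfolding A B unfolding v1(1) v2 qk by (simp add: tri_mv)
    qed
  qed
  show ?case
  proof (cases "rd w1 \<and> rd w2 \<and> rd w3")
    case False
    thus ?thesis using red by blast
  next
    case True
    hence r: "rd w1" "rd w2" "rd w3" by auto
    let ?p1 = "pos (?a w1 i1)" and ?p2 = "pos (?a w2 i2)" and ?p3 = "pos (?a w3 i3)"
    have pt: "pos (?t w1 i1) = rho ?p1" "pos (?t w2 i2) = rho ?p2" "pos (?t w3 i3) = rho ?p3"
      using pos_reflect r by blast+
    have ev: "?a v j = ?a v' j' \<and> ?t v j = ?t v' j'"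
      if "rd v" "rd v'" "pos (?a v j) = pos (?a v' j')" "even (pos (?a v j))" for v v' j j'
    proof
      show "?a v j = ?a v' j'" using even_pos_eq that by simp
      have q: "pos (?t v j) = rho (pos (?a v j))" "pos (?t v' j') = rho (pos (?a v' j'))" using pos_reflect that by blast+
      have "even (rho k)" if "even k" "k \<le> 7" for k using that by (auto simp: rho_def)
      thus "?t v j = ?t v' j'" using even_pos_eq[of "?t v j" "?t v' j'"] q that pos_le by simp
    qed
    have z: "tri a a b = 0" "tri a b a = 0" "tri b a a = 0" for a b by (auto simp: tri_def)
    show ?thesis
    proof (cases "?p1 = ?p2")
      case e: True
      show ?thesis
      proof (cases "odd ?p1")
        case True
        thus ?thesis using two[OF _ r] e by simp
      next
        case False
        thus ?thesis using ev[OF r(1,2) e] z by simp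
      qed
    next
      case n12: False
      show ?thesis
      proof (cases "?p2 = ?p3")
        case e: True
        show ?thesis
        proof (cases "odd ?p2")
          case True
          thus ?thesis using two[of w2 w3 w1 i2 i3 i1] r e tri_rot by simp
        next
          case False
          thus ?thesis using ev[OF r(2,3) e] z by simp
        qed
      next
        case n23: False
        show ?thesis
        proof (cases "?p3 = ?p1")
          case e: True
          show ?thesis
          proof (cases "odd ?p3")
            case True
            thus ?thesis using two[of w3 w1 w2 i3 i1 i2] r e tri_rot by simp
          next
            case False
            thus ?thesis using ev[OF r(3,1) e] z by simp
          qed
        next
          case n31: False
          have rne: "rho ?p1 \<noteq> rho ?p2" "rho ?p2 \<noteq> rho ?p3" "rho ?p1 \<noteq> rho ?p3"
            using rho_inj[OF pos_le pos_le] n12 n23 n31[symmetric] by blast+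
          show ?thesis
            using sgn_tri_distinct[of "?a w1 i1" "?a w2 i2" "?a w3 i3"] sgn_tri_distinct[of "?t w1 i1" "?t w2 i2" "?t w3 i3"]
              cyclic_less_rho[OF pos_le pos_le pos_le n12 n23 n31[symmetric]] n12 n23 n31 rne
            by (simp add: pt)
        qed
      qed
    qed
  qed
qed

text \<open>The linear action without normalisation. Words are compared as matrices up to sign, and
  \<open>nrm\<close> is applied once at the end, by \<open>actc_mp\<close>.\<close>

definition mp :: "letter list \<Rightarrow> vec \<Rightarrow> vec" where
  "mp w v = foldr (\<lambda>l. mapp (lm l)) w v"

lemma mp_simps [simp]: "mp [] v = v" "mp (l # w) v = mapp (lm l) (mp w v)"
  by (simp_all add: mp_def)

lemma cusp_coprime: "v \<in> cusps \<Longrightarrow> coprime (fst v) (snd v)"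
  by (simp add: cusps_def)

lemma coprime_nonzero: "coprime (fst v) (snd v :: int) \<Longrightarrow> v \<noteq> 0"
  by (auto simp: prod_eq_iff)

lemma nrm_mapp_nrm:
  assumes "mdet M = 1 \<or> mdet M = -1" "coprime (fst v) (snd v)"
  shows "nrm (mapp M (nrm v)) = nrm (mapp M v)"
  using nrm_cases[of v] nrm_minus[OF coprime_nonzero[OF mapp_coprime[OF assms]]] by (auto simp: mapp_minus)

lemma mv_mv:
  assumes "mdet M = 1 \<or> mdet M = -1" "mdet N = 1 \<or> mdet N = -1" "v \<in> cusps"
  shows "mv M (mv N v) = nrm (mapp M (mapp N v))"
  unfolding mv_def by (rule nrm_mapp_nrm[OF assms(1) mapp_coprime[OF assms(2) cusp_coprime[OF assms(3)]]])

lemma mp_coprime: "v \<in> cusps \<Longrightarrow> coprime (fst (mp w v)) (snd (mp w v))"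
  by (induction w) (auto intro: mapp_coprime cusp_coprime)

lemma actc_mp: "v \<in> cusps \<Longrightarrow> actc w v = nrm (mp w v)"
  by (induction w) (auto simp: cusp_nrm mv_def nrm_mapp_nrm mp_coprime)

lemma shear_minus [simp]: "shear k (- e) = shear k e"
  by (simp add: shear_def)

lemma shear_nrm [simp]: "shear k (nrm e) = shear k e"
  using nrm_cases[of e] by auto

lemma shear_conj:
  assumes "mdet M = 1" "e \<in> cusps" "v \<in> cusps"
  shows "mv (shear k (mv M e)) (mv M v) = mv M (mv (shear k e) v)"
proof -
  have "mapp (shear k (mapp M e)) (mapp M v) = mapp M (mapp (shear k e) v)"
    unfolding mapp_shear det_mapp assms(1)
    by (cases M; cases e; cases v) (simp add: algebra_simps det_def)
  thus ?thesis using mv_mv[of "shear k (mv M e)" M v] mv_mv[of M "shear k e" v] assms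
    by (simp add: mv_def[of M e])
qed

lemma shear_add:
  assumes "e \<in> cusps" "v \<in> cusps"
  shows "mv (shear j e) (mv (shear k e) v) = mv (shear (j + k) e) v"
proof -
  have "mapp (shear j e) (mapp (shear k e) v) = mapp (shear (j + k) e) v"
    unfolding mapp_shear by (simp add: det_def algebra_simps)
  thus ?thesis using mv_mv[of "shear j e" "shear k e" v] assms by (simp add: mv_def)
qed

lemma shear_zero: "v \<in> cusps \<Longrightarrow> mv (shear 0 e) v = v"
  by (simp add: mv_def mapp_shear cusp_nrm)

section \<open>All cusps form one orbit\<close>

definition rep :: "vec \<Rightarrow> bool" where
  "rep v \<longleftrightarrow> (\<exists>w. v = actc w (qv 0))"

lemma rep_lm: "rep v \<Longrightarrow> rep (mv (lm l) v)"
  unfolding rep_def by (metis actc_simps(2))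

lemma rep_lm_iff: "v \<in> cusps \<Longrightarrow> rep (mv (lm l) v) \<longleftrightarrow> rep v"
  using rep_lm[of v l] rep_lm[of "mv (lm l) v" "linv l"] by auto

lemma rep_qv: "rep (qv i)"
proof -
  have "qv 1 = actc [(False, False)] (qv 0)" "qv 2 = actc [(True, False), (False, False)] (qv 0)"
    "qv 3 = actc [(False, True), (True, False), (False, False)] (qv 0)"
    by (simp_all add: qv.simps mv_def nrm_def)
  hence "rep (qv 0)" "rep (qv 1)" "rep (qv 2)" "rep (qv 3)" unfolding rep_def using actc_simps(1) by metis+
  moreover have "qv i = qv 0 \<or> qv i = qv 1 \<or> qv i = qv 2 \<or> qv i = qv 3" by (auto simp: qv.simps)
  ultimately show ?thesis by auto
qed

abbreviation comm_word :: "letter list" where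
  "comm_word \<equiv> [(False, True), (True, True), (False, False), (True, False)]"

text \<open>As a matrix the commutator is minus a transvection, and cusps do not see the sign. This
  is the origin of the width 6 in \<open>wnd\<close> and \<open>shear\<close>.\<close>

lemma actc_comm: "v \<in> cusps \<Longrightarrow> actc comm_word v = mv (shear 1 (qv 0)) v"
proof -
  assume v: "v \<in> cusps"
  have "mp comm_word v = - mapp (shear 1 (qv 0)) v"
    by (cases v) (simp add: mapp_shear qv.simps det_def)
  moreover have "mapp (shear 1 (qv 0)) v \<noteq> 0"
    by (rule coprime_nonzero[OF mapp_coprime]) (simp_all add: cusp_coprime v)
  ultimately show ?thesis unfolding actc_mp[OF v] mv_def by (metis nrm_minus)
qed

lemma rep_actc: "v \<in> cusps \<Longrightarrow> rep (actc w v) \<longleftrightarrow> rep v"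
  by (induction w) (simp_all add: rep_lm_iff)

lemma rep_shift:
  assumes "(p, q) \<in> cusps" "q > 0" shows "rep (p + 6 * k * q, q) \<longleftrightarrow> rep (p, q)"
proof -
  have one: "rep (p + 6 * q, q) \<longleftrightarrow> rep (p, q)" if "(p, q) \<in> cusps" for p
  proof -
    have "actc comm_word (p, q) = (p + 6 * q, q)"
      unfolding actc_comm[OF that] using assms(2) by (simp add: mv_def mapp_shear qv.simps det_def nrm_def)
    thus ?thesis using rep_actc[OF that, of comm_word] by (simp only:)
  qed
  have cu: "(p + 6 * k * q, q) \<in> cusps" for k
  proof -
    have "gcd (p + (6 * k) * q) q = gcd p q" by (metis gcd_add_mult gcd.commute add.commute)
    hence "coprime (p + 6 * k * q) q" using assms(1) by (simp add: cusps_def coprime_iff_gcd_eq_1)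
    thus ?thesis using assms(2) by (simp add: cusps_def)
  qed
  show ?thesis
  proof (induction k rule: int_induct[of _ 0])
    case (step1 i)
    thus ?case using one[OF cu[of i]] by (simp add: algebra_simps)
  next
    case (step2 i)
    thus ?case using one[OF cu[of "i - 1"]] by (simp add: algebra_simps)
  qed simp
qed

text \<open>A Euclidean algorithm on the denominator: the commutator translates by 6, so the
  numerator can be brought between \<open>- 3 * q\<close> and \<open>3 * q\<close>; there a letter,
  or \<open>x y\<close>, lowers the denominator, apart from a few integers treated by hand.\<close>

lemma rep_cusp: "v \<in> cusps \<Longrightarrow> rep v"
proof (induction "nat (snd v)" arbitrary: v rule: less_induct)
  case less
  obtain p q where v: "v = (p, q)" by (cases v)
  have c: "q > 0 \<or> q = 0 \<and> p = 1" "coprime p q" using less.prems v by (auto simp: cusps_def)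
  show ?case
  proof (cases "q = 0")
    case True
    hence "v = qv 0" using c v by (simp add: qv.simps)
    thus ?thesis using rep_qv by simp
  next
    case False
    hence q: "q > 0" using c by simp
    have down: "rep u" if "u \<in> cusps" "nat (snd (mv (lm l) u)) < nat q \<or> rep (mv (lm l) u)" for u l
    proof -
      have "rep (mv (lm l) u)" using less.hyps[of "mv (lm l) u"] that v by auto
      thus ?thesis using rep_lm_iff[OF that(1)] by blast
    qed
    define k where "k = - ((p + 3 * q) div (6 * q))"
    define r where "r = p + 6 * k * q"
    have r: "- 3 * q \<le> r" "r < 3 * q"
    proof -
      have "r + 3 * q = (p + 3 * q) mod (6 * q)"
        unfolding r_def k_def by (simp add: minus_div_mult_eq_mod[symmetric] algebra_simps)
      moreover have "0 \<le> (p + 3 * q) mod (6 * q)" "(p + 3 * q) mod (6 * q) < 6 * q" using q by simp_all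
      ultimately show "- 3 * q \<le> r" "r < 3 * q" by linarith+
    qed
    have cr: "coprime r q"
    proof -
      have "gcd (p + (6 * k) * q) q = gcd p q" by (metis gcd_add_mult gcd.commute add.commute)
      thus ?thesis using c(2) by (simp add: r_def coprime_iff_gcd_eq_1)
    qed
    have rc: "(r, q) \<in> cusps" using cr q by (simp add: cusps_def)
    have unit: "q = 1" if "q dvd r" using cr q that by (metis coprime_common_divisor dvd_refl zdvd1_eq abs_of_pos)
    have "rep (r, q)"
    proof -
      consider "\<bar>r\<bar> < q" "r \<noteq> 0" | "q < r" "r < 3 * q" | "- 3 * q < r" "r < - q" | "r = 0" | "r = q" | "r = - q" | "r = - 3 * q"
        using r by linarith
      thus ?thesis
      proof cases
        \<comment> \<open>Here \<open>x y\<close>, acting by \<open>3 - 1/z\<close>, has the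
          numerator as its new denominator.\<close>
        case 1
        have m: "mv (lm (False, True)) (mv (lm (True, True)) (r, q)) = nrm (3 * r - q, r)"
          using mv_mv[of "lm (False, True)" "lm (True, True)" "(r, q)"] rc by (simp add: algebra_simps)
        have "snd (nrm (3 * r - q, r)) = \<bar>r\<bar>" using 1 by (auto simp: nrm_def)
        hence "nat (snd (mv (lm (False, True)) (mv (lm (True, True)) (r, q)))) < nat q" unfolding m using 1 by simp
        hence "rep (mv (lm (True, True)) (r, q))" using down[OF mv_lm_cusp[OF rc]] by blast
        thus ?thesis using rep_lm_iff[OF rc] by blast
      next
        case 2
        have "mv (lm (False, False)) (r, q) = nrm (r - q, 2 * q - r)" by (simp add: mv_def algebra_simps)
        moreover have "snd (nrm (r - q, 2 * q - r)) = \<bar>2 * q - r\<bar>" using 2 by (auto simp: nrm_def)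
        ultimately show ?thesis using down[OF rc, of "(False, False)"] abs_less_iff[of "2 * q - r" q] 2 by simp
      next
        case 3
        have "mv (lm (True, False)) (r, q) = nrm (r + q, r + 2 * q)" by (simp add: mv_def algebra_simps)
        moreover have "snd (nrm (r + q, r + 2 * q)) = \<bar>r + 2 * q\<bar>" using 3 by (auto simp: nrm_def)
        ultimately show ?thesis using down[OF rc, of "(True, False)"] abs_less_iff[of "r + 2 * q" q] 3 by simp
      next
        case 4
        thus ?thesis using unit rep_qv[of 2] by (simp add: qv.simps)
      next
        case 5
        thus ?thesis using unit rep_qv[of 3] by (simp add: qv.simps)
      next
        case 6
        thus ?thesis using unit rep_qv[of 1] by (simp add: qv.simps)
      next
        case 7
        hence q1: "q = 1" "r = -3" using unit by auto
        have s: "mv (lm (True, False)) (-3, 1) = (2, 1)" "mv (lm (False, False)) (2, 1) = qv 0"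
          by (simp_all add: mv_def nrm_def qv.simps)
        have cu: "(-3, 1) \<in> cusps" "(2, 1) \<in> cusps" by (simp_all add: cusps_def)
        have "rep (2, 1)" using rep_lm_iff[OF cu(2), of "(False, False)"] s rep_qv[of 0] by simp
        thus ?thesis using rep_lm_iff[OF cu(1), of "(True, False)"] s q1 by simp
      qed
    qed
    thus ?thesis using rep_shift[of p q k] less.prems v q by (simp add: r_def)
  qed
qed

text \<open>The action on cusps of the automorphism that inverts \<open>x\<close>, defined through
  an arbitrary word leading to the cusp; \<open>reflect_unique\<close> makes the choice
  immaterial.\<close>

definition mirror :: "vec \<Rightarrow> vec" where
  "mirror v = actc (map tl_l (SOME w. v = actc w (qv 0))) (qv (flip_i 0))"

text \<open>If the reflected cusps differed, some vertex would be distinct from both, and the three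
  would have a nonzero orientation. By \<open>sgn_tri_reflect\<close> it is minus the orientation of
  a triple with a repeated cusp, which is zero.\<close>

lemma reflect_unique:
  assumes e: "actc w (qv i) = actc w' (qv j)"
  shows "actc (map tl_l w) (qv (flip_i i)) = actc (map tl_l w') (qv (flip_i j))" (is "?a = ?b")
proof (rule ccontr)
  assume ne: "?a \<noteq> ?b"
  have "\<exists>k. qv (flip_i k) \<noteq> ?a \<and> qv (flip_i k) \<noteq> ?b"
  proof (rule ccontr)
    assume "\<nexists>k. qv (flip_i k) \<noteq> ?a \<and> qv (flip_i k) \<noteq> ?b"
    hence "\<forall>k. qv (flip_i k) = ?a \<or> qv (flip_i k) = ?b" by blast
    hence "qv (flip_i 0) \<in> {?a, ?b}" "qv (flip_i 1) \<in> {?a, ?b}" "qv (flip_i 2) \<in> {?a, ?b}" by auto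
    moreover have "qv (flip_i 0) \<noteq> qv (flip_i 1)" "qv (flip_i 1) \<noteq> qv (flip_i 2)" "qv (flip_i 0) \<noteq> qv (flip_i 2)"
      by (simp_all add: qv.simps flip_i_def)
    ultimately show False by (metis insert_iff singletonD)
  qed
  then obtain k where k: "qv (flip_i k) \<noteq> ?a" "qv (flip_i k) \<noteq> ?b" by blast
  have "sgn (tri ?a ?b (actc (map tl_l []) (qv (flip_i k)))) = - sgn (tri (actc w (qv i)) (actc w' (qv j)) (actc [] (qv k)))"
    by (rule sgn_tri_reflect)
  also have "\<dots> = 0" using e by (simp add: tri_def)
  finally have "det ?a ?b * det ?b (qv (flip_i k)) * det (qv (flip_i k)) ?a = 0" by (simp add: tri_def sgn_0_0)
  thus False using ne k det_zero_iff[of ?a ?b] det_zero_iff[of ?b "qv (flip_i k)"] det_zero_iff[of "qv (flip_i k)" ?a]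
    by (simp add: qv_cusp)
qed

lemma mirror_word: "mirror (actc w (qv i)) = actc (map tl_l w) (qv (flip_i i))"
proof -
  let ?v = "actc w (qv i)"
  have "\<exists>w. ?v = actc w (qv 0)" using rep_cusp[of ?v] by (simp add: rep_def)
  hence "?v = actc (SOME w. ?v = actc w (qv 0)) (qv 0)" by (rule someI_ex)
  thus ?thesis unfolding mirror_def using reflect_unique by metis
qed

lemma cusp_word: "v \<in> cusps \<Longrightarrow> \<exists>w. v = actc w (qv 0)"
  using rep_cusp by (simp add: rep_def)

lemma mirror_cusp [simp]: "v \<in> cusps \<Longrightarrow> mirror v \<in> cusps"
  using cusp_word mirror_word by (metis actc_cusp qv_cusp)

lemma mirror_lm: "v \<in> cusps \<Longrightarrow> mirror (mv (lm l) v) = mv (lm (tl_l l)) (mirror v)"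
  using cusp_word[of v] mirror_word[of _ 0] mirror_word[of "l # _" 0] by force

lemma flip_i_flip_i: "qv (flip_i (flip_i i)) = qv i"
  by (auto simp: qv.simps flip_i_def)

lemma mirror_mirror: "v \<in> cusps \<Longrightarrow> mirror (mirror v) = v"
proof -
  assume "v \<in> cusps"
  then obtain w where w: "v = actc w (qv 0)" using cusp_word by blast
  have "mirror (mirror v) = actc (map tl_l (map tl_l w)) (qv (flip_i (flip_i 0)))" unfolding w mirror_word by simp
  thus ?thesis unfolding w by (simp add: flip_i_flip_i o_def)
qed

lemma mirror_tri:
  assumes "a \<in> cusps" "b \<in> cusps" "c \<in> cusps"
  shows "sgn (tri (mirror a) (mirror b) (mirror c)) = - sgn (tri a b c)"
  using assms[THEN cusp_word] sgn_tri_reflect mirror_word by metis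

text \<open>At \<open>\<infinity>\<close> the shear is the commutator of \<open>x\<close> and
  \<open>y\<close>; that of \<open>x\<inverse>\<close> and \<open>y\<close> is the inverse shear at
  -1, the mirror image of \<open>\<infinity>\<close>. Every other cusp is reached by equivariance,
  letter by letter.\<close>

lemma mirror_shear_one:
  assumes "e \<in> cusps" "v \<in> cusps"
  shows "mirror (mv (shear 1 e) v) = mv (shear (-1) (mirror e)) (mirror v)"
proof -
  obtain w where w: "e = actc w (qv 0)" using cusp_word assms by blast
  show ?thesis using assms(2) unfolding w
  proof (induction w arbitrary: v)
    case Nil
    have m: "mirror (actc u v) = actc (map tl_l u) (mirror v)" for u
      by (induction u) (use Nil in \<open>simp_all add: mirror_lm\<close>)
    have 1: "mirror (mv (shear 1 (qv 0)) v) = actc (map tl_l comm_word) (mirror v)"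
      using actc_comm[OF Nil] m[of comm_word] by simp
    have q: "mirror (qv 0) = qv 1" using mirror_word[of "[]" 0] by (simp add: flip_i_def)
    have mc: "mirror v \<in> cusps" using Nil by simp
    have "mp (map tl_l comm_word) u = - mapp (shear (-1) (qv 1)) u" for u
      by (cases u) (simp add: mapp_shear qv.simps det_def tl_l_def linv_def)
    moreover have "mapp (shear (-1) (qv 1)) (mirror v) \<noteq> 0"
      by (rule coprime_nonzero[OF mapp_coprime]) (simp_all add: cusp_coprime mc)
    ultimately have "actc (map tl_l comm_word) (mirror v) = mv (shear (-1) (qv 1)) (mirror v)"
      unfolding actc_mp[OF mc] mv_def by (metis nrm_minus)
    thus ?case using 1 q by simp
  next
    case (Cons l w)
    let ?e = "actc w (qv 0)" and ?u = "mv (lm (linv l)) v"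
    have u: "?u \<in> cusps" "v = mv (lm l) ?u" "?e \<in> cusps" using Cons.prems by auto
    have "mv (shear 1 (mv (lm l) ?e)) v = mv (lm l) (mv (shear 1 ?e) ?u)"
      using shear_conj[of "lm l" ?e ?u 1] u by simp
    hence "mirror (mv (shear 1 (actc (l # w) (qv 0))) v) = mv (lm (tl_l l)) (mv (shear (-1) (mirror ?e)) (mirror ?u))"
      using Cons.IH[OF u(1)] mirror_lm[of "mv (shear 1 ?e) ?u" l] u mv_cusp[of "shear 1 ?e" ?u] by simp
    also have "\<dots> = mv (shear (-1) (mv (lm (tl_l l)) (mirror ?e))) (mv (lm (tl_l l)) (mirror ?u))"
      using shear_conj[of "lm (tl_l l)" "mirror ?e" "mirror ?u" "-1"] u by simp
    also have "mv (lm (tl_l l)) (mirror ?u) = mirror v" using mirror_lm[OF u(1), of l] u(2) by simp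
    also have "mv (lm (tl_l l)) (mirror ?e) = mirror (actc (l # w) (qv 0))" using mirror_lm[OF u(3), of l] by simp
    finally show ?case .
  qed
qed

lemma mirror_shear:
  assumes e: "e \<in> cusps" "v \<in> cusps"
  shows "mirror (mv (shear k e) v) = mv (shear (- k) (mirror e)) (mirror v)"
proof -
  have nat: "mirror (mv (shear (int n) e) v) = mv (shear (- int n) (mirror e)) (mirror v)" if "v \<in> cusps" for n v
  proof (induction n)
    case 0
    thus ?case using that by (simp add: shear_zero)
  next
    case (Suc n)
    let ?u = "mv (shear (int n) e) v"
    have u: "?u \<in> cusps" using that by (simp add: mv_cusp)
    have "mirror (mv (shear (int (Suc n)) e) v) = mirror (mv (shear 1 e) ?u)" using shear_add[OF e(1) that, of 1 "int n"] by simp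
    also have "\<dots> = mv (shear (-1) (mirror e)) (mv (shear (- int n) (mirror e)) (mirror v))"
      using mirror_shear_one[OF e(1) u] Suc by simp
    also have "\<dots> = mv (shear (-1 - int n) (mirror e)) (mirror v)"
      using shear_add[of "mirror e" "mirror v" "-1" "- int n"] e that by simp
    finally show ?case by simp
  qed
  show ?thesis
  proof (cases "k \<ge> 0")
    case True
    thus ?thesis using nat[OF e(2), of "nat k"] by simp
  next
    case False
    let ?u = "mv (shear k e) v"
    have u: "?u \<in> cusps" using e by (simp add: mv_cusp)
    have "v = mv (shear (- k) e) ?u" using shear_add[OF e, of "- k" k] shear_zero[OF e(2)] by simp
    hence "mirror v = mirror (mv (shear (- k) e) ?u)" by simp
    hence "mirror v = mv (shear k (mirror e)) (mirror ?u)" using nat[OF u, of "nat (- k)"] False by simp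
    hence "mv (shear (- k) (mirror e)) (mirror v) = mirror ?u"
      using shear_add[of "mirror e" "mirror ?u" "- k" k] shear_zero[of "mirror ?u"] e u by simp
    thus ?thesis by simp
  qed
qed

text \<open>Shearing by \<open>k\<close> first turns a comparison with \<open>k\<close> into a
  comparison with zero, that is, into a cyclic orientation. The mirror reverses orientations and
  inverts shears, so it reverses winding with respect to all integer thresholds.\<close>

lemma wnd_pos_tri:
  assumes "e \<in> cusps" "a \<in> cusps" "b \<in> cusps" "a \<noteq> e" "b \<noteq> e"
  shows "wnd e a b > of_int k \<longleftrightarrow> tri e (mv (shear k e) a) b > 0" "wnd e a b < of_int k \<longleftrightarrow> tri e (mv (shear k e) a) b < 0"
proof -
  let ?a = "mv (shear k e) a"
  have ac: "?a \<in> cusps" using assms by (simp add: mv_cusp)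
  have ae: "?a \<noteq> e"
  proof
    assume "?a = e"
    hence "mv (shear k e) a = mv (shear k e) e" using mv_shear_fix assms by simp
    thus False using winding_map_inj[OF mv_winding_map[of "shear k e"]] assms by simp
  qed
  have "wnd e a ?a = k" using wnd_shear[of e a k] assms det_zero_iff[of e a] by auto
  hence w: "wnd e a b = of_int k + wnd e ?a b" using wnd_add_cusp[of e a ?a b] assms ac ae by simp
  have d: "det e ?a \<noteq> 0" "det b e \<noteq> 0" using det_zero_iff assms ac ae by auto
  have s: "sgn (wnd e ?a b) = real_of_int (sgn (tri e ?a b))"
  proof -
    have "sgn (x / (6 * y * z)) = sgn x * sgn y * sgn z" for x y z :: real
    proof (cases "y = 0 \<or> z = 0")
      case True
      thus ?thesis by auto
    next
      case False
      hence "x / (6 * y * z) = (x * y * z) * (1 / (6 * (y * z)\<^sup>2))" by (simp add: field_simps power2_eq_square)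
      moreover have "sgn (1 / (6 * (y * z)\<^sup>2)) = 1" using False by (intro sgn_pos) simp
      ultimately show ?thesis by (simp only: sgn_mult mult_1_right)
    qed
    hence "sgn (wnd e ?a b) = sgn (real_of_int (det ?a b)) * sgn (real_of_int (det e ?a)) * sgn (real_of_int (det b e))"
      unfolding wnd_def of_int_mult of_int_numeral .
    moreover have "sgn (real_of_int x) = real_of_int (sgn x)" for x by (simp add: sgn_if)
    ultimately show ?thesis unfolding tri_def sgn_mult of_int_mult by simp
  qed
  show "wnd e a b > of_int k \<longleftrightarrow> tri e ?a b > 0" using w s
    by (auto simp: sgn_if split: if_splits)
  show "wnd e a b < of_int k \<longleftrightarrow> tri e ?a b < 0" using w s
    by (auto simp: sgn_if split: if_splits)
qed

lemma mirror_winding_map: "winding_map (-1) mirror"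
proof -
  have bij: "bij_betw mirror cusps cusps"
    by (rule bij_betw_byWitness[where f' = mirror]) (auto simp: mirror_mirror)
  have inj: "mirror a = mirror b \<longleftrightarrow> a = b" if "a \<in> cusps" "b \<in> cusps" for a b
    using mirror_mirror that by metis
  have "(- 1 * wnd (mirror e) (mirror a) (mirror b) > of_int k) = (wnd e a b > of_int k) \<and>
      (- 1 * wnd (mirror e) (mirror a) (mirror b) < of_int k) = (wnd e a b < of_int k)"
    if C: "e \<in> cusps" "a \<in> cusps" "b \<in> cusps" for e a b and k :: int
  proof (cases "a = e \<or> b = e")
    case True
    thus ?thesis by auto
  next
    case False
    hence ne: "a \<noteq> e" "b \<noteq> e" "mirror a \<noteq> mirror e" "mirror b \<noteq> mirror e" using inj C by auto
    let ?a = "mv (shear k e) a"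
    have ac: "?a \<in> cusps" using C by (simp add: mv_cusp)
    have t: "sgn (tri (mirror e) (mirror ?a) (mirror b)) = - sgn (tri e ?a b)" using mirror_tri C ac by simp
    have m: "mirror ?a = mv (shear (- k) (mirror e)) (mirror a)" using mirror_shear C by simp
    have tt: "tri (mirror e) (mirror ?a) (mirror b) < 0 \<longleftrightarrow> tri e ?a b > 0" "tri (mirror e) (mirror ?a) (mirror b) > 0 \<longleftrightarrow> tri e ?a b < 0"
      using t by (auto simp: sgn_if split: if_splits)
    have A: "wnd (mirror e) (mirror a) (mirror b) > of_int (- k) \<longleftrightarrow> tri (mirror e) (mirror ?a) (mirror b) > 0"
      "wnd (mirror e) (mirror a) (mirror b) < of_int (- k) \<longleftrightarrow> tri (mirror e) (mirror ?a) (mirror b) < 0"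
      unfolding m using wnd_pos_tri[of "mirror e" "mirror a" "mirror b" "- k"] C ne by auto
    show ?thesis using A tt wnd_pos_tri[OF C ne(1,2), of k] by auto
  qed
  thus ?thesis unfolding winding_map_def using bij by auto
qed

section \<open>Bases of the free group of rank two\<close>

lemma linv_eq_iff [simp]: "linv l = linv m \<longleftrightarrow> l = m"
  by (metis linv_linv)

definition wi :: "letter list \<Rightarrow> letter list" where
  "wi w = rev (map linv w)"

lemma wi_simps [simp]: "wi [] = []" "wi (l # w) = wi w @ [linv l]" "wi (u @ w) = wi w @ wi u" "wi w = [] \<longleftrightarrow> w = []"
    "length (wi w) = length w" "wi (wi w) = w"
  by (simp_all add: wi_def rev_map o_def)

lemma hd_wi: "w \<noteq> [] \<Longrightarrow> hd (wi w) = linv (last w)" and last_wi: "w \<noteq> [] \<Longrightarrow> last (wi w) = linv (hd w)"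
  by (simp_all add: wi_def hd_rev last_rev last_map hd_map)

lemma rd_Cons: "rd (l # w) \<longleftrightarrow> rd w \<and> (w \<noteq> [] \<longrightarrow> hd w \<noteq> linv l)"
  by (cases w) auto

lemma rd_append: "rd (u @ w) \<longleftrightarrow> rd u \<and> rd w \<and> (u \<noteq> [] \<and> w \<noteq> [] \<longrightarrow> hd w \<noteq> linv (last u))"
  by (induction u) (auto simp: rd_Cons hd_append)

lemma rd_wi [simp]: "rd (wi w) \<longleftrightarrow> rd w"
proof -
  have "rd (wi w)" if "rd w" for w using that
    by (induction w) (auto simp: rd_Cons rd_append last_wi)
  thus ?thesis by (metis wi_simps(6))
qed

locale free2 = group K for K (structure) + fixes e :: "letter \<Rightarrow> 'a"
  assumes e_closed [simp]: "e l \<in> carrier K" and e_linv: "e (linv l) = inv (e l)"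
    and e_free: "rd w \<Longrightarrow> w \<noteq> [] \<Longrightarrow> foldr (\<lambda>l x. e l \<otimes> x) w \<one> \<noteq> \<one>"
begin

definition ev :: "letter list \<Rightarrow> 'a" where
  "ev w = foldr (\<lambda>l x. e l \<otimes> x) w \<one>"

lemma ev_simps [simp]: "ev [] = \<one>" "ev (l # w) = e l \<otimes> ev w"
  by (simp_all add: ev_def)

lemma ev_closed [simp]: "ev w \<in> carrier K"
  by (induction w) auto

lemma ev_append [simp]: "ev (u @ w) = ev u \<otimes> ev w"
  by (induction u) (auto simp: m_assoc)

lemma ev_wi [simp]: "ev (wi w) = inv (ev w)"
  by (induction w) (auto simp: inv_mult_group e_linv)

lemma ev_free: "rd w \<Longrightarrow> w \<noteq> [] \<Longrightarrow> ev w \<noteq> \<one>"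
  using e_free by (simp add: ev_def)

lemma e_cancel: "x \<in> carrier K \<Longrightarrow> e (linv l) \<otimes> (e l \<otimes> x) = x" "x \<in> carrier K \<Longrightarrow> e l \<otimes> (e (linv l) \<otimes> x) = x"
  by (simp_all add: e_linv m_assoc[symmetric])

lemma ev_rd: "\<exists>w'. rd w' \<and> ev w' = ev w"
proof (induction w)
  case Nil
  thus ?case by (intro exI[of _ "[]"]) simp
next
  case (Cons l w)
  then obtain w' where w: "rd w'" "ev w' = ev w" by blast
  show ?case
  proof (cases "rd (l # w')")
    case True
    thus ?thesis using w by (intro exI[of _ "l # w'"]) simp
  next
    case False
    then obtain t where t: "w' = linv l # t" using w(1) by (cases w') (auto simp: rd_Cons)
    thus ?thesis using w e_cancel(2)[of "ev t" l] by (intro exI[of _ t]) (auto simp: rd_Cons)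
  qed
qed

lemma ev_letter:
  assumes "rd w" "ev w = e l" shows "w = [l]"
proof (cases "w \<noteq> [] \<and> hd w = l")
  case True
  then obtain t where t: "w = l # t" by (cases w) auto
  hence "ev t = \<one>" using assms(2) l_cancel_one[of "e l" "ev t"] by simp
  thus ?thesis using ev_free[of t] t assms(1) rd_tl by blast
next
  case False
  hence "rd (linv l # w)" using assms(1) by (auto simp: rd_Cons)
  moreover have "ev (linv l # w) = \<one>" using assms(2) by (simp add: e_linv)
  ultimately show ?thesis using ev_free by blast
qed

text \<open>Quantifying over subgroups, rather than naming the generated one, reduces the invariance
  under changes of the pair to membership.\<close>

definition spans :: "'a \<Rightarrow> 'a \<Rightarrow> bool" where
  "spans U V \<longleftrightarrow> (\<forall>S. subgroup S K \<longrightarrow> U \<in> S \<longrightarrow> V \<in> S \<longrightarrow> range e \<subseteq> S)"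

lemma spans_trans:
  "spans U V \<Longrightarrow> (\<And>S. subgroup S K \<Longrightarrow> U' \<in> S \<Longrightarrow> V' \<in> S \<Longrightarrow> U \<in> S \<and> V \<in> S) \<Longrightarrow> spans U' V'"
  unfolding spans_def by blast

text \<open>The elements that, together with their inverses, map \<open>L\<close> into itself form a
  subgroup. In the applications \<open>L\<close> consists of alternating products, so spanning
  exhibits a letter as such a product.\<close>

lemma spans_orbit:
  assumes sp: "spans U V" and UV: "U \<in> carrier K" "V \<in> carrier K" and LL: "L \<subseteq> carrier K" "\<one> \<in> L"
    and cl: "\<And>N. N \<in> L \<Longrightarrow> U \<otimes> N \<in> L \<and> inv U \<otimes> N \<in> L \<and> V \<otimes> N \<in> L \<and> inv V \<otimes> N \<in> L"
  shows "e l \<in> L"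
proof -
  let ?S = "{M \<in> carrier K. \<forall>N\<in>L. M \<otimes> N \<in> L \<and> inv M \<otimes> N \<in> L}"
  have "subgroup ?S K"
  proof (rule subgroupI)
    show "?S \<noteq> {}" using LL by (auto intro!: exI[of _ \<one>])
    fix M N assume MN: "M \<in> ?S" "N \<in> ?S"
    have "M \<otimes> N \<otimes> x \<in> L \<and> inv (M \<otimes> N) \<otimes> x \<in> L" if "x \<in> L" for x
    proof -
      have "x \<in> carrier K" using that LL by blast
      hence "M \<otimes> N \<otimes> x = M \<otimes> (N \<otimes> x)" "inv (M \<otimes> N) \<otimes> x = inv N \<otimes> (inv M \<otimes> x)"
        using MN by (simp_all add: m_assoc inv_mult_group)
      thus ?thesis using MN that by simp
    qed
    thus "M \<otimes> N \<in> ?S" using MN by simp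
  qed auto
  hence "range e \<subseteq> ?S" using sp UV cl unfolding spans_def by simp
  hence "e l \<otimes> \<one> \<in> L" using LL(2) by blast
  thus ?thesis by simp
qed

text \<open>Two rounds of centralisers: the generators commute with \<open>U\<close>, hence with one
  another, but their commutator is a nonempty reduced word.\<close>

lemma spans_noncommuting:
  assumes "spans U \<one>" "U \<in> carrier K" shows False
proof -
  have cent: "subgroup {M \<in> carrier K. M \<otimes> c = c \<otimes> M} K" if c: "c \<in> carrier K" for c
  proof (rule subgroupI)
    show "{M \<in> carrier K. M \<otimes> c = c \<otimes> M} \<noteq> {}" using c by (auto intro!: exI[of _ \<one>])
  next
    fix M assume M: "M \<in> {M \<in> carrier K. M \<otimes> c = c \<otimes> M}"
    hence "inv M \<otimes> c \<otimes> M = inv M \<otimes> (M \<otimes> c)" using c by (simp add: m_assoc)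
    also have "\<dots> = c" using M c by (subst m_assoc[symmetric]) auto
    finally have "inv M \<otimes> c = c \<otimes> inv M" using M c inv_solve_right[of "inv M \<otimes> c" c M] by simp
    thus "inv M \<in> {M \<in> carrier K. M \<otimes> c = c \<otimes> M}" using M by simp
  next
    fix M N
    assume MN: "M \<in> {M \<in> carrier K. M \<otimes> c = c \<otimes> M}" "N \<in> {M \<in> carrier K. M \<otimes> c = c \<otimes> M}"
    have "M \<otimes> N \<otimes> c = M \<otimes> (N \<otimes> c)" using MN c m_assoc by simp
    also have "\<dots> = M \<otimes> (c \<otimes> N)" using MN by simp
    also have "\<dots> = M \<otimes> c \<otimes> N" using MN c m_assoc[of M c N] by (simp only: mem_Collect_eq)
    also have "\<dots> = c \<otimes> M \<otimes> N" using MN by simp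
    finally show "M \<otimes> N \<in> {M \<in> carrier K. M \<otimes> c = c \<otimes> M}" using MN c by (simp add: m_assoc)
  qed auto
  have cc: "e l \<otimes> c = c \<otimes> e l" if "c \<in> carrier K" "U \<otimes> c = c \<otimes> U" for c l
  proof -
    have "range e \<subseteq> {M \<in> carrier K. M \<otimes> c = c \<otimes> M}"
      using assms(1)[unfolded spans_def, rule_format, OF cent[OF that(1)]] that assms(2) by simp
    thus ?thesis by blast
  qed
  have 1: "e l \<otimes> U = U \<otimes> e l" for l using cc[of U l] assms(2) by simp
  let ?x = "(False, True)" and ?y = "(True, True)"
  have 2: "e ?y \<otimes> e ?x = e ?x \<otimes> e ?y" using cc[of "e ?x" ?y] 1[of ?x] by simp
  have "ev [?x, ?y, linv ?x, linv ?y] = e ?x \<otimes> e ?y \<otimes> (inv (e ?x) \<otimes> inv (e ?y))"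
    by (simp add: e_linv m_assoc)
  also have "\<dots> = e ?x \<otimes> e ?y \<otimes> inv (e ?x \<otimes> e ?y)" using 2 inv_mult_group[of "e ?y" "e ?x"] by simp
  finally have "ev [?x, ?y, linv ?x, linv ?y] = \<one>" by simp
  moreover have "rd [?x, ?y, linv ?x, linv ?y]" by (simp add: linv_def)
  ultimately show False using ev_free by blast
qed

text \<open>Closed paths without backtracking in a theta graph: each pair goes out along the edge
  \<open>p\<close> and returns along the edge \<open>q\<close>.\<close>

fun alt3 :: "(nat \<times> nat) list \<Rightarrow> bool" where
  "alt3 [] = True"
| "alt3 ((p, q) # r) = (p < 3 \<and> q < 3 \<and> p \<noteq> q \<and> (r \<noteq> [] \<longrightarrow> fst (hd r) \<noteq> q) \<and> alt3 r)"

text \<open>If the edge words differ pairwise in their first and in their last letters, the graph is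
  folded: paths without backtracking spell reduced words. A nonempty closed one crosses at least two
  edges, so no loop spells a single letter.\<close>

lemma theta_not_spanning:
  fixes w :: "nat \<Rightarrow> letter list"
  assumes w: "\<And>i. i < 3 \<Longrightarrow> rd (w i) \<and> w i \<noteq> []"
    and h: "\<And>i j. i < 3 \<Longrightarrow> j < 3 \<Longrightarrow> i \<noteq> j \<Longrightarrow> hd (w i) \<noteq> hd (w j) \<and> last (w i) \<noteq> last (w j)"
    and sp: "spans (ev (w 0) \<otimes> inv (ev (w 2))) (ev (w 1) \<otimes> inv (ev (w 2)))"
  shows False
proof -
  define val where "val r = foldr (\<lambda>(p, q) x. ev (w p) \<otimes> inv (ev (w q)) \<otimes> x) r \<one>" for r
  have val_simps [simp]: "val [] = \<one>" "val ((p, q) # r) = ev (w p) \<otimes> inv (ev (w q)) \<otimes> val r" for p q r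
    by (simp_all add: val_def)
  have val_cl [simp]: "val r \<in> carrier K" for r by (induction r) auto
  let ?L = "val ` Collect alt3"
  have cl: "ev (w a) \<otimes> inv (ev (w c)) \<otimes> N \<in> ?L" if N: "N \<in> ?L" and ac: "a < 3" "c < 3" "a \<noteq> c" for a c N
  proof -
    obtain r where r: "alt3 r" "N = val r" using N by blast
    show ?thesis
    proof (cases "r \<noteq> [] \<and> fst (hd r) = c")
      case True
      then obtain q r' where q: "r = (c, q) # r'" by (cases r) auto
      have e: "ev (w a) \<otimes> inv (ev (w c)) \<otimes> N = ev (w a) \<otimes> inv (ev (w q)) \<otimes> val r'"
        using r(2) q inv_solve_left[of "inv (ev (w q)) \<otimes> val r'" "ev (w c)" "ev (w c) \<otimes> (inv (ev (w q)) \<otimes> val r')"]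
        by (simp add: m_assoc)
      show ?thesis
      proof (cases "a = q")
        case True
        thus ?thesis using e r q by simp
      next
        case False
        hence "alt3 ((a, q) # r')" using r q ac by simp
        thus ?thesis unfolding e by (metis val_simps(2) image_eqI mem_Collect_eq)
      qed
    next
      case False
      hence "alt3 ((a, c) # r)" using r ac by auto
      thus ?thesis unfolding r(2) by (metis val_simps(2) image_eqI mem_Collect_eq)
    qed
  qed
  have inv_eq: "inv (ev (w a) \<otimes> inv (ev (w c))) = ev (w c) \<otimes> inv (ev (w a))" for a c by (simp add: inv_mult_group)
  have x: "e l \<in> ?L" for l
  proof (rule spans_orbit[OF sp])
    show "\<one> \<in> ?L" by (rule image_eqI[of _ _ "[]"]) auto
  qed (auto simp del: image_iff simp: inv_eq intro!: cl)
  have wd: "\<exists>u. rd u \<and> ev u = val r \<and> length u \<ge> 2 \<and> hd u = hd (w (fst (hd r)))" if "alt3 r" "r \<noteq> []" for r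
    using that
  proof (induction r rule: alt3.induct)
    case (2 p q r)
    have u0: "rd (w p @ wi (w q))" "length (w p @ wi (w q)) \<ge> 2" "w p \<noteq> []" "wi (w q) \<noteq> []"
    proof -
      show ne: "w p \<noteq> []" "wi (w q) \<noteq> []" using 2 w by auto
      thus "length (w p @ wi (w q)) \<ge> 2" by (cases "w p"; cases "wi (w q)") auto
      have "last (w p) \<noteq> last (w q)" using 2 h by auto
      thus "rd (w p @ wi (w q))" using 2 w[of p] w[of q] by (auto simp: rd_append hd_wi)
    qed
    show ?case
    proof (cases "r = []")
      case True
      thus ?thesis using u0 by (intro exI[of _ "w p @ wi (w q)"]) simp
    next
      case False
      then obtain u where u: "rd u" "ev u = val r" "length u \<ge> 2" "hd u = hd (w (fst (hd r)))" using 2 by auto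
      have "fst (hd r) < 3" using 2 False by (cases r) auto
      hence "hd u \<noteq> hd (w q)" using u 2 False h[of "fst (hd r)" q] by simp
      hence "rd ((w p @ wi (w q)) @ u)" using u0 u w[of q] 2 by (subst rd_append) (auto simp: last_wi)
      thus ?thesis using u0 u by (intro exI[of _ "(w p @ wi (w q)) @ u"]) (simp add: m_assoc)
    qed
  qed simp
  have "e (False, True) \<in> ?L" by (rule x)
  then obtain r where r: "alt3 r" "e (False, True) = val r" by blast
  show False
  proof (cases "r = []")
    case True
    thus False using ev_free[of "[(False, True)]"] r by simp
  next
    case False
    then obtain u where "rd u" "ev u = e (False, True)" "length u \<ge> 2" using wd r by metis
    thus False using ev_letter[of u] by fastforce
  qed
qed

text \<open>A word whose ends cancel is a conjugate, by its first letter, of a shorter core. Taking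
  powers of the core keeps the outer letters.\<close>

lemma power_word:
  assumes "rd w" "w \<noteq> []" "k > (0::nat)"
  shows "\<exists>u. rd u \<and> u \<noteq> [] \<and> ev u = ev w [^] k \<and> hd u = hd w \<and> last u = last w \<and> length u \<ge> length w"
  using assms
proof (induction w rule: length_induct)
  case (1 w)
  show ?case
  proof (cases "hd w = linv (last w)")
    case False
    have "\<exists>u. rd u \<and> u \<noteq> [] \<and> ev u = ev w [^] Suc n \<and> hd u = hd w \<and> last u = last w \<and> length u \<ge> length w" for n
    proof (induction n)
      case 0
      thus ?case using 1 by (intro exI[of _ w]) simp
    next
      case (Suc n)
      then obtain u where "rd u" "u \<noteq> []" "ev u = ev w [^] Suc n" "hd u = hd w" "last u = last w" by blast
      thus ?case using 1 False by (intro exI[of _ "u @ w"]) (simp add: rd_append)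
    qed
    thus ?thesis using \<open>k > 0\<close> by (metis Suc_pred)
  next
    case True
    obtain l t where t: "w = l # t" using 1 by (cases w) auto
    have "t \<noteq> []" using True t by auto
    then obtain v m where v: "t = v @ [m]" by (metis rev_exhaust)
    have m: "w = l # v @ [linv l]" "m = linv l" using True t v by auto
    have v0: "v \<noteq> []" using 1 m by auto
    have v1: "rd v" "hd v \<noteq> linv l" "l \<noteq> last v" using 1(2) m(1) v0 by (auto simp: rd_Cons rd_append)
    have "length v < length w" using m(1) by simp
    note 1(1)[rule_format, OF this v1(1) v0 \<open>k > 0\<close>]
    then obtain u where u: "rd u" "u \<noteq> []" "ev u = ev v [^] k" "hd u = hd v" "last u = last v" "length u \<ge> length v"
      by blast
    have cp: "(g \<otimes> x \<otimes> inv g) [^] n = g \<otimes> x [^] n \<otimes> inv g" if "g \<in> carrier K" "x \<in> carrier K" for g x and n :: nat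
    proof (induction n)
      case (Suc n)
      have "g \<otimes> x [^] n \<otimes> inv g \<otimes> (g \<otimes> x \<otimes> inv g) = g \<otimes> x [^] n \<otimes> (inv g \<otimes> g) \<otimes> (x \<otimes> inv g)"
        using that by (simp add: m_assoc)
      thus ?case using that Suc by (simp add: m_assoc)
    qed (use that in simp)
    have "ev w [^] k = ev (l # u @ [linv l])" using cp[of "e l" "ev v" k] u(3) m(1) by (simp add: e_linv m_assoc)
    moreover have "rd (l # u @ [linv l])" using u v1 by (auto simp: rd_Cons rd_append)
    ultimately show ?thesis using u m by (intro exI[of _ "l # u @ [linv l]"]) simp
  qed
qed

fun alt2 :: "(bool \<times> int) list \<Rightarrow> bool" where
  "alt2 [] = True"
| "alt2 ((b, k) # r) = (k \<noteq> 0 \<and> (r \<noteq> [] \<longrightarrow> fst (hd r) \<noteq> b) \<and> alt2 r)"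

text \<open>The analogue for a rose with two petals. Only ends of different petals must differ; a
  petal may cancel against itself, which \<open>power_word\<close> absorbs. A product with several
  syllables is too long for a letter, so one petal is that letter or its inverse.\<close>

lemma rose_spanning:
  assumes w: "\<And>b. rd (w b) \<and> w b \<noteq> []"
    and h: "{hd (w True), linv (last (w True))} \<inter> {hd (w False), linv (last (w False))} = {}"
    and sp: "spans (ev (w False)) (ev (w True))"
  shows "\<exists>b. w b = [l] \<or> w b = [linv l]"
proof -
  define E where "E b = {hd (w b), linv (last (w b))}" for b
  have E: "E b \<inter> E (\<not> b) = {}" for b using h by (cases b) (auto simp: E_def)
  define val where "val r = foldr (\<lambda>(b, k) x. ev (w b) [^] (k::int) \<otimes> x) r \<one>" for r
  have val_simps [simp]: "val [] = \<one>" "val ((b, k) # r) = ev (w b) [^] k \<otimes> val r" for b k r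
    by (simp_all add: val_def)
  have val_cl [simp]: "val r \<in> carrier K" for r by (induction r) auto
  let ?L = "val ` Collect alt2"
  have cl: "ev (w b) [^] j \<otimes> N \<in> ?L" if N: "N \<in> ?L" and j: "j \<noteq> 0" for b N and j :: int
  proof -
    obtain r where r: "alt2 r" "N = val r" using N by blast
    show ?thesis
    proof (cases "r \<noteq> [] \<and> fst (hd r) = b")
      case True
      then obtain k r' where q: "r = (b, k) # r'" by (cases r) auto
      have e: "ev (w b) [^] j \<otimes> N = ev (w b) [^] (j + k) \<otimes> val r'"
        using r(2) q by (simp add: m_assoc int_pow_mult)
      show ?thesis
      proof (cases "j + k = 0")
        case True
        thus ?thesis using e r q by simp
      next
        case False
        hence "alt2 ((b, j + k) # r')" using r q by simp
        thus ?thesis unfolding e by (metis val_simps(2) image_eqI mem_Collect_eq)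
      qed
    next
      case False
      hence "alt2 ((b, j) # r)" using r j by auto
      thus ?thesis unfolding r(2) by (metis val_simps(2) image_eqI mem_Collect_eq)
    qed
  qed
  have x: "e l \<in> ?L"
  proof (rule spans_orbit[OF sp])
    show "\<one> \<in> ?L" by (rule image_eqI[of _ _ "[]"]) auto
    fix N assume N: "N \<in> ?L"
    have c: "ev (w b) \<otimes> N \<in> ?L \<and> inv (ev (w b)) \<otimes> N \<in> ?L" for b
      using cl[OF N, of 1 b] cl[OF N, of "-1" b] int_pow_neg[of "ev (w b)" 1] by (simp del: image_iff)
    show "ev (w False) \<otimes> N \<in> ?L \<and> inv (ev (w False)) \<otimes> N \<in> ?L \<and> ev (w True) \<otimes> N \<in> ?L \<and> inv (ev (w True)) \<otimes> N \<in> ?L"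
      using c[of True] c[of False] by blast
  qed auto
  have blk: "\<exists>u. rd u \<and> u \<noteq> [] \<and> ev u = ev (w b) [^] k \<and> hd u \<in> E b \<and> linv (last u) \<in> E b \<and> length u \<ge> length (w b)"
    if k: "k \<noteq> 0" for b and k :: int
  proof -
    have wb: "rd (w b)" "w b \<noteq> []" using w[of b] by auto
    obtain u where u: "rd u" "u \<noteq> []" "ev u = ev (w b) [^] nat \<bar>k\<bar>" "hd u = hd (w b)" "last u = last (w b)" "length u \<ge> length (w b)"
      using power_word[OF wb, of "nat \<bar>k\<bar>"] k by auto
    show ?thesis
    proof (cases "k > 0")
      case True
      hence "ev u = ev (w b) [^] k" using u(3) int_pow_int[of K "ev (w b)" "nat k"] by simp
      thus ?thesis using u by (intro exI[of _ u]) (simp add: E_def)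
    next
      case False
      hence "ev (wi u) = ev (w b) [^] k" using u(3) int_pow_int[of K "ev (w b)" "nat (- k)"] int_pow_neg[of "ev (w b)" "- k"] by simp
      thus ?thesis using u by (intro exI[of _ "wi u"]) (simp add: E_def hd_wi last_wi)
    qed
  qed
  have wd: "\<exists>u. rd u \<and> u \<noteq> [] \<and> ev u = val r \<and> hd u \<in> E (fst (hd r)) \<and> length u \<ge> length r \<and> (length r = 1 \<longrightarrow> length u \<ge> length (w (fst (hd r))))"
    if "alt2 r" "r \<noteq> []" for r
    using that
  proof (induction r rule: alt2.induct)
    case (2 b k r)
    obtain v where v: "rd v" "v \<noteq> []" "ev v = ev (w b) [^] k" "hd v \<in> E b" "linv (last v) \<in> E b" "length v \<ge> length (w b)"
      using blk[of k b] 2 by auto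
    have v1: "length v \<ge> 1" using v(2) by (cases v) auto
    show ?case
    proof (cases "r = []")
      case True
      thus ?thesis using v v1 by (intro exI[of _ v]) simp
    next
      case False
      then obtain u where u: "rd u" "u \<noteq> []" "ev u = val r" "length u \<ge> length r" "hd u \<in> E (fst (hd r))" using 2 by auto
      have "fst (hd r) = (\<not> b)" using 2 False by auto
      hence "hd u \<noteq> linv (last v)" using E[of b] u(5) v(5) by auto
      hence "rd (v @ u)" using u v by (simp add: rd_append)
      thus ?thesis using u v v1 False by (intro exI[of _ "v @ u"]) simp
    qed
  qed simp
  obtain r where r: "alt2 r" "e l = val r" using x by blast
  have "r \<noteq> []" using ev_free[of "[l]"] r by auto
  then obtain u where u: "rd u" "ev u = e l" "hd u \<in> E (fst (hd r))" "length u \<ge> length r" "length r = 1 \<longrightarrow> length u \<ge> length (w (fst (hd r)))"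
    using wd[OF r(1)] r(2) by auto
  have ul: "u = [l]" by (rule ev_letter[OF u(1,2)])
  hence "length r = 1" using u(4) \<open>r \<noteq> []\<close> by (cases r) auto
  hence "length (w (fst (hd r))) \<le> 1" using u(5) ul by simp
  then obtain m where "w (fst (hd r)) = [m]" using w[of "fst (hd r)"] by (cases "w (fst (hd r))") auto
  thus ?thesis using u(3) ul by (auto simp: E_def intro!: exI[of _ "fst (hd r)"])
qed

end

text \<open>Stallings folding of a theta graph: the pair \<open>(\<alpha> \<gamma>\<inverse>, \<beta> \<gamma>\<inverse>)\<close> is determined up to Nielsen moves by the
  unordered triple of its edge words \<open>\<alpha>, \<beta>, \<gamma>\<close>, and two edges with a common first or last letter can
  be folded, which shortens the triple.\<close>

locale nielsen = free2 +
  fixes good :: "'a \<Rightarrow> 'a \<Rightarrow> bool"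
  assumes good_base: "good (e (False, True)) (e (True, True))"
    and good_swap: "U \<in> carrier K \<Longrightarrow> V \<in> carrier K \<Longrightarrow> good U V \<Longrightarrow> good V U"
    and good_inv: "U \<in> carrier K \<Longrightarrow> V \<in> carrier K \<Longrightarrow> good U V \<Longrightarrow> good (inv U) V"
    and good_mult: "U \<in> carrier K \<Longrightarrow> V \<in> carrier K \<Longrightarrow> good U V \<Longrightarrow> good (inv U \<otimes> inv V) U"
    and good_conj: "U \<in> carrier K \<Longrightarrow> V \<in> carrier K \<Longrightarrow> g \<in> carrier K \<Longrightarrow> good U V \<Longrightarrow>
      good (g \<otimes> U \<otimes> inv g) (g \<otimes> V \<otimes> inv g)"
begin

text \<open>For the pair of a theta graph this move exchanges the first edge with the base edge. It
  makes \<open>good3\<close> symmetric in all three edges.\<close>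

lemma good_quot:
  assumes UV: "U \<in> carrier K" "V \<in> carrier K" and g: "good U V"
  shows "good (inv U) (V \<otimes> inv U)"
proof -
  have "good (inv V) U" by (rule good_inv[OF UV(2,1) good_swap[OF UV g]])
  from good_mult[OF _ _ this] have "good (V \<otimes> inv U) (inv V)" using UV by simp
  hence "good (inv V) (V \<otimes> inv U)" by (rule good_swap[rotated 2]) (use UV in auto)
  from good_inv[OF _ _ this] have "good V (V \<otimes> inv U)" using UV by simp
  hence "good (V \<otimes> inv U) V" by (rule good_swap[rotated 2]) (use UV in auto)
  from good_inv[OF _ _ this] have "good (U \<otimes> inv V) V" using UV by (simp add: inv_mult_group)
  from good_mult[OF _ _ this] have "good (inv (U \<otimes> inv V) \<otimes> inv V) (U \<otimes> inv V)" using UV by simp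
  hence 1: "good (V \<otimes> inv U \<otimes> inv V) (U \<otimes> inv V)" using UV by (simp add: inv_mult_group)
  from good_conj[OF _ _ _ this, of "inv V"]
  have "good (inv V \<otimes> (V \<otimes> inv U \<otimes> inv V) \<otimes> V) (inv V \<otimes> (U \<otimes> inv V) \<otimes> V)" using UV by simp
  moreover have "inv V \<otimes> (V \<otimes> inv U \<otimes> inv V) \<otimes> V = inv U"
  proof -
    have "inv V \<otimes> (V \<otimes> inv U \<otimes> inv V) \<otimes> V = (inv V \<otimes> V) \<otimes> inv U \<otimes> (inv V \<otimes> V)" using UV by (simp only: m_assoc m_closed inv_closed)
    thus ?thesis using UV by simp
  qed
  moreover have "inv V \<otimes> (U \<otimes> inv V) \<otimes> V = inv V \<otimes> U"
  proof -
    have "inv V \<otimes> (U \<otimes> inv V) \<otimes> V = inv V \<otimes> U \<otimes> (inv V \<otimes> V)" using UV by (simp only: m_assoc m_closed inv_closed)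
    thus ?thesis using UV by simp
  qed
  ultimately have "good (inv U) (inv V \<otimes> U)" by simp
  hence "good (inv V \<otimes> U) (inv U)" by (rule good_swap[rotated 2]) (use UV in auto)
  from good_inv[OF _ _ this] have "good (inv U \<otimes> V) (inv U)" using UV by (simp add: inv_mult_group)
  hence "good (inv U) (inv U \<otimes> V)" by (rule good_swap[rotated 2]) (use UV in auto)
  from good_conj[OF _ _ UV(1) this] have "good (U \<otimes> inv U \<otimes> inv U) (U \<otimes> (inv U \<otimes> V) \<otimes> inv U)" using UV by simp
  moreover have "U \<otimes> (inv U \<otimes> V) \<otimes> inv U = V \<otimes> inv U"
  proof -
    have "U \<otimes> (inv U \<otimes> V) \<otimes> inv U = (U \<otimes> inv U) \<otimes> V \<otimes> inv U" using UV by (simp only: m_assoc m_closed inv_closed)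
    thus ?thesis using UV by simp
  qed
  ultimately show ?thesis using UV by simp
qed

definition good3 :: "'a \<Rightarrow> 'a \<Rightarrow> 'a \<Rightarrow> bool" where
  "good3 a b c \<longleftrightarrow> good (a \<otimes> inv c) (b \<otimes> inv c)"

definition spans3 :: "'a \<Rightarrow> 'a \<Rightarrow> 'a \<Rightarrow> bool" where
  "spans3 a b c \<longleftrightarrow> spans (a \<otimes> inv c) (b \<otimes> inv c)"

lemma quot_quot: "a \<in> carrier K \<Longrightarrow> b \<in> carrier K \<Longrightarrow> c \<in> carrier K \<Longrightarrow> b \<otimes> inv a \<otimes> (a \<otimes> inv c) = b \<otimes> inv c"
proof -
  assume "a \<in> carrier K" "b \<in> carrier K" "c \<in> carrier K"
  hence "b \<otimes> inv a \<otimes> (a \<otimes> inv c) = b \<otimes> (inv a \<otimes> a) \<otimes> inv c" by (simp only: m_assoc m_closed inv_closed)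
  thus ?thesis using \<open>a \<in> carrier K\<close> \<open>b \<in> carrier K\<close> by simp
qed

lemma inv_quot: "a \<in> carrier K \<Longrightarrow> c \<in> carrier K \<Longrightarrow> inv (a \<otimes> inv c) = c \<otimes> inv a"
  by (simp add: inv_mult_group)

lemma good3_perm:
  assumes "a \<in> carrier K" "b \<in> carrier K" "c \<in> carrier K"
  shows "good3 b a c \<Longrightarrow> good3 a b c" "good3 c b a \<Longrightarrow> good3 a b c"
proof -
  show "good3 b a c \<Longrightarrow> good3 a b c" unfolding good3_def using assms good_swap by simp
  assume "good3 c b a"
  from good_quot[OF _ _ this[unfolded good3_def]] show "good3 a b c"
    using assms by (simp add: good3_def inv_quot quot_quot)
qed

lemma spans3_perm:
  assumes "a \<in> carrier K" "b \<in> carrier K" "c \<in> carrier K" "spans3 a b c"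
  shows "spans3 b a c" "spans3 c b a"
proof -
  show "spans3 b a c" using assms(4) unfolding spans3_def by (rule spans_trans) blast
  show "spans3 c b a" using assms(4) unfolding spans3_def
  proof (rule spans_trans)
    fix S assume S: "subgroup S K" "c \<otimes> inv a \<in> S" "b \<otimes> inv a \<in> S"
    have 1: "a \<otimes> inv c \<in> S" using subgroup.m_inv_closed[OF S(1,2)] assms inv_quot[of c a] by simp
    hence "b \<otimes> inv c \<in> S" using subgroup.m_closed[OF S(1,3) 1] assms quot_quot by simp
    thus "a \<otimes> inv c \<in> S \<and> b \<otimes> inv c \<in> S" using 1 by simp
  qed
qed

lemma left_quot: "a \<in> carrier K \<Longrightarrow> c \<in> carrier K \<Longrightarrow> s \<in> carrier K \<Longrightarrow>
    (s \<otimes> a) \<otimes> inv (s \<otimes> c) = s \<otimes> (a \<otimes> inv c) \<otimes> inv s"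
  by (simp add: inv_mult_group m_assoc)

lemma right_quot: "a \<in> carrier K \<Longrightarrow> c \<in> carrier K \<Longrightarrow> s \<in> carrier K \<Longrightarrow>
    (a \<otimes> s) \<otimes> inv (c \<otimes> s) = a \<otimes> inv c"
  using quot_quot[of "inv s" a "c"] by (simp add: inv_mult_group)

lemma good3_left:
  assumes "a \<in> carrier K" "b \<in> carrier K" "c \<in> carrier K" "s \<in> carrier K" "good3 a b c"
  shows "good3 (s \<otimes> a) (s \<otimes> b) (s \<otimes> c)"
  using assms good_conj[of "a \<otimes> inv c" "b \<otimes> inv c" s] by (simp add: good3_def left_quot)

text \<open>The conjugate of \<open>S\<close> contains all generators by assumption, in particular
  \<open>e l\<close>; so \<open>e l\<close> lies in \<open>S\<close>, and conjugating back stays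
  inside \<open>S\<close>.\<close>

lemma spans_conj:
  assumes UV: "U \<in> carrier K" "V \<in> carrier K" and sp: "spans (e l \<otimes> U \<otimes> inv (e l)) (e l \<otimes> V \<otimes> inv (e l))"
  shows "spans U V"
  unfolding spans_def
proof (intro allI impI)
  fix S assume S: "subgroup S K" "U \<in> S" "V \<in> S"
  let ?s = "e l" and ?T = "{x \<in> carrier K. inv (e l) \<otimes> x \<otimes> e l \<in> S}"
  have cancel: "inv ?s \<otimes> (?s \<otimes> x \<otimes> inv ?s) \<otimes> ?s = x" if "x \<in> carrier K" for x
  proof -
    have "inv ?s \<otimes> (?s \<otimes> x \<otimes> inv ?s) \<otimes> ?s = (inv ?s \<otimes> ?s) \<otimes> x \<otimes> (inv ?s \<otimes> ?s)" using that by (simp only: m_assoc m_closed inv_closed e_closed)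
    thus ?thesis using that by simp
  qed
  have "subgroup ?T K"
  proof (rule subgroupI)
    show "?T \<noteq> {}" using subgroup.one_closed[OF S(1)] by (auto intro!: exI[of _ \<one>])
  next
    fix x assume x: "x \<in> ?T"
    have "inv (inv ?s \<otimes> x \<otimes> ?s) = inv ?s \<otimes> inv x \<otimes> ?s" using x by (simp add: inv_mult_group m_assoc)
    thus "inv x \<in> ?T" using x subgroup.m_inv_closed[OF S(1), of "inv ?s \<otimes> x \<otimes> ?s"] by simp
  next
    fix x y assume xy: "x \<in> ?T" "y \<in> ?T"
    have "inv ?s \<otimes> x \<otimes> ?s \<otimes> (inv ?s \<otimes> y \<otimes> ?s) = inv ?s \<otimes> x \<otimes> (?s \<otimes> inv ?s) \<otimes> (y \<otimes> ?s)"
      using xy by (simp add: m_assoc del: r_inv)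
    also have "\<dots> = inv ?s \<otimes> (x \<otimes> y) \<otimes> ?s" using xy by (simp add: m_assoc)
    finally show "x \<otimes> y \<in> ?T" using xy subgroup.m_closed[OF S(1), of "inv ?s \<otimes> x \<otimes> ?s" "inv ?s \<otimes> y \<otimes> ?s"] by simp
  qed auto
  moreover have "?s \<otimes> U \<otimes> inv ?s \<in> ?T" "?s \<otimes> V \<otimes> inv ?s \<in> ?T" using cancel UV S by simp_all
  ultimately have T: "range e \<subseteq> ?T" using sp unfolding spans_def by blast
  have s: "?s \<in> S" using T by (auto simp: m_assoc dest!: subsetD[of _ _ ?s])
  show "range e \<subseteq> S"
  proof
    fix x assume "x \<in> range e"
    hence x: "inv ?s \<otimes> x \<otimes> ?s \<in> S" "x \<in> carrier K" using T by auto
    have "?s \<otimes> (inv ?s \<otimes> x \<otimes> ?s) \<otimes> inv ?s = (?s \<otimes> inv ?s) \<otimes> x \<otimes> (?s \<otimes> inv ?s)" using x(2) by (simp only: m_assoc m_closed inv_closed e_closed)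
    hence "?s \<otimes> (inv ?s \<otimes> x \<otimes> ?s) \<otimes> inv ?s = x" using x(2) by simp
    thus "x \<in> S" using subgroup.m_closed[OF S(1) subgroup.m_closed[OF S(1) s x(1)] subgroup.m_inv_closed[OF S(1) s]] by simp
  qed
qed

lemma spans3_left:
  assumes "a \<in> carrier K" "b \<in> carrier K" "c \<in> carrier K" "spans3 (e l \<otimes> a) (e l \<otimes> b) (e l \<otimes> c)"
  shows "spans3 a b c"
  using assms spans_conj[of "a \<otimes> inv c" "b \<otimes> inv c" l] by (simp add: spans3_def left_quot)

text \<open>One fold: two edges with a common first letter lose it, while the third may gain one
  letter, so the total length still drops.\<close>

lemma cancel_left_letter:
  assumes "rd w" shows "\<exists>u. rd u \<and> ev w = e s \<otimes> ev u \<and> length u \<le> length w + 1 \<and> (w \<noteq> [] \<and> hd w = s \<longrightarrow> length u < length w)"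
proof (cases "w \<noteq> [] \<and> hd w = s")
  case True
  then obtain t where "w = s # t" by (cases w) auto
  thus ?thesis using assms by (intro exI[of _ t]) (auto simp: rd_Cons)
next
  case False
  thus ?thesis using assms e_cancel(2)[of "ev w" s] by (intro exI[of _ "linv s # w"]) (auto simp: rd_Cons)
qed

lemma cancel_right_letter:
  assumes "rd w" shows "\<exists>u. rd u \<and> ev w = ev u \<otimes> e s \<and> length u \<le> length w + 1 \<and> (w \<noteq> [] \<and> last w = s \<longrightarrow> length u < length w)"
proof -
  have "rd (wi w)" using assms by simp
  from cancel_left_letter[OF this, of "linv s"] obtain u where u: "rd u" "ev (wi w) = e (linv s) \<otimes> ev u"
    "length u \<le> length (wi w) + 1" "wi w \<noteq> [] \<and> hd (wi w) = linv s \<longrightarrow> length u < length (wi w)" by blast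
  have u4: "w \<noteq> [] \<and> last w = s \<longrightarrow> length u < length w" using u(4) by (auto simp: hd_wi)
  have "ev w = inv (ev (wi w))" by simp
  also have "\<dots> = ev (wi u) \<otimes> e s" unfolding u(2) by (simp add: inv_mult_group e_linv)
  finally show ?thesis using u u4 by (intro exI[of _ "wi u"]) simp
qed

text \<open>Fold as long as two edges share an end letter. A folded theta graph with three nonempty
  edges cannot span, and a folded rose that spans consists of the two letters up to order and
  inversion.\<close>

lemma good3_if_spans3:
  assumes "rd \<alpha>" "rd \<beta>" "rd \<gamma>" "spans3 (ev \<alpha>) (ev \<beta>) (ev \<gamma>)"
  shows "good3 (ev \<alpha>) (ev \<beta>) (ev \<gamma>)"
  using assms
proof (induction "length \<alpha> + length \<beta> + length \<gamma>" arbitrary: \<alpha> \<beta> \<gamma> rule: less_induct)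
  case less
  define N where "N = length \<alpha> + length \<beta> + length \<gamma>"
  have IH: "good3 (ev a) (ev b) (ev c)" if "length a + length b + length c < N" "rd a" "rd b" "rd c" "spans3 (ev a) (ev b) (ev c)" for a b c
    using less.hyps that unfolding N_def by blast
  have fh: "good3 (ev a) (ev b) (ev c)"
    if t: "length a + length b + length c = N" "rd a" "rd b" "rd c" "spans3 (ev a) (ev b) (ev c)" "a \<noteq> []" "b \<noteq> []" "hd a = hd b" for a b c
  proof -
    obtain a' where a: "rd a'" "ev a = e (hd a) \<otimes> ev a'" "length a' < length a" using cancel_left_letter[OF t(2), of "hd a"] t by blast
    obtain b' where b: "rd b'" "ev b = e (hd a) \<otimes> ev b'" "length b' < length b" using cancel_left_letter[OF t(3), of "hd a"] t by metis
    obtain c' where c: "rd c'" "ev c = e (hd a) \<otimes> ev c'" "length c' \<le> length c + 1" using cancel_left_letter[OF t(4), of "hd a"] by blast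
    have "spans3 (ev a') (ev b') (ev c')" using t(5) unfolding a(2) b(2) c(2) by (rule spans3_left[rotated 3]) simp_all
    hence "good3 (ev a') (ev b') (ev c')" using IH a b c t(1) by simp
    thus ?thesis unfolding a(2) b(2) c(2) by (intro good3_left) simp_all
  qed
  have fl: "good3 (ev a) (ev b) (ev c)"
    if t: "length a + length b + length c = N" "rd a" "rd b" "rd c" "spans3 (ev a) (ev b) (ev c)" "a \<noteq> []" "b \<noteq> []" "last a = last b" for a b c
  proof -
    obtain a' where a: "rd a'" "ev a = ev a' \<otimes> e (last a)" "length a' < length a" using cancel_right_letter[OF t(2), of "last a"] t by blast
    obtain b' where b: "rd b'" "ev b = ev b' \<otimes> e (last a)" "length b' < length b" using cancel_right_letter[OF t(3), of "last a"] t by metis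
    obtain c' where c: "rd c'" "ev c = ev c' \<otimes> e (last a)" "length c' \<le> length c + 1" using cancel_right_letter[OF t(4), of "last a"] by blast
    have "spans3 (ev a') (ev b') (ev c')" using t(5) unfolding a(2) b(2) c(2) spans3_def by (simp add: right_quot)
    hence "good3 (ev a') (ev b') (ev c')" using IH a b c t(1) by simp
    thus ?thesis unfolding a(2) b(2) c(2) good3_def by (simp add: right_quot)
  qed
  \<comment> \<open>With an empty edge the graph is a rose. A petal may also be inverted, which
    allows folding the start of one petal with the end of the other.\<close>
  have e0: "good3 (ev a) (ev b) (ev [])"
    if t: "length a + length b = N" "rd a" "rd b" "spans3 (ev a) (ev b) (ev [])" for a b
  proof -
    have sp: "spans (ev a) (ev b)" using t(4) by (simp add: spans3_def)
    hence sp': "spans (ev b) (ev a)" "spans (inv (ev a)) (ev b)"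
      using subgroup.m_inv_closed by (auto intro: spans_trans elim!: spans_trans) fastforce
    have ne: "a \<noteq> []" "b \<noteq> []" using sp sp' spans_noncommuting by fastforce+
    have flip: "good3 (ev a) (ev b) (ev [])" if "good3 (ev (wi a)) (ev b) (ev [])"
      using that good_inv[of "inv (ev a)" "ev b"] by (simp add: good3_def)
    have w: "rd (wi a)" "wi a \<noteq> []" "length (wi a) + length b + length [] = N" "spans3 (ev (wi a)) (ev b) (ev [])"
      using t ne sp' by (simp_all add: spans3_def)
    consider "hd a = hd b" | "last a = last b" | "hd (wi a) = hd b" | "last (wi a) = last b"
      | "hd a \<noteq> hd b" "last a \<noteq> last b" "linv (last a) \<noteq> hd b" "linv (hd a) \<noteq> last b" using ne hd_wi last_wi by metis
    thus ?thesis
    proof cases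
      case 1
      thus ?thesis using fh[of a b "[]"] t ne by simp
    next
      case 2
      thus ?thesis using fl[of a b "[]"] t ne by simp
    next
      case 3
      thus ?thesis using flip fh[OF w(3,1) t(3) _ w(4,2) ne(2)] by simp
    next
      case 4
      thus ?thesis using flip fl[OF w(3,1) t(3) _ w(4,2) ne(2)] by simp
    next
      case 5
      let ?w = "\<lambda>t. if t then b else a"
      have "hd a \<noteq> linv (last b)" using 5 by (metis linv_linv)
      hence s: "\<exists>t. ?w t = [l] \<or> ?w t = [linv l]" for l
        using rose_spanning[of ?w l] t ne sp 5 by auto
      let ?x = "(False, True)" and ?y = "(True, True)"
      have ev1: "ev [l] = e l" for l by simp
      have dist: "[?x] \<noteq> [?y]" "[?x] \<noteq> [linv ?y]" "[linv ?x] \<noteq> [?y]" "[linv ?x] \<noteq> [linv ?y]" by (simp_all add: linv_def)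
      have "(a = [?x] \<or> a = [linv ?x]) \<and> (b = [?y] \<or> b = [linv ?y]) \<or> (b = [?x] \<or> b = [linv ?x]) \<and> (a = [?y] \<or> a = [linv ?y])"
        using s[of ?x] s[of ?y] dist by (metis (full_types))
      moreover have "good (ev u) (ev v)" if "u = [?x] \<or> u = [linv ?x]" "v = [?y] \<or> v = [linv ?y]" for u v
      proof -
        have 1: "good (ev u) (e ?y)" using that(1) good_base good_inv[OF _ _ good_base] by (auto simp: e_linv)
        hence "good (inv (e ?y)) (ev u)" using good_inv[of "e ?y" "ev u"] good_swap[of "ev u" "e ?y"] by simp
        thus ?thesis using 1 that(2) good_swap by (auto simp: e_linv)
      qed
      ultimately have "good (ev a) (ev b)" using good_swap[of "ev b" "ev a"] by auto
      thus ?thesis by (simp add: good3_def)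
    qed
  qed
  note P = spans3_perm[OF ev_closed ev_closed ev_closed] and Q = good3_perm[OF ev_closed ev_closed ev_closed]
  have len: "length \<alpha> + length \<beta> + length \<gamma> = N" "length \<gamma> + length \<alpha> + length \<beta> = N" "length \<gamma> + length \<beta> + length \<alpha> = N"
    by (simp_all add: N_def)
  note s1 = less.prems(4) and s2 = P(2)[OF less.prems(4)] and s3 = P(2)[OF P(1)[OF less.prems(4)]]
  consider "\<gamma> = []" | "\<alpha> = []" | "\<beta> = []" | "\<alpha> \<noteq> []" "\<beta> \<noteq> []" "\<gamma> \<noteq> []" by blast
  thus ?case
  proof cases
    case 1
    thus ?thesis using e0[of \<alpha> \<beta>] less.prems len by simp
  next
    case 2
    hence "good3 (ev \<gamma>) (ev \<beta>) (ev \<alpha>)" using e0[of \<gamma> \<beta>] less.prems len s2 by simp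
    thus ?thesis by (rule Q(2))
  next
    case 3
    hence "good3 (ev \<gamma>) (ev \<alpha>) (ev \<beta>)" using e0[of \<gamma> \<alpha>] less.prems len s3 by simp
    thus ?thesis using Q by blast
  next
    case 4
    consider "hd \<alpha> = hd \<beta>" | "last \<alpha> = last \<beta>" | "hd \<gamma> = hd \<beta>" | "last \<gamma> = last \<beta>" | "hd \<gamma> = hd \<alpha>" | "last \<gamma> = last \<alpha>"
      | "hd \<alpha> \<noteq> hd \<beta>" "last \<alpha> \<noteq> last \<beta>" "hd \<gamma> \<noteq> hd \<beta>" "last \<gamma> \<noteq> last \<beta>" "hd \<gamma> \<noteq> hd \<alpha>" "last \<gamma> \<noteq> last \<alpha>" by blast
    thus ?thesis
    proof cases
      case 1
      thus ?thesis using fh[of \<alpha> \<beta> \<gamma>] less.prems len 4 by blast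
    next
      case 2
      thus ?thesis using fl[of \<alpha> \<beta> \<gamma>] less.prems len 4 by blast
    next
      case 3
      thus ?thesis using fh[of \<gamma> \<beta> \<alpha>] less.prems len 4 s2 Q(2) by blast
    next
      case 4
      thus ?thesis using fl[of \<gamma> \<beta> \<alpha>] less.prems len \<open>\<gamma> \<noteq> []\<close> \<open>\<beta> \<noteq> []\<close> s2 Q(2) by blast
    next
      case 5
      hence "good3 (ev \<gamma>) (ev \<alpha>) (ev \<beta>)" using fh[of \<gamma> \<alpha> \<beta>] less.prems len 4 s3 by blast
      thus ?thesis using Q by blast
    next
      case 6
      hence "good3 (ev \<gamma>) (ev \<alpha>) (ev \<beta>)" using fl[of \<gamma> \<alpha> \<beta>] less.prems len 4 s3 by blast
      thus ?thesis using Q by blast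
    next
      case 7
      let ?w = "\<lambda>i::nat. if i = 0 then \<alpha> else if i = 1 then \<beta> else \<gamma>"
      have False
      proof (rule theta_not_spanning[of ?w])
        show "rd (?w i) \<and> ?w i \<noteq> []" for i using less.prems 4 by simp
        show "hd (?w i) \<noteq> hd (?w j) \<and> last (?w i) \<noteq> last (?w j)" if "i < 3" "j < 3" "i \<noteq> j" for i j
          using 7 7[THEN not_sym] that by simp
        show "spans (ev (?w 0) \<otimes> inv (ev (?w 2))) (ev (?w 1) \<otimes> inv (ev (?w 2)))" using s1 by (simp add: spans3_def)
      qed
      thus ?thesis ..
    qed
  qed
qed

theorem good_if_spans:
  assumes "spans (ev u) (ev v)" shows "good (ev u) (ev v)"
proof -
  obtain u' v' where "rd u'" "ev u' = ev u" "rd v'" "ev v' = ev v" using ev_rd by metis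
  thus ?thesis using good3_if_spans3[of u' v' "[]"] assms by (simp add: good3_def spans3_def)
qed

end

section \<open>Invariance of the counting quasimorphisms\<close>

context group
begin

definition sl :: "'a \<Rightarrow> 'a \<Rightarrow> letter \<Rightarrow> 'a" where
  "sl U V l = (let g = (if fst l then V else U) in if snd l then g else inv g)"

definition sub :: "'a \<Rightarrow> 'a \<Rightarrow> letter list \<Rightarrow> 'a" where
  "sub U V w = foldr (\<lambda>l x. sl U V l \<otimes> x) w \<one>"

lemma sl_closed [simp]: "U \<in> carrier G \<Longrightarrow> V \<in> carrier G \<Longrightarrow> sl U V l \<in> carrier G"
  by (simp add: sl_def Let_def)

lemma sl_linv: "U \<in> carrier G \<Longrightarrow> V \<in> carrier G \<Longrightarrow> sl U V (linv l) = inv (sl U V l)"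
  by (simp add: sl_def Let_def linv_def)

lemma sub_simps [simp]: "sub U V [] = \<one>" "sub U V (l # w) = sl U V l \<otimes> sub U V w"
  by (simp_all add: sub_def)

lemma sub_closed [simp]: "U \<in> carrier G \<Longrightarrow> V \<in> carrier G \<Longrightarrow> sub U V w \<in> carrier G"
  by (induction w) auto

lemma sub_append: "U \<in> carrier G \<Longrightarrow> V \<in> carrier G \<Longrightarrow> sub U V (u @ w) = sub U V u \<otimes> sub U V w"
  by (induction u) (auto simp: m_assoc)

lemma sub_wi: "U \<in> carrier G \<Longrightarrow> V \<in> carrier G \<Longrightarrow> sub U V (wi w) = inv (sub U V w)"
  by (induction w) (auto simp: sub_append sl_linv inv_mult_group)

definition subst :: "letter list \<Rightarrow> letter list \<Rightarrow> letter list \<Rightarrow> letter list" where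
  "subst a b w = concat (map (\<lambda>l. let u = (if fst l then b else a) in if snd l then u else wi u) w)"

lemma sub_subst:
  assumes "U \<in> carrier G" "V \<in> carrier G"
  shows "sub (sub U V a) (sub U V b) w = sub U V (subst a b w)"
  using assms by (induction w) (auto simp: subst_def sl_def Let_def sub_append sub_wi)

lemma conj_mult:
  assumes "g \<in> carrier G" "x \<in> carrier G" "y \<in> carrier G"
  shows "g \<otimes> x \<otimes> inv g \<otimes> (g \<otimes> y \<otimes> inv g) = g \<otimes> (x \<otimes> y) \<otimes> inv g"
proof -
  have "g \<otimes> x \<otimes> inv g \<otimes> (g \<otimes> y \<otimes> inv g) = g \<otimes> x \<otimes> (inv g \<otimes> g) \<otimes> (y \<otimes> inv g)"
    using assms by (simp add: m_assoc del: l_inv)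
  thus ?thesis using assms by (simp add: m_assoc)
qed

lemma sub_conj:
  assumes "U \<in> carrier G" "V \<in> carrier G" "g \<in> carrier G"
  shows "sub (g \<otimes> U \<otimes> inv g) (g \<otimes> V \<otimes> inv g) w = g \<otimes> sub U V w \<otimes> inv g"
proof (induction w)
  case (Cons l w)
  have "sl (g \<otimes> U \<otimes> inv g) (g \<otimes> V \<otimes> inv g) l = g \<otimes> sl U V l \<otimes> inv g"
    using assms by (simp add: sl_def Let_def inv_mult_group m_assoc)
  thus ?case using Cons conj_mult assms by simp
qed (use assms in simp)

end

section \<open>Integer matrices of determinant 1 or -1 and the count on them\<close>

fun mmul :: "mat \<Rightarrow> mat \<Rightarrow> mat" where
  "mmul (a, b, c, d) (a', b', c', d') = (a * a' + b * c', a * b' + b * d', c * a' + d * c', c * b' + d * d')"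

definition GL :: "mat monoid" where
  "GL = \<lparr>carrier = {M. mdet M = 1 \<or> mdet M = -1}, monoid.mult = mmul, one = (1, 0, 0, 1)\<rparr>"

lemma mapp_mmul: "mapp (mmul M N) v = mapp M (mapp N v)"
  by (cases M; cases N; cases v) (simp add: algebra_simps)

lemma mdet_mmul: "mdet (mmul M N) = mdet M * mdet N"
  by (cases M; cases N) (simp add: algebra_simps)

lemma GL_simps: "M \<in> carrier GL \<longleftrightarrow> mdet M = 1 \<or> mdet M = -1" "M \<otimes>\<^bsub>GL\<^esub> N = mmul M N" "\<one>\<^bsub>GL\<^esub> = (1, 0, 0, 1)"
  by (simp_all add: GL_def)

lemma group_GL: "group GL"
proof (rule groupI)
  fix M assume M: "M \<in> carrier GL"
  obtain a b c d where m: "M = (a, b, c, d)" by (cases M)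
  define D where "D = a * d - b * c"
  have D: "D * D = 1" "D = 1 \<or> D = -1" using M by (auto simp: m GL_simps D_def)
  let ?N = "(D * d, - (D * b), - (D * c), D * a)"
  have "mmul ?N M = (D * D, 0, 0, D * D)" by (simp add: m D_def algebra_simps)
  moreover have "mdet ?N = D"
  proof -
    have "mdet ?N = D * D * (a * d - b * c)" by (simp add: algebra_simps)
    thus ?thesis using D(1) by (simp add: D_def)
  qed
  ultimately show "\<exists>N\<in>carrier GL. N \<otimes>\<^bsub>GL\<^esub> M = \<one>\<^bsub>GL\<^esub>" using D by (intro bexI[of _ ?N]) (simp_all add: GL_simps)
next
  fix M N P assume "M \<in> carrier GL" "N \<in> carrier GL" "P \<in> carrier GL"
  show "M \<otimes>\<^bsub>GL\<^esub> N \<otimes>\<^bsub>GL\<^esub> P = M \<otimes>\<^bsub>GL\<^esub> (N \<otimes>\<^bsub>GL\<^esub> P)"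
    by (cases M; cases N; cases P) (simp add: GL_simps algebra_simps)
next
  fix M assume "M \<in> carrier GL"
  show "\<one>\<^bsub>GL\<^esub> \<otimes>\<^bsub>GL\<^esub> M = M" by (cases M) (simp add: GL_simps)
qed (auto simp: GL_simps mdet_mmul)

lemma mv_mult: "M \<in> carrier GL \<Longrightarrow> N \<in> carrier GL \<Longrightarrow> v \<in> cusps \<Longrightarrow> mv (M \<otimes>\<^bsub>GL\<^esub> N) v = mv M (mv N v)"
  using mv_mv[of M N v] by (simp add: GL_simps mv_def[of "mmul M N"] mapp_mmul)

lemma mv_one: "v \<in> cusps \<Longrightarrow> mv \<one>\<^bsub>GL\<^esub> v = v"
  by (cases v) (simp add: GL_simps mv_def cusp_nrm)

lemma lm_GL [simp]: "lm l \<in> carrier GL"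
  by (simp add: GL_simps)

lemma inv_GL: "mdet M = 1 \<Longrightarrow> inv\<^bsub>GL\<^esub> M = madj M"
  by (rule group.inv_equality[OF group_GL]; cases M) (simp_all add: GL_simps madj_def algebra_simps)

lemma mv_foldr_lm: "v \<in> cusps \<Longrightarrow> mv (foldr (\<lambda>l x. lm l \<otimes>\<^bsub>GL\<^esub> x) w \<one>\<^bsub>GL\<^esub>) v = actc w v \<and>
    foldr (\<lambda>l x. lm l \<otimes>\<^bsub>GL\<^esub> x) w \<one>\<^bsub>GL\<^esub> \<in> carrier GL"
proof (induction w)
  case Nil
  thus ?case by (simp add: mv_one) (simp add: GL_simps)
next
  case (Cons l w)
  thus ?case using mv_mult[OF lm_GL] group_GL by (simp add: group.is_monoid monoid.m_closed)
qed

lemma odd_step: "odd k \<Longrightarrow> step l k = arc l"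
  by (cases l rule: arc.cases) (auto dest: odd_pos)

text \<open>The last letter of the word moves a suitable vertex into an open arc, and reduced words
  keep it in open arcs. Hence no nonempty reduced word acts trivially: the matrices are free
  generators.\<close>

lemma word_moves_vertex:
  assumes "rd w" "w \<noteq> []" shows "\<exists>i. pos (actc w (qv i)) = arc (hd w)"
  using assms
proof (induction w)
  case (Cons l w)
  show ?case
  proof (cases "w = []")
    case True
    have "\<exists>i. step l (pos (qv i)) = arc l"
    proof (cases l rule: arc.cases)
      case 1
      thus ?thesis by (intro exI[of _ 0]) (simp add: pos_def qv.simps)
    next
      case 2
      thus ?thesis by (intro exI[of _ 2]) (simp add: pos_def qv.simps)
    next
      case 3
      thus ?thesis by (intro exI[of _ 2]) (simp add: pos_def qv.simps)
    next
      case 4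
      thus ?thesis by (intro exI[of _ 0]) (simp add: pos_def qv.simps)
    qed
    moreover have "pos (qv i) \<noteq> arc (linv l)" for i using pos_qv(1)[of i] arc_odd by metis
    ultimately show ?thesis using pos_step[of "qv _" l] True by simp
  next
    case False
    then obtain i where i: "pos (actc w (qv i)) = arc (hd w)" using Cons rd_tl by blast
    have "arc (hd w) \<noteq> arc (linv l)" using Cons.prems False by (simp add: rd_Cons arc_inj)
    hence "pos (actc (l # w) (qv i)) = arc l" using pos_step[of "actc w (qv i)" l] i odd_step[OF arc_odd] by simp
    thus ?thesis by auto
  qed
qed simp

interpretation GL: free2 GL lm
proof (intro free2.intro free2_axioms.intro group_GL lm_GL)
  show "lm (linv l) = inv\<^bsub>GL\<^esub> lm l" for l by (simp add: inv_GL madj_lm)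
  fix w assume w: "rd w" "w \<noteq> []"
  then obtain i where i: "pos (actc w (qv i)) = arc (hd w)" using word_moves_vertex by blast
  show "foldr (\<lambda>l x. lm l \<otimes>\<^bsub>GL\<^esub> x) w \<one>\<^bsub>GL\<^esub> \<noteq> \<one>\<^bsub>GL\<^esub>"
  proof
    assume "foldr (\<lambda>l x. lm l \<otimes>\<^bsub>GL\<^esub> x) w \<one>\<^bsub>GL\<^esub> = \<one>\<^bsub>GL\<^esub>"
    hence "actc w (qv i) = qv i" using mv_foldr_lm[of "qv i" w] mv_one[of "qv i"] by simp
    thus False using i pos_qv(1)[of i] arc_odd by metis
  qed
qed

abbreviation "mA \<equiv> lm (False, True)"
abbreviation "mB \<equiv> lm (True, True)"

lemma mv_ev: "v \<in> cusps \<Longrightarrow> mv (GL.ev w) v = actc w v"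
  using mv_foldr_lm by (simp add: GL.ev_def)

lemma sl_AB: "GL.sl mA mB l = lm l"
  using GL.e_linv[of "(fst l, True)"] by (cases l) (auto simp: GL.sl_def Let_def linv_def simp del: lm.simps)

lemma sub_AB: "GL.sub mA mB w = GL.ev w"
  by (induction w) (simp_all add: sl_AB del: lm.simps)

definition hh :: "nat \<Rightarrow> nat \<Rightarrow> mat \<Rightarrow> real" where
  "hh p q M = tdiff p q (qv 0) (mv M (qv 0))"

lemma mv_GL_cusp [simp]: "M \<in> carrier GL \<Longrightarrow> v \<in> cusps \<Longrightarrow> mv M v \<in> cusps"
  by (simp add: GL_simps mv_cusp)

lemma tdiff_mv: "M \<in> carrier GL \<Longrightarrow> a \<in> cusps \<Longrightarrow> b \<in> cusps \<Longrightarrow> tdiff p q (mv M a) (mv M b) = tdiff p q a b"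
  using winding_map_tdiff[OF mv_winding_map[of M]] by (simp add: GL_simps)

text \<open>\<open>hh\<close> measures the displacement of \<open>\<infinity>\<close>. By
  equivariance the defect is that of \<open>tdiff\<close> on a triangle of cusps.\<close>

lemma hh_mult:
  assumes "p \<ge> 3" "q \<ge> 3" "M \<in> carrier GL" "N \<in> carrier GL"
  shows "\<bar>hh p q M + hh p q N - hh p q (M \<otimes>\<^bsub>GL\<^esub> N)\<bar> \<le> 36"
proof -
  have "tdiff p q (mv M (qv 0)) (mv (M \<otimes>\<^bsub>GL\<^esub> N) (qv 0)) = hh p q N"
    using tdiff_mv[of M "qv 0" "mv N (qv 0)"] assms by (simp add: mv_mult hh_def)
  thus ?thesis
    using tdiff_defect[of "qv 0" "mv M (qv 0)" "mv (M \<otimes>\<^bsub>GL\<^esub> N) (qv 0)" p q] assms tdiff_swap[of p q "mv (M \<otimes>\<^bsub>GL\<^esub> N) (qv 0)" "qv 0"]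
    by (simp add: hh_def)
qed

lemma hh_inv: "M \<in> carrier GL \<Longrightarrow> hh p q (inv\<^bsub>GL\<^esub> M) = - hh p q M"
  using tdiff_mv[of M "qv 0" "mv (inv\<^bsub>GL\<^esub> M) (qv 0)" p q] mv_mult[of M "inv\<^bsub>GL\<^esub> M" "qv 0"]
    tdiff_swap[of p q "mv M (qv 0)" "qv 0"] by (simp add: hh_def mv_one)

lemma hh_conj:
  assumes "p \<ge> 3" "q \<ge> 3" "M \<in> carrier GL" "g \<in> carrier GL"
  shows "\<bar>hh p q (g \<otimes>\<^bsub>GL\<^esub> M \<otimes>\<^bsub>GL\<^esub> inv\<^bsub>GL\<^esub> g) - hh p q M\<bar> \<le> 72"
  using hh_mult[OF assms(1,2), of g M] hh_mult[OF assms(1,2), of "g \<otimes>\<^bsub>GL\<^esub> M" "inv\<^bsub>GL\<^esub> g"] hh_inv[of g p q] assms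
  by simp

text \<open>Substituting the pair for the free generators changes the count by a bounded amount,
  uniformly over all words.\<close>

definition good :: "nat \<Rightarrow> nat \<Rightarrow> mat \<Rightarrow> mat \<Rightarrow> bool" where
  "good p q U V \<longleftrightarrow> (\<exists>C. \<forall>w. \<bar>hh p q (GL.sub U V w) - hh p q (GL.ev w)\<bar> \<le> C)"

lemma good_base: "good p q mA mB"
  unfolding good_def sub_AB by (intro exI[of _ 0]) simp

lemma good_conj:
  assumes pq: "p \<ge> 3" "q \<ge> 3" and UV: "U \<in> carrier GL" "V \<in> carrier GL" "g \<in> carrier GL" and g: "good p q U V"
  shows "good p q (g \<otimes>\<^bsub>GL\<^esub> U \<otimes>\<^bsub>GL\<^esub> inv\<^bsub>GL\<^esub> g) (g \<otimes>\<^bsub>GL\<^esub> V \<otimes>\<^bsub>GL\<^esub> inv\<^bsub>GL\<^esub> g)"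
proof -
  obtain C where C: "\<And>w. \<bar>hh p q (GL.sub U V w) - hh p q (GL.ev w)\<bar> \<le> C" using g by (auto simp: good_def)
  have "\<bar>hh p q (g \<otimes>\<^bsub>GL\<^esub> GL.sub U V w \<otimes>\<^bsub>GL\<^esub> inv\<^bsub>GL\<^esub> g) - hh p q (GL.ev w)\<bar> \<le> C + 72" for w
    using C[of w] hh_conj[OF pq _ UV(3), of "GL.sub U V w"] UV by simp
  thus ?thesis unfolding good_def using GL.sub_conj[OF UV] by auto
qed

text \<open>Substitutions compose, so each Nielsen move has to be checked only for the pair of free
  generators.\<close>

lemma good_comp:
  assumes UV: "U \<in> carrier GL" "V \<in> carrier GL" and g: "good p q U V" and ab: "good p q (GL.ev a) (GL.ev b)"
  shows "good p q (GL.sub U V a) (GL.sub U V b)"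
proof -
  obtain C where C: "\<And>w. \<bar>hh p q (GL.sub U V w) - hh p q (GL.ev w)\<bar> \<le> C" using g by (auto simp: good_def)
  obtain D where D: "\<And>w. \<bar>hh p q (GL.sub (GL.ev a) (GL.ev b) w) - hh p q (GL.ev w)\<bar> \<le> D" using ab by (auto simp: good_def)
  have "\<bar>hh p q (GL.sub (GL.sub U V a) (GL.sub U V b) w) - hh p q (GL.ev w)\<bar> \<le> C + D" for w
    using C[of "GL.subst a b w"] D[of w] GL.sub_subst[OF UV, of a b w] GL.sub_subst[OF lm_GL lm_GL, of "(False, True)" "(True, True)" a b w] unfolding sub_AB by simp
  thus ?thesis unfolding good_def by blast
qed

lemma good_swap_AB: "p \<ge> 3 \<Longrightarrow> q \<ge> 3 \<Longrightarrow> good p q mB mA"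
proof -
  assume pq: "p \<ge> 3" "q \<ge> 3"
  \<comment> \<open>This reflection interchanges the two generators by conjugation.\<close>
  let ?L = "(-1, 0, 0, 1) :: mat"
  have L: "?L \<in> carrier GL" "inv\<^bsub>GL\<^esub> ?L = ?L"
    by (simp add: GL_simps) (rule GL.inv_equality, simp_all add: GL_simps)
  show ?thesis using good_conj[OF pq lm_GL lm_GL L(1) good_base] unfolding L(2) by (simp add: GL_simps)
qed

lemma good_mult_AB: "p \<ge> 3 \<Longrightarrow> q \<ge> 3 \<Longrightarrow> good p q (GL.ev [(False, False), (True, False)]) (GL.ev [(False, True)])"
proof -
  assume pq: "p \<ge> 3" "q \<ge> 3"
  \<comment> \<open>A matrix of order six conjugating \<open>x\<close> to
    \<open>x\<inverse> y\<inverse>\<close> and \<open>y\<close> to \<open>x\<close>.\<close>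
  let ?C = "(0, -1, 1, 1) :: mat"
  have L: "?C \<in> carrier GL" "inv\<^bsub>GL\<^esub> ?C = (1, 1, -1, 0)"
    by (simp add: GL_simps) (rule GL.inv_equality, simp_all add: GL_simps)
  show ?thesis using good_conj[OF pq lm_GL lm_GL L(1) good_base] unfolding L(2) by (simp add: GL_simps)
qed

text \<open>The one move that comes from no matrix. The mirror carries \<open>\<infinity>\<close> to
  -1, so the base point has to be moved back; this uses two triangles of cusps, each with defect
  36.\<close>

lemma good_inv_AB:
  assumes pq: "p \<ge> 3" "q \<ge> 3" shows "good p q (GL.ev [(False, False)]) (GL.ev [(True, True)])"
proof -
  have sl: "GL.sl (GL.ev [(False, False)]) (GL.ev [(True, True)]) l = lm (tl_l l)" for l
    using GL.e_linv[of "(False, False)"] GL.e_linv[of "(True, True)"]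
    by (cases l) (auto simp: GL.sl_def Let_def linv_def tl_l_def simp del: lm.simps)
  have s: "GL.sub (GL.ev [(False, False)]) (GL.ev [(True, True)]) w = GL.ev (map tl_l w)" for w
    by (induction w) (simp_all only: GL.sub_simps GL.ev_simps(1) sl list.map, simp)
  have q: "mirror (qv 0) = qv 1" using mirror_word[of "[]" 0] by (simp add: flip_i_def)
  have "\<bar>hh p q (GL.ev (map tl_l w)) - hh p q (GL.ev w)\<bar> \<le> 72" for w
  proof -
    let ?M = "GL.ev (map tl_l w)"
    have "hh p q (GL.ev w) = tdiff p q (mirror (qv 0)) (mirror (actc w (qv 0)))"
      using winding_map_tdiff[OF mirror_winding_map] by (simp add: hh_def mv_ev)
    also have "mirror (actc w (qv 0)) = mv ?M (qv 1)" using mirror_word[of w 0] by (simp add: mv_ev flip_i_def)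
    finally have 1: "hh p q (GL.ev w) = tdiff p q (qv 1) (mv ?M (qv 1))" using q by simp
    have 2: "tdiff p q (mv ?M (qv 0)) (mv ?M (qv 1)) = tdiff p q (qv 0) (qv 1)" by (rule tdiff_mv) simp_all
    have c: "mv ?M (qv 0) \<in> cusps" "mv ?M (qv 1) \<in> cusps" by simp_all
    show ?thesis
      using tdiff_defect[OF qv_cusp[of 0] c pq] tdiff_defect[OF qv_cusp[of 0] qv_cusp[of 1] c(2) pq] 1 2
        tdiff_swap[of p q "mv ?M (qv 1)" "qv 0"] unfolding hh_def[of p q ?M] by linarith
  qed
  thus ?thesis unfolding good_def s by blast
qed

lemma nielsen_good: "p \<ge> 3 \<Longrightarrow> q \<ge> 3 \<Longrightarrow> nielsen GL lm (good p q)"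
proof (intro nielsen.intro nielsen_axioms.intro GL.free2_axioms good_base)
  assume pq: "p \<ge> 3" "q \<ge> 3"
  fix U V assume UV: "U \<in> carrier GL" "V \<in> carrier GL" "good p q U V"
  show "good p q V U" using good_comp[OF UV, of "[(True, True)]" "[(False, True)]"] good_swap_AB[OF pq] UV
    by (simp add: GL.sl_def del: lm.simps)
  show "good p q (inv\<^bsub>GL\<^esub> U) V" using good_comp[OF UV good_inv_AB[OF pq]] UV by (simp add: GL.sl_def)
  show "good p q (inv\<^bsub>GL\<^esub> U \<otimes>\<^bsub>GL\<^esub> inv\<^bsub>GL\<^esub> V) U" using good_comp[OF UV good_mult_AB[OF pq]] UV by (simp add: GL.sl_def)
  fix g assume "g \<in> carrier GL"
  thus "good p q (g \<otimes>\<^bsub>GL\<^esub> U \<otimes>\<^bsub>GL\<^esub> inv\<^bsub>GL\<^esub> g) (g \<otimes>\<^bsub>GL\<^esub> V \<otimes>\<^bsub>GL\<^esub> inv\<^bsub>GL\<^esub> g)" using good_conj[OF pq] UV by blast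
qed

lemmas good_if_spans = nielsen.good_if_spans[OF nielsen_good]

text \<open>Inverting \<open>x\<close> changes the count on powers of \<open>x\<close> by a bounded
  amount, but also reverses its sign; so it is bounded. Swapping transfers this to
  \<open>y\<close>.\<close>

lemma hh_letter_power_bounded:
  assumes pq: "p \<ge> 3" "q \<ge> 3" shows "\<exists>C. \<forall>n l. \<bar>hh p q (GL.ev (replicate n l))\<bar> \<le> C"
proof -
  obtain C where C: "\<And>w. \<bar>hh p q (GL.sub (GL.ev [(False, False)]) (GL.ev [(True, True)]) w) - hh p q (GL.ev w)\<bar> \<le> C"
    using good_inv_AB[OF pq] by (auto simp: good_def)
  obtain D where D: "\<And>w. \<bar>hh p q (GL.sub mB mA w) - hh p q (GL.ev w)\<bar> \<le> D"
    using good_swap_AB[OF pq] by (auto simp: good_def)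
  have neg: "GL.ev (replicate n (linv l)) = inv\<^bsub>GL\<^esub> GL.ev (replicate n l)" for n l
    using GL.ev_wi[of "replicate n l"] by (simp add: wi_def del: GL.ev_wi)
  have fl: "(False, False) = linv (False, True)" by (simp add: linv_def)
  have 1: "\<bar>hh p q (GL.ev (replicate n (False, True)))\<bar> \<le> C" for n
  proof -
    have "GL.sub (GL.ev [(False, False)]) (GL.ev [(True, True)]) (replicate n (False, True)) = GL.ev (replicate n (False, False))"
      by (induction n) (simp_all add: GL.sl_def del: lm.simps)
    also have "\<dots> = inv\<^bsub>GL\<^esub> GL.ev (replicate n (False, True))" unfolding fl by (rule neg)
    finally show ?thesis using C[of "replicate n (False, True)"] hh_inv[of "GL.ev (replicate n (False, True))" p q] by simp
  qed
  have 2: "\<bar>hh p q (GL.ev (replicate n (True, True)))\<bar> \<le> C + D" for n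
  proof -
    have "GL.sub mB mA (replicate n (False, True)) = GL.ev (replicate n (True, True))"
      by (induction n) (simp_all add: GL.sl_def del: lm.simps)
    thus ?thesis using D[of "replicate n (False, True)"] 1[of n] by simp
  qed
  have CD: "C \<ge> 0" "D \<ge> 0" using C[of "[]"] D[of "[]"] by simp_all
  have "\<bar>hh p q (GL.ev (replicate n l))\<bar> \<le> C + D" for n l
  proof -
    obtain b s where l: "l = (b, s)" by (cases l)
    have t: "\<bar>hh p q (GL.ev (replicate n (b, True)))\<bar> \<le> C + D" using 1[of n] 2[of n] CD by (cases b) auto
    moreover have "(b, False) = linv (b, True)" by (simp add: linv_def)
    ultimately show ?thesis using neg[of n "(b, True)"] hh_inv[of "GL.ev (replicate n (b, True))" p q] l by (cases s) auto
  qed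
  thus ?thesis by blast
qed

section \<open>Chains of cusps\<close>

lemma triples_reverse: "(\<epsilon>, c, d) \<in> triples p q b a \<longleftrightarrow> (- \<epsilon>, d, c) \<in> triples q p a b"
  using wnd_swap[of c b d] wnd_swap[of d c a] by (auto simp: triples_def adjc_sym)

text \<open>Convergents of a minus continued fraction with entries \<open>6 * \<mu> + 3\<close>. In
  units of 6 the turn at a vertex is \<open>\<mu> + 1/2\<close>, in the middle of its integer
  interval, which leaves room for errors.\<close>

fun chn :: "(nat \<Rightarrow> nat) \<Rightarrow> nat \<Rightarrow> vec" where
  "chn \<mu> 0 = (1, 0)"
| "chn \<mu> (Suc 0) = (6 * int (\<mu> 0) + 3, 1)"
| "chn \<mu> (Suc (Suc j)) = ((6 * int (\<mu> (Suc j)) + 3) * fst (chn \<mu> (Suc j)) - fst (chn \<mu> j),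
     (6 * int (\<mu> (Suc j)) + 3) * snd (chn \<mu> (Suc j)) - snd (chn \<mu> j))"

declare chn.simps [simp del]

lemma det_chn_rec:
  "det x (chn \<mu> (Suc (Suc j))) = (6 * int (\<mu> (Suc j)) + 3) * det x (chn \<mu> (Suc j)) - det x (chn \<mu> j)"
  "det (chn \<mu> j) x = (6 * int (\<mu> (Suc j)) + 3) * det (chn \<mu> (Suc j)) x - det (chn \<mu> (Suc (Suc j))) x"
  by (simp_all add: chn.simps(3) det_def algebra_simps)

lemma det_chn_Suc: "det (chn \<mu> j) (chn \<mu> (Suc j)) = 1"
proof (induction j)
  case 0
  thus ?case by (simp add: det_def chn.simps)
next
  case (Suc j)
  thus ?case using det_chn_rec(1)[of "chn \<mu> (Suc j)" \<mu> j] det_swap[of "chn \<mu> (Suc j)" "chn \<mu> j"] by simp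
qed

lemma triple_growth: "0 \<le> x \<Longrightarrow> x < y \<Longrightarrow> y < (6 * int m + 3) * y - x"
proof -
  assume "0 \<le> x" "x < y"
  hence "3 * y \<le> (6 * int m + 3) * y" by (intro mult_right_mono) auto
  thus ?thesis using \<open>0 \<le> x\<close> \<open>x < y\<close> by linarith
qed

lemma det_chn_increasing:
  "0 \<le> det (chn \<mu> i) (chn \<mu> (i + n)) \<and> det (chn \<mu> i) (chn \<mu> (i + n)) < det (chn \<mu> i) (chn \<mu> (Suc (i + n)))"
proof (induction n)
  case 0
  thus ?case by (simp add: det_chn_Suc)
next
  case (Suc n)
  thus ?case using det_chn_rec(1)[of "chn \<mu> i" \<mu> "i + n"] triple_growth by simp
qed

lemma det_chn_decreasing:
  "0 \<le> det (chn \<mu> (Suc i)) (chn \<mu> (Suc (i + n))) \<and> det (chn \<mu> (Suc i)) (chn \<mu> (Suc (i + n))) < det (chn \<mu> i) (chn \<mu> (Suc (i + n)))"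
proof (induction n arbitrary: i)
  case 0
  thus ?case by (simp add: det_chn_Suc)
next
  case (Suc n)
  thus ?case using Suc[of "Suc i"] det_chn_rec(2)[of \<mu> i "chn \<mu> (Suc (Suc (i + n)))"] triple_growth by simp
qed

lemma det_chn_pos: "i < j \<Longrightarrow> 0 < det (chn \<mu> i) (chn \<mu> j)"
  using det_chn_increasing[of \<mu> i "j - i - 1"] by simp

lemma snd_chn: "snd (chn \<mu> j) = det (chn \<mu> 0) (chn \<mu> j)"
  by (simp add: det_def chn.simps(1))

lemma chn_cusp [simp]: "chn \<mu> j \<in> cusps"
proof (cases "j = 0")
  case False
  hence "snd (chn \<mu> j) > 0" unfolding snd_chn using det_chn_pos by simp
  moreover have "coprime (fst (chn \<mu> j)) (snd (chn \<mu> j))"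
  proof (rule coprimeI)
    fix k assume "k dvd fst (chn \<mu> j)" "k dvd snd (chn \<mu> j)"
    hence "k dvd det (chn \<mu> j) (chn \<mu> (Suc j))" unfolding det_def by (simp add: dvd_diff)
    thus "is_unit k" by (simp add: det_chn_Suc)
  qed
  ultimately show ?thesis by (simp add: cusps_def)
qed (simp add: cusps_def chn.simps(1))

lemma chn_inj: "chn \<mu> i = chn \<mu> j \<longleftrightarrow> i = j"
  using det_chn_pos[of i j \<mu>] det_chn_pos[of j i \<mu>] by (metis det_self less_irrefl nat_neq_iff)

lemma abs_det_chn: "\<bar>det (chn \<mu> i) (chn \<mu> j)\<bar> = det (chn \<mu> (min i j)) (chn \<mu> (max i j))"
proof (cases i j rule: linorder_cases)
  case less
  thus ?thesis using det_chn_pos[OF less, of \<mu>] by simp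
next
  case greater
  thus ?thesis using det_chn_pos[OF greater, of \<mu>] det_swap[of "chn \<mu> i" "chn \<mu> j"] by simp
qed simp

lemma det_chn_zero_mono: "det (chn \<mu> 0) (chn \<mu> i) < det (chn \<mu> 0) (chn \<mu> j) \<longleftrightarrow> i < j"
proof -
  have "strict_mono (\<lambda>i. det (chn \<mu> 0) (chn \<mu> i))" unfolding strict_mono_Suc_iff using det_chn_increasing[of \<mu> 0] by simp
  thus ?thesis using strict_mono_less[of "\<lambda>i. det (chn \<mu> 0) (chn \<mu> i)" i j] by simp
qed

text \<open>Consecutive vertices have determinant one, and the determinants with a third cusp are at
  least one in modulus.\<close>

lemma wnd_chn_edge:
  assumes "c \<in> cusps" shows "\<bar>wnd c (chn \<mu> i) (chn \<mu> (Suc i))\<bar> \<le> 1 / 6"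
proof (cases "c = chn \<mu> i \<or> c = chn \<mu> (Suc i)")
  case False
  let ?x = "\<bar>det c (chn \<mu> i)\<bar>" and ?y = "\<bar>det (chn \<mu> (Suc i)) c\<bar>"
  have "1 \<le> ?x" "1 \<le> ?y" using False assms det_ge_1[of c "chn \<mu> i"] det_ge_1[of "chn \<mu> (Suc i)" c] by auto
  hence "1 * 1 \<le> ?x * ?y" by (intro mult_mono) auto
  hence "(1::real) \<le> of_int ?x * of_int ?y" by (metis of_int_1_le_iff of_int_mult mult_1)
  hence "1 / (6 * (of_int ?x * of_int ?y)) \<le> (1::real) / 6" by (simp add: field_simps)
  thus ?thesis unfolding abs_wnd by (simp add: det_chn_Suc mult.assoc)
qed auto

lemma wnd_turn: "wnd (chn \<mu> (Suc i)) (chn \<mu> i) (chn \<mu> (Suc (Suc i))) = \<mu> (Suc i) + 1 / 2"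
proof -
  have "det (chn \<mu> i) (chn \<mu> (Suc (Suc i))) = 6 * int (\<mu> (Suc i)) + 3"
    using det_chn_rec(1)[of "chn \<mu> i" \<mu> i] by (simp add: det_chn_Suc)
  thus ?thesis unfolding wnd_def using det_swap[of "chn \<mu> (Suc i)" "chn \<mu> i"] det_swap[of "chn \<mu> (Suc (Suc i))" "chn \<mu> (Suc i)"]
    by (simp add: det_chn_Suc)
qed

lemma abs_wnd_le:
  assumes "\<bar>det e a\<bar> * \<bar>det b e\<bar> \<ge> \<bar>det a b\<bar>" shows "\<bar>wnd e a b\<bar> \<le> 1 / 6"
proof (cases "\<bar>det e a\<bar> * \<bar>det b e\<bar> = 0")
  case True
  thus ?thesis unfolding wnd_def by auto
next
  case False
  hence "\<bar>det e a\<bar> * \<bar>det b e\<bar> > 0" by (metis abs_ge_zero abs_mult order_le_less)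
  hence p: "0 < real_of_int \<bar>det e a\<bar> * real_of_int \<bar>det b e\<bar>" by (metis of_int_0_less_iff of_int_mult)
  have "real_of_int \<bar>det a b\<bar> \<le> real_of_int \<bar>det e a\<bar> * real_of_int \<bar>det b e\<bar>" using assms by (metis of_int_le_iff of_int_mult)
  thus ?thesis unfolding abs_wnd using p by (simp add: divide_le_eq mult.assoc)
qed

text \<open>Together with \<open>wnd_chn_after\<close>: by monotonicity of determinants along the
  chain, an end of the chain looks from a vertex like the neighbouring vertex, up to
  \<open>1 / 6\<close>. So the turns stay inside their unit intervals.\<close>

lemma wnd_chn_before: "\<bar>wnd (chn \<mu> (Suc i)) (chn \<mu> 0) (chn \<mu> i)\<bar> \<le> 1 / 6"
proof (rule abs_wnd_le)
  show "\<bar>det (chn \<mu> 0) (chn \<mu> i)\<bar> \<le> \<bar>det (chn \<mu> (Suc i)) (chn \<mu> 0)\<bar> * \<bar>det (chn \<mu> i) (chn \<mu> (Suc i))\<bar>"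
    using det_chn_increasing[of \<mu> 0 i] by (simp only: abs_det_chn det_chn_Suc) simp
qed

lemma wnd_chn_after:
  assumes "i < n" shows "\<bar>wnd (chn \<mu> i) (chn \<mu> (Suc i)) (chn \<mu> n)\<bar> \<le> 1 / 6"
proof (rule abs_wnd_le)
  obtain k where n: "n = Suc (i + k)" using assms less_iff_Suc_add by auto
  show "\<bar>det (chn \<mu> (Suc i)) (chn \<mu> n)\<bar> \<le> \<bar>det (chn \<mu> i) (chn \<mu> (Suc i))\<bar> * \<bar>det (chn \<mu> n) (chn \<mu> i)\<bar>"
    using det_chn_decreasing[of \<mu> i k] unfolding n by (simp only: abs_det_chn det_chn_Suc) simp
qed

lemma wnd_chn_left: "\<bar>wnd (chn \<mu> (Suc i)) (chn \<mu> 0) (chn \<mu> (Suc (Suc i))) - (\<mu> (Suc i) + 1 / 2)\<bar> \<le> 1 / 6"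
  using wnd_add_cusp[of "chn \<mu> (Suc i)" "chn \<mu> 0" "chn \<mu> i" "chn \<mu> (Suc (Suc i))"] wnd_chn_before[of \<mu> i] wnd_turn[of \<mu> i]
  by (simp add: chn_inj)

lemma wnd_chn_right:
  "Suc i < n \<Longrightarrow> \<bar>wnd (chn \<mu> (Suc i)) (chn \<mu> i) (chn \<mu> n) - (\<mu> (Suc i) + 1 / 2)\<bar> \<le> 1 / 6"
  using wnd_add_cusp[of "chn \<mu> (Suc i)" "chn \<mu> i" "chn \<mu> (Suc (Suc i))" "chn \<mu> n"] wnd_chn_after[of "Suc i" n \<mu>] wnd_turn[of \<mu> i]
  by (simp add: chn_inj)

lemma big_chn:
  assumes \<mu>: "\<mu> (Suc i) \<ge> 3" and n: "Suc i < n" shows "big (chn \<mu> 0) (chn \<mu> n) (chn \<mu> (Suc i))"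
proof -
  have "wnd (chn \<mu> (Suc i)) (chn \<mu> 0) (chn \<mu> n) =
      wnd (chn \<mu> (Suc i)) (chn \<mu> 0) (chn \<mu> i) + wnd (chn \<mu> (Suc i)) (chn \<mu> i) (chn \<mu> n)"
    by (rule wnd_add_cusp) (use n in \<open>auto simp: chn_inj\<close>)
  moreover have "real (\<mu> (Suc i)) \<ge> 3" using \<mu> by simp
  ultimately have "wnd (chn \<mu> (Suc i)) (chn \<mu> 0) (chn \<mu> n) > 29 / 10"
    using wnd_chn_before[of \<mu> i] wnd_chn_right[OF n, of \<mu>] by linarith
  thus ?thesis by (simp add: big_def)
qed

lemma adjc_chn: "adjc (chn \<mu> i) (chn \<mu> (Suc i))"
  unfolding adjc_def using wnd_chn_edge[of _ \<mu> i] by (force simp: chn_inj)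

lemma triples_chn_mem:
  assumes "Suc (Suc i) < n" shows "(1, chn \<mu> (Suc i), chn \<mu> (Suc (Suc i))) \<in> triples (\<mu> (Suc i)) (\<mu> (Suc (Suc i))) (chn \<mu> 0) (chn \<mu> n)"
proof -
  let ?a = "wnd (chn \<mu> (Suc i)) (chn \<mu> 0) (chn \<mu> (Suc (Suc i)))" and ?b = "wnd (chn \<mu> (Suc (Suc i))) (chn \<mu> (Suc i)) (chn \<mu> n)"
  have "\<mu> (Suc i) < ?a" "?a < \<mu> (Suc i) + 1" "\<mu> (Suc (Suc i)) < ?b" "?b < \<mu> (Suc (Suc i)) + 1"
    using wnd_chn_left[of \<mu> i] wnd_chn_right[OF assms, of \<mu>] by linarith+
  thus ?thesis using adjc_chn[of \<mu> "Suc i"] by (simp add: triples_def)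
qed

text \<open>A cusp that is big for the ends of the chain but not on it would lie between two consecutive chain
  vertices, where \<open>big_order\<close> and \<open>big_between\<close> contradict \<open>wnd_chn_edge\<close>.\<close>

lemma big_on_chn:
  assumes \<mu>: "\<And>j. \<mu> j \<ge> 3" and c: "big (chn \<mu> 0) (chn \<mu> n) c"
  obtains i where "Suc i < n" "c = chn \<mu> (Suc i)"
proof (cases "\<exists>i\<le>n. c = chn \<mu> i")
  case True
  then obtain i where i: "i \<le> n" "c = chn \<mu> i" by blast
  have "i \<noteq> 0" "i \<noteq> n" using big_ne[OF c] unfolding i(2) chn_inj by auto
  thus ?thesis using that[of "i - 1"] i by auto
next
  case False
  let ?E = "chn \<mu>" and ?D = "\<lambda>x. \<bar>det (chn \<mu> 0) x\<bar>"
  have cc: "c \<in> cusps" using c by (simp add: big_def)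
  have n0: "n \<noteq> 0"
  proof
    assume "n = 0"
    thus False using c by (simp add: big_def)
  qed
  let ?P = "\<lambda>i. i < n \<and> ?D (?E i) \<le> ?D c"
  have P0: "?P 0" using n0 by simp
  define i where "i = (GREATEST i. ?P i)"
  have Pi: "?P i" unfolding i_def by (rule GreatestI_nat[where P = ?P and k = 0 and b = n]) (use P0 in auto)
  have max: "j \<le> i" if "?P j" for j unfolding i_def by (rule Greatest_le_nat[where P = ?P and k = j and b = n]) (use that in auto)
  have nb: "?D c \<le> ?D (?E (Suc i))" if "Suc i < n" using max[of "Suc i"] that by force
  have ne: "c \<noteq> ?E i" "c \<noteq> ?E (Suc i)" using False Pi by (auto simp: Suc_le_eq)
  have edge: "\<bar>wnd c (?E i) (?E (Suc i))\<bar> \<le> 1 / 6" by (rule wnd_chn_edge[OF cc])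
  have big: "big (?E 0) (?E n) (?E j)" if "0 < j" "j < n" for j using big_chn[of \<mu> "j - 1" n] \<mu> that by simp
  note C = chn_cusp[of \<mu> 0] chn_cusp[of \<mu> n]
  consider "i = 0" "Suc i = n" | "i = 0" "Suc i < n" | "i > 0" "Suc i = n" | "i > 0" "Suc i < n" using Pi by linarith
  thus ?thesis
  proof cases
    case 1
    thus ?thesis using edge c by (simp add: big_def)
  next
    case 2
    have "\<bar>wnd c (?E 0) (?E (Suc i))\<bar> > 27 / 10" by (rule big_order(4)[OF C c big ne(2) nb]) (use 2 in auto)
    thus ?thesis using edge 2 by simp
  next
    case 3
    have "\<bar>wnd c (?E i) (?E n)\<bar> > 27 / 10" by (rule big_order(2)[OF C big c]) (use 3 Pi ne in auto)
    thus ?thesis using edge 3 by simp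
  next
    case 4
    have "\<bar>wnd c (?E i) (?E (Suc i))\<bar> > 2" by (rule big_between[OF C big big c]) (use 4 Pi ne nb in auto)
    thus ?thesis using edge by simp
  qed
qed

text \<open>Both cusps lie on the chain by \<open>big_on_chn\<close>, and adjacency makes them
  consecutive, since a big vertex in between would separate them. All turns of the chain are
  positive, hence \<open>\<epsilon> = 1\<close>, and a value within \<open>1 / 6\<close> of a
  half-integer determines \<open>p\<close> and \<open>q\<close>.\<close>

lemma triples_chn_only:
  assumes \<mu>: "\<And>j. \<mu> j \<ge> 3" and pq: "p \<ge> 3" "q \<ge> 3" and t: "(\<epsilon>, c, d) \<in> triples p q (chn \<mu> 0) (chn \<mu> n)"
  shows "\<exists>i. p = \<mu> i \<and> q = \<mu> (Suc i)"
proof -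
  note C = chn_cusp[of \<mu> 0] chn_cusp[of \<mu> n]
  note b = triples_big[OF C pq t]
  obtain i where i: "Suc i < n" "c = chn \<mu> (Suc i)" using big_on_chn[OF \<mu> b(2)] by blast
  obtain j where j: "Suc j < n" "d = chn \<mu> (Suc j)" using big_on_chn[OF \<mu> b(3)] by blast
  have t': "\<epsilon> = 1 \<or> \<epsilon> = -1" "adjc c d" "real p < \<epsilon> * wnd c (chn \<mu> 0) d" "\<epsilon> * wnd c (chn \<mu> 0) d < real p + 1"
    "real q < \<epsilon> * wnd d c (chn \<mu> n)" "\<epsilon> * wnd d c (chn \<mu> n) < real q + 1"
    using t by (auto simp: triples_def)
  have ij: "i < j" using b(4) unfolding i(2) j(2) abs_det_chn using det_chn_zero_mono[of \<mu> "Suc i" "Suc j"] by simp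
  have "j = Suc i"
  proof (rule ccontr)
    assume "j \<noteq> Suc i"
    hence "\<not> adjc c d"
      unfolding i(2) j(2) using i j ij \<mu>
      by (intro big_between_not_adjc[OF C big_chn big_chn big_chn[of \<mu> "Suc i"]])
        (auto simp: chn_inj abs_det_chn det_chn_zero_mono less_imp_le)
    thus False using t'(2) by simp
  qed
  hence d: "d = chn \<mu> (Suc (Suc i))" using j by simp
  have l: "\<bar>wnd c (chn \<mu> 0) d - (\<mu> (Suc i) + 1 / 2)\<bar> \<le> 1 / 6" unfolding d i(2) by (rule wnd_chn_left)
  have r: "\<bar>wnd d c (chn \<mu> n) - (\<mu> (Suc (Suc i)) + 1 / 2)\<bar> \<le> 1 / 6" unfolding d i(2) by (rule wnd_chn_right) (use j d chn_inj in auto)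
  have eps: "\<epsilon> = 1"
  proof (rule ccontr)
    assume "\<epsilon> \<noteq> 1"
    hence "\<epsilon> = -1" using t'(1) by simp
    thus False using t'(3) l by simp
  qed
  have floor: "x = y" if "real x < w" "w < real x + 1" "\<bar>w - (real y + 1 / 2)\<bar> \<le> 1 / 6" for x y :: nat and w
  proof -
    have "real x < real y + 1" "real y < real x + 1" using that by linarith+
    thus ?thesis by linarith
  qed
  have "p = \<mu> (Suc i)" by (rule floor[OF _ _ l]) (use t'(3,4) eps in simp_all)
  moreover have "q = \<mu> (Suc (Suc i))" by (rule floor[OF _ _ r]) (use t'(5,6) eps in simp_all)
  ultimately show ?thesis by blast
qed

text \<open>The word of index \<open>m\<close> turns around consecutive cusps by \<open>3m+3, 3m+4, 3m+5\<close> periodically.  The three values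
  are distinct, so the pair \<open>(3m+3, 3m+4)\<close> never occurs in the reverse order, nor for another \<open>m\<close>.\<close>

definition fam :: "nat \<Rightarrow> nat \<Rightarrow> nat" where
  "fam m j = 3 * m + 3 + j mod 3"

lemma fam_ge: "fam m j \<ge> 3"
  by (simp add: fam_def)

lemma fam_eq: "fam m j = 3 * m' + 3 + r \<Longrightarrow> r < 3 \<Longrightarrow> m = m' \<and> j mod 3 = r"
proof -
  assume "fam m j = 3 * m' + 3 + r" "r < 3"
  thus ?thesis unfolding fam_def by presburger
qed

lemma tdiff_fam_other:
  assumes "m \<noteq> m'" shows "tdiff (3 * m' + 3) (3 * m' + 4) (chn (fam m) 0) (chn (fam m) n) = 0"
proof -
  have 1: "triples (3 * m' + 3) (3 * m' + 4) (chn (fam m) 0) (chn (fam m) n) = {}"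
    using triples_chn_only[of "fam m" "3 * m' + 3" "3 * m' + 4"] fam_ge fam_eq[of m _ m' 0] assms by fastforce
  have "triples (3 * m' + 4) (3 * m' + 3) (chn (fam m) 0) (chn (fam m) n) = {}"
    using triples_chn_only[of "fam m" "3 * m' + 4" "3 * m' + 3"] fam_ge fam_eq[of m _ m' 0] assms by fastforce
  hence "triples (3 * m' + 3) (3 * m' + 4) (chn (fam m) n) (chn (fam m) 0) = {}"
    using triples_reverse by (metis equals0I empty_iff prod_cases3)
  thus ?thesis using 1 by (simp add: tdiff_def)
qed

lemma tdiff_fam:
  shows "real N \<le> tdiff (3 * m + 3) (3 * m + 4) (chn (fam m) 0) (chn (fam m) (3 * N)) + 1"
proof -
  let ?p = "3 * m + 3" and ?q = "3 * m + 4" and ?E = "chn (fam m)"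
  have "triples ?q ?p (?E 0) (?E (3 * N)) = {}"
  proof (rule ccontr)
    assume "triples ?q ?p (?E 0) (?E (3 * N)) \<noteq> {}"
    then obtain \<epsilon> c d where "(\<epsilon>, c, d) \<in> triples ?q ?p (?E 0) (?E (3 * N))" by (metis equals0I prod_cases3)
    then obtain i where i: "?q = fam m i" "?p = fam m (Suc i)" using triples_chn_only[of "fam m" ?q ?p \<epsilon> c d "3 * N", OF fam_ge] by auto
    hence "i mod 3 = 1" "Suc i mod 3 = 0" using fam_eq[of m i m 1] fam_eq[of m "Suc i" m 0] by simp_all
    thus False by presburger
  qed
  hence 0: "triples ?p ?q (?E (3 * N)) (?E 0) = {}" using triples_reverse by (metis equals0I empty_iff prod_cases3)
  define f where "f t = (1 :: real, ?E (3 * t), ?E (Suc (3 * t)))" for t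
  \<comment> \<open>The index 0 is left out because the chain starts there and makes no turn; this
    is the one in the bound.\<close>
  have "f ` {1..<N} \<subseteq> triples ?p ?q (?E 0) (?E (3 * N))"
  proof
    fix x assume "x \<in> f ` {1..<N}"
    then obtain t where t: "x = f t" "1 \<le> t" "t < N" by auto
    then obtain i where i: "3 * t = Suc i" by (metis Suc_pred nat_0_less_mult_iff zero_less_numeral less_le_trans zero_less_one)
    have "fam m (Suc i) = ?p" "fam m (Suc (Suc i)) = ?q" unfolding i[symmetric] by (simp_all add: fam_def)
    thus "x \<in> triples ?p ?q (?E 0) (?E (3 * N))" using triples_chn_mem[of i "3 * N" "fam m"] i t by (simp add: f_def)
  qed
  moreover have "inj_on f {1..<N}" by (auto simp: inj_on_def f_def chn_inj)
  ultimately have "card {1..<N} \<le> card (triples ?p ?q (?E 0) (?E (3 * N)))"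
    by (intro card_inj_on_le[of f] finite_triples) simp_all
  thus ?thesis using 0 by (simp add: tdiff_def)
qed

text \<open>Dropping the first entry of the continued fraction amounts to applying a fixed matrix.
  So a chain with periodic entries is traced out by the powers of one group element, as
  \<open>actc_fam_word\<close> shows.\<close>

lemma chn_shift: "chn \<mu> (Suc n) = mapp (6 * int (\<mu> 0) + 3, -1, 1, 0) (chn (\<lambda>j. \<mu> (Suc j)) n)"
proof (induction n rule: induct_nat_012)
  case 0
  thus ?case by (simp add: chn.simps)
next
  case 1
  thus ?case by (simp add: chn.simps algebra_simps)
next
  case (ge2 n)
  obtain a b c d where "chn (\<lambda>j. \<mu> (Suc j)) n = (a, b)" "chn (\<lambda>j. \<mu> (Suc j)) (Suc n) = (c, d)" by fastforce
  thus ?case unfolding chn.simps(3)[of \<mu> "Suc n"] chn.simps(3)[of "\<lambda>j. \<mu> (Suc j)" n] ge2 by (simp add: algebra_simps)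
qed

lemma chn_mv: "chn \<mu> (Suc n) = mv (6 * int (\<mu> 0) + 3, -1, 1, 0) (chn (\<lambda>j. \<mu> (Suc j)) n)"
  unfolding mv_def chn_shift[symmetric] by (simp add: cusp_nrm)

text \<open>The commutator acts by \<open>z \<mapsto> z + 6\<close> and \<open>x y\<close> by \<open>z \<mapsto> 3 - 1/z\<close>.\<close>

definition twist_word :: "nat \<Rightarrow> letter list" where
  "twist_word k = concat (replicate k comm_word) @ [(False, True), (True, True)]"

lemma actc_twist_word:
  assumes v: "v \<in> cusps" shows "actc (twist_word k) v = mv (6 * int k + 3, -1, 1, 0) v"
proof -
  have c: "actc (concat (replicate k comm_word)) u = mv (shear (int k) (qv 0)) u" if "u \<in> cusps" for u
  proof (induction k)
    case 0
    thus ?case using that by (simp add: shear_zero)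
  next
    case (Suc k)
    have "actc (concat (replicate (Suc k) comm_word)) u = actc comm_word (mv (shear (int k) (qv 0)) u)"
      unfolding replicate_Suc concat.simps actc_append Suc ..
    also have "\<dots> = mv (shear 1 (qv 0)) (mv (shear (int k) (qv 0)) u)"
      by (rule actc_comm) (use that in \<open>simp add: mv_cusp\<close>)
    finally show ?case using shear_add[OF qv_cusp that, of 1 0 "int k"] by simp
  qed
  have "actc [(False, True), (True, True)] v = mv (3, -1, 1, 0) v"
    using mv_mv[of "lm (False, True)" "lm (True, True)" v] v by (cases v) (simp add: mv_def algebra_simps)
  moreover have "mv (3, -1, 1, 0) v \<in> cusps" using v by (simp add: mv_cusp)
  ultimately have "actc (twist_word k) v = mv (shear (int k) (qv 0)) (mv (3, -1, 1, 0) v)"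
    unfolding twist_word_def actc_append using c by simp
  also have "\<dots> = nrm (mapp (shear (int k) (qv 0)) (mapp (3, -1, 1, 0) v))"
    by (rule mv_mv) (use v in simp_all)
  finally show ?thesis unfolding mv_def by (cases v) (simp add: shear_def qv.simps algebra_simps)
qed

definition fam_word :: "nat \<Rightarrow> letter list" where
  "fam_word m = twist_word (fam m 0) @ twist_word (fam m 1) @ twist_word (fam m 2)"

lemma actc_fam_word: "actc (concat (replicate N (fam_word m))) (qv 0) = chn (fam m) (3 * N)"
proof (induction N)
  case 0
  thus ?case by (simp add: chn.simps qv.simps)
next
  case (Suc N)
  have per: "(\<lambda>j. fam m (Suc (Suc (Suc j)))) = fam m"
  proof
    fix j :: nat
    have "Suc (Suc (Suc j)) mod 3 = j mod 3" by presburger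
    thus "fam m (Suc (Suc (Suc j))) = fam m j" by (simp add: fam_def)
  qed
  have "chn (fam m) (3 * Suc N) = chn (fam m) (Suc (Suc (Suc (3 * N))))" by (simp add: numeral_3_eq_3)
  also have "\<dots> = mv (6 * int (fam m 0) + 3, -1, 1, 0) (mv (6 * int (fam m 1) + 3, -1, 1, 0)
      (mv (6 * int (fam m 2) + 3, -1, 1, 0) (chn (fam m) (3 * N))))"
    by (simp only: chn_mv per One_nat_def Suc_1[symmetric])
  also have "\<dots> = actc (fam_word m) (chn (fam m) (3 * N))"
    unfolding fam_word_def actc_append by (simp add: actc_twist_word mv_cusp)
  finally show ?case using Suc by (simp add: actc_append)
qed

lemma hh_fam_word:
  "m \<noteq> m' \<Longrightarrow> hh (3 * m' + 3) (3 * m' + 4) (GL.ev (concat (replicate N (fam_word m)))) = 0"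
  "real N \<le> hh (3 * m + 3) (3 * m + 4) (GL.ev (concat (replicate N (fam_word m)))) + 1"
  using tdiff_fam_other[of m m' "3 * N"] tdiff_fam[of N m]
  by (simp_all add: hh_def mv_ev actc_fam_word) (simp_all add: qv.simps chn.simps)

section \<open>Two infinite cyclic factors\<close>

lemma (in group) sub_subgroup:
  assumes "subgroup S G" "U \<in> S" "V \<in> S" shows "sub U V w \<in> S"
  by (induction w) (use assms in \<open>auto simp: sl_def Let_def subgroup.one_closed subgroup.m_closed subgroup.m_inv_closed\<close>)

lemma (in group) sub_hom:
  assumes K: "group K" and f: "f \<in> hom G K" and UV: "U \<in> carrier G" "V \<in> carrier G"
  shows "f (sub U V w) = group.sub K (f U) (f V) w"
proof -
  interpret f: group_hom G K f using K f by (simp add: group_hom_def group_hom_axioms_def)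
  have "f (sl U V l) = group.sl K (f U) (f V) l" for l using UV by (simp add: sl_def f.H.sl_def Let_def)
  thus ?thesis by (induction w) (use UV in \<open>simp_all\<close>)
qed

lemma (in group) sub_replicate:
  assumes "U \<in> carrier G" "V \<in> carrier G"
  shows "sub U V (replicate n (b, True)) = (if b then V else U) [^] n" "sub U V (replicate n (b, False)) = inv ((if b then V else U) [^] n)"
proof -
  show 1: "sub U V (replicate n (b, True)) = (if b then V else U) [^] n"
    by (induction n) (use assms in \<open>auto simp: sl_def sub_append simp flip: replicate_append_same\<close>)
  have "replicate n (b, False) = wi (replicate n (b, True))" by (simp add: wi_def linv_def)
  thus "sub U V (replicate n (b, False)) = inv ((if b then V else U) [^] n)" using sub_wi[OF assms] 1 by simp
qed

definition pow_word :: "bool \<Rightarrow> int \<Rightarrow> letter list" where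
  "pow_word b k = (if k \<ge> 0 then replicate (nat k) (b, True) else replicate (nat (- k)) (b, False))"

lemma (in group) sub_pow_word:
  assumes "U \<in> carrier G" "V \<in> carrier G" shows "sub U V (pow_word b k) = (if b then V else U) [^] k"
  by (cases "k \<ge> 0") (simp_all only: pow_word_def int_pow_def2 sub_replicate[OF assms] not_le[symmetric] if_True if_False not_not simp_thms)

context free_prod
begin

text \<open>Automorphisms preserve the normal closure of the factors that are not infinite cyclic,
  so each of them replaces the pair of free generators in the quotient by another pair that spans,
  and \<open>good_if_spans\<close> bounds the change of the count.\<close>

lemma quasimorphisms_two_cyclic_factors:
  assumes fi: indecomposable_factors and nc: "noncyc = I - {z1, z2}" and z: "z1 \<noteq> z2"
    and cg: "cyc_gen z1 \<zeta>1" "cyc_gen z2 \<zeta>2"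
  shows "\<exists>S. infinite S \<and> lin_indep_funs G S \<and>
      (\<forall>\<psi>\<in>S. quasimorphism G \<psi> \<and> homogeneous_qm G \<psi> \<and> aut_invariant G \<psi> \<and> (\<forall>g\<in>\<Union>(H ` I). \<psi> g = 0))"
proof -
  interpret c1: free_prod_cyclic G I H z1 \<zeta>1 by unfold_locales (rule cg(1))
  interpret c2: free_prod_cyclic G I H z2 \<zeta>2 by unfold_locales (rule cg(2))
  note GLg = group_GL
  define f where "f i a = (if i = z1 then mA [^]\<^bsub>GL\<^esub> c1.expo a else if i = z2 then mB [^]\<^bsub>GL\<^esub> c2.expo a else \<one>\<^bsub>GL\<^esub>)" for i a
  have f: "letter_homs GL f"
    unfolding letter_homs_def
  proof (intro ballI homI)
    fix i a b assume i: "i \<in> I"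
    show "a \<in> carrier (G\<lparr>carrier := H i\<rparr>) \<Longrightarrow> f i a \<in> carrier GL" by (simp add: f_def del: lm.simps)
    assume "a \<in> carrier (G\<lparr>carrier := H i\<rparr>)" "b \<in> carrier (G\<lparr>carrier := H i\<rparr>)"
    thus "f i (a \<otimes>\<^bsub>G\<lparr>carrier := H i\<rparr>\<^esub> b) = f i a \<otimes>\<^bsub>GL\<^esub> f i b"
      using c1.expo_mult[of a b] c2.expo_mult[of a b] by (auto simp: f_def GL.int_pow_mult simp del: lm.simps)
  qed
  define \<rho> where "\<rho> = extend GL f"
  have rho: "\<rho> \<in> hom G GL" unfolding \<rho>_def by (rule extend_hom[OF GLg f])
  have rho_l: "\<rho> a = f i a" if "i \<in> I" "a \<in> H i" for i a unfolding \<rho>_def by (rule extend_letter[OF GLg f that])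
  have rz: "\<rho> \<zeta>1 = mA" "\<rho> \<zeta>2 = mB" using rho_l[OF c1.z_I c1.zeta_H] rho_l[OF c2.z_I c2.zeta_H] c1.expo_zeta c2.expo_zeta z
    by (simp_all add: f_def GL.int_pow_1 del: lm.simps)
  \<comment> \<open>One set for \<open>\<rho>\<close> and for \<open>\<rho>\<close> after an
    automorphism: the same word in the images of \<open>\<zeta>1\<close> and \<open>\<zeta>2\<close>
    then computes both, which is what \<open>good\<close> compares.\<close>
  define \<Theta> where "\<Theta> = {\<theta> \<in> hom G GL. \<forall>i\<in>noncyc. \<forall>a\<in>H i. \<theta> a = \<one>\<^bsub>GL\<^esub>}"
  have word: "\<exists>w. \<forall>\<theta>\<in>\<Theta>. \<theta> g = GL.sub (\<theta> \<zeta>1) (\<theta> \<zeta>2) w" if "g \<in> carrier G" for g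
    using that
  proof (induction rule: letter_induct)
    case one
    thus ?case using hom_one[OF _ group_axioms GLg] by (intro exI[of _ "[]"]) (auto simp: \<Theta>_def)
  next
    case (letter i a g)
    obtain w where w: "\<And>\<theta>. \<theta> \<in> \<Theta> \<Longrightarrow> \<theta> g = GL.sub (\<theta> \<zeta>1) (\<theta> \<zeta>2) w" using letter by blast
    have "\<exists>u. \<forall>\<theta>\<in>\<Theta>. \<theta> a = GL.sub (\<theta> \<zeta>1) (\<theta> \<zeta>2) u"
    proof -
      have cl: "\<theta> \<zeta>1 \<in> carrier GL" "\<theta> \<zeta>2 \<in> carrier GL" if "\<theta> \<in> \<Theta>" for \<theta>
        using that hom_in_carrier c1.zeta_closed c2.zeta_closed by (fastforce simp: \<Theta>_def)+
      consider "i = z1" | "i = z2" | "i \<in> noncyc" using letter(1) nc by blast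
      thus ?thesis
      proof cases
        case 1
        hence a: "a = \<zeta>1 [^] c1.expo a" using c1.zeta_expo letter(2) by simp
        have "\<theta> a = GL.sub (\<theta> \<zeta>1) (\<theta> \<zeta>2) (pow_word False (c1.expo a))" if "\<theta> \<in> \<Theta>" for \<theta>
          using hom_int_pow[OF _ c1.zeta_closed group_axioms GLg, of \<theta> "c1.expo a"] that a GL.sub_pow_word[OF cl[OF that], of False]
          by (simp add: \<Theta>_def)
        thus ?thesis by blast
      next
        case 2
        hence a: "a = \<zeta>2 [^] c2.expo a" using c2.zeta_expo letter(2) by simp
        have "\<theta> a = GL.sub (\<theta> \<zeta>1) (\<theta> \<zeta>2) (pow_word True (c2.expo a))" if "\<theta> \<in> \<Theta>" for \<theta>
          using hom_int_pow[OF _ c2.zeta_closed group_axioms GLg, of \<theta> "c2.expo a"] that a GL.sub_pow_word[OF cl[OF that], of True]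
          by (simp add: \<Theta>_def)
        thus ?thesis by blast
      next
        case 3
        thus ?thesis using letter(2) by (intro exI[of _ "[]"]) (simp add: \<Theta>_def)
      qed
    qed
    then obtain u where u: "\<And>\<theta>. \<theta> \<in> \<Theta> \<Longrightarrow> \<theta> a = GL.sub (\<theta> \<zeta>1) (\<theta> \<zeta>2) u" by blast
    have "\<theta> (a \<otimes> g) = GL.sub (\<theta> \<zeta>1) (\<theta> \<zeta>2) (u @ w)" if t: "\<theta> \<in> \<Theta>" for \<theta>
    proof -
      have th: "\<theta> \<in> hom G GL" using t by (simp add: \<Theta>_def)
      show ?thesis using hom_mult[OF th] u[OF t] w[OF t] letter(1-3) hom_in_carrier[OF th]
          GL.sub_append[of "\<theta> \<zeta>1" "\<theta> \<zeta>2" u w] by simp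
    qed
    thus ?case by blast
  qed
  have rT: "\<rho> \<in> \<Theta>" using rho rho_l nc by (auto simp: \<Theta>_def f_def)
  have x_pow: "\<rho> (sub \<zeta>1 \<zeta>2 w [^] n) = GL.ev (concat (replicate n w))" for w and n :: nat
  proof -
    have "\<rho> (sub \<zeta>1 \<zeta>2 w) = GL.ev w" using sub_hom[OF GLg rho c1.zeta_closed c2.zeta_closed, of w] rz sub_AB[of w] by simp
    hence "\<rho> (sub \<zeta>1 \<zeta>2 w [^] n) = GL.ev w [^]\<^bsub>GL\<^esub> n" using hom_nat_pow[OF rho _ group_axioms GLg, of "sub \<zeta>1 \<zeta>2 w" n] by simp
    also have "\<dots> = GL.ev (concat (replicate n w))" 
    proof (induction n)
      case (Suc n)
      have "GL.ev w [^]\<^bsub>GL\<^esub> Suc n = GL.ev w \<otimes>\<^bsub>GL\<^esub> GL.ev w [^]\<^bsub>GL\<^esub> n" by (rule GL.nat_pow_Suc2) simp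
      thus ?case using Suc by simp
    qed simp
    finally show ?thesis .
  qed
  show ?thesis
  proof (rule independent_homogenizations[of "\<lambda>m g. hh (3 * m + 3) (3 * m + 4) (\<rho> g)" "\<Union>(H ` I)" "\<lambda>m. sub \<zeta>1 \<zeta>2 (fam_word m)"])
    fix m :: nat
    let ?p = "3 * m + 3" and ?q = "3 * m + 4"
    have pq: "?p \<ge> 3" "?q \<ge> 3" by simp_all
    have "quasimorphism GL (hh ?p ?q)" unfolding quasimorphism_def using hh_mult[OF pq] by (intro exI[of _ 36]) auto
    thus "quasimorphism G (\<lambda>g. hh ?p ?q (\<rho> g))" using rho by (rule quasimorphism_hom)
    fix \<phi> assume phi: "\<phi> \<in> auto G"
    define \<theta> where "\<theta> g = \<rho> (\<phi> g)" for g
    have th: "\<theta> \<in> hom G GL" unfolding \<theta>_def by (rule hom_comp[OF auto_hom[OF phi] rho])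
    \<comment> \<open>The automorphism sends such a factor to a conjugate of another one of this
      kind, and \<open>\<rho>\<close> kills conjugates too.\<close>
    have "\<theta> a = \<one>\<^bsub>GL\<^esub>" if i: "i \<in> noncyc" "a \<in> H i" for i a
    proof -
      obtain j t where j: "j \<in> noncyc" "t \<in> carrier G" "\<phi> ` H i = cj t ` H j" using auto_conj_factor[OF fi phi i(1)] by blast
      then obtain b where b: "b \<in> H j" "\<phi> a = cj t b" using i(2) by blast
      have bc: "b \<in> carrier G" using H_closed[OF noncyc_I[OF j(1)] b(1)] .
      have rb: "\<rho> b = \<one>\<^bsub>GL\<^esub>" using rT j(1) b(1) by (simp add: \<Theta>_def)
      have "\<rho> (cj t b) = \<rho> t \<otimes>\<^bsub>GL\<^esub> \<rho> b \<otimes>\<^bsub>GL\<^esub> inv\<^bsub>GL\<^esub> \<rho> t"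
        unfolding cj_def using hom_mult[OF rho] bc j(2) group_hom.hom_inv[of G GL \<rho> t] rho GLg group_axioms
        by (simp add: group_hom_def group_hom_axioms_def)
      thus ?thesis using b(2) rb hom_in_carrier[OF rho j(2)] by (simp add: \<theta>_def)
    qed
    hence tT: "\<theta> \<in> \<Theta>" using th by (simp add: \<Theta>_def)
    have rev: "\<exists>w. \<rho> g = GL.ev w" if "g \<in> carrier G" for g using word[OF that] rT rz sub_AB by metis
    have phc: "\<phi> g \<in> carrier G" if "g \<in> carrier G" for g using hom_in_carrier[OF auto_hom[OF phi] that] .
    obtain u v where uv: "\<theta> \<zeta>1 = GL.ev u" "\<theta> \<zeta>2 = GL.ev v"
      using rev[OF phc[OF c1.zeta_closed]] rev[OF phc[OF c2.zeta_closed]] unfolding \<theta>_def by blast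
    \<comment> \<open>As \<open>\<phi>\<close> is onto, each value of \<open>\<rho>\<close> is a
      value of \<open>\<theta>\<close>, hence a word in the new pair.\<close>
    have "GL.spans (\<theta> \<zeta>1) (\<theta> \<zeta>2)"
      unfolding GL.spans_def
    proof (intro allI impI)
      fix S assume S: "subgroup S GL" "\<theta> \<zeta>1 \<in> S" "\<theta> \<zeta>2 \<in> S"
      have in_S: "\<rho> g \<in> S" if g: "g \<in> carrier G" for g
      proof -
        obtain \<phi>' where p: "\<phi>' \<in> hom G G" "\<And>g. g \<in> carrier G \<Longrightarrow> \<phi> (\<phi>' g) = g" using auto_inverse[OF phi] by metis
        obtain w where "\<theta> (\<phi>' g) = GL.sub (\<theta> \<zeta>1) (\<theta> \<zeta>2) w" using word[OF hom_in_carrier[OF p(1) g]] tT by blast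
        thus ?thesis using GL.sub_subgroup[OF S] p(2)[OF g] by (simp add: \<theta>_def)
      qed
      have "mA \<in> S" "mB \<in> S" using in_S[OF c1.zeta_closed] in_S[OF c2.zeta_closed] unfolding rz .
      hence "GL.sub mA mB [l] \<in> S" for l by (rule GL.sub_subgroup[OF S(1)])
      thus "range lm \<subseteq> S" unfolding sub_AB by auto
    qed
    hence "good ?p ?q (\<theta> \<zeta>1) (\<theta> \<zeta>2)" unfolding uv by (rule good_if_spans[OF pq])
    then obtain C where C: "\<And>w. \<bar>hh ?p ?q (GL.sub (\<theta> \<zeta>1) (\<theta> \<zeta>2) w) - hh ?p ?q (GL.ev w)\<bar> \<le> C" by (auto simp: good_def)
    have "\<bar>hh ?p ?q (\<theta> g) - hh ?p ?q (\<rho> g)\<bar> \<le> C" if g: "g \<in> carrier G" for g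
    proof -
      obtain w where "\<theta> g = GL.sub (\<theta> \<zeta>1) (\<theta> \<zeta>2) w" "\<rho> g = GL.sub (\<rho> \<zeta>1) (\<rho> \<zeta>2) w" using word[OF g] tT rT by blast
      thus ?thesis using C[of w] unfolding rz sub_AB by simp
    qed
    thus "\<exists>C. \<forall>g\<in>carrier G. \<bar>hh ?p ?q (\<rho> (\<phi> g)) - hh ?p ?q (\<rho> g)\<bar> \<le> C" unfolding \<theta>_def by blast
  next
    show "\<Union>(H ` I) \<subseteq> carrier G" by auto
  next
    fix m :: nat and g
    assume "g \<in> \<Union>(H ` I)"
    then obtain l where l: "l \<in> I" "g \<in> H l" by blast
    let ?p = "3 * m + 3" and ?q = "3 * m + 4"
    obtain C where C: "\<And>n l. \<bar>hh ?p ?q (GL.ev (replicate n l))\<bar> \<le> C" using hh_letter_power_bounded[of ?p ?q] by auto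
    have pw: "\<bar>hh ?p ?q (GL.ev (pow_word b k))\<bar> \<le> C" for b k
      using C[of "nat k" "(b, True)"] C[of "nat (- k)" "(b, False)"] by (cases "k \<ge> 0") (simp_all only: pow_word_def if_True if_False)
    have "\<bar>hh ?p ?q (\<rho> (g [^] n))\<bar> \<le> C" for n :: nat
    proof -
      let ?a = "g [^] n"
      note s = GL.sub_pow_word[OF lm_GL[of "(False, True)"] lm_GL[of "(True, True)"], unfolded sub_AB]
      consider "l = z1" | "l = z2" "l \<noteq> z1" | "l \<noteq> z1" "l \<noteq> z2" by blast
      hence "f l ?a = GL.ev (pow_word False (c1.expo ?a)) \<or> f l ?a = GL.ev (pow_word True (c2.expo ?a)) \<or> f l ?a = GL.ev (pow_word True 0)"
      proof cases
        case 1
        thus ?thesis unfolding s f_def by simp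
      next
        case 2
        thus ?thesis unfolding s f_def by simp
      next
        case 3
        thus ?thesis by (simp add: f_def pow_word_def)
      qed
      thus ?thesis unfolding rho_l[OF l(1) letter_pow_in[OF l]] using pw by (elim disjE) simp_all
    qed
    thus "\<exists>C. \<forall>n::nat. \<bar>hh ?p ?q (\<rho> (g [^] n))\<bar> \<le> C" by blast
  next
    show "sub \<zeta>1 \<zeta>2 (fam_word m) \<in> carrier G" for m by simp
    show "\<exists>C. \<forall>n::nat. \<bar>hh (3 * m + 3) (3 * m + 4) (\<rho> (sub \<zeta>1 \<zeta>2 (fam_word m') [^] n))\<bar> \<le> C" if "m \<noteq> m'" for m m'
      unfolding x_pow using hh_fam_word(1)[of m' m] that by (intro exI[of _ 0]) simp
    show "\<exists>C. \<forall>n::nat. real n \<le> \<bar>hh (3 * m + 3) (3 * m + 4) (\<rho> (sub \<zeta>1 \<zeta>2 (fam_word m) [^] n))\<bar> + C" for m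
    proof (intro exI allI)
      fix n :: nat
      show "real n \<le> \<bar>hh (3 * m + 3) (3 * m + 4) (\<rho> (sub \<zeta>1 \<zeta>2 (fam_word m) [^] n))\<bar> + 1"
        unfolding x_pow using hh_fam_word(2)[of n m] by linarith
    qed
  qed
qed

end

lemma (in group) two_elements_iso:
  assumes "carrier G = {\<one>, a}" "a \<noteq> \<one>" shows "G \<cong> integer_mod_group 2"
proof -
  have a: "a \<in> carrier G" using assms by simp
  have "a \<otimes> a \<noteq> a" using assms a by (metis r_cancel_one)
  hence aa: "a \<otimes> a = \<one>" using assms m_closed[OF a a] by auto
  define f where "f x = (if x = \<one> then 0 else 1 :: int)" for x
  have Z: "carrier (integer_mod_group 2) = {0, 1}" "x \<otimes>\<^bsub>integer_mod_group 2\<^esub> y = (x + y) mod 2" for x y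
    by (auto simp: integer_mod_group_def)
  have "f \<in> iso G (integer_mod_group 2)"
  proof (rule isoI)
    show "f \<in> hom G (integer_mod_group 2)"
      by (rule homI) (use assms a aa Z in \<open>auto simp: f_def\<close>)
    show "bij_betw f (carrier G) (carrier (integer_mod_group 2))"
      unfolding Z(1) assms(1) using assms(2) by (auto simp: bij_betw_def f_def)
  qed
  thus ?thesis by (auto simp: is_iso_def)
qed

theorem theorem1p1:
  fixes G :: "'a monoid" and k :: nat and H :: "nat \<Rightarrow> 'a set"
  assumes "k \<ge> 2"
    and "is_free_product G {1..k} H"
    and "\<forall>i\<in>{1..k}. freely_indecomposable (G\<lparr>carrier := H i\<rparr>)"
    and "card {i\<in>{1..k}. infinite_cyclic (G\<lparr>carrier := H i\<rparr>)} \<le> 2"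
    and "\<exists>j\<in>{1..k}. \<not> (G\<lparr>carrier := H j\<rparr> \<cong> integer_mod_group 2)"
  shows "\<exists>S. infinite S \<and> lin_indep_funs G S \<and>
           (\<forall>\<psi>\<in>S. quasimorphism G \<psi> \<and> homogeneous_qm G \<psi> \<and> aut_invariant G \<psi> \<and>
                   (\<forall>i\<in>{1..k}. \<forall>g\<in>H i. \<psi> g = 0))"
proof -
  note One_nat_def [simp del]
  interpret free_prod G "{1..k}" H by (rule free_prod.intro) (rule assms(2))
  have fi: indecomposable_factors using assms(3) unfolding indecomposable_factors_def .
  define Z where "Z = {i\<in>{1..k}. infinite_cyclic (G\<lparr>carrier := H i\<rparr>)}"
  have nc: "noncyc = {1..k} - Z" unfolding noncyc_def Z_def by auto
  have other: "\<exists>j\<in>{1..k}. j \<noteq> i" for i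
  proof (cases "i = 1")
    case True
    thus ?thesis using assms(1) by (intro bexI[of _ 2]) auto
  next
    case False
    thus ?thesis using assms(1) by (intro bexI[of _ 1]) auto
  qed
  have "finite Z" by (simp add: Z_def)
  moreover have "card Z = 0 \<or> card Z = 1 \<or> card Z = 2" using assms(4) unfolding Z_def by linarith
  ultimately consider "Z = {}" | z where "Z = {z}" | z1 z2 where "Z = {z1, z2}" "z1 \<noteq> z2"
    by (metis card_0_eq card_1_singletonE card_2_iff)
  hence "\<exists>S. infinite S \<and> lin_indep_funs G S \<and>
      (\<forall>\<psi>\<in>S. quasimorphism G \<psi> \<and> homogeneous_qm G \<psi> \<and> aut_invariant G \<psi> \<and> (\<forall>g\<in>\<Union>(H ` {1..k}). \<psi> g = 0))"
  proof cases
    case 1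
    obtain i where i: "i \<in> {1..k}" "\<not> (G\<lparr>carrier := H i\<rparr> \<cong> integer_mod_group 2)" using assms(5) by blast
    obtain j where j: "j \<in> {1..k}" "j \<noteq> i" using other by blast
    obtain u where u: "u \<in> H i" "u \<noteq> \<one>\<^bsub>G\<^esub>" using H_nontrivial[OF fi i(1)] by blast
    obtain b where b: "b \<in> H j" "b \<noteq> \<one>\<^bsub>G\<^esub>" using H_nontrivial[OF fi j(1)] by blast
    \<comment> \<open>A nontrivial group other than Z/2 has two different nontrivial elements, the
      letters \<open>u\<close> and \<open>v\<close> of the test words.\<close>
    have "H i \<noteq> {\<one>\<^bsub>G\<^esub>, u}" using group.two_elements_iso[OF H_group[OF i(1)], of u] u(2) i(2) by auto
    then obtain v where "v \<in> H i" "v \<noteq> \<one>\<^bsub>G\<^esub>" "u \<noteq> v" using u(1) H_one[OF i(1)] by blast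
    thus ?thesis using quasimorphisms_no_cyclic_factor[OF fi _ _ i(1) j(1) _ u(1) _ u(2) _ _ b] j nc 1 by simp
  next
    case (2 z)
    hence z: "z \<in> {1..k}" "infinite_cyclic (G\<lparr>carrier := H z\<rparr>)" by (auto simp: Z_def)
    obtain \<zeta> where "cyc_gen z \<zeta>" using cyc_gen_ex[OF z] by blast
    then interpret c: free_prod_cyclic G "{1..k}" H z \<zeta> by unfold_locales
    obtain j where "j \<in> {1..k}" "j \<noteq> z" using other by blast
    thus ?thesis using c.quasimorphisms_one_cyclic_factor[OF fi, of j] nc 2 by simp
  next
    case (3 z1 z2)
    hence z: "z1 \<in> {1..k}" "infinite_cyclic (G\<lparr>carrier := H z1\<rparr>)" "z2 \<in> {1..k}" "infinite_cyclic (G\<lparr>carrier := H z2\<rparr>)"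
      by (auto simp: Z_def)
    obtain \<zeta>1 \<zeta>2 where "cyc_gen z1 \<zeta>1" "cyc_gen z2 \<zeta>2" using cyc_gen_ex[OF z(1,2)] cyc_gen_ex[OF z(3,4)] by blast
    thus ?thesis using quasimorphisms_two_cyclic_factors[OF fi _ 3(2)] nc 3 by simp
  qed
  thus ?thesis by simp
qed

end
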